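(* Let $\pi\colon Y\to X$ be as in the context. If $\mathcal{S}_1$ is an $\mathcal{O}_X$-coherent sheaf, then $\mathfrak{F}(\mathfrak{G}(\mathcal{S}_1))\simeq\mathcal{S}_1$; that is, $(\mathcal{O}_Y\otimes_{\mathcal{O}_X}\mathcal{S}_1)^{\nabla}\simeq\mathcal{S}_1$ as $\mathcal{O}_X$-modules, where $\nabla=d\otimes_{\mathcal{O}_X}1_{\mathcal{S}_1}$.
   Context: Setting: $K$ is a non-perfect, separably closed field of characteristic $p>0$, $L|K$ is a finite purely inseparable field extension, $X$ and $Y$ are varieties (integral) over $K$ and $L$ respectively, and $\pi\colon Y\to X$ is a purely inseparable morphism factorizing the absolute Frobenius morphism of $Y$ (so $\pi$ is a homeomorphism and $\mathcal{O}_Y^p\subset\mathcal{O}_X\subset\mathcal{O}_Y$), such that $\Omega_{Y/X}$ is locally free. Let $d\colon\mathcal{O}_Y\to\Omega_{Y/X}$ be the natural $\mathcal{O}_X$-derivation. An $X$-connection on an $\mathcal{O}_Y$-coherent sheaf $\mathcal{S}$ is an $\mathcal{O}_X$-linear morphism $\nabla\colon\mathcal{S}\to\Omega_{Y/X}\otimes_{\mathcal{O}_Y}\mathcal{S}$ with $\nabla(ax)=d(a)\otimes x+a\nabla(x)$. For $U\subset X$ open, $V=\pi^{-1}(U)$ and a derivation $D\in\operatorname{Der}_{\mathcal{O}_X(U)}(\mathcal{O}_Y(V))$, write $D=D_d\circ d$ with $D_d\colon\Omega_{Y/X}(V)\to\mathcal{O}_Y(V)$ $\mathcal{O}_Y$-linear,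 and put $\nabla_D=(D_d\otimes 1_{\mathcal{S}})\circ\nabla$. The connection is $X$-invariant if $\nabla_{[D,D']}=[\nabla_D,\nabla_{D'}]$ and $\nabla_{D^p}=(\nabla_D)^p$ for all such $D,D'$. $\operatorname{Inv}(Y/X)$ is the category of pairs $(\mathcal{S},\nabla)$ with $\mathcal{S}$ an $\mathcal{O}_Y$-coherent sheaf and $\nabla$ an $X$-invariant connection; morphisms are $\mathcal{O}_Y$-morphisms commuting with all $\nabla_D$. $\mathcal{S}^{\nabla}$ is the $\mathcal{O}_X$-coherent sheaf $\mathcal{S}^\nabla(U)=\{x\in\mathcal{S}(\pi^{-1}(U)) : \nabla(x)=0\}$. The functor $\mathfrak{F}$ from $\operatorname{Inv}(Y/X)$ to $\mathcal{O}_X$-coherent sheaves is $\mathfrak{F}(\mathcal{S},\nabla)=\mathcal{S}^{\nabla}$. The functor $\mathfrak{G}$ in the opposite direction is $\mathfrak{G}(\mathcal{S}_1)=(\mathcal{O}_Y\otimes_{\mathcal{O}_X}\mathcal{S}_1,\ d\otimes_{\mathcal{O}_X}1_{\mathcal{S}_1})$, using $\Omega_{Y/X}\otimes_{\mathcal{O}_Y}(\mathcal{O}_Y\otimes_{\mathcal{O}_X}\mathcal{S}_1)\simeq\Omega_{Y/X}\otimes_{\mathcal{O}_X}\mathcal{S}_1$. *)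

theory Defs
  imports
    "HOL-Analysis.Abstract_Topology"
    "HOL-Computational_Algebra.Primes"
    "HOL-Algebra.Module"
    "HOL-Algebra.Embedded_Algebras"
    "HOL-Algebra.Polynomial_Divisibility"
    "HOL-Algebra.Generated_Rings"
begin

section \<open>Fields\<close>

definition perfect_char :: "nat \<Rightarrow> ('k, 'z) ring_scheme \<Rightarrow> bool" where
  "perfect_char p k \<longleftrightarrow> (\<forall>a\<in>carrier k. \<exists>b\<in>carrier k. b [^]\<^bsub>k\<^esub> p = a)"

text \<open>Polynomials are coefficient lists, leading coefficient first.\<close>

definition poly_deriv :: "('k, 'z) ring_scheme \<Rightarrow> 'k list \<Rightarrow> 'k list" where
  "poly_deriv k f = ring.normalize k
     (map (\<lambda>i. [i] \<cdot>\<^bsub>k\<^esub> ring.coeff k f i) (rev [1..<length f]))"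

definition separable_poly :: "('k, 'z) ring_scheme \<Rightarrow> 'k list \<Rightarrow> bool" where
  "separable_poly k f \<longleftrightarrow>
     (\<forall>g\<in>carrier (poly_ring k).
        g divides\<^bsub>poly_ring k\<^esub> f \<and> g divides\<^bsub>poly_ring k\<^esub> poly_deriv k f
        \<longrightarrow> g \<in> Units (poly_ring k))"

definition separably_closed :: "('k, 'z) ring_scheme \<Rightarrow> bool" where
  "separably_closed k \<longleftrightarrow>
     (\<forall>f\<in>carrier (poly_ring k). degree f > 0 \<and> separable_poly k f
        \<longrightarrow> (\<exists>a\<in>carrier k. ring.eval k f a = \<zero>\<^bsub>k\<^esub>))"

text \<open>For a subfield \<open>K\<close> of a field \<open>L\<close> of characteristic \<open>p\<close>.\<close>

definition finite_purely_insep_ext :: "nat \<Rightarrow> ('l, 'z) ring_scheme \<Rightarrow> 'l set \<Rightarrow> bool" where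
  "finite_purely_insep_ext p L K \<longleftrightarrow>
     ring.finite_dimension L K (carrier L) \<and>
     (\<forall>a\<in>carrier L. \<exists>n::nat. a [^]\<^bsub>L\<^esub> (p ^ n) \<in> K)"


section \<open>Ringed spaces and schemes\<close>

text \<open>\<open>Osec \<X> U\<close> is the ring of sections over \<open>U\<close> and \<open>rst \<X> U V\<close> the restriction from
  \<open>U\<close> to \<open>V\<close>; both are meaningful only for open sets \<open>V \<subseteq> U\<close>.\<close>

record ('x, 'a) ringed_space =
  tops :: "'x topology"
  Osec :: "'x set \<Rightarrow> 'a ring"
  rst :: "'x set \<Rightarrow> 'x set \<Rightarrow> 'a \<Rightarrow> 'a"

definition sheaf_of_sets ::
    "'x topology \<Rightarrow> ('x set \<Rightarrow> 's set) \<Rightarrow> ('x set \<Rightarrow> 'x set \<Rightarrow> 's \<Rightarrow> 's) \<Rightarrow> bool" where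
  "sheaf_of_sets T S r \<longleftrightarrow>
     (\<forall>U V. openin T U \<and> openin T V \<and> V \<subseteq> U \<longrightarrow> r U V \<in> S U \<rightarrow> S V) \<and>
     (\<forall>U. openin T U \<longrightarrow> (\<forall>s\<in>S U. r U U s = s)) \<and>
     (\<forall>U V W. openin T U \<and> openin T V \<and> openin T W \<and> W \<subseteq> V \<and> V \<subseteq> U \<longrightarrow>
        (\<forall>s\<in>S U. r V W (r U V s) = r U W s)) \<and>
     (\<forall>\<U>. (\<forall>V\<in>\<U>. openin T V) \<longrightarrow>
        (\<forall>s\<in>S (\<Union>\<U>). \<forall>t\<in>S (\<Union>\<U>). (\<forall>V\<in>\<U>. r (\<Union>\<U>) V s = r (\<Union>\<U>) V t) \<longrightarrow> s = t)) \<and>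
     (\<forall>\<U> s. (\<forall>V\<in>\<U>. openin T V \<and> s V \<in> S V) \<and>
        (\<forall>V\<in>\<U>. \<forall>W\<in>\<U>. r V (V \<inter> W) (s V) = r W (V \<inter> W) (s W)) \<longrightarrow>
        (\<exists>t\<in>S (\<Union>\<U>). \<forall>V\<in>\<U>. r (\<Union>\<U>) V t = s V))"

definition is_ringed_space :: "('x, 'a) ringed_space \<Rightarrow> bool" where
  "is_ringed_space \<X> \<longleftrightarrow>
     sheaf_of_sets (tops \<X>) (\<lambda>U. carrier (Osec \<X> U)) (rst \<X>) \<and>
     (\<forall>U. openin (tops \<X>) U \<longrightarrow> cring (Osec \<X> U)) \<and>
     (\<forall>U V. openin (tops \<X>) U \<and> openin (tops \<X>) V \<and> V \<subseteq> U \<longrightarrow>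
        rst \<X> U V \<in> ring_hom (Osec \<X> U) (Osec \<X> V))"

definition germ_unit :: "('x, 'a) ringed_space \<Rightarrow> 'x \<Rightarrow> 'x set \<Rightarrow> 'a \<Rightarrow> bool" where
  "germ_unit \<X> x U s \<longleftrightarrow>
     (\<exists>V. openin (tops \<X>) V \<and> x \<in> V \<and> V \<subseteq> U \<and> rst \<X> U V s \<in> Units (Osec \<X> V))"

definition prime_spectrum :: "('a, 'z) ring_scheme \<Rightarrow> 'a set set" where
  "prime_spectrum A = {P. primeideal P A}"

definition basic_open :: "('a, 'z) ring_scheme \<Rightarrow> 'a \<Rightarrow> 'a set set" where
  "basic_open A f = {P \<in> prime_spectrum A. f \<notin> P}"

definition zariski_topology :: "('a, 'z) ring_scheme \<Rightarrow> 'a set topology" where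
  "zariski_topology A = topology_generated_by (basic_open A ` carrier A)"

text \<open>\<open>h : A \<rightarrow> B\<close> exhibits \<open>B\<close> as the localization of \<open>A\<close> at the powers of \<open>f\<close>.\<close>

definition is_localization_at ::
    "('a, 'z) ring_scheme \<Rightarrow> 'a \<Rightarrow> ('b, 'w) ring_scheme \<Rightarrow> ('a \<Rightarrow> 'b) \<Rightarrow> bool" where
  "is_localization_at A f B h \<longleftrightarrow>
     h \<in> ring_hom A B \<and> h f \<in> Units B \<and>
     (\<forall>b\<in>carrier B. \<exists>a\<in>carrier A. \<exists>n::nat. b \<otimes>\<^bsub>B\<^esub> (h f [^]\<^bsub>B\<^esub> n) = h a) \<and>
     (\<forall>a\<in>carrier A. h a = \<zero>\<^bsub>B\<^esub> \<longrightarrow> (\<exists>n::nat. (f [^]\<^bsub>A\<^esub> n) \<otimes>\<^bsub>A\<^esub> a = \<zero>\<^bsub>A\<^esub>))"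

text \<open>The structure sheaf of \<open>Spec A\<close> is the sheaf with value \<open>A\<^sub>f\<close> on each basic open set
  \<open>D(f)\<close>, so an isomorphism of \<open>(U, \<O>\<^sub>\<X>|U)\<close> with \<open>Spec A\<close>, where necessarily
  \<open>A = \<O>\<^sub>\<X>(U)\<close>, is a homeomorphism for which the sections over the preimage of each
  \<open>D(f)\<close> are \<open>A\<^sub>f\<close>.\<close>

definition affine_open :: "('x, 'a) ringed_space \<Rightarrow> 'x set \<Rightarrow> bool" where
  "affine_open \<X> U \<longleftrightarrow>
     openin (tops \<X>) U \<and>
     (\<exists>\<phi>. homeomorphic_map (subtopology (tops \<X>) U) (zariski_topology (Osec \<X> U)) \<phi> \<and>
        (\<forall>f\<in>carrier (Osec \<X> U).
           is_localization_at (Osec \<X> U) f (Osec \<X> {x\<in>U. \<phi> x \<in> basic_open (Osec \<X> U) f})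
             (rst \<X> U {x\<in>U. \<phi> x \<in> basic_open (Osec \<X> U) f})))"

definition is_scheme :: "('x, 'a) ringed_space \<Rightarrow> bool" where
  "is_scheme \<X> \<longleftrightarrow>
     is_ringed_space \<X> \<and> (\<forall>x\<in>topspace (tops \<X>). \<exists>U. affine_open \<X> U \<and> x \<in> U)"

definition integral_scheme :: "('x, 'a) ringed_space \<Rightarrow> bool" where
  "integral_scheme \<X> \<longleftrightarrow>
     is_scheme \<X> \<and> topspace (tops \<X>) \<noteq> {} \<and>
     (\<forall>U. openin (tops \<X>) U \<and> U \<noteq> {} \<longrightarrow> domain (Osec \<X> U))"

text \<open>A morphism \<open>\<X> \<rightarrow> Spec k\<close> is given as the ring homomorphism \<open>\<kappa>\<close> from \<open>k\<close> to the
  global sections.\<close>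

definition finite_type_over ::
    "('k, 'z) ring_scheme \<Rightarrow> ('k \<Rightarrow> 'a) \<Rightarrow> ('x, 'a) ringed_space \<Rightarrow> bool" where
  "finite_type_over k \<kappa> \<X> \<longleftrightarrow>
     (\<exists>\<U>. finite \<U> \<and> \<Union>\<U> = topspace (tops \<X>) \<and>
       (\<forall>U\<in>\<U>. affine_open \<X> U \<and>
          (\<exists>G. finite G \<and> G \<subseteq> carrier (Osec \<X> U) \<and>
             generate_ring (Osec \<X> U) (rst \<X> (topspace (tops \<X>)) U ` \<kappa> ` carrier k \<union> G)
               = carrier (Osec \<X> U))))"

text \<open>Over an affine base, the diagonal is a closed immersion iff any two affine open sets have
  an affine intersection whose ring of sections is generated by theirs.\<close>

definition separated_scheme :: "('x, 'a) ringed_space \<Rightarrow> bool" where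
  "separated_scheme \<X> \<longleftrightarrow>
     (\<forall>U V. affine_open \<X> U \<and> affine_open \<X> V \<longrightarrow>
        affine_open \<X> (U \<inter> V) \<and>
        generate_ring (Osec \<X> (U \<inter> V))
          (rst \<X> U (U \<inter> V) ` carrier (Osec \<X> U) \<union> rst \<X> V (U \<inter> V) ` carrier (Osec \<X> V))
          = carrier (Osec \<X> (U \<inter> V)))"

definition variety_over ::
    "('k, 'z) ring_scheme \<Rightarrow> ('k \<Rightarrow> 'a) \<Rightarrow> ('x, 'a) ringed_space \<Rightarrow> bool" where
  "variety_over k \<kappa> \<X> \<longleftrightarrow>
     integral_scheme \<X> \<and> separated_scheme \<X> \<and>
     \<kappa> \<in> ring_hom k (Osec \<X> (topspace (tops \<X>))) \<and> finite_type_over k \<kappa> \<X>"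


section \<open>Morphisms\<close>

text \<open>For \<open>f : \<Y> \<rightarrow> \<X>\<close>, \<open>sharp f U\<close> maps \<open>\<O>\<^sub>\<X>(U)\<close> to \<open>\<O>\<^sub>\<Y>(f\<^sup>-\<^sup>1(U))\<close>.\<close>

record ('y, 'b, 'x, 'a) rs_map =
  pt :: "'y \<Rightarrow> 'x"
  sharp :: "'x set \<Rightarrow> 'a \<Rightarrow> 'b"

definition preim :: "('y, 'b) ringed_space \<Rightarrow> ('y, 'b, 'x, 'a) rs_map \<Rightarrow> 'x set \<Rightarrow> 'y set" where
  "preim \<Y> f U = {y \<in> topspace (tops \<Y>). pt f y \<in> U}"

text \<open>The last condition says that the maps on stalks are local.\<close>

definition scheme_morphism ::
    "('y, 'b) ringed_space \<Rightarrow> ('x, 'a) ringed_space \<Rightarrow> ('y, 'b, 'x, 'a) rs_map \<Rightarrow> bool" where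
  "scheme_morphism \<Y> \<X> f \<longleftrightarrow>
     continuous_map (tops \<Y>) (tops \<X>) (pt f) \<and>
     (\<forall>U. openin (tops \<X>) U \<longrightarrow> sharp f U \<in> ring_hom (Osec \<X> U) (Osec \<Y> (preim \<Y> f U))) \<and>
     (\<forall>U V. openin (tops \<X>) U \<and> openin (tops \<X>) V \<and> V \<subseteq> U \<longrightarrow>
        (\<forall>s\<in>carrier (Osec \<X> U).
           sharp f V (rst \<X> U V s) = rst \<Y> (preim \<Y> f U) (preim \<Y> f V) (sharp f U s))) \<and>
     (\<forall>U y. openin (tops \<X>) U \<and> y \<in> preim \<Y> f U \<longrightarrow>
        (\<forall>s\<in>carrier (Osec \<X> U).
           germ_unit \<Y> y (preim \<Y> f U) (sharp f U s) \<longrightarrow> germ_unit \<X> (pt f y) U s))"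

text \<open>Injective with purely inseparable residue field extensions: for every germ \<open>s\<close> at
  \<open>y\<close> there is a germ \<open>t\<close> at \<open>f(y)\<close> such that \<open>s\<^sup>q - f\<^sup>#(t)\<close> lies in the maximal
  ideal at \<open>y\<close>, where \<open>q\<close> is a power of \<open>p\<close>.\<close>

definition purely_insep_morphism ::
    "nat \<Rightarrow> ('y, 'b) ringed_space \<Rightarrow> ('x, 'a) ringed_space \<Rightarrow> ('y, 'b, 'x, 'a) rs_map \<Rightarrow> bool" where
  "purely_insep_morphism p \<Y> \<X> f \<longleftrightarrow>
     scheme_morphism \<Y> \<X> f \<and> inj_on (pt f) (topspace (tops \<Y>)) \<and>
     (\<forall>V. openin (tops \<Y>) V \<longrightarrow> (\<forall>y\<in>V. \<forall>s\<in>carrier (Osec \<Y> V).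
        \<exists>(n::nat) U t W. openin (tops \<X>) U \<and> pt f y \<in> U \<and> t \<in> carrier (Osec \<X> U) \<and>
          W = V \<inter> preim \<Y> f U \<and>
          \<not> germ_unit \<Y> y W
             (rst \<Y> V W (s [^]\<^bsub>Osec \<Y> V\<^esub> (p ^ n)) \<ominus>\<^bsub>Osec \<Y> W\<^esub> rst \<Y> (preim \<Y> f U) W (sharp f U t))))"

text \<open>\<open>g \<circ> f\<close> is the absolute Frobenius morphism of \<open>\<Y>\<close>, which is the identity on points and
  the \<open>p\<close>-th power map on sections.\<close>

definition factors_abs_frobenius ::
    "nat \<Rightarrow> ('y, 'b) ringed_space \<Rightarrow> ('x, 'a) ringed_space \<Rightarrow> ('y, 'b, 'x, 'a) rs_map \<Rightarrow> bool" where
  "factors_abs_frobenius p \<Y> \<X> f \<longleftrightarrow>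
     (\<exists>g. scheme_morphism \<X> \<Y> g \<and>
        (\<forall>y\<in>topspace (tops \<Y>). pt g (pt f y) = y) \<and>
        (\<forall>V. openin (tops \<Y>) V \<longrightarrow> (\<forall>s\<in>carrier (Osec \<Y> V).
           sharp f (preim \<X> g V) (sharp g V s) = s [^]\<^bsub>Osec \<Y> V\<^esub> p)))"


section \<open>Sheaves of modules\<close>

record ('x, 'a, 'm) mod_sheaf =
  msec :: "'x set \<Rightarrow> ('a, 'm) module"
  mrst :: "'x set \<Rightarrow> 'x set \<Rightarrow> 'm \<Rightarrow> 'm"

definition is_module_sheaf ::
    "('x, 'a) ringed_space \<Rightarrow> ('x, 'a, 'm) mod_sheaf \<Rightarrow> bool" where
  "is_module_sheaf \<X> F \<longleftrightarrow>
     sheaf_of_sets (tops \<X>) (\<lambda>U. carrier (msec F U)) (mrst F) \<and>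
     (\<forall>U. openin (tops \<X>) U \<longrightarrow> Module.module (Osec \<X> U) (msec F U)) \<and>
     (\<forall>U V. openin (tops \<X>) U \<and> openin (tops \<X>) V \<and> V \<subseteq> U \<longrightarrow>
        (\<forall>s\<in>carrier (msec F U).
           (\<forall>t\<in>carrier (msec F U).
              mrst F U V (s \<oplus>\<^bsub>msec F U\<^esub> t) = mrst F U V s \<oplus>\<^bsub>msec F V\<^esub> mrst F U V t) \<and>
           (\<forall>a\<in>carrier (Osec \<X> U).
              mrst F U V (a \<odot>\<^bsub>msec F U\<^esub> s) = rst \<X> U V a \<odot>\<^bsub>msec F V\<^esub> mrst F U V s)))"

definition mod_sheaf_iso ::
    "('x, 'a) ringed_space \<Rightarrow> ('x, 'a, 'm) mod_sheaf \<Rightarrow> ('x, 'a, 'n) mod_sheaf \<Rightarrow> bool" where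
  "mod_sheaf_iso \<X> F G \<longleftrightarrow>
     (\<exists>\<phi>. \<forall>U. openin (tops \<X>) U \<longrightarrow>
        bij_betw (\<phi> U) (carrier (msec F U)) (carrier (msec G U)) \<and>
        (\<forall>s\<in>carrier (msec F U).
           (\<forall>t\<in>carrier (msec F U). \<phi> U (s \<oplus>\<^bsub>msec F U\<^esub> t) = \<phi> U s \<oplus>\<^bsub>msec G U\<^esub> \<phi> U t) \<and>
           (\<forall>a\<in>carrier (Osec \<X> U). \<phi> U (a \<odot>\<^bsub>msec F U\<^esub> s) = a \<odot>\<^bsub>msec G U\<^esub> \<phi> U s) \<and>
           (\<forall>V. openin (tops \<X>) V \<and> V \<subseteq> U \<longrightarrow> \<phi> V (mrst F U V s) = mrst G U V (\<phi> U s))))"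

text \<open>The section \<open>\<Sum>\<^sub>i a\<^sub>i s\<^sub>i\<close> over \<open>W \<subseteq> U\<close>, where the \<open>s\<^sub>i\<close> are sections over \<open>U\<close>.\<close>

definition lin_comb ::
    "('x, 'a, 'm) mod_sheaf \<Rightarrow> 'x set \<Rightarrow> nat \<Rightarrow> (nat \<Rightarrow> 'm) \<Rightarrow> 'x set \<Rightarrow> (nat \<Rightarrow> 'a) \<Rightarrow> 'm" where
  "lin_comb F U n s W a =
     finsum (msec F W) (\<lambda>i. a i \<odot>\<^bsub>msec F W\<^esub> mrst F U W (s i)) {..<n}"

definition finite_type_sheaf ::
    "('x, 'a) ringed_space \<Rightarrow> ('x, 'a, 'm) mod_sheaf \<Rightarrow> bool" where
  "finite_type_sheaf \<X> F \<longleftrightarrow>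
     (\<forall>x\<in>topspace (tops \<X>). \<exists>U n s. openin (tops \<X>) U \<and> x \<in> U \<and>
        s \<in> {..<n} \<rightarrow> carrier (msec F U) \<and>
        (\<forall>W. openin (tops \<X>) W \<and> W \<subseteq> U \<longrightarrow> (\<forall>t\<in>carrier (msec F W). \<forall>z\<in>W.
           \<exists>W' a. openin (tops \<X>) W' \<and> z \<in> W' \<and> W' \<subseteq> W \<and>
             a \<in> {..<n} \<rightarrow> carrier (Osec \<X> W') \<and> mrst F W W' t = lin_comb F U n s W' a)))"

text \<open>For all sections \<open>s\<^sub>1, \<dots>, s\<^sub>n\<close> over an open set \<open>U\<close>, the kernel of the induced map
  \<open>\<O>\<^sup>n|U \<rightarrow> F|U\<close> is of finite type: it is locally generated by finitely many relations
  \<open>r\<^sub>1, \<dots>, r\<^sub>m\<close>.\<close>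

definition finite_type_relations ::
    "('x, 'a) ringed_space \<Rightarrow> ('x, 'a, 'm) mod_sheaf \<Rightarrow> bool" where
  "finite_type_relations \<X> F \<longleftrightarrow>
     (\<forall>U n s. openin (tops \<X>) U \<and> s \<in> {..<n} \<rightarrow> carrier (msec F U) \<longrightarrow>
       (\<forall>x\<in>U. \<exists>V (m::nat) r. openin (tops \<X>) V \<and> x \<in> V \<and> V \<subseteq> U \<and>
          (\<forall>j<m. r j \<in> {..<n} \<rightarrow> carrier (Osec \<X> V) \<and>
                 lin_comb F U n s V (r j) = \<zero>\<^bsub>msec F V\<^esub>) \<and>
          (\<forall>W. openin (tops \<X>) W \<and> W \<subseteq> V \<longrightarrow>
            (\<forall>a\<in>{..<n} \<rightarrow> carrier (Osec \<X> W). lin_comb F U n s W a = \<zero>\<^bsub>msec F W\<^esub> \<longrightarrow>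
              (\<forall>z\<in>W. \<exists>W' c. openin (tops \<X>) W' \<and> z \<in> W' \<and> W' \<subseteq> W \<and>
                c \<in> {..<m} \<rightarrow> carrier (Osec \<X> W') \<and>
                (\<forall>i<n. rst \<X> W W' (a i) =
                   finsum (Osec \<X> W') (\<lambda>j. c j \<otimes>\<^bsub>Osec \<X> W'\<^esub> rst \<X> V W' (r j i)) {..<m}))))))"

definition coherent_sheaf ::
    "('x, 'a) ringed_space \<Rightarrow> ('x, 'a, 'm) mod_sheaf \<Rightarrow> bool" where
  "coherent_sheaf \<X> F \<longleftrightarrow>
     is_module_sheaf \<X> F \<and> finite_type_sheaf \<X> F \<and> finite_type_relations \<X> F"

text \<open>Locally free of finite rank.\<close>

definition locally_free_sheaf ::
    "('x, 'a) ringed_space \<Rightarrow> ('x, 'a, 'm) mod_sheaf \<Rightarrow> bool" where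
  "locally_free_sheaf \<X> F \<longleftrightarrow>
     (\<forall>x\<in>topspace (tops \<X>). \<exists>U n e. openin (tops \<X>) U \<and> x \<in> U \<and>
        e \<in> {..<n} \<rightarrow> carrier (msec F U) \<and>
        (\<forall>W. openin (tops \<X>) W \<and> W \<subseteq> U \<longrightarrow> (\<forall>t\<in>carrier (msec F W).
           \<exists>!a. a \<in> {..<n} \<rightarrow>\<^sub>E carrier (Osec \<X> W) \<and> t = lin_comb F U n e W a)))"

definition structure_module :: "('x, 'a) ringed_space \<Rightarrow> ('x, 'a, 'a) mod_sheaf" where
  "structure_module \<X> =
     \<lparr> msec = (\<lambda>U. \<lparr> carrier = carrier (Osec \<X> U), monoid.mult = monoid.mult (Osec \<X> U),
                    one = one (Osec \<X> U), zero = zero (Osec \<X> U), add = add (Osec \<X> U),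
                    smult = monoid.mult (Osec \<X> U) \<rparr>),
       mrst = rst \<X> \<rparr>"


subsection \<open>Sheafification\<close>

definition germ :: "'x topology \<Rightarrow> ('x, 'a, 'm) mod_sheaf \<Rightarrow> 'x \<Rightarrow> 'x set \<Rightarrow> 'm \<Rightarrow> ('x set \<times> 'm) set"
  where
  "germ T F x V m = {(W, n). openin T W \<and> x \<in> W \<and> n \<in> carrier (msec F W) \<and>
     (\<exists>Z. openin T Z \<and> x \<in> Z \<and> Z \<subseteq> V \<inter> W \<and> mrst F V Z m = mrst F W Z n)}"

text \<open>A section over \<open>U\<close> of the sheaf associated with a presheaf \<open>F\<close> of modules is a family of
  germs that is locally given by sections of \<open>F\<close>; it takes the value \<open>{}\<close> outside \<open>U\<close>.\<close>

definition sheafify ::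
    "('x, 'a) ringed_space \<Rightarrow> ('x, 'a, 'm) mod_sheaf
      \<Rightarrow> ('x, 'a, 'x \<Rightarrow> ('x set \<times> 'm) set) mod_sheaf" where
  "sheafify \<X> F =
     \<lparr> msec = (\<lambda>U.
         \<lparr> carrier = {s. (\<forall>x. x \<notin> U \<longrightarrow> s x = {}) \<and>
             (\<forall>x\<in>U. \<exists>V m. openin (tops \<X>) V \<and> x \<in> V \<and> V \<subseteq> U \<and> m \<in> carrier (msec F V) \<and>
                (\<forall>z\<in>V. s z = germ (tops \<X>) F z V m))},
           monoid.mult = undefined,
           one = undefined,
           zero = (\<lambda>x. if x \<in> U then germ (tops \<X>) F x U \<zero>\<^bsub>msec F U\<^esub> else {}),
           add = (\<lambda>s t x. \<Union>(V, m)\<in>s x. \<Union>(W, n)\<in>t x.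
             germ (tops \<X>) F x (V \<inter> W)
               (mrst F V (V \<inter> W) m \<oplus>\<^bsub>msec F (V \<inter> W)\<^esub> mrst F W (V \<inter> W) n)),
           smult = (\<lambda>a s x. \<Union>(V, m)\<in>s x.
             germ (tops \<X>) F x (U \<inter> V)
               (rst \<X> U (U \<inter> V) a \<odot>\<^bsub>msec F (U \<inter> V)\<^esub> mrst F V (U \<inter> V) m)) \<rparr>),
       mrst = (\<lambda>U V s x. if x \<in> V then s x else {}) \<rparr>"

definition sheafify_unit ::
    "'x topology \<Rightarrow> ('x, 'a, 'm) mod_sheaf \<Rightarrow> 'x set \<Rightarrow> 'm \<Rightarrow> 'x \<Rightarrow> ('x set \<times> 'm) set" where
  "sheafify_unit T F U m = (\<lambda>x. if x \<in> U then germ T F x U m else {})"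

text \<open>The map induced on associated sheaves by a map \<open>\<phi>\<close> of presheaves into \<open>G\<close>.\<close>

definition sheafify_map ::
    "'x topology \<Rightarrow> ('x, 'b, 'n) mod_sheaf \<Rightarrow> ('x set \<Rightarrow> 'm \<Rightarrow> 'n)
      \<Rightarrow> ('x \<Rightarrow> ('x set \<times> 'm) set) \<Rightarrow> 'x \<Rightarrow> ('x set \<times> 'n) set" where
  "sheafify_map T G \<phi> s = (\<lambda>x. \<Union>(V, m)\<in>s x. germ T G x V (\<phi> V m))"


subsection \<open>Modules given by generators and relations\<close>

text \<open>A list \<open>[g\<^sub>1, \<dots>, g\<^sub>n]\<close> of generators represents the formal sum \<open>g\<^sub>1 + \<dots> + g\<^sub>n\<close>;
  \<open>fs_cong G E\<close> is the congruence generated by the relations in \<open>E\<close> on these sums. In the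
  instances below the relations make each class of sums invertible, so that the quotient is the
  abelian group with these generators and relations.\<close>

inductive fs_cong :: "'g set \<Rightarrow> ('g list \<times> 'g list) set \<Rightarrow> 'g list \<Rightarrow> 'g list \<Rightarrow> bool"
  for G E where
  fs_rel: "(xs, ys) \<in> E \<Longrightarrow> fs_cong G E xs ys"
| fs_refl: "set xs \<subseteq> G \<Longrightarrow> fs_cong G E xs xs"
| fs_sym: "fs_cong G E xs ys \<Longrightarrow> fs_cong G E ys xs"
| fs_trans: "fs_cong G E xs ys \<Longrightarrow> fs_cong G E ys zs \<Longrightarrow> fs_cong G E xs zs"
| fs_add: "fs_cong G E xs ys \<Longrightarrow> fs_cong G E xs' ys' \<Longrightarrow> fs_cong G E (xs @ xs') (ys @ ys')"
| fs_comm: "set xs \<subseteq> G \<Longrightarrow> set ys \<subseteq> G \<Longrightarrow> fs_cong G E (xs @ ys) (ys @ xs)"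

definition fs_class :: "'g set \<Rightarrow> ('g list \<times> 'g list) set \<Rightarrow> 'g list \<Rightarrow> 'g list set" where
  "fs_class G E xs = {ys. fs_cong G E xs ys}"

definition fs_map ::
    "'g set \<Rightarrow> ('g list \<times> 'g list) set \<Rightarrow> ('f \<Rightarrow> 'g) \<Rightarrow> 'f list set \<Rightarrow> 'g list set" where
  "fs_map G E h c = (\<Union>xs\<in>c. fs_class G E (map h xs))"

text \<open>\<open>act b\<close> is scalar multiplication by \<open>b\<close> on the generators.\<close>

definition fs_module ::
    "'g set \<Rightarrow> ('g list \<times> 'g list) set \<Rightarrow> ('b \<Rightarrow> 'g \<Rightarrow> 'g) \<Rightarrow> ('b, 'g list set) module" where
  "fs_module G E act =
     \<lparr> carrier = fs_class G E ` {xs. set xs \<subseteq> G},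
       monoid.mult = undefined,
       one = undefined,
       zero = fs_class G E [],
       add = (\<lambda>c c'. \<Union>xs\<in>c. \<Union>ys\<in>c'. fs_class G E (xs @ ys)),
       smult = (\<lambda>b. fs_map G E (act b)) \<rparr>"

text \<open>For a ring homomorphism \<open>f : R \<rightarrow> B\<close>, a \<open>B\<close>-module \<open>M\<close> and an \<open>R\<close>-module \<open>N\<close>, the
  \<open>B\<close>-module \<open>M \<otimes>\<^sub>R N\<close>; the pair \<open>(m, n)\<close> stands for \<open>m \<otimes> n\<close>.\<close>

definition tens_gens :: "('b, 'm, 'z) module_scheme \<Rightarrow> ('r, 'n, 'w) module_scheme \<Rightarrow> ('m \<times> 'n) set"
  where
  "tens_gens M N = carrier M \<times> carrier N"

definition tens_rels ::
    "('r, 'v) ring_scheme \<Rightarrow> ('r \<Rightarrow> 'b) \<Rightarrow> ('b, 'm, 'z) module_scheme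
      \<Rightarrow> ('r, 'n, 'w) module_scheme \<Rightarrow> (('m \<times> 'n) list \<times> ('m \<times> 'n) list) set" where
  "tens_rels R f M N =
     {([(\<zero>\<^bsub>M\<^esub>, n)], []) | n. n \<in> carrier N} \<union>
     {([(m \<oplus>\<^bsub>M\<^esub> m', n)], [(m, n), (m', n)]) | m m' n.
        m \<in> carrier M \<and> m' \<in> carrier M \<and> n \<in> carrier N} \<union>
     {([(m, n \<oplus>\<^bsub>N\<^esub> n')], [(m, n), (m, n')]) | m n n'.
        m \<in> carrier M \<and> n \<in> carrier N \<and> n' \<in> carrier N} \<union>
     {([(f r \<odot>\<^bsub>M\<^esub> m, n)], [(m, r \<odot>\<^bsub>N\<^esub> n)]) | r m n.
        r \<in> carrier R \<and> m \<in> carrier M \<and> n \<in> carrier N}"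

definition tens_class ::
    "('r, 'v) ring_scheme \<Rightarrow> ('r \<Rightarrow> 'b) \<Rightarrow> ('b, 'm, 'z) module_scheme
      \<Rightarrow> ('r, 'n, 'w) module_scheme \<Rightarrow> ('m \<times> 'n) list \<Rightarrow> ('m \<times> 'n) list set" where
  "tens_class R f M N = fs_class (tens_gens M N) (tens_rels R f M N)"

definition tensor ::
    "('r, 'v) ring_scheme \<Rightarrow> ('r \<Rightarrow> 'b) \<Rightarrow> ('b, 'm, 'z) module_scheme
      \<Rightarrow> ('r, 'n, 'w) module_scheme \<Rightarrow> ('b, ('m \<times> 'n) list set) module" where
  "tensor R f M N =
     fs_module (tens_gens M N) (tens_rels R f M N) (\<lambda>b (m, n). (b \<odot>\<^bsub>M\<^esub> m, n))"

text \<open>For a ring homomorphism \<open>f : A \<rightarrow> B\<close>, the module of Kaehler differentials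
  \<open>\<Omega>\<^bsub>B/A\<^esub>\<close>; the pair \<open>(b, c)\<close> stands for \<open>b dc\<close>.\<close>

definition kaehler_gens :: "('b, 'w) ring_scheme \<Rightarrow> ('b \<times> 'b) set" where
  "kaehler_gens B = carrier B \<times> carrier B"

definition kaehler_rels ::
    "('a, 'z) ring_scheme \<Rightarrow> ('a \<Rightarrow> 'b) \<Rightarrow> ('b, 'w) ring_scheme
      \<Rightarrow> (('b \<times> 'b) list \<times> ('b \<times> 'b) list) set" where
  "kaehler_rels A f B =
     {([(\<zero>\<^bsub>B\<^esub>, c)], []) | c. c \<in> carrier B} \<union>
     {([(b \<oplus>\<^bsub>B\<^esub> b', c)], [(b, c), (b', c)]) | b b' c.
        b \<in> carrier B \<and> b' \<in> carrier B \<and> c \<in> carrier B} \<union>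
     {([(b, c \<oplus>\<^bsub>B\<^esub> c')], [(b, c), (b, c')]) | b c c'.
        b \<in> carrier B \<and> c \<in> carrier B \<and> c' \<in> carrier B} \<union>
     {([(b, c \<otimes>\<^bsub>B\<^esub> c')], [(b \<otimes>\<^bsub>B\<^esub> c, c'), (b \<otimes>\<^bsub>B\<^esub> c', c)]) | b c c'.
        b \<in> carrier B \<and> c \<in> carrier B \<and> c' \<in> carrier B} \<union>
     {([(b, f a)], []) | b a. b \<in> carrier B \<and> a \<in> carrier A}"

definition kaehler_class ::
    "('a, 'z) ring_scheme \<Rightarrow> ('a \<Rightarrow> 'b) \<Rightarrow> ('b, 'w) ring_scheme
      \<Rightarrow> ('b \<times> 'b) list \<Rightarrow> ('b \<times> 'b) list set" where
  "kaehler_class A f B = fs_class (kaehler_gens B) (kaehler_rels A f B)"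

definition kaehler ::
    "('a, 'z) ring_scheme \<Rightarrow> ('a \<Rightarrow> 'b) \<Rightarrow> ('b, 'w) ring_scheme
      \<Rightarrow> ('b, ('b \<times> 'b) list set) module" where
  "kaehler A f B =
     fs_module (kaehler_gens B) (kaehler_rels A f B) (\<lambda>b (b', c). (b \<otimes>\<^bsub>B\<^esub> b', c))"


subsection \<open>Tensor products and inverse images of sheaves\<close>

text \<open>Let \<open>P\<close> be a sheaf of rings on the space of \<open>\<Y>\<close> with a map \<open>h : P \<rightarrow> \<O>\<^sub>\<Y>\<close>, \<open>M\<close> an
  \<open>\<O>\<^sub>\<Y>\<close>-module and \<open>N\<close> a \<open>P\<close>-module. Then \<open>tensor_sheaf \<Y> P h M N\<close> is the
  \<open>\<O>\<^sub>\<Y>\<close>-module \<open>M \<otimes>\<^sub>P N\<close>.\<close>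

definition tensor_presheaf ::
    "('y, 'r) ringed_space \<Rightarrow> ('y set \<Rightarrow> 'r \<Rightarrow> 'b) \<Rightarrow> ('y, 'b, 'm) mod_sheaf
      \<Rightarrow> ('y, 'r, 'n) mod_sheaf \<Rightarrow> ('y, 'b, ('m \<times> 'n) list set) mod_sheaf" where
  "tensor_presheaf P h M N =
     \<lparr> msec = (\<lambda>V. tensor (Osec P V) (h V) (msec M V) (msec N V)),
       mrst = (\<lambda>V W. fs_map (tens_gens (msec M W) (msec N W))
                       (tens_rels (Osec P W) (h W) (msec M W) (msec N W))
                       (map_prod (mrst M V W) (mrst N V W))) \<rparr>"

definition tensor_sheaf where
  "tensor_sheaf \<Y> P h M N = sheafify \<Y> (tensor_presheaf P h M N)"

text \<open>The sheaves \<open>\<pi>\<^sup>-\<^sup>1\<O>\<^sub>\<X>\<close> and \<open>\<pi>\<^sup>-\<^sup>1 S\<close> on \<open>\<Y>\<close> when \<open>\<pi>\<close> is a homeomorphism, so that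
  \<open>V \<subseteq> \<Y>\<close> is open iff \<open>\<pi>(V) \<subseteq> \<X>\<close> is.\<close>

definition inv_image_rs ::
    "('y, 'b) ringed_space \<Rightarrow> ('x, 'a) ringed_space \<Rightarrow> ('y, 'b, 'x, 'a) rs_map
      \<Rightarrow> ('y, 'a) ringed_space" where
  "inv_image_rs \<Y> \<X> \<pi> =
     \<lparr> tops = tops \<Y>,
       Osec = (\<lambda>V. Osec \<X> (pt \<pi> ` V)),
       rst = (\<lambda>V W. rst \<X> (pt \<pi> ` V) (pt \<pi> ` W)) \<rparr>"

definition inv_image_mod ::
    "('y, 'b, 'x, 'a) rs_map \<Rightarrow> ('x, 'a, 'm) mod_sheaf \<Rightarrow> ('y, 'a, 'm) mod_sheaf" where
  "inv_image_mod \<pi> S =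
     \<lparr> msec = (\<lambda>V. msec S (pt \<pi> ` V)),
       mrst = (\<lambda>V W. mrst S (pt \<pi> ` V) (pt \<pi> ` W)) \<rparr>"

definition inv_image_map :: "('y, 'b, 'x, 'a) rs_map \<Rightarrow> 'y set \<Rightarrow> 'a \<Rightarrow> 'b" where
  "inv_image_map \<pi> V = sharp \<pi> (pt \<pi> ` V)"


section \<open>Differentials and the functors between sheaves\<close>

text \<open>From here on \<open>\<pi> : \<Y> \<rightarrow> \<X>\<close> is a morphism that is a homeomorphism on the spaces.
  \<open>\<Omega>\<^bsub>\<Y>/\<X>\<^esub>\<close> is the sheaf associated with \<open>V \<mapsto> \<Omega>\<close> of \<open>\<O>\<^sub>\<Y>(V)\<close> over
  \<open>(\<pi>\<^sup>-\<^sup>1\<O>\<^sub>\<X>)(V)\<close>.\<close>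

definition Omega_presheaf ::
    "('y, 'b) ringed_space \<Rightarrow> ('x, 'a) ringed_space \<Rightarrow> ('y, 'b, 'x, 'a) rs_map
      \<Rightarrow> ('y, 'b, ('b \<times> 'b) list set) mod_sheaf" where
  "Omega_presheaf \<Y> \<X> \<pi> =
     \<lparr> msec = (\<lambda>V. kaehler (Osec (inv_image_rs \<Y> \<X> \<pi>) V) (inv_image_map \<pi> V) (Osec \<Y> V)),
       mrst = (\<lambda>V W. fs_map (kaehler_gens (Osec \<Y> W))
                       (kaehler_rels (Osec (inv_image_rs \<Y> \<X> \<pi>) W) (inv_image_map \<pi> W) (Osec \<Y> W))
                       (map_prod (rst \<Y> V W) (rst \<Y> V W))) \<rparr>"

definition Omega where
  "Omega \<Y> \<X> \<pi> = sheafify \<Y> (Omega_presheaf \<Y> \<X> \<pi>)"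

definition diff where
  "diff \<Y> \<X> \<pi> V b = sheafify_unit (tops \<Y>) (Omega_presheaf \<Y> \<X> \<pi>) V
     (kaehler_class (Osec (inv_image_rs \<Y> \<X> \<pi>) V) (inv_image_map \<pi> V) (Osec \<Y> V) [(\<one>\<^bsub>Osec \<Y> V\<^esub>, b)])"

text \<open>\<open>M \<otimes>\<^bsub>\<O>\<^sub>\<X>\<^esub> S\<close> for an \<open>\<O>\<^sub>\<Y>\<close>-module \<open>M\<close> and an \<open>\<O>\<^sub>\<X>\<close>-module \<open>S\<close>.\<close>

definition tensor_X_presheaf where
  "tensor_X_presheaf \<Y> \<X> \<pi> M S =
     tensor_presheaf (inv_image_rs \<Y> \<X> \<pi>) (inv_image_map \<pi>) M (inv_image_mod \<pi> S)"

definition tensor_X where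
  "tensor_X \<Y> \<X> \<pi> M S = tensor_sheaf \<Y> (inv_image_rs \<Y> \<X> \<pi>) (inv_image_map \<pi>) M (inv_image_mod \<pi> S)"

definition tensor_X_fs_map where
  "tensor_X_fs_map \<Y> \<X> \<pi> M S V =
     fs_map (tens_gens (msec M V) (msec (inv_image_mod \<pi> S) V))
       (tens_rels (Osec (inv_image_rs \<Y> \<X> \<pi>) V) (inv_image_map \<pi> V)
          (msec M V) (msec (inv_image_mod \<pi> S) V))"

text \<open>\<open>\<Omega>\<^bsub>\<Y>/\<X>\<^esub> \<otimes>\<^bsub>\<O>\<^sub>\<Y>\<^esub> S\<close> for an \<open>\<O>\<^sub>\<Y>\<close>-module \<open>S\<close>.\<close>

definition Omega_tensor_presheaf where
  "Omega_tensor_presheaf \<Y> \<X> \<pi> S = tensor_presheaf \<Y> (\<lambda>V b. b) (Omega \<Y> \<X> \<pi>) S"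

definition Omega_tensor where
  "Omega_tensor \<Y> \<X> \<pi> S = tensor_sheaf \<Y> \<Y> (\<lambda>V b. b) (Omega \<Y> \<X> \<pi>) S"

text \<open>\<open>d \<otimes> 1 : \<O>\<^sub>\<Y> \<otimes>\<^bsub>\<O>\<^sub>\<X>\<^esub> S \<rightarrow> \<Omega>\<^bsub>\<Y>/\<X>\<^esub> \<otimes>\<^bsub>\<O>\<^sub>\<X>\<^esub> S\<close>.\<close>

definition d_tensor_one where
  "d_tensor_one \<Y> \<X> \<pi> S =
     sheafify_map (tops \<Y>) (tensor_X_presheaf \<Y> \<X> \<pi> (Omega \<Y> \<X> \<pi>) S)
       (\<lambda>V. tensor_X_fs_map \<Y> \<X> \<pi> (Omega \<Y> \<X> \<pi>) S V (map_prod (diff \<Y> \<X> \<pi> V) (\<lambda>m. m)))"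

text \<open>The canonical isomorphism \<open>\<Omega>\<^bsub>\<Y>/\<X>\<^esub> \<otimes>\<^bsub>\<O>\<^sub>\<X>\<^esub> S \<rightarrow>
  \<Omega>\<^bsub>\<Y>/\<X>\<^esub> \<otimes>\<^bsub>\<O>\<^sub>\<Y>\<^esub> (\<O>\<^sub>\<Y> \<otimes>\<^bsub>\<O>\<^sub>\<X>\<^esub> S)\<close>, \<open>\<omega> \<otimes> m \<mapsto> \<omega> \<otimes> (1 \<otimes> m)\<close>.\<close>

definition one_tensor where
  "one_tensor \<Y> \<X> \<pi> S V m =
     sheafify_unit (tops \<Y>) (tensor_X_presheaf \<Y> \<X> \<pi> (structure_module \<Y>) S) V
       (tens_class (Osec (inv_image_rs \<Y> \<X> \<pi>) V) (inv_image_map \<pi> V)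
          (msec (structure_module \<Y>) V) (msec (inv_image_mod \<pi> S) V) [(\<one>\<^bsub>Osec \<Y> V\<^esub>, m)])"

definition assoc_iso where
  "assoc_iso \<Y> \<X> \<pi> S =
     sheafify_map (tops \<Y>)
       (Omega_tensor_presheaf \<Y> \<X> \<pi> (tensor_X \<Y> \<X> \<pi> (structure_module \<Y>) S))
       (\<lambda>V. fs_map
          (tens_gens (msec (Omega \<Y> \<X> \<pi>) V) (msec (tensor_X \<Y> \<X> \<pi> (structure_module \<Y>) S) V))
          (tens_rels (Osec \<Y> V) (\<lambda>b. b) (msec (Omega \<Y> \<X> \<pi>) V)
             (msec (tensor_X \<Y> \<X> \<pi> (structure_module \<Y>) S) V))
          (map_prod (\<lambda>\<omega>. \<omega>) (one_tensor \<Y> \<X> \<pi> S V)))"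

text \<open>The functors act on pairs \<open>(S, \<nabla>)\<close> of an \<open>\<O>\<^sub>\<Y>\<close>-module and a map
  \<open>\<nabla> : S \<rightarrow> \<Omega>\<^bsub>\<Y>/\<X>\<^esub> \<otimes>\<^bsub>\<O>\<^sub>\<Y>\<^esub> S\<close>, given as a family indexed by the open subsets
  of \<open>\<Y>\<close>.\<close>

definition G_functor where
  "G_functor \<Y> \<X> \<pi> S =
     (tensor_X \<Y> \<X> \<pi> (structure_module \<Y>) S,
      \<lambda>V. assoc_iso \<Y> \<X> \<pi> S \<circ> d_tensor_one \<Y> \<X> \<pi> S)"

definition F_functor where
  "F_functor \<Y> \<X> \<pi> = (\<lambda>(S, D).
     \<lparr> msec = (\<lambda>U.
         \<lparr> carrier = {s \<in> carrier (msec S (preim \<Y> \<pi> U)).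
              D (preim \<Y> \<pi> U) s = \<zero>\<^bsub>msec (Omega_tensor \<Y> \<X> \<pi> S) (preim \<Y> \<pi> U)\<^esub>},
           monoid.mult = monoid.mult (msec S (preim \<Y> \<pi> U)),
           one = one (msec S (preim \<Y> \<pi> U)),
           zero = zero (msec S (preim \<Y> \<pi> U)),
           add = add (msec S (preim \<Y> \<pi> U)),
           smult = (\<lambda>a. smult (msec S (preim \<Y> \<pi> U)) (sharp \<pi> U a)) \<rparr>),
       mrst = (\<lambda>U V. mrst S (preim \<Y> \<pi> U) (preim \<Y> \<pi> V)) \<rparr>)"

end

theory Submission imports Defs begin

text \<open>Near a point of \<open>\<Y>\<close>, the locally free sheaf \<open>\<Omega>\<close> of differentials has a basis of the form
  \<open>dx\<^sub>1, \<dots>, dx\<^sub>n\<close>; let \<open>l\<^sub>i\<close> be the dual basis and \<open>D\<^sub>i = l\<^sub>i \<circ> d\<close>, so that \<open>D\<^sub>i x\<^sub>j = \<delta>\<^sub>i\<^sub>j\<close>.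
  Every derivation of \<open>\<O>\<^sub>\<Y>\<close> over the subring \<open>C = \<O>\<^sub>\<X>[x\<^sub>1, \<dots>, x\<^sub>n]\<close> with values in the quotient by the
  prime ideal of non-units at the point vanishes. As \<open>\<O>\<^sub>\<Y>\<close> is finitely generated over \<open>C\<close> and
  its \<open>p\<close>-th powers lie in \<open>C\<close>, this forces \<open>\<O>\<^sub>\<Y> = C\<close> near the point: otherwise some \<open>C\<close>-linear
  map to the quotient is not \<open>\<O>\<^sub>\<Y>\<close>-linear, its iterated commutators with generators of \<open>\<O>\<^sub>\<Y>\<close> vanish
  eventually because \<open>p\<close>-fold ones do, and the last one that is not \<open>\<O>\<^sub>\<Y>\<close>-linear is, up to a linear map,
  a nonzero derivation. Applying the \<open>D\<^sub>i\<close> repeatedly shows that the monomials in the \<open>x\<^sub>i\<close> with exponents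
  below \<open>p\<close> form a basis of \<open>\<O>\<^sub>\<Y>\<close> over \<open>\<O>\<^sub>\<X>\<close>.

  In \<open>\<O>\<^sub>\<Y> \<otimes> S\<^sub>1\<close> the operator \<open>D\<^sub>i \<otimes> 1\<close> lowers the \<open>i\<close>-th exponent and multiplies by it, which is
  invertible unless it is zero. A section killed by \<open>d \<otimes> 1\<close>, hence by all \<open>D\<^sub>i \<otimes> 1\<close>, is therefore locally of
  the form \<open>1 \<otimes> m\<close>, with \<open>m\<close> unique as the coefficient of the monomial \<open>1\<close>; uniqueness lets the local
  \<open>m\<close> glue.\<close>

section \<open>Modules given by generators and relations\<close>

text \<open>Two obstacles shape the proof. Both \<Omega> and the tensor products are associated
  sheaves of quotients of formal sums, so an equality of sections becomes a congruence of formal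
  sums only after shrinking the neighbourhood, and for finitely many sums at a time. And no stalks
  are formed: a point is represented by the prime ideal of those sections over a neighbourhood whose
  germ is no unit, and its residue field by the quotient domain. Finite generation comes from \<Y>
  being of finite type over \<open>L\<close> and \<open>L\<close> finite over \<open>K\<close>. It
  survives localization because a unit \<open>u\<close> has the inverse \<open>u^(p-1) a\<close>
  with \<open>a\<close> from \<X>: the map through which Frobenius factors sends \<open>u\<close> to
  a unit there. As p-th powers come from \<X>, algebra generators yield finitely many module
  generators. The p-fold commutators vanish because they are p-th powers of a sum of two commuting
  operators; in characteristic p such a power splits, and p-th powers are scalars of
  \<open>C\<close>. Uniqueness of coefficients needs sections of \<X> to embed in those of \<Y>: a
  section that dies on \<Y> is invertible on no nonempty open set of the integral scheme \<X>, hence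
  zero.\<close>

definition wf_rels :: "'g set \<Rightarrow> ('g list \<times> 'g list) set \<Rightarrow> bool" where
  "wf_rels G E \<longleftrightarrow> (\<forall>(xs, ys)\<in>E. set xs \<subseteq> G \<and> set ys \<subseteq> G)"

lemma wf_relsD: "wf_rels G E \<Longrightarrow> (xs, ys) \<in> E \<Longrightarrow> set xs \<subseteq> G \<and> set ys \<subseteq> G"
  unfolding wf_rels_def by blast

text \<open>The rule \<open>fs_rel\<close> puts no condition on the relations, so without
  \<open>wf_rels\<close> a congruence could lead out of the lists over \<open>G\<close>.\<close>

lemma fs_cong_gens: "fs_cong G E xs ys \<Longrightarrow> wf_rels G E \<Longrightarrow> set xs \<subseteq> G \<and> set ys \<subseteq> G"
  by (induction rule: fs_cong.induct) (auto dest: wf_relsD)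

lemma fs_class_eqI: "fs_cong G E xs ys \<Longrightarrow> fs_class G E xs = fs_class G E ys"
  unfolding fs_class_def using fs_sym fs_trans by blast

lemma fs_class_self: "set xs \<subseteq> G \<Longrightarrow> xs \<in> fs_class G E xs"
  unfolding fs_class_def by (simp add: fs_refl)

lemma fs_class_eq_iff:
  "set ys \<subseteq> G \<Longrightarrow> fs_class G E xs = fs_class G E ys \<longleftrightarrow> fs_cong G E xs ys"
  using fs_class_eqI fs_class_self unfolding fs_class_def by blast

lemma fs_cong_map:
  assumes "fs_cong G E xs ys" and h: "h ` G \<subseteq> G'"
    and rel: "\<And>xs ys. (xs, ys) \<in> E \<Longrightarrow> fs_cong G' E' (map h xs) (map h ys)"
  shows "fs_cong G' E' (map h xs) (map h ys)"
  using assms(1)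
proof (induction rule: fs_cong.induct)
  case (fs_refl xs)
  then show ?case using h by (intro fs_cong.fs_refl) auto
next
  case (fs_sym xs ys)
  show ?case using fs_sym.IH by (rule fs_cong.fs_sym)
next
  case (fs_trans xs ys zs)
  then show ?case by (blast intro: fs_cong.fs_trans)
next
  case (fs_add xs ys xs' ys')
  then show ?case by (simp add: fs_cong.fs_add)
next
  case (fs_comm xs ys)
  then show ?case using h by (simp, intro fs_cong.fs_comm) auto
qed (simp add: rel)

text \<open>\<open>fs_map\<close> is a union over all representatives of a class. When
  \<open>h\<close> respects the relations, every representative yields the same class and the union
  collapses to it.\<close>

lemma fs_map_class:
  assumes "set xs \<subseteq> G" and "h ` G \<subseteq> G'"
    and "\<And>xs ys. (xs, ys) \<in> E \<Longrightarrow> fs_cong G' E' (map h xs) (map h ys)"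
  shows "fs_map G' E' h (fs_class G E xs) = fs_class G' E' (map h xs)"
proof -
  have "fs_class G' E' (map h ys) = fs_class G' E' (map h xs)" if "ys \<in> fs_class G E xs" for ys
  proof -
    have "fs_cong G E xs ys" using that unfolding fs_class_def by simp
    from fs_cong_map[OF this assms(2,3)] show ?thesis by (simp add: fs_class_eqI)
  qed
  moreover have "xs \<in> fs_class G E xs" using assms(1) by (rule fs_class_self)
  ultimately show ?thesis unfolding fs_map_def by blast
qed

lemma fs_add_class:
  assumes "set xs \<subseteq> G" and "set ys \<subseteq> G"
  shows "(\<Union>us\<in>fs_class G E xs. \<Union>vs\<in>fs_class G E ys. fs_class G E (us @ vs)) = fs_class G E (xs @ ys)"
proof -
  have "fs_class G E (us @ vs) = fs_class G E (xs @ ys)"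
    if "us \<in> fs_class G E xs" "vs \<in> fs_class G E ys" for us vs
    using that unfolding fs_class_def[of G E xs] fs_class_def[of G E ys]
    by (intro fs_class_eqI) (auto intro: fs_cong.fs_add fs_cong.fs_sym)
  moreover have "xs \<in> fs_class G E xs" "ys \<in> fs_class G E ys" using assms by (simp_all add: fs_class_self)
  ultimately show ?thesis by blast
qed

lemma fs_module_simps:
  "carrier (fs_module G E act) = fs_class G E ` {xs. set xs \<subseteq> G}"
  "\<zero>\<^bsub>fs_module G E act\<^esub> = fs_class G E []"
  "smult (fs_module G E act) b = fs_map G E (act b)"
  unfolding fs_module_def by simp_all

lemma fs_module_add:
  "set xs \<subseteq> G \<Longrightarrow> set ys \<subseteq> G \<Longrightarrow>
    fs_class G E xs \<oplus>\<^bsub>fs_module G E act\<^esub> fs_class G E ys = fs_class G E (xs @ ys)"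
  unfolding fs_module_def by (simp add: fs_add_class)

lemma fs_cong_concat:
  assumes "\<And>x. x \<in> set xs \<Longrightarrow> fs_cong G E (f x) (g x)"
  shows "fs_cong G E (concat (map f xs)) (concat (map g xs))"
  using assms by (induction xs) (auto intro: fs_cong.fs_refl fs_cong.fs_add)

lemma fs_cong_concat_append:
  assumes "\<And>x. x \<in> set xs \<Longrightarrow> set (f x) \<subseteq> G \<and> set (g x) \<subseteq> G"
  shows "fs_cong G E (concat (map (\<lambda>x. f x @ g x) xs)) (concat (map f xs) @ concat (map g xs))"
  using assms
proof (induction xs)
  case Nil
  then show ?case by (simp add: fs_cong.fs_refl)
next
  case (Cons x xs)
  let ?F = "concat (map f xs)" and ?G = "concat (map g xs)"
  have sub: "set (f x) \<subseteq> G" "set (g x) \<subseteq> G" "set ?F \<subseteq> G" "set ?G \<subseteq> G"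
    using Cons.prems by auto
  have "fs_cong G E (f x @ g x @ concat (map (\<lambda>x. f x @ g x) xs)) (f x @ g x @ ?F @ ?G)"
    using Cons sub by (intro fs_cong.fs_add fs_cong.fs_refl) auto
  moreover have "fs_cong G E (f x @ (g x @ ?F) @ ?G) (f x @ (?F @ g x) @ ?G)"
    using sub by (intro fs_cong.fs_add fs_cong.fs_refl fs_cong.fs_comm) auto
  ultimately show ?case by (auto intro: fs_cong.fs_trans)
qed

section \<open>The module presented by generators, relations and an action on the generators\<close>

locale fs_presentation = cring B for B (structure) +
  fixes G :: "'g set" and E :: "('g list \<times> 'g list) set" and act :: "'a \<Rightarrow> 'g \<Rightarrow> 'g"
  assumes wf: "wf_rels G E"
    and act_gens: "b \<in> carrier B \<Longrightarrow> g \<in> G \<Longrightarrow> act b g \<in> G"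
    and act_rels: "b \<in> carrier B \<Longrightarrow> (xs, ys) \<in> E \<Longrightarrow> fs_cong G E (map (act b) xs) (map (act b) ys)"
    and act_add: "b \<in> carrier B \<Longrightarrow> c \<in> carrier B \<Longrightarrow> g \<in> G \<Longrightarrow>
        fs_cong G E [act (b \<oplus> c) g] [act b g, act c g]"
    and act_mult: "b \<in> carrier B \<Longrightarrow> c \<in> carrier B \<Longrightarrow> g \<in> G \<Longrightarrow> act (b \<otimes> c) g = act b (act c g)"
    and act_one: "g \<in> G \<Longrightarrow> act \<one> g = g"
    and act_zero: "g \<in> G \<Longrightarrow> fs_cong G E [act \<zero> g] []"
begin

abbreviation "Q \<equiv> fs_module G E act"

lemma smult_class:
  "b \<in> carrier B \<Longrightarrow> set xs \<subseteq> G \<Longrightarrow> b \<odot>\<^bsub>Q\<^esub> fs_class G E xs = fs_class G E (map (act b) xs)"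
  unfolding fs_module_simps by (rule fs_map_class) (auto simp: act_gens act_rels)

lemma act_set: "b \<in> carrier B \<Longrightarrow> set xs \<subseteq> G \<Longrightarrow> act b ` set xs \<subseteq> G"
  using act_gens by blast

lemma act_add_list:
  assumes "b \<in> carrier B" "c \<in> carrier B" "set xs \<subseteq> G"
  shows "fs_cong G E (map (act (b \<oplus> c)) xs) (map (act b) xs @ map (act c) xs)"
proof -
  have s: "concat (map (\<lambda>x. [f x]) xs) = map f xs" for f :: "'g \<Rightarrow> 'g"
    by (induction xs) auto
  have "fs_cong G E (concat (map (\<lambda>x. [act (b \<oplus> c) x]) xs)) (concat (map (\<lambda>x. [act b x] @ [act c x]) xs))"
    using assms act_add by (intro fs_cong_concat) auto
  also have "fs_cong G E \<dots> (concat (map (\<lambda>x. [act b x]) xs) @ concat (map (\<lambda>x. [act c x]) xs))"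
    using assms act_gens by (intro fs_cong_concat_append) auto
  finally (fs_cong.fs_trans) show ?thesis unfolding s .
qed

lemma act_zero_list: "set xs \<subseteq> G \<Longrightarrow> fs_cong G E (map (act \<zero>) xs) []"
proof (induction xs)
  case Nil
  then show ?case by (simp add: fs_cong.fs_refl)
next
  case (Cons x xs)
  have "fs_cong G E ([act \<zero> x] @ map (act \<zero>) xs) ([] @ [])"
    using Cons act_zero by (intro fs_cong.fs_add) auto
  then show ?case by simp
qed

lemma map_act_one: "set xs \<subseteq> G \<Longrightarrow> map (act \<one>) xs = xs"
  by (induction xs) (auto simp: act_one)

lemma class_carrier: "set xs \<subseteq> G \<Longrightarrow> fs_class G E xs \<in> carrier Q"
  unfolding fs_module_simps by blast

lemma module_Q: "Module.module B Q"
proof (rule moduleI)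
  show "cring B" ..
  show "abelian_group Q"
  proof (rule abelian_groupI)
    fix x assume "x \<in> carrier Q"
    then obtain xs where x: "x = fs_class G E xs" "set xs \<subseteq> G" unfolding fs_module_simps by blast
    \<comment> \<open>The negative of a class is its multiple by -1: the sum of the two is the
      action of -1 + 1 = 0, which \<open>act_zero\<close> makes trivial. Here the commutative monoid
      of formal sums becomes a group.\<close>
    have "fs_class G E (map (act (\<ominus> \<one>)) xs) \<oplus>\<^bsub>Q\<^esub> x = fs_class G E (map (act (\<ominus> \<one>)) xs @ map (act \<one>) xs)"
      using x act_set[of "\<ominus> \<one>" xs] by (simp add: fs_module_add map_act_one)
    also have "\<dots> = fs_class G E (map (act (\<ominus> \<one> \<oplus> \<one>)) xs)"
      using x by (intro fs_class_eqI[symmetric] act_add_list) auto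
    also have "\<dots> = \<zero>\<^bsub>Q\<^esub>"
      unfolding fs_module_simps using act_zero_list x by (intro fs_class_eqI) (simp add: l_neg)
    finally show "\<exists>y\<in>carrier Q. y \<oplus>\<^bsub>Q\<^esub> x = \<zero>\<^bsub>Q\<^esub>"
      using x act_set[of "\<ominus> \<one>" xs] class_carrier[of "map (act (\<ominus> \<one>)) xs"]
      by (intro bexI[of _ "fs_class G E (map (act (\<ominus> \<one>)) xs)"]) simp_all
  next
    fix x y z assume "x \<in> carrier Q" "y \<in> carrier Q" "z \<in> carrier Q"
    then obtain xs ys zs where x: "x = fs_class G E xs" "set xs \<subseteq> G"
        "y = fs_class G E ys" "set ys \<subseteq> G" "z = fs_class G E zs" "set zs \<subseteq> G"
      unfolding fs_module_simps by blast
    then show "x \<oplus>\<^bsub>Q\<^esub> y \<oplus>\<^bsub>Q\<^esub> z = x \<oplus>\<^bsub>Q\<^esub> (y \<oplus>\<^bsub>Q\<^esub> z)" by (simp add: fs_module_add)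
  next
    fix x y assume "x \<in> carrier Q" "y \<in> carrier Q"
    then obtain xs ys where x: "x = fs_class G E xs" "set xs \<subseteq> G" "y = fs_class G E ys" "set ys \<subseteq> G"
      unfolding fs_module_simps by blast
    show "x \<oplus>\<^bsub>Q\<^esub> y = y \<oplus>\<^bsub>Q\<^esub> x"
      unfolding x using x(2,4) by (simp add: fs_module_add fs_class_eqI[OF fs_comm])
    show "x \<oplus>\<^bsub>Q\<^esub> y \<in> carrier Q"
      unfolding x using x(2,4) class_carrier[of "xs @ ys"] by (simp add: fs_module_add)
  next
    fix x assume "x \<in> carrier Q"
    then obtain xs where x: "x = fs_class G E xs" "set xs \<subseteq> G" unfolding fs_module_simps by blast
    show "\<zero>\<^bsub>Q\<^esub> \<oplus>\<^bsub>Q\<^esub> x = x"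
      unfolding fs_module_simps(2) x using fs_module_add[of "[]" G xs E act] x(2) by simp
  next
    show "\<zero>\<^bsub>Q\<^esub> \<in> carrier Q" using class_carrier[of "[]"] unfolding fs_module_simps(2) by simp
  qed
next
  fix x assume "x \<in> carrier Q"
  then obtain xs where xs: "x = fs_class G E xs" "set xs \<subseteq> G" unfolding fs_module_simps by blast
  show "\<one> \<odot>\<^bsub>Q\<^esub> x = x"
    using smult_class[OF one_closed xs(2)] xs by (simp add: map_act_one)
next
  fix b x assume b: "b \<in> carrier B" and x: "x \<in> carrier Q"
  then obtain xs where xs: "x = fs_class G E xs" "set xs \<subseteq> G" unfolding fs_module_simps by blast
  show "b \<odot>\<^bsub>Q\<^esub> x \<in> carrier Q"
    using smult_class[OF b xs(2)] xs act_set[OF b xs(2)] class_carrier by simp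
  fix c assume c: "c \<in> carrier B"
  show "(b \<oplus> c) \<odot>\<^bsub>Q\<^esub> x = b \<odot>\<^bsub>Q\<^esub> x \<oplus>\<^bsub>Q\<^esub> c \<odot>\<^bsub>Q\<^esub> x"
    using xs b c act_set[OF b xs(2)] act_set[OF c xs(2)]
    by (simp add: smult_class fs_module_add fs_class_eqI act_add_list)
  show "(b \<otimes> c) \<odot>\<^bsub>Q\<^esub> x = b \<odot>\<^bsub>Q\<^esub> (c \<odot>\<^bsub>Q\<^esub> x)"
    using xs b c act_set[OF c xs(2)] act_mult
    by (simp add: smult_class subset_iff cong: map_cong)
next
  fix b x y assume b: "b \<in> carrier B" and x: "x \<in> carrier Q" and y: "y \<in> carrier Q"
  then obtain xs ys where xs: "x = fs_class G E xs" "set xs \<subseteq> G" "y = fs_class G E ys" "set ys \<subseteq> G"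
    unfolding fs_module_simps by blast
  then show "b \<odot>\<^bsub>Q\<^esub> (x \<oplus>\<^bsub>Q\<^esub> y) = b \<odot>\<^bsub>Q\<^esub> x \<oplus>\<^bsub>Q\<^esub> b \<odot>\<^bsub>Q\<^esub> y"
    using b act_set[OF b, of xs] act_set[OF b, of ys] by (simp add: smult_class fs_module_add)
qed

end

section \<open>Evaluation of formal sums in an abelian monoid\<close>

definition fs_eval :: "('n, 'z) ring_scheme \<Rightarrow> ('g \<Rightarrow> 'n) \<Rightarrow> 'g list \<Rightarrow> 'n" where
  "fs_eval N h xs = foldr (\<lambda>g v. h g \<oplus>\<^bsub>N\<^esub> v) xs \<zero>\<^bsub>N\<^esub>"

lemma fs_eval_simps [simp]:
  "fs_eval N h [] = \<zero>\<^bsub>N\<^esub>"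
  "fs_eval N h (g # xs) = h g \<oplus>\<^bsub>N\<^esub> fs_eval N h xs"
  unfolding fs_eval_def by simp_all

context abelian_monoid
begin

lemma fs_eval_closed: "(\<And>g. g \<in> set xs \<Longrightarrow> h g \<in> carrier G) \<Longrightarrow> fs_eval G h xs \<in> carrier G"
  by (induction xs) auto

lemma fs_eval_append:
  "(\<And>g. g \<in> set xs \<union> set ys \<Longrightarrow> h g \<in> carrier G) \<Longrightarrow>
    fs_eval G h (xs @ ys) = fs_eval G h xs \<oplus> fs_eval G h ys"
  by (induction xs) (auto simp: fs_eval_closed a_assoc)

text \<open>The universal property of the quotient, by induction on the congruence. All maps out of
  tensor products and differentials to a given module (coordinates, contractions, derivations) are
  shown to be well defined through it.\<close>

lemma fs_eval_cong:
  assumes "fs_cong Gs E xs ys" and wf: "wf_rels Gs E" and h: "\<And>g. g \<in> Gs \<Longrightarrow> h g \<in> carrier G"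
    and rel: "\<And>xs ys. (xs, ys) \<in> E \<Longrightarrow> fs_eval G h xs = fs_eval G h ys"
  shows "fs_eval G h xs = fs_eval G h ys"
  using assms(1)
proof (induction rule: fs_cong.induct)
  case (fs_add xs ys xs' ys')
  then show ?case using fs_cong_gens[OF fs_add.hyps(1) wf] fs_cong_gens[OF fs_add.hyps(2) wf] h
    by (subst (1 2) fs_eval_append) auto
next
  case (fs_comm xs ys)
  then have "h g \<in> carrier G" if "g \<in> set xs \<union> set ys" for g using that h by blast
  then show ?case
    by (subst (1 2) fs_eval_append) (auto intro!: a_comm fs_eval_closed)
qed (simp_all add: rel)

end

section \<open>Presheaves of modules and sheafification\<close>

text \<open>Gluing is left out: germs and sheafification use restriction maps only, and the inverse
  image of the structure sheaf of \<X> then qualifies at once.\<close>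

definition ring_presheaf :: "('x, 'a) ringed_space \<Rightarrow> bool" where
  "ring_presheaf \<X> \<longleftrightarrow>
     (\<forall>U. openin (tops \<X>) U \<longrightarrow> cring (Osec \<X> U) \<and> (\<forall>a\<in>carrier (Osec \<X> U). rst \<X> U U a = a)) \<and>
     (\<forall>U V. openin (tops \<X>) U \<and> openin (tops \<X>) V \<and> V \<subseteq> U \<longrightarrow>
        rst \<X> U V \<in> ring_hom (Osec \<X> U) (Osec \<X> V)) \<and>
     (\<forall>U V W. openin (tops \<X>) U \<and> openin (tops \<X>) V \<and> openin (tops \<X>) W \<and> W \<subseteq> V \<and> V \<subseteq> U \<longrightarrow>
        (\<forall>a\<in>carrier (Osec \<X> U). rst \<X> V W (rst \<X> U V a) = rst \<X> U W a))"

lemma is_ringed_space_ring_presheaf: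
  assumes "is_ringed_space \<X>"
  shows "ring_presheaf \<X>"
proof -
  note R = assms[unfolded is_ringed_space_def]
  note sh = R[THEN conjunct1, unfolded sheaf_of_sets_def]
  show ?thesis
    unfolding ring_presheaf_def
    using R[THEN conjunct2] sh[THEN conjunct2, THEN conjunct1]
      sh[THEN conjunct2, THEN conjunct2, THEN conjunct1] by simp
qed

lemma ringed_space_rst:
  assumes "ring_presheaf \<X>" "openin (tops \<X>) U" "openin (tops \<X>) V" "V \<subseteq> U"
  shows "rst \<X> U V \<in> ring_hom (Osec \<X> U) (Osec \<X> V)"
  using assms unfolding ring_presheaf_def by simp

lemma ringed_space_rst_closed:
  assumes "ring_presheaf \<X>" "openin (tops \<X>) U" "openin (tops \<X>) V" "V \<subseteq> U" "a \<in> carrier (Osec \<X> U)"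
  shows "rst \<X> U V a \<in> carrier (Osec \<X> V)"
  using ringed_space_rst[OF assms(1-4)] assms(5) by (rule ring_hom_closed)

lemma ringed_space_cring:
  assumes "ring_presheaf \<X>" "openin (tops \<X>) U"
  shows "cring (Osec \<X> U)"
  using assms unfolding ring_presheaf_def by simp

lemma ringed_space_rst_id:
  assumes "ring_presheaf \<X>" "openin (tops \<X>) U" "a \<in> carrier (Osec \<X> U)"
  shows "rst \<X> U U a = a"
  using assms unfolding ring_presheaf_def by simp

lemma ringed_space_rst_comp:
  assumes "ring_presheaf \<X>" "openin (tops \<X>) U" "openin (tops \<X>) V" "openin (tops \<X>) W"
    "W \<subseteq> V" "V \<subseteq> U" "a \<in> carrier (Osec \<X> U)"
  shows "rst \<X> V W (rst \<X> U V a) = rst \<X> U W a"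
  using assms unfolding ring_presheaf_def by simp

text \<open>The sheaf conditions are omitted so that presheaf tensor products and presheaf
  differentials, which need not be sheaves, are covered and can be sheafified.\<close>

locale module_presheaf =
  fixes \<X> :: "('x, 'a) ringed_space" and F :: "('x, 'a, 'm) mod_sheaf"
  assumes ringed: "ring_presheaf \<X>"
    and module_sec: "openin (tops \<X>) U \<Longrightarrow> Module.module (Osec \<X> U) (msec F U)"
    and res_closed: "openin (tops \<X>) U \<Longrightarrow> openin (tops \<X>) V \<Longrightarrow> V \<subseteq> U \<Longrightarrow>
        m \<in> carrier (msec F U) \<Longrightarrow> mrst F U V m \<in> carrier (msec F V)"
    and res_add: "openin (tops \<X>) U \<Longrightarrow> openin (tops \<X>) V \<Longrightarrow> V \<subseteq> U \<Longrightarrow>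
        m \<in> carrier (msec F U) \<Longrightarrow> n \<in> carrier (msec F U) \<Longrightarrow>
        mrst F U V (m \<oplus>\<^bsub>msec F U\<^esub> n) = mrst F U V m \<oplus>\<^bsub>msec F V\<^esub> mrst F U V n"
    and res_smult: "openin (tops \<X>) U \<Longrightarrow> openin (tops \<X>) V \<Longrightarrow> V \<subseteq> U \<Longrightarrow>
        m \<in> carrier (msec F U) \<Longrightarrow> a \<in> carrier (Osec \<X> U) \<Longrightarrow>
        mrst F U V (a \<odot>\<^bsub>msec F U\<^esub> m) = rst \<X> U V a \<odot>\<^bsub>msec F V\<^esub> mrst F U V m"
    and res_id: "openin (tops \<X>) U \<Longrightarrow> m \<in> carrier (msec F U) \<Longrightarrow> mrst F U U m = m"
    and res_comp: "openin (tops \<X>) U \<Longrightarrow> openin (tops \<X>) V \<Longrightarrow> openin (tops \<X>) W \<Longrightarrow>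
        W \<subseteq> V \<Longrightarrow> V \<subseteq> U \<Longrightarrow> m \<in> carrier (msec F U) \<Longrightarrow>
        mrst F V W (mrst F U V m) = mrst F U W m"

lemma is_module_sheaf_module_presheaf:
  assumes "ring_presheaf \<X>" and "is_module_sheaf \<X> F"
  shows "module_presheaf \<X> F"
proof (rule module_presheaf.intro)
  note F = assms(2)[unfolded is_module_sheaf_def]
  note sh = F[THEN conjunct1, unfolded sheaf_of_sets_def]
  show "ring_presheaf \<X>" by (rule assms)
  fix U assume "openin (tops \<X>) U"
  then show "Module.module (Osec \<X> U) (msec F U)"
    using F[THEN conjunct2, THEN conjunct1] by blast
next
  note F = assms(2)[unfolded is_module_sheaf_def]
  note sh = F[THEN conjunct1, unfolded sheaf_of_sets_def]
  fix U m assume *: "openin (tops \<X>) U" "m \<in> carrier (msec F U)"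
  show "mrst F U U m = m" using sh[THEN conjunct2, THEN conjunct1] * by blast
  fix V assume V: "openin (tops \<X>) V" "V \<subseteq> U"
  show "mrst F U V m \<in> carrier (msec F V)" using sh[THEN conjunct1] * V by blast
  show "mrst F U V (m \<oplus>\<^bsub>msec F U\<^esub> n) = mrst F U V m \<oplus>\<^bsub>msec F V\<^esub> mrst F U V n"
    if "n \<in> carrier (msec F U)" for n
    using F[THEN conjunct2, THEN conjunct2] * V that by blast
  show "mrst F U V (a \<odot>\<^bsub>msec F U\<^esub> m) = rst \<X> U V a \<odot>\<^bsub>msec F V\<^esub> mrst F U V m"
    if "a \<in> carrier (Osec \<X> U)" for a
    using F[THEN conjunct2, THEN conjunct2] * V that by blast
  fix W assume "openin (tops \<X>) W" "W \<subseteq> V"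
  then show "mrst F V W (mrst F U V m) = mrst F U W m"
    using sh[THEN conjunct2, THEN conjunct2, THEN conjunct1] * V by blast
qed

lemma (in abelian_group) zero_unique: "x \<in> carrier G \<Longrightarrow> x \<oplus> x = x \<Longrightarrow> x = \<zero>"
  by (metis add.l_cancel r_zero zero_closed)

section \<open>Germs of a presheaf of modules\<close>

context module_presheaf
begin

abbreviation "T \<equiv> tops \<X>"

abbreviation gm where "gm \<equiv> germ T F"

abbreviation "S \<equiv> sheafify \<X> F"

lemma res_zero:
  assumes "openin T U" "openin T V" "V \<subseteq> U"
  shows "mrst F U V \<zero>\<^bsub>msec F U\<^esub> = \<zero>\<^bsub>msec F V\<^esub>"
proof -
  interpret U: Module.module "Osec \<X> U" "msec F U" using assms module_sec by blast
  interpret V: Module.module "Osec \<X> V" "msec F V" using assms module_sec by blast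
  show ?thesis
    using res_add[OF assms U.zero_closed U.zero_closed] res_closed[OF assms U.zero_closed]
    by (intro V.zero_unique) simp_all
qed

lemma germ_self:
  "openin T V \<Longrightarrow> x \<in> V \<Longrightarrow> m \<in> carrier (msec F V) \<Longrightarrow> (V, m) \<in> gm x V m"
  unfolding germ_def by blast

text \<open>A germ is coded as the set of all its representatives, so equality of germs is equality
  of sets. What has to be proved is that agreement near \<open>x\<close> is transitive.\<close>

lemma germ_eq_iff:
  assumes V: "openin T V" "x \<in> V" "m \<in> carrier (msec F V)"
    and W: "openin T W" "x \<in> W" "n \<in> carrier (msec F W)"
  shows "gm x V m = gm x W n \<longleftrightarrow>
    (\<exists>Z. openin T Z \<and> x \<in> Z \<and> Z \<subseteq> V \<inter> W \<and> mrst F V Z m = mrst F W Z n)"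
proof
  assume "gm x V m = gm x W n"
  then have "(W, n) \<in> gm x V m" using germ_self[OF W] by simp
  then show "\<exists>Z. openin T Z \<and> x \<in> Z \<and> Z \<subseteq> V \<inter> W \<and> mrst F V Z m = mrst F W Z n"
    unfolding germ_def by blast
next
  have sub: "gm x V m \<subseteq> gm x W n"
    if V: "openin T V" "m \<in> carrier (msec F V)" and W: "openin T W" "n \<in> carrier (msec F W)"
      and Z: "openin T Z" "x \<in> Z" "Z \<subseteq> V \<inter> W" "mrst F V Z m = mrst F W Z n"
    for V W m n Z
  proof
    fix q assume "q \<in> gm x V m"
    then obtain W' n' Z' where q: "q = (W', n')" "openin T W'" "x \<in> W'" "n' \<in> carrier (msec F W')"
      "openin T Z'" "x \<in> Z'" "Z' \<subseteq> V \<inter> W'" "mrst F V Z' m = mrst F W' Z' n'"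
      unfolding germ_def by blast
    \<comment> \<open>One agreement is known on \<open>Z\<close> and the other on \<open>Z'\<close>;
      the two chains of restrictions meet on the intersection.\<close>
    have o: "openin T (Z \<inter> Z')" "x \<in> Z \<inter> Z'" "Z \<inter> Z' \<subseteq> W \<inter> W'" using Z q by auto
    have "mrst F W (Z \<inter> Z') n = mrst F Z (Z \<inter> Z') (mrst F W Z n)"
      using W Z o by (subst res_comp) auto
    also have "\<dots> = mrst F V (Z \<inter> Z') m"
      using V Z o by (subst Z(4)[symmetric], subst res_comp) auto
    also have "\<dots> = mrst F Z' (Z \<inter> Z') (mrst F V Z' m)"
      using V q o by (subst res_comp) auto
    also have "\<dots> = mrst F W' (Z \<inter> Z') n'"
      using q o by (subst q(8), subst res_comp) auto
    finally show "q \<in> gm x W n" unfolding germ_def q(1) using q o by blast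
  qed
  assume "\<exists>Z. openin T Z \<and> x \<in> Z \<and> Z \<subseteq> V \<inter> W \<and> mrst F V Z m = mrst F W Z n"
  then obtain Z where Z: "openin T Z" "x \<in> Z" "Z \<subseteq> V \<inter> W" "mrst F V Z m = mrst F W Z n" by blast
  show "gm x V m = gm x W n"
    using sub[of V m W n Z] sub[of W n V m Z] V W Z by (simp add: Int_commute)
qed

lemma germ_memD:
  assumes "openin T V" "x \<in> V" "m \<in> carrier (msec F V)" "(W, n) \<in> gm x V m"
  shows "openin T W" "x \<in> W" "n \<in> carrier (msec F W)" "gm x W n = gm x V m"
proof -
  show *: "openin T W" "x \<in> W" "n \<in> carrier (msec F W)" using assms(4) unfolding germ_def by auto
  show "gm x W n = gm x V m"
    unfolding germ_eq_iff[OF * assms(1-3)] using assms(4) by (auto simp: germ_def eq_commute)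
qed

lemma germ_res:
  assumes "openin T V" "openin T Z" "x \<in> Z" "Z \<subseteq> V" "m \<in> carrier (msec F V)"
  shows "gm x Z (mrst F V Z m) = gm x V m"
proof -
  have "x \<in> V" using assms by blast
  then show ?thesis
    using assms by (subst germ_eq_iff) (auto intro!: res_closed exI[of _ Z] simp: res_comp)
qed

lemma germ_eq_resD:
  assumes "openin T V" "m \<in> carrier (msec F V)" "n \<in> carrier (msec F V)" "x \<in> V" "gm x V m = gm x V n"
  obtains Z where "openin T Z" "x \<in> Z" "Z \<subseteq> V" "mrst F V Z m = mrst F V Z n"
  using germ_eq_iff[OF assms(1,4,2,1,4,3)] assms(5) by auto

text \<open>The operations of \<open>sheafify\<close> are unions over all representatives of a germ.
  A representative exists, and if all of them give the same value, the union is that value.\<close>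

lemma germ_Un_const:
  assumes "openin T V" "x \<in> V" "m \<in> carrier (msec F V)"
    and "\<And>W n. openin T W \<Longrightarrow> x \<in> W \<Longrightarrow> n \<in> carrier (msec F W) \<Longrightarrow> gm x W n = gm x V m \<Longrightarrow> f (W, n) = c"
  shows "(\<Union>p\<in>gm x V m. f p) = c"
proof -
  have "f p = c" if "p \<in> gm x V m" for p
    using that assms germ_memD[OF assms(1-3)] by (cases p) auto
  moreover have "gm x V m \<noteq> {}" using germ_self[OF assms(1-3)] by blast
  ultimately show ?thesis by auto
qed

lemma germ_add_cong:
  assumes m: "openin T V" "x \<in> V" "m \<in> carrier (msec F V)" "n \<in> carrier (msec F V)"
    and n: "openin T V'" "x \<in> V'" "m' \<in> carrier (msec F V')" "gm x V' m' = gm x V m"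
    and n': "openin T W'" "x \<in> W'" "n' \<in> carrier (msec F W')" "gm x W' n' = gm x V n"
  shows "gm x (V' \<inter> W') (mrst F V' (V' \<inter> W') m' \<oplus>\<^bsub>msec F (V' \<inter> W')\<^esub> mrst F W' (V' \<inter> W') n')
    = gm x V (m \<oplus>\<^bsub>msec F V\<^esub> n)"
proof -
  let ?I = "V' \<inter> W'"
  have I: "openin T ?I" "x \<in> ?I" using n n' by auto
  interpret I: Module.module "Osec \<X> ?I" "msec F ?I" using I module_sec by blast
  interpret V: Module.module "Osec \<X> V" "msec F V" using m module_sec by blast
  obtain Z where Z: "openin T Z" "x \<in> Z" "Z \<subseteq> V' \<inter> V" "mrst F V' Z m' = mrst F V Z m"
    using n(4) unfolding germ_eq_iff[OF n(1-3) m(1-3)] by blast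
  obtain Y where Y: "openin T Y" "x \<in> Y" "Y \<subseteq> W' \<inter> V" "mrst F W' Y n' = mrst F V Y n"
    using n'(4) unfolding germ_eq_iff[OF n'(1-3) m(1,2,4)] by blast
  let ?Z = "Z \<inter> Y"
  have o: "openin T ?Z" "x \<in> ?Z" "?Z \<subseteq> ?I" "?Z \<subseteq> V" using Z Y by auto
  have c: "mrst F V' ?I m' \<in> carrier (msec F ?I)" "mrst F W' ?I n' \<in> carrier (msec F ?I)"
    using n n' I by (auto intro!: res_closed)
  have "mrst F V' ?Z m' = mrst F V ?Z m"
    using res_comp[of V' Z ?Z m'] res_comp[of V Z ?Z m] Z Y n m o(1) by auto
  moreover have "mrst F W' ?Z n' = mrst F V ?Z n"
    using res_comp[of W' Y ?Z n'] res_comp[of V Y ?Z n] Z Y n' m o(1) by auto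
  moreover have "mrst F ?I ?Z (mrst F V' ?I m') = mrst F V' ?Z m'"
    using I o n by (intro res_comp) auto
  moreover have "mrst F ?I ?Z (mrst F W' ?I n') = mrst F W' ?Z n'"
    using I o n' by (intro res_comp) auto
  ultimately have "mrst F ?I ?Z (mrst F V' ?I m' \<oplus>\<^bsub>msec F ?I\<^esub> mrst F W' ?I n')
    = mrst F V ?Z (m \<oplus>\<^bsub>msec F V\<^esub> n)"
    using res_add[OF I(1) o(1,3) c] res_add[OF m(1) o(1,4) m(3,4)] by simp
  then show ?thesis
    using c m I o by (subst germ_eq_iff) (auto intro!: exI[of _ ?Z])
qed

section \<open>Sections of the associated sheaf\<close>

lemma sheafify_simps:
  "carrier (msec S U) = {s. (\<forall>x. x \<notin> U \<longrightarrow> s x = {}) \<and>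
      (\<forall>x\<in>U. \<exists>V m. openin T V \<and> x \<in> V \<and> V \<subseteq> U \<and> m \<in> carrier (msec F V) \<and> (\<forall>z\<in>V. s z = gm z V m))}"
  "\<zero>\<^bsub>msec S U\<^esub> = sheafify_unit T F U \<zero>\<^bsub>msec F U\<^esub>"
  "mrst S U V s = (\<lambda>x. if x \<in> V then s x else {})"
  unfolding sheafify_def sheafify_unit_def by simp_all

lemma sec_outside: "s \<in> carrier (msec S U) \<Longrightarrow> x \<notin> U \<Longrightarrow> s x = {}"
  unfolding sheafify_simps by blast

lemma sec_local:
  assumes "s \<in> carrier (msec S U)" "x \<in> U"
  obtains V m where "openin T V" "x \<in> V" "V \<subseteq> U" "m \<in> carrier (msec F V)" "\<And>z. z \<in> V \<Longrightarrow> s z = gm z V m"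
proof -
  from assms have "\<exists>V m. openin T V \<and> x \<in> V \<and> V \<subseteq> U \<and> m \<in> carrier (msec F V) \<and> (\<forall>z\<in>V. s z = gm z V m)"
    unfolding sheafify_simps by simp
  then obtain V m where "openin T V" "x \<in> V" "V \<subseteq> U" "m \<in> carrier (msec F V)" "\<forall>z\<in>V. s z = gm z V m"
    by (elim exE conjE)
  then show ?thesis using that by simp
qed

lemma sec_local2:
  assumes "s \<in> carrier (msec S U)" "t \<in> carrier (msec S U)" "x \<in> U"
  obtains V m n where "openin T V" "x \<in> V" "V \<subseteq> U" "m \<in> carrier (msec F V)" "n \<in> carrier (msec F V)"
    "\<And>z. z \<in> V \<Longrightarrow> s z = gm z V m" "\<And>z. z \<in> V \<Longrightarrow> t z = gm z V n"
proof -
  obtain V m where V: "openin T V" "x \<in> V" "V \<subseteq> U" "m \<in> carrier (msec F V)" "\<And>z. z \<in> V \<Longrightarrow> s z = gm z V m"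
    using sec_local[OF assms(1,3)] by blast
  obtain W n where W: "openin T W" "x \<in> W" "W \<subseteq> U" "n \<in> carrier (msec F W)" "\<And>z. z \<in> W \<Longrightarrow> t z = gm z W n"
    using sec_local[OF assms(2,3)] by blast
  show thesis
  proof (rule that[of "V \<inter> W" "mrst F V (V \<inter> W) m" "mrst F W (V \<inter> W) n"])
    show "openin T (V \<inter> W)" using V W by blast
    then show "s z = gm z (V \<inter> W) (mrst F V (V \<inter> W) m)" "t z = gm z (V \<inter> W) (mrst F W (V \<inter> W) n)"
      if "z \<in> V \<inter> W" for z
      using that V W germ_res[of V "V \<inter> W" z m] germ_res[of W "V \<inter> W" z n] by auto
  qed (use V W in \<open>auto intro!: res_closed\<close>)
qed

lemma sec_local3:
  assumes "s \<in> carrier (msec S U)" "t \<in> carrier (msec S U)" "u \<in> carrier (msec S U)" "x \<in> U"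
  obtains V m n k where "openin T V" "x \<in> V" "V \<subseteq> U"
    "m \<in> carrier (msec F V)" "n \<in> carrier (msec F V)" "k \<in> carrier (msec F V)"
    "\<And>z. z \<in> V \<Longrightarrow> s z = gm z V m" "\<And>z. z \<in> V \<Longrightarrow> t z = gm z V n" "\<And>z. z \<in> V \<Longrightarrow> u z = gm z V k"
proof -
  obtain V m n where V: "openin T V" "x \<in> V" "V \<subseteq> U" "m \<in> carrier (msec F V)" "n \<in> carrier (msec F V)"
    "\<And>z. z \<in> V \<Longrightarrow> s z = gm z V m" "\<And>z. z \<in> V \<Longrightarrow> t z = gm z V n"
    using sec_local2[OF assms(1,2,4)] by blast
  obtain W k where W: "openin T W" "x \<in> W" "W \<subseteq> U" "k \<in> carrier (msec F W)" "\<And>z. z \<in> W \<Longrightarrow> u z = gm z W k"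
    using sec_local[OF assms(3,4)] by blast
  show thesis
  proof (rule that[of "V \<inter> W" "mrst F V (V \<inter> W) m" "mrst F V (V \<inter> W) n" "mrst F W (V \<inter> W) k"])
    show "openin T (V \<inter> W)" using V W by blast
    then show "s z = gm z (V \<inter> W) (mrst F V (V \<inter> W) m)" "t z = gm z (V \<inter> W) (mrst F V (V \<inter> W) n)"
      "u z = gm z (V \<inter> W) (mrst F W (V \<inter> W) k)" if "z \<in> V \<inter> W" for z
      using that V W germ_res[of V "V \<inter> W" z m] germ_res[of V "V \<inter> W" z n] germ_res[of W "V \<inter> W" z k] by auto
  qed (use V W in \<open>auto intro!: res_closed\<close>)
qed

lemma secI:
  assumes "\<And>x. x \<notin> U \<Longrightarrow> s x = {}"
    and "\<And>x. x \<in> U \<Longrightarrow> \<exists>V m. openin T V \<and> x \<in> V \<and> V \<subseteq> U \<and> m \<in> carrier (msec F V) \<and> (\<forall>z\<in>V. s z = gm z V m)"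
  shows "s \<in> carrier (msec S U)"
  using assms unfolding sheafify_simps by simp

lemma unit_closed: "openin T U \<Longrightarrow> m \<in> carrier (msec F U) \<Longrightarrow> sheafify_unit T F U m \<in> carrier (msec S U)"
  by (intro secI) (auto simp: sheafify_unit_def)

lemma unit_eqI:
  assumes "openin T U" "m \<in> carrier (msec F U)" "s \<in> carrier (msec S U)"
    "\<And>z. z \<in> U \<Longrightarrow> s z = gm z U m"
  shows "s = sheafify_unit T F U m"
  using assms sec_outside[OF assms(3)] unfolding sheafify_unit_def by (intro ext) auto

lemma add_outside:
  assumes "x \<notin> U" "s \<in> carrier (msec S U)"
  shows "(s \<oplus>\<^bsub>msec S U\<^esub> t) x = {}"
  using sec_outside[OF assms(2,1)] unfolding sheafify_def by simp

lemma smult_outside: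
  assumes "x \<notin> U" "s \<in> carrier (msec S U)"
  shows "(a \<odot>\<^bsub>msec S U\<^esub> s) x = {}"
  using sec_outside[OF assms(2,1)] unfolding sheafify_def by simp

lemma add_germ:
  assumes "openin T V" "x \<in> V" "m \<in> carrier (msec F V)" "n \<in> carrier (msec F V)"
    "s x = gm x V m" "t x = gm x V n"
  shows "(s \<oplus>\<^bsub>msec S U\<^esub> t) x = gm x V (m \<oplus>\<^bsub>msec F V\<^esub> n)"
proof -
  have "(\<Union>(V', m')\<in>gm x V m. \<Union>(W', n')\<in>gm x V n.
      gm x (V' \<inter> W') (mrst F V' (V' \<inter> W') m' \<oplus>\<^bsub>msec F (V' \<inter> W')\<^esub> mrst F W' (V' \<inter> W') n'))
    = gm x V (m \<oplus>\<^bsub>msec F V\<^esub> n)"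
    by (rule germ_Un_const[OF assms(1-3)], simp only: prod.case, rule germ_Un_const[OF assms(1,2,4)])
      (simp add: germ_add_cong[OF assms(1-4)])
  then show ?thesis using assms(5,6) unfolding sheafify_def by simp
qed

lemma smult_germ:
  assumes U: "openin T U" "V \<subseteq> U" and V: "openin T V" "x \<in> V" "m \<in> carrier (msec F V)"
    and s: "s x = gm x V m" and a: "a \<in> carrier (Osec \<X> U)"
  shows "(a \<odot>\<^bsub>msec S U\<^esub> s) x = gm x V (rst \<X> U V a \<odot>\<^bsub>msec F V\<^esub> m)"
proof -
  have "gm x (U \<inter> W) (rst \<X> U (U \<inter> W) a \<odot>\<^bsub>msec F (U \<inter> W)\<^esub> mrst F W (U \<inter> W) n)
      = gm x V (rst \<X> U V a \<odot>\<^bsub>msec F V\<^esub> m)"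
    if W: "openin T W" "x \<in> W" "n \<in> carrier (msec F W)" "gm x W n = gm x V m" for W n
  proof -
    let ?I = "U \<inter> W"
    obtain Z where Z: "openin T Z" "x \<in> Z" "Z \<subseteq> W \<inter> V" "mrst F W Z n = mrst F V Z m"
      using W(4) unfolding germ_eq_iff[OF W(1-3) V] by blast
    have I: "openin T ?I" "x \<in> ?I" "Z \<subseteq> ?I" using U V W Z by auto
    interpret I: Module.module "Osec \<X> ?I" "msec F ?I" using I module_sec by blast
    interpret V: Module.module "Osec \<X> V" "msec F V" using V module_sec by blast
    have c: "rst \<X> U ?I a \<in> carrier (Osec \<X> ?I)" "mrst F W ?I n \<in> carrier (msec F ?I)"
      "rst \<X> U V a \<in> carrier (Osec \<X> V)"
      using W U V I a by (auto intro!: res_closed ringed_space_rst_closed[OF ringed])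
    have "mrst F ?I Z (rst \<X> U ?I a \<odot>\<^bsub>msec F ?I\<^esub> mrst F W ?I n) = rst \<X> U Z a \<odot>\<^bsub>msec F Z\<^esub> mrst F W Z n"
      using I Z c W U a by (simp add: res_smult res_comp ringed_space_rst_comp[OF ringed])
    also have "\<dots> = mrst F V Z (rst \<X> U V a \<odot>\<^bsub>msec F V\<^esub> m)"
      using I Z c V U a by (simp add: res_smult ringed_space_rst_comp[OF ringed])
    finally show ?thesis
      using I Z c V by (subst germ_eq_iff) (auto intro!: exI[of _ Z])
  qed
  then have "(\<Union>(W, n)\<in>gm x V m. gm x (U \<inter> W) (rst \<X> U (U \<inter> W) a \<odot>\<^bsub>msec F (U \<inter> W)\<^esub> mrst F W (U \<inter> W) n))
    = gm x V (rst \<X> U V a \<odot>\<^bsub>msec F V\<^esub> m)"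
    using V by (intro germ_Un_const) auto
  then show ?thesis using s unfolding sheafify_def by simp
qed

lemma add_sec_closed:
  assumes "openin T U" "s \<in> carrier (msec S U)" "t \<in> carrier (msec S U)"
  shows "s \<oplus>\<^bsub>msec S U\<^esub> t \<in> carrier (msec S U)"
proof (rule secI)
  fix x assume "x \<in> U"
  then obtain V m n where V: "openin T V" "x \<in> V" "V \<subseteq> U" "m \<in> carrier (msec F V)" "n \<in> carrier (msec F V)"
    "\<And>z. z \<in> V \<Longrightarrow> s z = gm z V m" "\<And>z. z \<in> V \<Longrightarrow> t z = gm z V n"
    using sec_local2[OF assms(2,3)] by blast
  interpret V: Module.module "Osec \<X> V" "msec F V" using V module_sec by blast
  show "\<exists>V m. openin T V \<and> x \<in> V \<and> V \<subseteq> U \<and> m \<in> carrier (msec F V) \<and>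
      (\<forall>z\<in>V. (s \<oplus>\<^bsub>msec S U\<^esub> t) z = gm z V m)"
    using V by (intro exI[of _ V] exI[of _ "m \<oplus>\<^bsub>msec F V\<^esub> n"] conjI ballI add_germ V.a_closed)
qed (simp add: add_outside assms)

lemma smult_sec_closed:
  assumes "openin T U" "s \<in> carrier (msec S U)" "a \<in> carrier (Osec \<X> U)"
  shows "a \<odot>\<^bsub>msec S U\<^esub> s \<in> carrier (msec S U)"
proof (rule secI)
  fix x assume "x \<in> U"
  then obtain V m where V: "openin T V" "x \<in> V" "V \<subseteq> U" "m \<in> carrier (msec F V)"
    "\<And>z. z \<in> V \<Longrightarrow> s z = gm z V m"
    using sec_local[OF assms(2)] by blast
  interpret V: Module.module "Osec \<X> V" "msec F V" using V module_sec by blast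
  have "rst \<X> U V a \<odot>\<^bsub>msec F V\<^esub> m \<in> carrier (msec F V)"
    using V assms by (intro V.smult_closed ringed_space_rst_closed[OF ringed])
  then show "\<exists>V m. openin T V \<and> x \<in> V \<and> V \<subseteq> U \<and> m \<in> carrier (msec F V) \<and>
      (\<forall>z\<in>V. (a \<odot>\<^bsub>msec S U\<^esub> s) z = gm z V m)"
    using V assms by (intro exI[of _ V] exI[of _ "rst \<X> U V a \<odot>\<^bsub>msec F V\<^esub> m"] conjI ballI smult_germ)
qed (simp add: smult_outside assms)

lemma unit_add:
  assumes "openin T U" "m \<in> carrier (msec F U)" "n \<in> carrier (msec F U)"
  shows "sheafify_unit T F U m \<oplus>\<^bsub>msec S U\<^esub> sheafify_unit T F U n = sheafify_unit T F U (m \<oplus>\<^bsub>msec F U\<^esub> n)"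
proof -
  interpret U: Module.module "Osec \<X> U" "msec F U" using assms module_sec by blast
  show ?thesis
    using assms by (intro unit_eqI add_sec_closed unit_closed add_germ U.a_closed) (simp_all add: sheafify_unit_def)
qed

lemma unit_smult:
  assumes "openin T U" "m \<in> carrier (msec F U)" "a \<in> carrier (Osec \<X> U)"
  shows "a \<odot>\<^bsub>msec S U\<^esub> sheafify_unit T F U m = sheafify_unit T F U (a \<odot>\<^bsub>msec F U\<^esub> m)"
proof -
  interpret U: Module.module "Osec \<X> U" "msec F U" using assms module_sec by blast
  show ?thesis
    using assms smult_germ[OF assms(1) order_refl assms(1) _ assms(2) _ assms(3)]
    by (intro unit_eqI smult_sec_closed unit_closed)
      (auto simp: sheafify_unit_def ringed_space_rst_id[OF ringed])
qed

lemma zero_germ: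
  assumes "openin T U" "openin T V" "V \<subseteq> U" "x \<in> V"
  shows "\<zero>\<^bsub>msec S U\<^esub> x = gm x V \<zero>\<^bsub>msec F V\<^esub>"
proof -
  interpret U: Module.module "Osec \<X> U" "msec F U" using assms module_sec by blast
  show ?thesis
    using assms germ_res[OF assms(1,2,4,3) U.zero_closed] res_zero[OF assms(1-3)]
    unfolding sheafify_simps sheafify_unit_def by auto
qed

lemma sec_eqI:
  assumes "s \<in> carrier (msec S U)" "t \<in> carrier (msec S U)" "\<And>x. x \<in> U \<Longrightarrow> s x = t x"
  shows "s = t"
  using assms sec_outside by (intro ext) metis

text \<open>Each axiom is an equality of sections and is checked at one point \<open>x\<close>,
  after all sections involved have been represented by elements of a single \<open>msec F V\<close>
  with \<open>x\<close> in \<open>V\<close>. There it is the same axiom of that module.\<close>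

lemma sheafify_module:
  assumes U: "openin T U"
  shows "Module.module (Osec \<X> U) (msec S U)"
proof (rule moduleI)
  interpret U: Module.module "Osec \<X> U" "msec F U" using assms module_sec by blast
  show "cring (Osec \<X> U)" ..
  note cl = add_sec_closed[OF U] smult_sec_closed[OF U]
  have z: "\<zero>\<^bsub>msec S U\<^esub> \<in> carrier (msec S U)"
    unfolding sheafify_simps(2) using unit_closed[OF U U.zero_closed] .
  have rc: "rst \<X> U V a \<in> carrier (Osec \<X> V)" if "a \<in> carrier (Osec \<X> U)" "openin T V" "V \<subseteq> U" for a V
    using ringed_space_rst_closed[OF ringed U that(2,3,1)] .
  have rhom: "rst \<X> U V \<in> ring_hom (Osec \<X> U) (Osec \<X> V)" if "openin T V" "V \<subseteq> U" for V
    using ringed_space_rst[OF ringed U that] .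
  show "abelian_group (msec S U)"
  proof (rule abelian_groupI)
    fix s t u assume s: "s \<in> carrier (msec S U)" "t \<in> carrier (msec S U)" "u \<in> carrier (msec S U)"
    show "s \<oplus>\<^bsub>msec S U\<^esub> t \<oplus>\<^bsub>msec S U\<^esub> u = s \<oplus>\<^bsub>msec S U\<^esub> (t \<oplus>\<^bsub>msec S U\<^esub> u)"
    proof (rule sec_eqI)
      fix x assume "x \<in> U"
      then obtain V m n k where V: "openin T V" "x \<in> V" "V \<subseteq> U"
        "m \<in> carrier (msec F V)" "n \<in> carrier (msec F V)" "k \<in> carrier (msec F V)"
        "\<And>z. z \<in> V \<Longrightarrow> s z = gm z V m" "\<And>z. z \<in> V \<Longrightarrow> t z = gm z V n" "\<And>z. z \<in> V \<Longrightarrow> u z = gm z V k"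
        using sec_local3[OF s] by blast
      interpret V: Module.module "Osec \<X> V" "msec F V" using V module_sec by blast
      show "(s \<oplus>\<^bsub>msec S U\<^esub> t \<oplus>\<^bsub>msec S U\<^esub> u) x = (s \<oplus>\<^bsub>msec S U\<^esub> (t \<oplus>\<^bsub>msec S U\<^esub> u)) x"
      proof -
        have "(s \<oplus>\<^bsub>msec S U\<^esub> t \<oplus>\<^bsub>msec S U\<^esub> u) x = gm x V (m \<oplus>\<^bsub>msec F V\<^esub> n \<oplus>\<^bsub>msec F V\<^esub> k)"
          using V by (intro add_germ V.a_closed)
        moreover have "(s \<oplus>\<^bsub>msec S U\<^esub> (t \<oplus>\<^bsub>msec S U\<^esub> u)) x = gm x V (m \<oplus>\<^bsub>msec F V\<^esub> (n \<oplus>\<^bsub>msec F V\<^esub> k))"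
          using V by (intro add_germ V.a_closed)
        ultimately show ?thesis using V.a_assoc[OF V(4-6)] by simp
      qed
    qed (use s cl in auto)
  next
    fix s t assume s: "s \<in> carrier (msec S U)" "t \<in> carrier (msec S U)"
    show "s \<oplus>\<^bsub>msec S U\<^esub> t = t \<oplus>\<^bsub>msec S U\<^esub> s"
    proof (rule sec_eqI)
      fix x assume "x \<in> U"
      then obtain V m n where V: "openin T V" "x \<in> V" "V \<subseteq> U"
        "m \<in> carrier (msec F V)" "n \<in> carrier (msec F V)"
        "\<And>z. z \<in> V \<Longrightarrow> s z = gm z V m" "\<And>z. z \<in> V \<Longrightarrow> t z = gm z V n"
        using sec_local2[OF s] by blast
      interpret V: Module.module "Osec \<X> V" "msec F V" using V module_sec by blast
      show "(s \<oplus>\<^bsub>msec S U\<^esub> t) x = (t \<oplus>\<^bsub>msec S U\<^esub> s) x"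
      proof -
        have "(s \<oplus>\<^bsub>msec S U\<^esub> t) x = gm x V (m \<oplus>\<^bsub>msec F V\<^esub> n)" using V by (intro add_germ)
        moreover have "(t \<oplus>\<^bsub>msec S U\<^esub> s) x = gm x V (n \<oplus>\<^bsub>msec F V\<^esub> m)" using V by (intro add_germ)
        ultimately show ?thesis using V.a_comm[OF V(4,5)] by simp
      qed
    qed (use s cl in auto)
  next
    fix s assume s: "s \<in> carrier (msec S U)"
    show "\<zero>\<^bsub>msec S U\<^esub> \<oplus>\<^bsub>msec S U\<^esub> s = s"
    proof (rule sec_eqI)
      fix x assume "x \<in> U"
      then obtain V m where V: "openin T V" "x \<in> V" "V \<subseteq> U"
        "m \<in> carrier (msec F V)" "\<And>z. z \<in> V \<Longrightarrow> s z = gm z V m"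
        using sec_local[OF s] by blast
      interpret V: Module.module "Osec \<X> V" "msec F V" using V module_sec by blast
      show "(\<zero>\<^bsub>msec S U\<^esub> \<oplus>\<^bsub>msec S U\<^esub> s) x = s x"
      proof -
        have "(\<zero>\<^bsub>msec S U\<^esub> \<oplus>\<^bsub>msec S U\<^esub> s) x = gm x V (\<zero>\<^bsub>msec F V\<^esub> \<oplus>\<^bsub>msec F V\<^esub> m)"
          using V U by (intro add_germ zero_germ V.zero_closed)
        then show ?thesis using V by simp
      qed
    qed (use s cl z in auto)
    \<comment> \<open>The negative of a section is taken to be its multiple by -1, because
      \<open>smult_germ\<close> computes the germs of a multiple.\<close>
    let ?m = "(\<ominus>\<^bsub>Osec \<X> U\<^esub> \<one>\<^bsub>Osec \<X> U\<^esub>) \<odot>\<^bsub>msec S U\<^esub> s"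
    have "?m \<oplus>\<^bsub>msec S U\<^esub> s = \<zero>\<^bsub>msec S U\<^esub>"
    proof (rule sec_eqI)
      fix x assume "x \<in> U"
      then obtain V m where V: "openin T V" "x \<in> V" "V \<subseteq> U"
        "m \<in> carrier (msec F V)" "\<And>z. z \<in> V \<Longrightarrow> s z = gm z V m"
        using sec_local[OF s] by blast
      interpret V: Module.module "Osec \<X> V" "msec F V" using V module_sec by blast
      interpret r: ring_hom_cring "Osec \<X> U" "Osec \<X> V" "rst \<X> U V"
        by (intro ring_hom_cring.intro ring_hom_cring_axioms.intro rhom V U.R.is_cring V.R.is_cring)
      have "rst \<X> U V (\<ominus>\<^bsub>Osec \<X> U\<^esub> \<one>\<^bsub>Osec \<X> U\<^esub>) \<odot>\<^bsub>msec F V\<^esub> m \<oplus>\<^bsub>msec F V\<^esub> m = \<zero>\<^bsub>msec F V\<^esub>"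
        using V by (simp add: V.smult_l_minus V.M.l_neg)
      moreover have "(?m \<oplus>\<^bsub>msec S U\<^esub> s) x = gm x V (rst \<X> U V (\<ominus>\<^bsub>Osec \<X> U\<^esub> \<one>\<^bsub>Osec \<X> U\<^esub>) \<odot>\<^bsub>msec F V\<^esub> m \<oplus>\<^bsub>msec F V\<^esub> m)"
        using V U by (intro add_germ smult_germ V.smult_closed rc U.R.a_inv_closed U.R.one_closed)
      ultimately show "(?m \<oplus>\<^bsub>msec S U\<^esub> s) x = \<zero>\<^bsub>msec S U\<^esub> x"
        using zero_germ[OF U V(1,3,2)] by simp
    qed (use s cl z in auto)
    then show "\<exists>t\<in>carrier (msec S U). t \<oplus>\<^bsub>msec S U\<^esub> s = \<zero>\<^bsub>msec S U\<^esub>"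
      using s cl by (intro bexI[of _ ?m]) auto
  qed (use cl z in auto)
  fix a s assume a: "a \<in> carrier (Osec \<X> U)" and s: "s \<in> carrier (msec S U)"
  show "a \<odot>\<^bsub>msec S U\<^esub> s \<in> carrier (msec S U)" using a s cl by blast
  fix b assume b: "b \<in> carrier (Osec \<X> U)"
  {
    fix x assume "x \<in> U"
    then obtain V m where V: "openin T V" "x \<in> V" "V \<subseteq> U"
      "m \<in> carrier (msec F V)" "\<And>z. z \<in> V \<Longrightarrow> s z = gm z V m"
      using sec_local[OF s] by blast
    interpret V: Module.module "Osec \<X> V" "msec F V" using V module_sec by blast
    note r = ring_hom_add[OF rhom[OF V(1,3)] a b] ring_hom_mult[OF rhom[OF V(1,3)] a b]
    have "((a \<oplus>\<^bsub>Osec \<X> U\<^esub> b) \<odot>\<^bsub>msec S U\<^esub> s) x = gm x V (rst \<X> U V (a \<oplus>\<^bsub>Osec \<X> U\<^esub> b) \<odot>\<^bsub>msec F V\<^esub> m)"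
      using V U a b by (intro smult_germ U.R.a_closed)
    moreover have "(a \<odot>\<^bsub>msec S U\<^esub> s \<oplus>\<^bsub>msec S U\<^esub> b \<odot>\<^bsub>msec S U\<^esub> s) x
        = gm x V (rst \<X> U V a \<odot>\<^bsub>msec F V\<^esub> m \<oplus>\<^bsub>msec F V\<^esub> rst \<X> U V b \<odot>\<^bsub>msec F V\<^esub> m)"
      using V U a b by (intro add_germ smult_germ V.smult_closed rc)
    ultimately have add: "((a \<oplus>\<^bsub>Osec \<X> U\<^esub> b) \<odot>\<^bsub>msec S U\<^esub> s) x = (a \<odot>\<^bsub>msec S U\<^esub> s \<oplus>\<^bsub>msec S U\<^esub> b \<odot>\<^bsub>msec S U\<^esub> s) x"
      using V rc[OF a V(1,3)] rc[OF b V(1,3)] by (simp add: r V.smult_l_distr)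
    have "((a \<otimes>\<^bsub>Osec \<X> U\<^esub> b) \<odot>\<^bsub>msec S U\<^esub> s) x = gm x V (rst \<X> U V (a \<otimes>\<^bsub>Osec \<X> U\<^esub> b) \<odot>\<^bsub>msec F V\<^esub> m)"
      using V U a b by (intro smult_germ U.R.m_closed)
    moreover have "(a \<odot>\<^bsub>msec S U\<^esub> (b \<odot>\<^bsub>msec S U\<^esub> s)) x
        = gm x V (rst \<X> U V a \<odot>\<^bsub>msec F V\<^esub> (rst \<X> U V b \<odot>\<^bsub>msec F V\<^esub> m))"
      using V U a b by (intro smult_germ V.smult_closed rc)
    ultimately have "((a \<otimes>\<^bsub>Osec \<X> U\<^esub> b) \<odot>\<^bsub>msec S U\<^esub> s) x = (a \<odot>\<^bsub>msec S U\<^esub> (b \<odot>\<^bsub>msec S U\<^esub> s)) x"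
      using V rc[OF a V(1,3)] rc[OF b V(1,3)] by (simp add: r V.smult_assoc1)
    note this add
  }
  note eq = this
  show "(a \<oplus>\<^bsub>Osec \<X> U\<^esub> b) \<odot>\<^bsub>msec S U\<^esub> s = a \<odot>\<^bsub>msec S U\<^esub> s \<oplus>\<^bsub>msec S U\<^esub> b \<odot>\<^bsub>msec S U\<^esub> s"
    using a b s cl eq(2) by (intro sec_eqI[of _ U]) auto
  show "(a \<otimes>\<^bsub>Osec \<X> U\<^esub> b) \<odot>\<^bsub>msec S U\<^esub> s = a \<odot>\<^bsub>msec S U\<^esub> (b \<odot>\<^bsub>msec S U\<^esub> s)"
    using a b s cl eq(1) by (intro sec_eqI[of _ U]) auto
next
  interpret UR: cring "Osec \<X> U" using ringed_space_cring[OF ringed U] .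
  note cl = add_sec_closed[OF U] smult_sec_closed[OF U]
  have rhom: "rst \<X> U V \<in> ring_hom (Osec \<X> U) (Osec \<X> V)" if "openin T V" "V \<subseteq> U" for V
    using ringed_space_rst[OF ringed U that] .
  fix s assume s: "s \<in> carrier (msec S U)"
  show "\<one>\<^bsub>Osec \<X> U\<^esub> \<odot>\<^bsub>msec S U\<^esub> s = s"
  proof (rule sec_eqI)
    fix x assume "x \<in> U"
    then obtain V m where V: "openin T V" "x \<in> V" "V \<subseteq> U"
      "m \<in> carrier (msec F V)" "\<And>z. z \<in> V \<Longrightarrow> s z = gm z V m"
      using sec_local[OF s] by blast
    interpret V: Module.module "Osec \<X> V" "msec F V" using V module_sec by blast
    show "(\<one>\<^bsub>Osec \<X> U\<^esub> \<odot>\<^bsub>msec S U\<^esub> s) x = s x"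
      using V smult_germ[where s = s, OF U V(3,1,2,4) V(5)[OF V(2)] UR.one_closed] by (simp add: ring_hom_one[OF rhom])
  qed (use s cl in auto)
next
  note cl = add_sec_closed[OF U] smult_sec_closed[OF U]
  fix a s t assume a: "a \<in> carrier (Osec \<X> U)" and s: "s \<in> carrier (msec S U)" "t \<in> carrier (msec S U)"
  show "a \<odot>\<^bsub>msec S U\<^esub> (s \<oplus>\<^bsub>msec S U\<^esub> t) = a \<odot>\<^bsub>msec S U\<^esub> s \<oplus>\<^bsub>msec S U\<^esub> a \<odot>\<^bsub>msec S U\<^esub> t"
  proof (rule sec_eqI)
    fix x assume "x \<in> U"
    then obtain V m n where V: "openin T V" "x \<in> V" "V \<subseteq> U"
      "m \<in> carrier (msec F V)" "n \<in> carrier (msec F V)"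
      "\<And>z. z \<in> V \<Longrightarrow> s z = gm z V m" "\<And>z. z \<in> V \<Longrightarrow> t z = gm z V n"
      using sec_local2[OF s] by blast
    interpret V: Module.module "Osec \<X> V" "msec F V" using V module_sec by blast
    show "(a \<odot>\<^bsub>msec S U\<^esub> (s \<oplus>\<^bsub>msec S U\<^esub> t)) x = (a \<odot>\<^bsub>msec S U\<^esub> s \<oplus>\<^bsub>msec S U\<^esub> a \<odot>\<^bsub>msec S U\<^esub> t) x"
    proof -
      note ra = ringed_space_rst_closed[OF ringed U V(1,3) a]
      have "(a \<odot>\<^bsub>msec S U\<^esub> (s \<oplus>\<^bsub>msec S U\<^esub> t)) x = gm x V (rst \<X> U V a \<odot>\<^bsub>msec F V\<^esub> (m \<oplus>\<^bsub>msec F V\<^esub> n))"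
        using V U a ra by (intro add_germ smult_germ V.smult_closed V.a_closed)
      moreover have "(a \<odot>\<^bsub>msec S U\<^esub> s \<oplus>\<^bsub>msec S U\<^esub> a \<odot>\<^bsub>msec S U\<^esub> t) x
          = gm x V (rst \<X> U V a \<odot>\<^bsub>msec F V\<^esub> m \<oplus>\<^bsub>msec F V\<^esub> rst \<X> U V a \<odot>\<^bsub>msec F V\<^esub> n)"
        using V U a ra by (intro add_germ smult_germ V.smult_closed V.a_closed)
      ultimately show ?thesis using V.smult_r_distr[OF ra V(4,5)] by simp
    qed
  qed (use a s cl in auto)
qed

lemma sec_res_closed:
  assumes "openin T U" "openin T V" "V \<subseteq> U" "s \<in> carrier (msec S U)"
  shows "mrst S U V s \<in> carrier (msec S V)"
proof (rule secI)
  fix x assume x: "x \<in> V"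
  then obtain W m where W: "openin T W" "x \<in> W" "W \<subseteq> U" "m \<in> carrier (msec F W)"
    "\<And>z. z \<in> W \<Longrightarrow> s z = gm z W m"
    using sec_local[OF assms(4)] assms(3) by blast
  have o: "openin T (V \<inter> W)" using assms W by blast
  show "\<exists>Z m. openin T Z \<and> x \<in> Z \<and> Z \<subseteq> V \<and> m \<in> carrier (msec F Z) \<and> (\<forall>z\<in>Z. mrst S U V s z = gm z Z m)"
    using W x o germ_res[OF W(1) o _ _ W(4)]
    by (intro exI[of _ "V \<inter> W"] exI[of _ "mrst F W (V \<inter> W) m"]) (auto simp: sheafify_simps intro!: res_closed)
qed (simp add: sheafify_simps)

lemma unit_res:
  assumes "openin T U" "openin T V" "V \<subseteq> U" "m \<in> carrier (msec F U)"
  shows "mrst S U V (sheafify_unit T F U m) = sheafify_unit T F V (mrst F U V m)"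
  using assms(3) germ_res[OF assms(1,2) _ assms(3,4)]
  unfolding sheafify_simps sheafify_unit_def by (intro ext) (simp add: subset_iff)

text \<open>Associated sheaves enter further tensor products as factors, so they have to be
  instances of the same locale.\<close>

lemma sheafify_presheaf: "module_presheaf \<X> S"
proof (rule module_presheaf.intro)
  show "ring_presheaf \<X>" by (rule ringed)
  fix U V assume U: "openin T U" and V: "openin T V" "V \<subseteq> U"
  fix s assume s: "s \<in> carrier (msec S U)"
  show cl: "mrst S U V s \<in> carrier (msec S V)" using sec_res_closed[OF U V s] .
  {
    fix t assume t: "t \<in> carrier (msec S U)"
    show "mrst S U V (s \<oplus>\<^bsub>msec S U\<^esub> t) = mrst S U V s \<oplus>\<^bsub>msec S V\<^esub> mrst S U V t"
    proof (rule sec_eqI)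
      fix x assume x: "x \<in> V"
      then obtain W m n where W: "openin T W" "x \<in> W" "W \<subseteq> U"
        "m \<in> carrier (msec F W)" "n \<in> carrier (msec F W)"
        "\<And>z. z \<in> W \<Longrightarrow> s z = gm z W m" "\<And>z. z \<in> W \<Longrightarrow> t z = gm z W n"
        using sec_local2[OF s t] V by blast
      have "(s \<oplus>\<^bsub>msec S U\<^esub> t) x = gm x W (m \<oplus>\<^bsub>msec F W\<^esub> n)" using W by (intro add_germ)
      moreover have "(mrst S U V s \<oplus>\<^bsub>msec S V\<^esub> mrst S U V t) x = gm x W (m \<oplus>\<^bsub>msec F W\<^esub> n)"
        using W x by (intro add_germ) (simp_all add: sheafify_simps)
      ultimately have "(s \<oplus>\<^bsub>msec S U\<^esub> t) x = (mrst S U V s \<oplus>\<^bsub>msec S V\<^esub> mrst S U V t) x" by simp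
      then show "mrst S U V (s \<oplus>\<^bsub>msec S U\<^esub> t) x = (mrst S U V s \<oplus>\<^bsub>msec S V\<^esub> mrst S U V t) x"
        using x by (simp add: sheafify_simps(3)[of U V "s \<oplus>\<^bsub>msec S U\<^esub> t"])
    qed (use U V s t in \<open>auto intro!: sec_res_closed add_sec_closed\<close>)
  }
  fix a assume a: "a \<in> carrier (Osec \<X> U)"
  have ra: "rst \<X> U V a \<in> carrier (Osec \<X> V)" using ringed_space_rst_closed[OF ringed U V a] .
  show "mrst S U V (a \<odot>\<^bsub>msec S U\<^esub> s) = rst \<X> U V a \<odot>\<^bsub>msec S V\<^esub> mrst S U V s"
  proof (rule sec_eqI)
    fix x assume x: "x \<in> V"
    obtain W m where W: "openin T W" "x \<in> W" "W \<subseteq> V"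
      "m \<in> carrier (msec F W)" "\<And>z. z \<in> W \<Longrightarrow> mrst S U V s z = gm z W m"
      using sec_local[OF cl x] by blast
    have "(a \<odot>\<^bsub>msec S U\<^esub> s) x = (rst \<X> U V a \<odot>\<^bsub>msec S V\<^esub> mrst S U V s) x"
      using W(5)[OF W(2)] x smult_germ[where s = "mrst S U V s", OF V(1) W(3,1,2,4) W(5)[OF W(2)] ra]
        smult_germ[OF U order_trans[OF W(3) V(2)] W(1,2,4) _ a, of s]
      by (simp add: ringed_space_rst_comp[OF ringed U V(1) W(1,3) V(2) a] sheafify_simps)
    then show "mrst S U V (a \<odot>\<^bsub>msec S U\<^esub> s) x = (rst \<X> U V a \<odot>\<^bsub>msec S V\<^esub> mrst S U V s) x"
      using x by (simp add: sheafify_simps(3)[of U V "a \<odot>\<^bsub>msec S U\<^esub> s"])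
  qed (use U V s a ra cl in \<open>auto intro!: sec_res_closed smult_sec_closed\<close>)
next
  fix U assume "openin T U"
  then show "Module.module (Osec \<X> U) (msec S U)" by (rule sheafify_module)
next
  fix U s assume "s \<in> carrier (msec S U)"
  from sec_outside[OF this] show "mrst S U U s = s" by (intro ext) (simp add: sheafify_simps(3))
next
  fix U V W s assume "openin T U" "openin T V" "openin T W" "W \<subseteq> V" "V \<subseteq> U"
  then show "mrst S V W (mrst S U V s) = mrst S U W s"
    by (intro ext) (auto simp: sheafify_simps(3))
qed

end

section \<open>Presheaves of tensor products and differentials\<close>

text \<open>Everything is reduced to generators: restriction maps on generators that respect
  relations and scalars induce restriction maps on the quotients. Tensor products and Kaehler
  differentials are the two instances.\<close>

lemma fs_presheaf:
  assumes ringed: "ring_presheaf \<Y>"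
    and pres: "\<And>V. openin (tops \<Y>) V \<Longrightarrow> fs_presentation (Osec \<Y> V) (G V) (E V) (act V)"
    and gens: "\<And>V W g. openin (tops \<Y>) V \<Longrightarrow> openin (tops \<Y>) W \<Longrightarrow> W \<subseteq> V \<Longrightarrow> g \<in> G V \<Longrightarrow> r V W g \<in> G W"
    and rels: "\<And>V W xs ys. openin (tops \<Y>) V \<Longrightarrow> openin (tops \<Y>) W \<Longrightarrow> W \<subseteq> V \<Longrightarrow> (xs, ys) \<in> E V \<Longrightarrow>
        fs_cong (G W) (E W) (map (r V W) xs) (map (r V W) ys)"
    and act: "\<And>V W b g. openin (tops \<Y>) V \<Longrightarrow> openin (tops \<Y>) W \<Longrightarrow> W \<subseteq> V \<Longrightarrow> g \<in> G V \<Longrightarrow>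
        b \<in> carrier (Osec \<Y> V) \<Longrightarrow> r V W (act V b g) = act W (rst \<Y> V W b) (r V W g)"
    and id: "\<And>V g. openin (tops \<Y>) V \<Longrightarrow> g \<in> G V \<Longrightarrow> r V V g = g"
    and comp: "\<And>U V W g. openin (tops \<Y>) U \<Longrightarrow> openin (tops \<Y>) V \<Longrightarrow> openin (tops \<Y>) W \<Longrightarrow>
        W \<subseteq> V \<Longrightarrow> V \<subseteq> U \<Longrightarrow> g \<in> G U \<Longrightarrow> r V W (r U V g) = r U W g"
    and F: "\<And>V. msec F V = fs_module (G V) (E V) (act V)" "\<And>V W. mrst F V W = fs_map (G W) (E W) (r V W)"
  shows "module_presheaf \<Y> F"
    and "\<And>V W xs. openin (tops \<Y>) V \<Longrightarrow> openin (tops \<Y>) W \<Longrightarrow> W \<subseteq> V \<Longrightarrow> set xs \<subseteq> G V \<Longrightarrow>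
        mrst F V W (fs_class (G V) (E V) xs) = fs_class (G W) (E W) (map (r V W) xs)"
proof -
  show res: "mrst F V W (fs_class (G V) (E V) xs) = fs_class (G W) (E W) (map (r V W) xs)"
    if "openin (tops \<Y>) V" "openin (tops \<Y>) W" "W \<subseteq> V" "set xs \<subseteq> G V" for V W xs
    unfolding F using gens[OF that(1-3)] rels[OF that(1-3)] by (intro fs_map_class[OF that(4)]) auto
  have im: "set (map (r V W) xs) \<subseteq> G W"
    if "openin (tops \<Y>) V" "openin (tops \<Y>) W" "W \<subseteq> V" "set xs \<subseteq> G V" for V W xs
    using gens[OF that(1-3)] that(4) by auto
  show "module_presheaf \<Y> F"
  proof (rule module_presheaf.intro)
    show "ring_presheaf \<Y>" by (rule ringed)
  next
    fix U assume "openin (tops \<Y>) U"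
    then show "Module.module (Osec \<Y> U) (msec F U)"
      unfolding F by (rule fs_presentation.module_Q[OF pres])
  next
    fix U V m assume U: "openin (tops \<Y>) U" and V: "openin (tops \<Y>) V" "V \<subseteq> U" and "m \<in> carrier (msec F U)"
    then obtain xs where xs: "m = fs_class (G U) (E U) xs" "set xs \<subseteq> G U"
      unfolding F(1) fs_module_simps(1) by blast
    interpret U: fs_presentation "Osec \<Y> U" "G U" "E U" "act U" using U by (rule pres)
    interpret V: fs_presentation "Osec \<Y> V" "G V" "E V" "act V" using V(1) by (rule pres)
    note resU = res[OF U V]
    note imU = im[OF U V]
    show "mrst F U V m \<in> carrier (msec F V)"
      unfolding xs(1) resU[OF xs(2)] F(1) using imU[OF xs(2)] by (rule V.class_carrier)
    {
      fix n assume "n \<in> carrier (msec F U)"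
      then obtain ys where ys: "n = fs_class (G U) (E U) ys" "set ys \<subseteq> G U"
        unfolding F(1) fs_module_simps(1) by blast
      have "mrst F U V (m \<oplus>\<^bsub>msec F U\<^esub> n) = fs_class (G V) (E V) (map (r U V) (xs @ ys))"
        unfolding xs(1) ys(1) F(1) fs_module_add[OF xs(2) ys(2)] using xs ys by (intro resU) simp
      also have "\<dots> = mrst F U V m \<oplus>\<^bsub>msec F V\<^esub> mrst F U V n"
        unfolding xs(1) ys(1) resU[OF xs(2)] resU[OF ys(2)] F(1) fs_module_add[OF imU[OF xs(2)] imU[OF ys(2)]]
        by simp
      finally show "mrst F U V (m \<oplus>\<^bsub>msec F U\<^esub> n) = mrst F U V m \<oplus>\<^bsub>msec F V\<^esub> mrst F U V n" .
    }
    fix a assume a: "a \<in> carrier (Osec \<Y> U)"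
    have ra: "rst \<Y> U V a \<in> carrier (Osec \<Y> V)" using ringed_space_rst_closed[OF ringed U V a] .
    have "mrst F U V (a \<odot>\<^bsub>msec F U\<^esub> m) = fs_class (G V) (E V) (map (r U V) (map (act U a) xs))"
      unfolding xs(1) F(1) U.smult_class[OF a xs(2)] using U.act_set[OF a xs(2)] by (intro resU) simp
    also have "map (r U V) (map (act U a) xs) = map (act V (rst \<Y> U V a)) (map (r U V) xs)"
      using act[OF U V _ a] xs(2) by auto
    also have "fs_class (G V) (E V) \<dots> = rst \<Y> U V a \<odot>\<^bsub>msec F V\<^esub> mrst F U V m"
      unfolding xs(1) resU[OF xs(2)] F(1) V.smult_class[OF ra imU[OF xs(2)]] ..
    finally show "mrst F U V (a \<odot>\<^bsub>msec F U\<^esub> m) = rst \<Y> U V a \<odot>\<^bsub>msec F V\<^esub> mrst F U V m" .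
  next
    fix U m assume U: "openin (tops \<Y>) U" and "m \<in> carrier (msec F U)"
    then obtain xs where xs: "m = fs_class (G U) (E U) xs" "set xs \<subseteq> G U"
      unfolding F(1) fs_module_simps(1) by blast
    have "map (r U U) xs = xs" using id[OF U] xs(2) by (intro map_idI) auto
    then show "mrst F U U m = m" unfolding xs(1) res[OF U U order_refl xs(2)] by simp
  next
    fix U V W m assume U: "openin (tops \<Y>) U" and V: "openin (tops \<Y>) V" and W: "openin (tops \<Y>) W"
      and sub: "W \<subseteq> V" "V \<subseteq> U" and "m \<in> carrier (msec F U)"
    then obtain xs where xs: "m = fs_class (G U) (E U) xs" "set xs \<subseteq> G U"
      unfolding F(1) fs_module_simps(1) by blast
    have "map (r V W) (map (r U V) xs) = map (r U W) xs" using comp[OF U V W sub] xs(2) by auto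
    then show "mrst F V W (mrst F U V m) = mrst F U W m"
      unfolding xs(1) res[OF U V sub(2) xs(2)] res[OF V W sub(1) im[OF U V sub(2) xs(2)]]
        res[OF U W order_trans[OF sub] xs(2)] by (rule arg_cong)
  qed
qed

lemma tens_relsE:
  assumes "(xs, ys) \<in> tens_rels R f M N"
  obtains
    (zero) n where "xs = [(\<zero>\<^bsub>M\<^esub>, n)]" "ys = []" "n \<in> carrier N"
  | (add_l) m m' n where "xs = [(m \<oplus>\<^bsub>M\<^esub> m', n)]" "ys = [(m, n), (m', n)]"
      "m \<in> carrier M" "m' \<in> carrier M" "n \<in> carrier N"
  | (add_r) m n n' where "xs = [(m, n \<oplus>\<^bsub>N\<^esub> n')]" "ys = [(m, n), (m, n')]"
      "m \<in> carrier M" "n \<in> carrier N" "n' \<in> carrier N"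
  | (bal) r m n where "xs = [(f r \<odot>\<^bsub>M\<^esub> m, n)]" "ys = [(m, r \<odot>\<^bsub>N\<^esub> n)]"
      "r \<in> carrier R" "m \<in> carrier M" "n \<in> carrier N"
proof -
  show thesis
    by (insert assms, unfold tens_rels_def) (elim UnE CollectE exE conjE Pair_inject;
        ((rule zero, assumption+) | (rule add_l, assumption+) | (rule add_r, assumption+) | (rule bal, assumption+)))
qed

lemma
  shows tens_zero: "n \<in> carrier N \<Longrightarrow> fs_cong G (tens_rels R f M N) [(\<zero>\<^bsub>M\<^esub>, n)] []"
    and tens_add_l: "m \<in> carrier M \<Longrightarrow> m' \<in> carrier M \<Longrightarrow> n \<in> carrier N \<Longrightarrow>
      fs_cong G (tens_rels R f M N) [(m \<oplus>\<^bsub>M\<^esub> m', n)] [(m, n), (m', n)]"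
    and tens_add_r: "m \<in> carrier M \<Longrightarrow> n \<in> carrier N \<Longrightarrow> n' \<in> carrier N \<Longrightarrow>
      fs_cong G (tens_rels R f M N) [(m, n \<oplus>\<^bsub>N\<^esub> n')] [(m, n), (m, n')]"
    and tens_bal: "r \<in> carrier R \<Longrightarrow> m \<in> carrier M \<Longrightarrow> n \<in> carrier N \<Longrightarrow>
      fs_cong G (tens_rels R f M N) [(f r \<odot>\<^bsub>M\<^esub> m, n)] [(m, r \<odot>\<^bsub>N\<^esub> n)]"
  subgoal by (rule fs_rel, unfold tens_rels_def, rule UnI1, rule UnI1, rule UnI1, rule CollectI) (intro exI conjI, rule refl, assumption+)
  subgoal by (rule fs_rel, unfold tens_rels_def, rule UnI1, rule UnI1, rule UnI2, rule CollectI) (intro exI conjI, rule refl, assumption+)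
  subgoal by (rule fs_rel, unfold tens_rels_def, rule UnI1, rule UnI2, rule CollectI) (intro exI conjI, rule refl, assumption+)
  subgoal by (rule fs_rel, unfold tens_rels_def, rule UnI2, rule CollectI) (intro exI conjI, rule refl, assumption+)
  done

text \<open>Three of the four kinds of relations are preserved by any pair of additive maps. The
  balancing relation stays a hypothesis, since source and target may be tensor products over
  different rings. Scalar action, restriction, \<open>d \<otimes> 1\<close> and \<open>\<omega>
  \<otimes> m \<mapsto> \<omega> \<otimes> (1 \<otimes> m)\<close> are all obtained from it.\<close>

lemma tens_rels_map:
  assumes "(xs, ys) \<in> tens_rels R f M N"
    and \<phi>: "\<And>m. m \<in> carrier M \<Longrightarrow> \<phi> m \<in> carrier M'" and \<psi>: "\<And>n. n \<in> carrier N \<Longrightarrow> \<psi> n \<in> carrier N'"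
    and "\<phi> \<zero>\<^bsub>M\<^esub> = \<zero>\<^bsub>M'\<^esub>"
    and "\<And>m m'. m \<in> carrier M \<Longrightarrow> m' \<in> carrier M \<Longrightarrow> \<phi> (m \<oplus>\<^bsub>M\<^esub> m') = \<phi> m \<oplus>\<^bsub>M'\<^esub> \<phi> m'"
    and "\<And>n n'. n \<in> carrier N \<Longrightarrow> n' \<in> carrier N \<Longrightarrow> \<psi> (n \<oplus>\<^bsub>N\<^esub> n') = \<psi> n \<oplus>\<^bsub>N'\<^esub> \<psi> n'"
    and "\<And>r m n. r \<in> carrier R \<Longrightarrow> m \<in> carrier M \<Longrightarrow> n \<in> carrier N \<Longrightarrow>
      fs_cong G' (tens_rels R' f' M' N') [(\<phi> (f r \<odot>\<^bsub>M\<^esub> m), \<psi> n)] [(\<phi> m, \<psi> (r \<odot>\<^bsub>N\<^esub> n))]"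
  shows "fs_cong G' (tens_rels R' f' M' N') (map (map_prod \<phi> \<psi>) xs) (map (map_prod \<phi> \<psi>) ys)"
  using assms(1)
proof (cases rule: tens_relsE)
  case zero
  then show ?thesis using assms(4) tens_zero[OF \<psi>] by simp
next
  case add_l
  then show ?thesis using assms(5) tens_add_l[OF \<phi> \<phi> \<psi>] by simp
next
  case add_r
  then show ?thesis using assms(6) tens_add_r[OF \<phi> \<psi> \<psi>] by simp
next
  case bal
  then show ?thesis using assms(7) by simp
qed

lemma tens_presentation:
  assumes M: "Module.module B M" and N: "Module.module R N" and f: "f \<in> ring_hom R B"
  shows "fs_presentation B (tens_gens M N) (tens_rels R f M N) (\<lambda>b (m, n). (b \<odot>\<^bsub>M\<^esub> m, n))"
proof -
  interpret M: Module.module B M by (rule M)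
  interpret N: Module.module R N by (rule N)
  show ?thesis
  proof (intro fs_presentation.intro fs_presentation_axioms.intro M.R.is_cring)
    show "wf_rels (tens_gens M N) (tens_rels R f M N)"
      unfolding wf_rels_def
    proof (intro ballI case_prodI2)
      fix p xs ys assume "p \<in> tens_rels R f M N" "p = (xs, ys)"
      then have "(xs, ys) \<in> tens_rels R f M N" by simp
      then show "set xs \<subseteq> tens_gens M N \<and> set ys \<subseteq> tens_gens M N"
        by (cases rule: tens_relsE) (simp_all add: tens_gens_def ring_hom_closed[OF f])
    qed
  next
    fix b xs ys assume b: "b \<in> carrier B" and r: "(xs, ys) \<in> tens_rels R f M N"
    have eq: "(\<lambda>(m, n). (b \<odot>\<^bsub>M\<^esub> m, n)) = map_prod (\<lambda>m. b \<odot>\<^bsub>M\<^esub> m) (\<lambda>n. n)"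
      by (intro ext) (auto simp: map_prod_def)
    show "fs_cong (tens_gens M N) (tens_rels R f M N) (map (\<lambda>(m, n). (b \<odot>\<^bsub>M\<^esub> m, n)) xs)
        (map (\<lambda>(m, n). (b \<odot>\<^bsub>M\<^esub> m, n)) ys)"
      unfolding eq
    proof (rule tens_rels_map[OF r])
      fix r m n assume r: "r \<in> carrier R" and m: "m \<in> carrier M" and n: "n \<in> carrier N"
      have "b \<odot>\<^bsub>M\<^esub> (f r \<odot>\<^bsub>M\<^esub> m) = f r \<odot>\<^bsub>M\<^esub> (b \<odot>\<^bsub>M\<^esub> m)"
        using b m ring_hom_closed[OF f r] by (simp add: M.smult_assoc1[symmetric] M.R.m_comm)
      then show "fs_cong (tens_gens M N) (tens_rels R f M N) [(b \<odot>\<^bsub>M\<^esub> (f r \<odot>\<^bsub>M\<^esub> m), n)]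
          [(b \<odot>\<^bsub>M\<^esub> m, r \<odot>\<^bsub>N\<^esub> n)]"
        using tens_bal[OF r M.smult_closed[OF b m] n] by simp
    qed (use b in \<open>simp_all add: M.smult_r_distr\<close>)
  next
    fix b c g assume b: "b \<in> carrier B" and c: "c \<in> carrier B" and g: "g \<in> tens_gens M N"
    obtain m n where g: "g = (m, n)" "m \<in> carrier M" "n \<in> carrier N" using g unfolding tens_gens_def by blast
    show "fs_cong (tens_gens M N) (tens_rels R f M N) [case g of (m, n) \<Rightarrow> ((b \<oplus>\<^bsub>B\<^esub> c) \<odot>\<^bsub>M\<^esub> m, n)]
        [case g of (m, n) \<Rightarrow> (b \<odot>\<^bsub>M\<^esub> m, n), case g of (m, n) \<Rightarrow> (c \<odot>\<^bsub>M\<^esub> m, n)]"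
      unfolding g prod.case M.smult_l_distr[OF b c g(2)] using b c g by (intro tens_add_l) simp_all
    show "(case g of (m, n) \<Rightarrow> ((b \<otimes>\<^bsub>B\<^esub> c) \<odot>\<^bsub>M\<^esub> m, n)) =
        (case case g of (m, n) \<Rightarrow> (c \<odot>\<^bsub>M\<^esub> m, n) of (m, n) \<Rightarrow> (b \<odot>\<^bsub>M\<^esub> m, n))"
      unfolding g prod.case M.smult_assoc1[OF b c g(2)] ..
  next
    fix b g assume b: "b \<in> carrier B" and g: "g \<in> tens_gens M N"
    then show "(case g of (m, n) \<Rightarrow> (b \<odot>\<^bsub>M\<^esub> m, n)) \<in> tens_gens M N" unfolding tens_gens_def by auto
  next
    fix g assume g: "g \<in> tens_gens M N"
    then obtain m n where g: "g = (m, n)" "m \<in> carrier M" "n \<in> carrier N" unfolding tens_gens_def by blast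
    show "(case g of (m, n) \<Rightarrow> (\<one>\<^bsub>B\<^esub> \<odot>\<^bsub>M\<^esub> m, n)) = g" using g by simp
    show "fs_cong (tens_gens M N) (tens_rels R f M N) [case g of (m, n) \<Rightarrow> (\<zero>\<^bsub>B\<^esub> \<odot>\<^bsub>M\<^esub> m, n)] []"
      using g tens_zero[of n N] by simp
  qed
qed

lemma kaehler_relsE:
  assumes "(xs, ys) \<in> kaehler_rels A f B"
  obtains
    (zero) c where "xs = [(\<zero>\<^bsub>B\<^esub>, c)]" "ys = []" "c \<in> carrier B"
  | (add_l) b b' c where "xs = [(b \<oplus>\<^bsub>B\<^esub> b', c)]" "ys = [(b, c), (b', c)]"
      "b \<in> carrier B" "b' \<in> carrier B" "c \<in> carrier B"
  | (add_r) b c c' where "xs = [(b, c \<oplus>\<^bsub>B\<^esub> c')]" "ys = [(b, c), (b, c')]"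
      "b \<in> carrier B" "c \<in> carrier B" "c' \<in> carrier B"
  | (leibniz) b c c' where "xs = [(b, c \<otimes>\<^bsub>B\<^esub> c')]" "ys = [(b \<otimes>\<^bsub>B\<^esub> c, c'), (b \<otimes>\<^bsub>B\<^esub> c', c)]"
      "b \<in> carrier B" "c \<in> carrier B" "c' \<in> carrier B"
  | (const) b a where "xs = [(b, f a)]" "ys = []" "b \<in> carrier B" "a \<in> carrier A"
proof -
  show thesis
    by (insert assms, unfold kaehler_rels_def) (elim UnE CollectE exE conjE Pair_inject;
        ((rule zero, assumption+) | (rule add_l, assumption+) | (rule add_r, assumption+) |
         (rule leibniz, assumption+) | (rule const, assumption+)))
qed

lemma
  shows kaehler_zero: "c \<in> carrier B \<Longrightarrow> fs_cong G (kaehler_rels A f B) [(\<zero>\<^bsub>B\<^esub>, c)] []"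
    and kaehler_add_l: "b \<in> carrier B \<Longrightarrow> b' \<in> carrier B \<Longrightarrow> c \<in> carrier B \<Longrightarrow>
      fs_cong G (kaehler_rels A f B) [(b \<oplus>\<^bsub>B\<^esub> b', c)] [(b, c), (b', c)]"
    and kaehler_add_r: "b \<in> carrier B \<Longrightarrow> c \<in> carrier B \<Longrightarrow> c' \<in> carrier B \<Longrightarrow>
      fs_cong G (kaehler_rels A f B) [(b, c \<oplus>\<^bsub>B\<^esub> c')] [(b, c), (b, c')]"
    and kaehler_leibniz: "b \<in> carrier B \<Longrightarrow> c \<in> carrier B \<Longrightarrow> c' \<in> carrier B \<Longrightarrow>
      fs_cong G (kaehler_rels A f B) [(b, c \<otimes>\<^bsub>B\<^esub> c')] [(b \<otimes>\<^bsub>B\<^esub> c, c'), (b \<otimes>\<^bsub>B\<^esub> c', c)]"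
    and kaehler_const: "b \<in> carrier B \<Longrightarrow> a \<in> carrier A \<Longrightarrow>
      fs_cong G (kaehler_rels A f B) [(b, f a)] []"
  subgoal by (rule fs_rel, unfold kaehler_rels_def, rule UnI1, rule UnI1, rule UnI1, rule UnI1, rule CollectI) (intro exI conjI, rule refl, assumption+)
  subgoal by (rule fs_rel, unfold kaehler_rels_def, rule UnI1, rule UnI1, rule UnI1, rule UnI2, rule CollectI) (intro exI conjI, rule refl, assumption+)
  subgoal by (rule fs_rel, unfold kaehler_rels_def, rule UnI1, rule UnI1, rule UnI2, rule CollectI) (intro exI conjI, rule refl, assumption+)
  subgoal by (rule fs_rel, unfold kaehler_rels_def, rule UnI1, rule UnI2, rule CollectI) (intro exI conjI, rule refl, assumption+)
  subgoal by (rule fs_rel, unfold kaehler_rels_def, rule UnI2, rule CollectI) (intro exI conjI, rule refl, assumption+)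
  done

lemma kaehler_wf:
  assumes "cring B" and f: "f \<in> ring_hom A B"
  shows "wf_rels (kaehler_gens B) (kaehler_rels A f B)"
proof -
  interpret cring B by (rule assms)
  show ?thesis
    unfolding wf_rels_def
  proof (intro ballI case_prodI2)
    fix p xs ys assume "p \<in> kaehler_rels A f B" "p = (xs, ys)"
    then have "(xs, ys) \<in> kaehler_rels A f B" by simp
    then show "set xs \<subseteq> kaehler_gens B \<and> set ys \<subseteq> kaehler_gens B"
      by (cases rule: kaehler_relsE) (simp_all add: kaehler_gens_def ring_hom_closed[OF f])
  qed
qed

lemma kaehler_presentation:
  assumes B: "cring B" and f: "f \<in> ring_hom A B"
  shows "fs_presentation B (kaehler_gens B) (kaehler_rels A f B) (\<lambda>b (b', c). (b \<otimes>\<^bsub>B\<^esub> b', c))"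
proof -
  interpret B: cring B by (rule B)
  let ?G = "kaehler_gens B" and ?E = "kaehler_rels A f B" and ?act = "\<lambda>b (b', c). (b \<otimes>\<^bsub>B\<^esub> b', c)"
  show ?thesis
  proof (intro fs_presentation.intro fs_presentation_axioms.intro B kaehler_wf f)
    fix b xs ys assume b: "b \<in> carrier B" and r: "(xs, ys) \<in> ?E"
    from r show "fs_cong ?G ?E (map (?act b) xs) (map (?act b) ys)"
    proof (cases rule: kaehler_relsE)
      case zero
      then show ?thesis using b kaehler_zero by simp
    next
      case (add_l b' b'' c)
      then show ?thesis using b kaehler_add_l[of "b \<otimes>\<^bsub>B\<^esub> b'" B "b \<otimes>\<^bsub>B\<^esub> b''" c] by (simp add: B.r_distr)
    next
      case (add_r b' c c')
      then show ?thesis using b kaehler_add_r[of "b \<otimes>\<^bsub>B\<^esub> b'" B c c'] by simp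
    next
      case (leibniz b' c c')
      then show ?thesis using b kaehler_leibniz[of "b \<otimes>\<^bsub>B\<^esub> b'" B c c'] by (simp add: B.m_assoc)
    next
      case (const b' a)
      then show ?thesis using b kaehler_const[of "b \<otimes>\<^bsub>B\<^esub> b'" B a] by simp
    qed
  next
    fix b c g assume b: "b \<in> carrier B" and c: "c \<in> carrier B" and g: "g \<in> ?G"
    obtain m n where g: "g = (m, n)" "m \<in> carrier B" "n \<in> carrier B" using g unfolding kaehler_gens_def by blast
    show "fs_cong ?G ?E [?act (b \<oplus>\<^bsub>B\<^esub> c) g] [?act b g, ?act c g]"
      unfolding g prod.case B.l_distr[OF b c g(2)] using b c g by (intro kaehler_add_l) simp_all
    show "?act (b \<otimes>\<^bsub>B\<^esub> c) g = ?act b (?act c g)"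
      unfolding g prod.case B.m_assoc[OF b c g(2)] ..
  next
    fix b g assume b: "b \<in> carrier B" and g: "g \<in> ?G"
    then show "?act b g \<in> ?G" unfolding kaehler_gens_def by auto
  next
    fix g assume g: "g \<in> ?G"
    then obtain m n where g: "g = (m, n)" "m \<in> carrier B" "n \<in> carrier B" unfolding kaehler_gens_def by blast
    show "?act \<one>\<^bsub>B\<^esub> g = g" using g by simp
    show "fs_cong ?G ?E [?act \<zero>\<^bsub>B\<^esub> g] []" using g kaehler_zero[of n B] by simp
  qed
qed

text \<open>Serves twice: with the inverse image of the structure sheaf of \<X> as
  \<open>\<A>\<close>, and with \<open>\<A> = \<Y>\<close> and \<open>h\<close> the identity for
  tensor products over the structure sheaf of \<Y>.\<close>

locale ringed_pair =
  fixes \<Y> :: "('y, 'b) ringed_space" and \<A> :: "('y, 'a) ringed_space" and h :: "'y set \<Rightarrow> 'a \<Rightarrow> 'b"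
  assumes ringed_Y: "ring_presheaf \<Y>" and ringed_A: "ring_presheaf \<A>"
    and tops_A: "tops \<A> = tops \<Y>"
    and h_hom: "openin (tops \<Y>) V \<Longrightarrow> h V \<in> ring_hom (Osec \<A> V) (Osec \<Y> V)"
    and h_rst: "openin (tops \<Y>) V \<Longrightarrow> openin (tops \<Y>) W \<Longrightarrow> W \<subseteq> V \<Longrightarrow> a \<in> carrier (Osec \<A> V) \<Longrightarrow>
      h W (rst \<A> V W a) = rst \<Y> V W (h V a)"
begin

lemma tensor_presheaf:
  assumes M: "module_presheaf \<Y> M" and N: "module_presheaf \<A> N"
  shows "module_presheaf \<Y> (tensor_presheaf \<A> h M N)"
    and "\<And>V W xs. openin (tops \<Y>) V \<Longrightarrow> openin (tops \<Y>) W \<Longrightarrow> W \<subseteq> V \<Longrightarrow>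
      set xs \<subseteq> tens_gens (msec M V) (msec N V) \<Longrightarrow>
      mrst (tensor_presheaf \<A> h M N) V W (tens_class (Osec \<A> V) (h V) (msec M V) (msec N V) xs)
        = tens_class (Osec \<A> W) (h W) (msec M W) (msec N W) (map (map_prod (mrst M V W) (mrst N V W)) xs)"
proof -
  interpret M: module_presheaf \<Y> M by (rule M)
  interpret N: module_presheaf \<A> N by (rule N)
  let ?G = "\<lambda>V. tens_gens (msec M V) (msec N V)"
  let ?E = "\<lambda>V. tens_rels (Osec \<A> V) (h V) (msec M V) (msec N V)"
  let ?r = "\<lambda>V W. map_prod (mrst M V W) (mrst N V W)"
  let ?act = "\<lambda>V b (m, n). (b \<odot>\<^bsub>msec M V\<^esub> m, n)"
  note N_thms = N.module_sec[unfolded tops_A] N.res_closed[unfolded tops_A] N.res_add[unfolded tops_A]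
    N.res_smult[unfolded tops_A] N.res_id[unfolded tops_A] N.res_comp[unfolded tops_A]
  have pres: "fs_presentation (Osec \<Y> V) (?G V) (?E V) (?act V)" if "openin (tops \<Y>) V" for V
    using that by (intro tens_presentation M.module_sec N_thms(1) h_hom)
  have gens: "?r V W g \<in> ?G W"
    if "openin (tops \<Y>) V" "openin (tops \<Y>) W" "W \<subseteq> V" "g \<in> ?G V" for V W g
    using that M.res_closed[OF that(1-3)] N_thms(2)[OF that(1-3)] unfolding tens_gens_def by auto
  have rels: "fs_cong (?G W) (?E W) (map (?r V W) xs) (map (?r V W) ys)"
    if o: "openin (tops \<Y>) V" "openin (tops \<Y>) W" "W \<subseteq> V" and E: "(xs, ys) \<in> ?E V" for V W xs ys
  proof (rule tens_rels_map[OF E])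
    fix r m n assume r: "r \<in> carrier (Osec \<A> V)" and m: "m \<in> carrier (msec M V)" and n: "n \<in> carrier (msec N V)"
    have rr: "rst \<A> V W r \<in> carrier (Osec \<A> W)"
      using ringed_space_rst_closed[OF ringed_A _ _ o(3) r] o by (simp add: tops_A)
    show "fs_cong (?G W) (?E W) [(mrst M V W (h V r \<odot>\<^bsub>msec M V\<^esub> m), mrst N V W n)]
        [(mrst M V W m, mrst N V W (r \<odot>\<^bsub>msec N V\<^esub> n))]"
      unfolding M.res_smult[OF o m ring_hom_closed[OF h_hom[OF o(1)] r]] N_thms(4)[OF o n r] h_rst[OF o r, symmetric]
      by (rule tens_bal[OF rr M.res_closed[OF o m] N_thms(2)[OF o n]])
  qed (use o in \<open>simp_all add: M.res_closed N_thms(2,3) M.res_zero M.res_add\<close>)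
  have act: "?r V W (?act V b g) = ?act W (rst \<Y> V W b) (?r V W g)"
    if o: "openin (tops \<Y>) V" "openin (tops \<Y>) W" "W \<subseteq> V" and g: "g \<in> ?G V" and b: "b \<in> carrier (Osec \<Y> V)" for V W b g
  proof -
    obtain m n where g: "g = (m, n)" "m \<in> carrier (msec M V)" using g unfolding tens_gens_def by blast
    then show ?thesis using M.res_smult[OF o g(2) b] by simp
  qed
  have id: "?r V V g = g" if "openin (tops \<Y>) V" "g \<in> ?G V" for V g
    using that M.res_id[OF that(1)] N_thms(5)[OF that(1)] unfolding tens_gens_def by auto
  have comp: "?r V W (?r U V g) = ?r U W g"
    if "openin (tops \<Y>) U" "openin (tops \<Y>) V" "openin (tops \<Y>) W" "W \<subseteq> V" "V \<subseteq> U" "g \<in> ?G U" for U V W g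
    using that M.res_comp[OF that(1-5)] N_thms(6)[OF that(1-5)] unfolding tens_gens_def by auto
  have F: "msec (tensor_presheaf \<A> h M N) V = fs_module (?G V) (?E V) (?act V)"
    "mrst (tensor_presheaf \<A> h M N) V W = fs_map (?G W) (?E W) (?r V W)" for V W
    unfolding tensor_presheaf_def tensor_def by simp_all
  from fs_presheaf[of \<Y> ?G ?E ?act ?r "tensor_presheaf \<A> h M N", OF ringed_Y pres gens rels act id comp F]
  show "module_presheaf \<Y> (tensor_presheaf \<A> h M N)"
    and "\<And>V W xs. openin (tops \<Y>) V \<Longrightarrow> openin (tops \<Y>) W \<Longrightarrow> W \<subseteq> V \<Longrightarrow>
      set xs \<subseteq> tens_gens (msec M V) (msec N V) \<Longrightarrow>
      mrst (tensor_presheaf \<A> h M N) V W (tens_class (Osec \<A> V) (h V) (msec M V) (msec N V) xs)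
        = tens_class (Osec \<A> W) (h W) (msec M W) (msec N W) (map (map_prod (mrst M V W) (mrst N V W)) xs)"
    unfolding tens_class_def by blast+
qed

definition kaehler_presheaf :: "('y, 'b, ('b \<times> 'b) list set) mod_sheaf" where
  "kaehler_presheaf = \<lparr> msec = (\<lambda>V. kaehler (Osec \<A> V) (h V) (Osec \<Y> V)),
     mrst = (\<lambda>V W. fs_map (kaehler_gens (Osec \<Y> W)) (kaehler_rels (Osec \<A> W) (h W) (Osec \<Y> W))
               (map_prod (rst \<Y> V W) (rst \<Y> V W))) \<rparr>"

lemma kaehler_presheaf:
  shows "module_presheaf \<Y> kaehler_presheaf"
    and "\<And>V W xs. openin (tops \<Y>) V \<Longrightarrow> openin (tops \<Y>) W \<Longrightarrow> W \<subseteq> V \<Longrightarrow>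
      set xs \<subseteq> kaehler_gens (Osec \<Y> V) \<Longrightarrow>
      mrst kaehler_presheaf V W (kaehler_class (Osec \<A> V) (h V) (Osec \<Y> V) xs)
        = kaehler_class (Osec \<A> W) (h W) (Osec \<Y> W) (map (map_prod (rst \<Y> V W) (rst \<Y> V W)) xs)"
proof -
  let ?G = "\<lambda>V. kaehler_gens (Osec \<Y> V)"
  let ?E = "\<lambda>V. kaehler_rels (Osec \<A> V) (h V) (Osec \<Y> V)"
  let ?r = "\<lambda>V W. map_prod (rst \<Y> V W) (rst \<Y> V W)"
  let ?act = "\<lambda>V b (b', c). (b \<otimes>\<^bsub>Osec \<Y> V\<^esub> b', c)"
  have pres: "fs_presentation (Osec \<Y> V) (?G V) (?E V) (?act V)" if "openin (tops \<Y>) V" for V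
    using that by (intro kaehler_presentation ringed_space_cring[OF ringed_Y] h_hom)
  note rc = ringed_space_rst_closed[OF ringed_Y]
  have gens: "?r V W g \<in> ?G W"
    if "openin (tops \<Y>) V" "openin (tops \<Y>) W" "W \<subseteq> V" "g \<in> ?G V" for V W g
    using that rc[OF that(1-3)] unfolding kaehler_gens_def by auto
  have rels: "fs_cong (?G W) (?E W) (map (?r V W) xs) (map (?r V W) ys)"
    if o: "openin (tops \<Y>) V" "openin (tops \<Y>) W" "W \<subseteq> V" and E: "(xs, ys) \<in> ?E V" for V W xs ys
  proof -
    interpret r: ring_hom_cring "Osec \<Y> V" "Osec \<Y> W" "rst \<Y> V W"
      using o by (intro ring_hom_cring.intro ring_hom_cring_axioms.intro ringed_space_cring[OF ringed_Y]
          ringed_space_rst[OF ringed_Y])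
    from E show ?thesis
    proof (cases rule: kaehler_relsE)
      case zero
      then show ?thesis by (simp add: kaehler_zero)
    next
      case add_l
      then show ?thesis by (simp add: kaehler_add_l)
    next
      case add_r
      then show ?thesis by (simp add: kaehler_add_r)
    next
      case leibniz
      then show ?thesis by (simp add: kaehler_leibniz)
    next
      case (const b a)
      have "rst \<A> V W a \<in> carrier (Osec \<A> W)"
        using ringed_space_rst_closed[OF ringed_A _ _ o(3) const(4)] o by (simp add: tops_A)
      then show ?thesis using const h_rst[OF o const(4)] by (simp add: kaehler_const flip: h_rst[OF o])
    qed
  qed
  have act: "?r V W (?act V b g) = ?act W (rst \<Y> V W b) (?r V W g)"
    if o: "openin (tops \<Y>) V" "openin (tops \<Y>) W" "W \<subseteq> V" and g: "g \<in> ?G V" and b: "b \<in> carrier (Osec \<Y> V)" for V W b g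
  proof -
    obtain m n where g: "g = (m, n)" "m \<in> carrier (Osec \<Y> V)" using g unfolding kaehler_gens_def by blast
    then show ?thesis using ring_hom_mult[OF ringed_space_rst[OF ringed_Y o] b g(2)] by simp
  qed
  have id: "?r V V g = g" if "openin (tops \<Y>) V" "g \<in> ?G V" for V g
    using that ringed_space_rst_id[OF ringed_Y that(1)] unfolding kaehler_gens_def by auto
  have comp: "?r V W (?r U V g) = ?r U W g"
    if "openin (tops \<Y>) U" "openin (tops \<Y>) V" "openin (tops \<Y>) W" "W \<subseteq> V" "V \<subseteq> U" "g \<in> ?G U" for U V W g
    using that ringed_space_rst_comp[OF ringed_Y that(1-5)] unfolding kaehler_gens_def by auto
  have F: "msec kaehler_presheaf V = fs_module (?G V) (?E V) (?act V)"
    "mrst kaehler_presheaf V W = fs_map (?G W) (?E W) (?r V W)" for V W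
    unfolding kaehler_presheaf_def kaehler_def by simp_all
  from fs_presheaf[of \<Y> ?G ?E ?act ?r kaehler_presheaf, OF ringed_Y pres gens rels act id comp F]
  show "module_presheaf \<Y> kaehler_presheaf"
    and "\<And>V W xs. openin (tops \<Y>) V \<Longrightarrow> openin (tops \<Y>) W \<Longrightarrow> W \<subseteq> V \<Longrightarrow>
      set xs \<subseteq> kaehler_gens (Osec \<Y> V) \<Longrightarrow>
      mrst kaehler_presheaf V W (kaehler_class (Osec \<A> V) (h V) (Osec \<Y> V) xs)
        = kaehler_class (Osec \<A> W) (h W) (Osec \<Y> W) (map (map_prod (rst \<Y> V W) (rst \<Y> V W)) xs)"
    unfolding kaehler_class_def by blast+
qed

end

lemma structure_module_presheaf:
  assumes "ring_presheaf \<X>"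
  shows "module_presheaf \<X> (structure_module \<X>)"
proof (rule module_presheaf.intro)
  show "ring_presheaf \<X>" by (rule assms)
next
  fix U assume U: "openin (tops \<X>) U"
  interpret cring "Osec \<X> U" using ringed_space_cring[OF assms U] .
  let ?M = "msec (structure_module \<X>) U"
  have s: "carrier ?M = carrier (Osec \<X> U)" "add ?M = add (Osec \<X> U)" "zero ?M = zero (Osec \<X> U)"
    "smult ?M = monoid.mult (Osec \<X> U)" unfolding structure_module_def by simp_all
  show "Module.module (Osec \<X> U) ?M"
  proof (rule moduleI)
    show "cring (Osec \<X> U)" by (rule is_cring)
    show "abelian_group ?M"
    proof (rule abelian_groupI)
      fix x assume "x \<in> carrier ?M"
      then show "\<exists>y\<in>carrier ?M. y \<oplus>\<^bsub>?M\<^esub> x = \<zero>\<^bsub>?M\<^esub>"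
        unfolding s by (intro bexI[of _ "\<ominus>\<^bsub>Osec \<X> U\<^esub> x"]) (simp_all add: l_neg)
    qed (simp_all add: s a_ac)
  qed (simp_all add: s l_distr r_distr m_assoc)
next
  fix U V m assume o: "openin (tops \<X>) U" "openin (tops \<X>) V" "V \<subseteq> U" and m: "m \<in> carrier (msec (structure_module \<X>) U)"
  note r = ringed_space_rst[OF assms o]
  show "mrst (structure_module \<X>) U V m \<in> carrier (msec (structure_module \<X>) V)"
    using m ring_hom_closed[OF r] unfolding structure_module_def by simp
  show "mrst (structure_module \<X>) U V (m \<oplus>\<^bsub>msec (structure_module \<X>) U\<^esub> n)
      = mrst (structure_module \<X>) U V m \<oplus>\<^bsub>msec (structure_module \<X>) V\<^esub> mrst (structure_module \<X>) U V n"
    if "n \<in> carrier (msec (structure_module \<X>) U)" for n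
    using m that ring_hom_add[OF r] unfolding structure_module_def by simp
  show "mrst (structure_module \<X>) U V (a \<odot>\<^bsub>msec (structure_module \<X>) U\<^esub> m)
      = rst \<X> U V a \<odot>\<^bsub>msec (structure_module \<X>) V\<^esub> mrst (structure_module \<X>) U V m"
    if "a \<in> carrier (Osec \<X> U)" for a
    using m that ring_hom_mult[OF r] unfolding structure_module_def by simp
next
  fix U m assume "openin (tops \<X>) U" "m \<in> carrier (msec (structure_module \<X>) U)"
  then show "mrst (structure_module \<X>) U U m = m"
    using ringed_space_rst_id[OF assms] unfolding structure_module_def by simp
next
  fix U V W m assume o: "openin (tops \<X>) U" "openin (tops \<X>) V" "openin (tops \<X>) W" "W \<subseteq> V" "V \<subseteq> U"
    and m: "m \<in> carrier (msec (structure_module \<X>) U)"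
  then show "mrst (structure_module \<X>) V W (mrst (structure_module \<X>) U V m) = mrst (structure_module \<X>) U W m"
    using ringed_space_rst_comp[OF assms o] unfolding structure_module_def by simp
qed

section \<open>Detecting generators by derivations in characteristic p\<close>

text \<open>Raising \<open>i\<close> and raising \<open>m\<close> are commuting shifts, and the
  recurrence says that passing from \<open>k\<close> to \<open>Suc k\<close> applies their sum. The
  formula is the binomial theorem for the k-th power of that sum.\<close>

lemma (in abelian_monoid) binomial_array:
  fixes e :: "nat \<Rightarrow> nat \<Rightarrow> nat \<Rightarrow> 'a"
  assumes e: "\<And>k i m. e k i m \<in> carrier G"
    and rec: "\<And>k i m. e (Suc k) i m = e k (Suc i) m \<oplus> e k i (Suc m)"
  shows "e k i m = (\<Oplus>j\<in>{..k}. [(k choose j)] \<cdot> e 0 (i + j) (m + k - j))"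
proof (induction k arbitrary: i m)
  case 0
  then show ?case using e by simp
next
  case (Suc k)
  define f where "f = (\<lambda>j. e 0 (i + j) (m + Suc k - j))"
  have f: "f j \<in> carrier G" for j unfolding f_def by (rule e)
  have c: "(\<lambda>j. [n j] \<cdot> f (g j)) \<in> A \<rightarrow> carrier G" for n :: "nat \<Rightarrow> nat" and g A
    using f by simp
  have "e k (Suc i) m = (\<Oplus>j\<in>{..k}. [(k choose j)] \<cdot> f (Suc j))"
    unfolding Suc.IH f_def by simp
  moreover have "e k i (Suc m) = (\<Oplus>j\<in>{..Suc k}. [(k choose j)] \<cdot> f j)"
  proof -
    have "e k i (Suc m) = (\<Oplus>j\<in>{..k}. [(k choose j)] \<cdot> f j)"
      unfolding Suc.IH f_def by simp
    then show ?thesis using f c finsum_closed[OF c] by (simp add: finsum_Suc binomial_eq_0)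
  qed
  then have "e k i (Suc m) = (\<Oplus>j\<in>{..k}. [(k choose Suc j)] \<cdot> f (Suc j)) \<oplus> f 0"
    using c f by (simp add: finsum_Suc2 del: binomial_Suc_Suc finsum_Suc)
  ultimately have "e (Suc k) i m =
      (\<Oplus>j\<in>{..k}. [(k choose j)] \<cdot> f (Suc j) \<oplus> [(k choose Suc j)] \<cdot> f (Suc j)) \<oplus> f 0"
    unfolding rec using c f finsum_closed[OF c] by (simp add: finsum_addf a_assoc)
  also have "\<dots> = (\<Oplus>j\<in>{..k}. [(Suc k choose Suc j)] \<cdot> f (Suc j)) \<oplus> f 0"
    using f by (simp add: add.nat_pow_mult)
  also have "\<dots> = (\<Oplus>j\<in>{..Suc k}. [(Suc k choose j)] \<cdot> f j)"
    using c f by (simp add: finsum_Suc2 del: binomial_Suc_Suc finsum_Suc)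
  finally show ?case unfolding f_def .
qed

text \<open>The coefficients \<open>p choose j\<close> with \<open>0 < j < p\<close> are multiples
  of \<open>p\<close>, so only the two ends of the binomial sum survive.\<close>

lemma (in abelian_monoid) binomial_array_prime:
  fixes e :: "nat \<Rightarrow> nat \<Rightarrow> nat \<Rightarrow> 'a"
  assumes e: "\<And>k i m. e k i m \<in> carrier G"
    and rec: "\<And>k i m. e (Suc k) i m = e k (Suc i) m \<oplus> e k i (Suc m)"
    and p: "Factorial_Ring.prime p" and char: "\<And>x. x \<in> carrier G \<Longrightarrow> [p] \<cdot> x = \<zero>"
  shows "e p i m = e 0 (i + p) m \<oplus> e 0 i (m + p)"
proof -
  let ?f = "\<lambda>j. [(p choose j)] \<cdot> e 0 (i + j) (m + p - j)"
  obtain q where q: "p = Suc q" using prime_gt_0_nat[OF p] gr0_conv_Suc by blast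
  have f: "?f \<in> A \<rightarrow> carrier G" for A using e by simp
  have z: "?f j = \<zero>" if "0 < j" "j < p" for j
  proof -
    have "p dvd p choose j" using that p by (intro dvd_choose_prime) auto
    then obtain n where n: "p choose j = p * n" by blast
    have "[(p * n)] \<cdot> e 0 (i + j) (m + p - j) = [n] \<cdot> ([p] \<cdot> e 0 (i + j) (m + p - j))"
      using e by (simp add: add.nat_pow_pow)
    then show ?thesis unfolding n using char e by simp
  qed
  have "q \<noteq> 0" using q prime_ge_2_nat[OF p] by auto
  have "(\<Oplus>j\<in>{..q}. ?f j) = ?f 0"
  proof -
    obtain r where r: "q = Suc r" using \<open>q \<noteq> 0\<close> not0_implies_Suc by blast
    have "(\<Oplus>j\<in>{..r}. ?f (Suc j)) = (\<Oplus>j\<in>{..r}. \<zero>)"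
    proof (rule finsum_cong')
      fix j assume "j \<in> {..r}"
      then have "0 < Suc j" "Suc j < p" using q r by auto
      then show "?f (Suc j) = \<zero>" by (rule z)
    qed simp_all
    then show ?thesis unfolding r using f e by (simp add: finsum_Suc2 finsum_zero del: binomial_Suc_Suc finsum_Suc)
  qed
  moreover have "e p i m = (\<Oplus>j\<in>{..Suc q}. ?f j)"
    using binomial_array[of e p i m, OF e rec] unfolding q by simp
  ultimately have "e p i m = ?f p \<oplus> ?f 0" using finsum_Suc[OF f, of q] q by simp
  then show ?thesis using e by simp
qed

text \<open>In the application \<open>C\<close> is generated by the sections coming from \<X> and by
  \<open>x\<^sub>1, \<dots>, x\<^sub>n\<close>, and \<open>K\<close> is the quotient of
  \<open>B\<close> by the prime ideal of sections whose germ at the point is no unit.\<close>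

locale char_p_extension = B?: cring B + K?: domain K + q?: ring_hom_cring B K q
  for B (structure) and K (structure) and q +
  fixes C :: "'a set" and p :: nat
  assumes C: "subring C B" and p: "Factorial_Ring.prime p"
    and char: "[p] \<cdot> \<one> = \<zero>"
    and frob: "b \<in> carrier B \<Longrightarrow> b [^] p \<in> C"
begin

lemma C_sub: "c \<in> C \<Longrightarrow> c \<in> carrier B" using subringE(1)[OF C] by blast

lemma char_K: "x \<in> carrier K \<Longrightarrow> [p] \<cdot>\<^bsub>K\<^esub> x = \<zero>\<^bsub>K\<^esub>"
proof -
  assume x: "x \<in> carrier K"
  have "[n] \<cdot>\<^bsub>K\<^esub> q \<one> = q ([n] \<cdot> \<one>)" for n :: nat
    by (induction n) (simp_all add: add.nat_pow_Suc)
  then have "[p] \<cdot>\<^bsub>K\<^esub> \<one>\<^bsub>K\<^esub> = \<zero>\<^bsub>K\<^esub>" using char by simp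
  then have "([p] \<cdot>\<^bsub>K\<^esub> \<one>\<^bsub>K\<^esub>) \<otimes>\<^bsub>K\<^esub> x = \<zero>\<^bsub>K\<^esub>" using x by simp
  then show ?thesis using x by (simp add: K.add_pow_ldistr)
qed

section \<open>Commutators of linear maps with multiplications\<close>

definition Hom :: "('a \<Rightarrow> 'c) \<Rightarrow> bool" where
  "Hom \<eta> \<longleftrightarrow> (\<forall>b\<in>carrier B. \<eta> b \<in> carrier K) \<and>
    (\<forall>b\<in>carrier B. \<forall>b'\<in>carrier B. \<eta> (b \<oplus> b') = \<eta> b \<oplus>\<^bsub>K\<^esub> \<eta> b') \<and>
    (\<forall>c\<in>C. \<forall>b\<in>carrier B. \<eta> (c \<otimes> b) = q c \<otimes>\<^bsub>K\<^esub> \<eta> b)"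

text \<open>The commutator of \<open>\<eta>\<close> with multiplication by \<open>b\<close>. It
  vanishes for all \<open>b\<close> exactly when \<open>\<eta>\<close> is linear over
  \<open>B\<close>.\<close>

definition ad :: "'a \<Rightarrow> ('a \<Rightarrow> 'c) \<Rightarrow> 'a \<Rightarrow> 'c" where
  "ad b \<eta> u = \<eta> (b \<otimes> u) \<ominus>\<^bsub>K\<^esub> q b \<otimes>\<^bsub>K\<^esub> \<eta> u"

definition lin :: "('a \<Rightarrow> 'c) \<Rightarrow> bool" where
  "lin \<eta> \<longleftrightarrow> (\<forall>b\<in>carrier B. \<forall>u\<in>carrier B. \<eta> (b \<otimes> u) = q b \<otimes>\<^bsub>K\<^esub> \<eta> u)"

lemma Hom_closed: "Hom \<eta> \<Longrightarrow> b \<in> carrier B \<Longrightarrow> \<eta> b \<in> carrier K"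
  and Hom_add: "Hom \<eta> \<Longrightarrow> b \<in> carrier B \<Longrightarrow> b' \<in> carrier B \<Longrightarrow> \<eta> (b \<oplus> b') = \<eta> b \<oplus>\<^bsub>K\<^esub> \<eta> b'"
  and Hom_C: "Hom \<eta> \<Longrightarrow> c \<in> C \<Longrightarrow> b \<in> carrier B \<Longrightarrow> \<eta> (c \<otimes> b) = q c \<otimes>\<^bsub>K\<^esub> \<eta> b"
  unfolding Hom_def by simp_all

lemma lin_eq: "lin \<eta> \<Longrightarrow> b \<in> carrier B \<Longrightarrow> u \<in> carrier B \<Longrightarrow> \<eta> (b \<otimes> u) = q b \<otimes>\<^bsub>K\<^esub> \<eta> u"
  unfolding lin_def by simp

lemma ad_Hom:
  assumes \<eta>: "Hom \<eta>" and b: "b \<in> carrier B"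
  shows "Hom (ad b \<eta>)"
  unfolding Hom_def
proof (intro conjI ballI)
  fix u u' assume u: "u \<in> carrier B" and u': "u' \<in> carrier B"
  show "ad b \<eta> u \<in> carrier K" unfolding ad_def using b u Hom_closed[OF \<eta>] by simp
  show "ad b \<eta> (u \<oplus> u') = ad b \<eta> u \<oplus>\<^bsub>K\<^esub> ad b \<eta> u'"
    unfolding ad_def using b u u' Hom_closed[OF \<eta>]
    by (simp add: Hom_add[OF \<eta>] B.r_distr K.r_distr K.minus_eq K.minus_add K.a_ac)
next
  fix c u assume c: "c \<in> C" and u: "u \<in> carrier B"
  have "\<eta> (b \<otimes> (c \<otimes> u)) = q c \<otimes>\<^bsub>K\<^esub> \<eta> (b \<otimes> u)"
    using Hom_C[OF \<eta> c, of "b \<otimes> u"] b u C_sub[OF c] by (simp add: B.m_lcomm)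
  then show "ad b \<eta> (c \<otimes> u) = q c \<otimes>\<^bsub>K\<^esub> ad b \<eta> u"
    unfolding ad_def using b u C_sub[OF c] Hom_closed[OF \<eta>]
    by (simp add: Hom_C[OF \<eta> c] K.r_distr K.minus_eq K.r_minus K.m_lcomm)
qed

lemma ad_lin: "Hom \<eta> \<Longrightarrow> lin \<eta> \<Longrightarrow> b \<in> carrier B \<Longrightarrow> u \<in> carrier B \<Longrightarrow> ad b \<eta> u = \<zero>\<^bsub>K\<^esub>"
  unfolding ad_def using Hom_closed by (simp add: lin_eq K.minus_eq K.r_neg)

lemma lin_zero: "(\<And>u. u \<in> carrier B \<Longrightarrow> \<eta> u = \<zero>\<^bsub>K\<^esub>) \<Longrightarrow> lin \<eta>"
  unfolding lin_def by simp

lemma ad_comm: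
  assumes \<eta>: "Hom \<eta>" and "a \<in> carrier B" "b \<in> carrier B" "u \<in> carrier B"
  shows "ad a (ad b \<eta>) u = ad b (ad a \<eta>) u"
proof -
  have *: "a \<otimes> (b \<otimes> u) = b \<otimes> (a \<otimes> u)" using assms by (simp add: B.m_lcomm)
  show ?thesis
    unfolding ad_def * using assms Hom_closed[OF \<eta>]
    by (simp add: K.minus_eq K.r_distr K.minus_add K.r_minus K.m_lcomm K.a_ac)
qed

lemma ad_pow_Hom: "Hom \<eta> \<Longrightarrow> b \<in> carrier B \<Longrightarrow> Hom ((ad b ^^ k) \<eta>)"
  by (induction k) (simp_all add: ad_Hom)

text \<open>\<open>ad g\<close> is the sum of two commuting operators, precomposition with
  multiplication by \<open>g\<close> and multiplication by \<open>- q g\<close>; in characteristic p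
  the p-th power of the sum is the sum of the p-th powers.\<close>

lemma ad_pow_formula:
  assumes \<eta>: "Hom \<eta>" and g: "g \<in> carrier B" and u: "u \<in> carrier B"
  shows "(ad g ^^ p) \<eta> u = \<eta> (g [^] p \<otimes> u) \<oplus>\<^bsub>K\<^esub> (\<ominus>\<^bsub>K\<^esub> q g) [^]\<^bsub>K\<^esub> p \<otimes>\<^bsub>K\<^esub> \<eta> u"
proof -
  \<comment> \<open>Here \<open>k\<close> counts commutators already taken, \<open>i\<close> the
    uses of precomposition and \<open>m\<close> those of multiplication by \<open>- q g\<close>. The
    definition of \<open>ad\<close> becomes Pascal's recurrence for \<open>e\<close>.\<close>
  define e where "e k i m = (\<ominus>\<^bsub>K\<^esub> q g) [^]\<^bsub>K\<^esub> (m::nat) \<otimes>\<^bsub>K\<^esub> (ad g ^^ k) \<eta> (g [^] (i::nat) \<otimes> u)" for k i m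
  have H: "(ad g ^^ k) \<eta> v \<in> carrier K" if "v \<in> carrier B" for k v
    using Hom_closed[OF ad_pow_Hom[OF \<eta> g] that] .
  have e: "e k i m \<in> carrier K" for k i m
    unfolding e_def using g u H by simp
  have rec: "e (Suc k) i m = e k (Suc i) m \<oplus>\<^bsub>K\<^esub> e k i (Suc m)" for k i m
  proof -
    let ?X = "(ad g ^^ k) \<eta>"
    have *: "g \<otimes> (g [^] i \<otimes> u) = g [^] Suc i \<otimes> u"
      using g u by (simp add: B.m_ac)
    have "(ad g ^^ Suc k) \<eta> (g [^] i \<otimes> u) = ?X (g [^] Suc i \<otimes> u) \<oplus>\<^bsub>K\<^esub> (\<ominus>\<^bsub>K\<^esub> q g) \<otimes>\<^bsub>K\<^esub> ?X (g [^] i \<otimes> u)"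
      unfolding funpow.simps o_def ad_def[of g ?X] * using g u H by (simp add: K.minus_eq K.l_minus)
    then show ?thesis
      unfolding e_def using g u H by (simp add: K.r_distr K.m_assoc del: funpow.simps B.nat_pow_Suc)
  qed
  have "e p 0 0 = e 0 (0 + p) 0 \<oplus>\<^bsub>K\<^esub> e 0 0 (0 + p)"
    by (rule K.binomial_array_prime[where e = e]) (use e rec p char_K in simp_all)
  then show ?thesis unfolding e_def using g u H[of _ 0] H[of u p] by simp
qed

text \<open>As \<open>g [^] p\<close> lies in \<open>C\<close>, it can be pulled out of
  \<open>\<eta>\<close>. The formula becomes a multiple of \<open>\<eta> u\<close> whose factor
  depends on \<open>g\<close> and \<open>q\<close> alone, so it can be evaluated on the linear map
  \<open>q\<close>, all of whose commutators vanish.\<close>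

lemma ad_pow_zero:
  assumes \<eta>: "Hom \<eta>" and g: "g \<in> carrier B" and u: "u \<in> carrier B"
  shows "(ad g ^^ p) \<eta> u = \<zero>\<^bsub>K\<^esub>"
proof -
  have qH: "Hom q" unfolding Hom_def using C_sub by simp
  have "lin q" unfolding lin_def by simp
  \<comment> \<open>applying the formula to \<open>q\<close> itself shows \<open>(- q g)\<^sup>p = - (q g)\<^sup>p\<close>, also for \<open>p = 2\<close>\<close>
  have z: "(ad g ^^ Suc k) q v = \<zero>\<^bsub>K\<^esub>" if "v \<in> carrier B" for k v
    using that
  proof (induction k arbitrary: v)
    case 0
    then show ?case using ad_lin[OF qH \<open>lin q\<close> g] by simp
  next
    case (Suc k)
    then show ?case using g by (simp add: ad_def[of g "ad g ((ad g ^^ k) q)"] K.minus_eq)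
  qed
  obtain k where "p = Suc k" using prime_gt_0_nat[OF p] gr0_conv_Suc by blast
  then have s: "q (g [^] p) \<oplus>\<^bsub>K\<^esub> (\<ominus>\<^bsub>K\<^esub> q g) [^]\<^bsub>K\<^esub> p = \<zero>\<^bsub>K\<^esub>"
    using ad_pow_formula[OF qH g B.one_closed] z[OF B.one_closed] g by simp
  have "(ad g ^^ p) \<eta> u = (q (g [^] p) \<oplus>\<^bsub>K\<^esub> (\<ominus>\<^bsub>K\<^esub> q g) [^]\<^bsub>K\<^esub> p) \<otimes>\<^bsub>K\<^esub> \<eta> u"
    unfolding ad_pow_formula[OF \<eta> g u] Hom_C[OF \<eta> frob[OF g] u]
    using g u Hom_closed[OF \<eta>] by (simp only: K.l_distr q.hom_closed B.nat_pow_closed K.nat_pow_closed K.a_inv_closed)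
  then show ?thesis unfolding s using u Hom_closed[OF \<eta>] by simp
qed

text \<open>One generator is settled at a time by replacing the map with a suitable iterated
  commutator; the point is that this does not spoil the generators settled before.\<close>

lemma exists_ad_lin:
  assumes "finite G" and "G \<subseteq> carrier B" and "Hom \<eta>" and "\<not> lin \<eta>"
  shows "\<exists>\<eta>'. Hom \<eta>' \<and> \<not> lin \<eta>' \<and> (\<forall>g\<in>G. lin (ad g \<eta>'))"
  using assms
proof (induction G rule: finite_induct)
  case empty
  then show ?case by auto
next
  case (insert g G)
  then obtain \<eta>' where \<eta>': "Hom \<eta>'" "\<not> lin \<eta>'" "\<forall>g\<in>G. lin (ad g \<eta>')" by auto
  have g: "g \<in> carrier B" and G: "G \<subseteq> carrier B" using insert by auto
  have "lin ((ad g ^^ p) \<eta>')" using ad_pow_zero[OF \<eta>'(1) g] by (intro lin_zero)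
  \<comment> \<open>The least \<open>k\<close> for which the k-fold commutator is linear is positive
    because \<open>\<eta>'\<close> is not linear. The map taken is the one just before.\<close>
  then obtain k where k: "lin ((ad g ^^ k) \<eta>')" "\<And>j. j < k \<Longrightarrow> \<not> lin ((ad g ^^ j) \<eta>')"
    using exists_least_iff[of "\<lambda>k. lin ((ad g ^^ k) \<eta>')"] by blast
  with \<eta>'(2) obtain j where j: "k = Suc j" by (cases k) auto
  have "lin (ad g' ((ad g ^^ i) \<eta>'))" if g': "g' \<in> G" for g' i
  proof (induction i)
    case 0
    then show ?case using \<eta>' g' by simp
  next
    case (Suc i)
    have g'B: "g' \<in> carrier B" using g' G by blast
    have H: "Hom ((ad g ^^ i) \<eta>')" by (rule ad_pow_Hom[OF \<eta>'(1) g])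
    show ?case
    proof (rule lin_zero)
      fix u assume u: "u \<in> carrier B"
      have "ad g' (ad g ((ad g ^^ i) \<eta>')) u = ad g (ad g' ((ad g ^^ i) \<eta>')) u"
        by (rule ad_comm[OF H g'B g u])
      also have "\<dots> = \<zero>\<^bsub>K\<^esub>" by (rule ad_lin[OF ad_Hom[OF H g'B] Suc g u])
      finally show "ad g' ((ad g ^^ Suc i) \<eta>') u = \<zero>\<^bsub>K\<^esub>" by simp
    qed
  qed
  then show ?case
    using k j ad_pow_Hom[OF \<eta>'(1) g, of j] by (intro exI[of _ "(ad g ^^ j) \<eta>'"]) auto
qed

lemma ad_add:
  assumes "Hom \<eta>" "b \<in> carrier B" "c \<in> carrier B" "u \<in> carrier B"
  shows "ad (b \<oplus> c) \<eta> u = ad b \<eta> u \<oplus>\<^bsub>K\<^esub> ad c \<eta> u"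
  unfolding ad_def using assms Hom_closed[OF assms(1)]
  by (simp add: B.l_distr K.l_distr Hom_add K.minus_eq K.minus_add K.a_ac)

text \<open>The mixed term \<open>q b \<otimes> \<eta> (c \<otimes> u)\<close> is inserted and
  cancelled. Once \<open>ad b \<eta>\<close> is linear, this is the Leibniz rule for the commutator
  as a function of the multiplier.\<close>

lemma ad_mult:
  assumes "Hom \<eta>" "b \<in> carrier B" "c \<in> carrier B" "u \<in> carrier B"
  shows "ad (b \<otimes> c) \<eta> u = ad b \<eta> (c \<otimes> u) \<oplus>\<^bsub>K\<^esub> q b \<otimes>\<^bsub>K\<^esub> ad c \<eta> u"
proof -
  have c: "\<eta> (b \<otimes> (c \<otimes> u)) \<in> carrier K" "\<eta> (c \<otimes> u) \<in> carrier K" "\<eta> u \<in> carrier K"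
    using assms Hom_closed[OF assms(1)] by simp_all
  let ?x = "q b \<otimes>\<^bsub>K\<^esub> \<eta> (c \<otimes> u)"
  have x: "?x \<in> carrier K" using assms c by simp
  have "ad b \<eta> (c \<otimes> u) \<oplus>\<^bsub>K\<^esub> q b \<otimes>\<^bsub>K\<^esub> ad c \<eta> u =
      \<eta> (b \<otimes> (c \<otimes> u)) \<oplus>\<^bsub>K\<^esub> (\<ominus>\<^bsub>K\<^esub> ?x \<oplus>\<^bsub>K\<^esub> ?x) \<oplus>\<^bsub>K\<^esub> \<ominus>\<^bsub>K\<^esub> (q b \<otimes>\<^bsub>K\<^esub> (q c \<otimes>\<^bsub>K\<^esub> \<eta> u))"
    unfolding ad_def using assms c x by (simp add: K.minus_eq K.r_distr K.r_minus K.a_assoc)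
  then show ?thesis
    using assms c x by (simp add: ad_def K.l_neg K.minus_eq B.m_assoc K.m_assoc)
qed

lemma ad_C: "Hom \<eta> \<Longrightarrow> c \<in> C \<Longrightarrow> u \<in> carrier B \<Longrightarrow> ad c \<eta> u = \<zero>\<^bsub>K\<^esub>"
  unfolding ad_def using Hom_closed C_sub by (simp add: Hom_C K.minus_eq K.r_neg)

lemma C_minus_one: "\<ominus> \<one> \<in> C" using subringE(3,5)[OF C] by blast

text \<open>A subring containing \<open>C\<close> need not be tested for additive inverses, as \<open>C\<close> contains \<open>-1\<close>.\<close>

lemma gen_induct:
  assumes gen: "\<And>H. subring H B \<Longrightarrow> C \<union> G \<subseteq> H \<Longrightarrow> H = carrier B"
    and "\<And>c. c \<in> C \<Longrightarrow> Q c" "\<And>g. g \<in> G \<Longrightarrow> Q g" and G: "G \<subseteq> carrier B"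
    and add: "\<And>b c. b \<in> carrier B \<Longrightarrow> c \<in> carrier B \<Longrightarrow> Q b \<Longrightarrow> Q c \<Longrightarrow> Q (b \<oplus> c)"
    and mult: "\<And>b c. b \<in> carrier B \<Longrightarrow> c \<in> carrier B \<Longrightarrow> Q b \<Longrightarrow> Q c \<Longrightarrow> Q (b \<otimes> c)"
    and b: "b \<in> carrier B"
  shows "Q b"
proof -
  let ?H = "{b \<in> carrier B. Q b}"
  have "\<one> \<in> C" using subringE(3)[OF C] .
  have "subring ?H B"
  proof (rule B.subringI)
    fix h assume h: "h \<in> ?H"
    have "\<ominus> \<one> \<otimes> h = \<ominus> h" using h by (simp add: B.l_minus)
    then show "\<ominus> h \<in> ?H" using h mult[of "\<ominus> \<one>" h] assms(2)[OF C_minus_one] by simp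
  qed (use assms(2)[OF \<open>\<one> \<in> C\<close>] add mult in auto)
  moreover have "C \<union> G \<subseteq> ?H" using assms(2,3) C_sub G by auto
  ultimately show ?thesis using gen[of ?H] b by blast
qed

lemma all_lin:
  assumes G: "finite G" "G \<subseteq> carrier B"
    and gen: "\<And>H. subring H B \<Longrightarrow> C \<union> G \<subseteq> H \<Longrightarrow> H = carrier B"
    and der: "\<And>\<delta>. (\<And>b. b \<in> carrier B \<Longrightarrow> \<delta> b \<in> carrier K) \<Longrightarrow>
      (\<And>b c. b \<in> carrier B \<Longrightarrow> c \<in> carrier B \<Longrightarrow> \<delta> (b \<oplus> c) = \<delta> b \<oplus>\<^bsub>K\<^esub> \<delta> c) \<Longrightarrow>
      (\<And>b c. b \<in> carrier B \<Longrightarrow> c \<in> carrier B \<Longrightarrow> \<delta> (b \<otimes> c) = q b \<otimes>\<^bsub>K\<^esub> \<delta> c \<oplus>\<^bsub>K\<^esub> q c \<otimes>\<^bsub>K\<^esub> \<delta> b) \<Longrightarrow>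
      (\<And>c. c \<in> C \<Longrightarrow> \<delta> c = \<zero>\<^bsub>K\<^esub>) \<Longrightarrow> \<forall>g\<in>G. \<delta> g = \<zero>\<^bsub>K\<^esub>"
    and \<eta>: "Hom \<eta>"
  shows "lin \<eta>"
proof (rule ccontr)
  assume "\<not> lin \<eta>"
  then obtain \<eta>' where \<eta>': "Hom \<eta>'" "\<not> lin \<eta>'" "\<forall>g\<in>G. lin (ad g \<eta>')"
    using exists_ad_lin[OF G \<eta>] by blast
  have lin: "lin (ad b \<eta>')" if "b \<in> carrier B" for b
    using gen _ _ G(2) _ _ that
  proof (rule gen_induct)
    fix c assume "c \<in> C"
    then show "lin (ad c \<eta>')" using ad_C[OF \<eta>'(1)] by (intro lin_zero)
  next
    fix b c assume b: "b \<in> carrier B" and c: "c \<in> carrier B" and l: "lin (ad b \<eta>')" "lin (ad c \<eta>')"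
    note H = Hom_closed[OF ad_Hom[OF \<eta>'(1) b]] Hom_closed[OF ad_Hom[OF \<eta>'(1) c]]
    show "lin (ad (b \<oplus> c) \<eta>')"
      unfolding lin_def
    proof (intro ballI)
      fix x u assume x: "x \<in> carrier B" and u: "u \<in> carrier B"
      show "ad (b \<oplus> c) \<eta>' (x \<otimes> u) = q x \<otimes>\<^bsub>K\<^esub> ad (b \<oplus> c) \<eta>' u"
        using b c x u H by (simp add: ad_add[OF \<eta>'(1) b c] lin_eq[OF l(1)] lin_eq[OF l(2)] K.r_distr)
    qed
    show "lin (ad (b \<otimes> c) \<eta>')"
      unfolding lin_def
    proof (intro ballI)
      fix x u assume x: "x \<in> carrier B" and u: "u \<in> carrier B"
      have "ad b \<eta>' (c \<otimes> (x \<otimes> u)) = q x \<otimes>\<^bsub>K\<^esub> ad b \<eta>' (c \<otimes> u)"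
        using lin_eq[OF l(1) x, of "c \<otimes> u"] b c x u by (simp add: B.m_lcomm)
      then show "ad (b \<otimes> c) \<eta>' (x \<otimes> u) = q x \<otimes>\<^bsub>K\<^esub> ad (b \<otimes> c) \<eta>' u"
        using b c x u H by (simp add: ad_mult[OF \<eta>'(1) b c] lin_eq[OF l(2)] K.r_distr K.m_lcomm)
    qed
  qed (use \<eta>'(3) in auto)
  \<comment> \<open>A linear map is determined by its value at 1, so nothing of
    \<open>ad b \<eta>'\<close> is lost; \<open>\<delta>\<close> is a derivation over
    \<open>C\<close> by \<open>ad_add\<close>, \<open>ad_mult\<close> and
    \<open>ad_C\<close>.\<close>
  define \<delta> where "\<delta> b = ad b \<eta>' \<one>" for b
  have \<delta>: "\<delta> b \<in> carrier K" if "b \<in> carrier B" for b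
    unfolding \<delta>_def using Hom_closed[OF ad_Hom[OF \<eta>'(1) that]] by simp
  have add: "\<delta> (b \<oplus> c) = \<delta> b \<oplus>\<^bsub>K\<^esub> \<delta> c" if "b \<in> carrier B" "c \<in> carrier B" for b c
    unfolding \<delta>_def using ad_add[OF \<eta>'(1) that] by simp
  have mult: "\<delta> (b \<otimes> c) = q b \<otimes>\<^bsub>K\<^esub> \<delta> c \<oplus>\<^bsub>K\<^esub> q c \<otimes>\<^bsub>K\<^esub> \<delta> b" if b: "b \<in> carrier B" and c: "c \<in> carrier B" for b c
  proof -
    have "ad b \<eta>' (c \<otimes> \<one>) = q c \<otimes>\<^bsub>K\<^esub> \<delta> b"
      unfolding \<delta>_def by (rule lin_eq[OF lin[OF b] c B.one_closed])
    then show ?thesis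
      using ad_mult[OF \<eta>'(1) b c B.one_closed] \<delta>[OF b] \<delta>[OF c] b c by (simp add: \<delta>_def K.a_comm)
  qed
  have C0: "\<delta> c = \<zero>\<^bsub>K\<^esub>" if "c \<in> C" for c unfolding \<delta>_def using ad_C[OF \<eta>'(1) that] by simp
  have "\<forall>g\<in>G. \<delta> g = \<zero>\<^bsub>K\<^esub>" by (rule der[OF \<delta> add mult C0])
  then have z: "\<delta> b = \<zero>\<^bsub>K\<^esub>" if "b \<in> carrier B" for b
    using gen C0 _ G(2) _ _ that
    by (rule_tac gen_induct[of G "\<lambda>b. \<delta> b = \<zero>\<^bsub>K\<^esub>"]) (simp_all add: add mult)
  \<comment> \<open>Each \<open>ad b \<eta>'\<close> is linear and vanishes at 1, hence vanishes;
    then \<open>\<eta>'\<close> commutes with all multiplications.\<close>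
  have "lin \<eta>'"
    unfolding lin_def
  proof (intro ballI)
    fix b u assume b: "b \<in> carrier B" and u: "u \<in> carrier B"
    have "ad b \<eta>' (u \<otimes> \<one>) = \<zero>\<^bsub>K\<^esub>" using lin_eq[OF lin[OF b] u B.one_closed] z[OF b] u by (simp add: \<delta>_def)
    then show "\<eta>' (b \<otimes> u) = q b \<otimes>\<^bsub>K\<^esub> \<eta>' u"
      using b u Hom_closed[OF \<eta>'(1)] by (simp add: ad_def)
  qed
  with \<eta>'(2) show False by blast
qed

section \<open>Finitely generated modules over the subring\<close>

inductive_set span :: "'a set \<Rightarrow> 'a set" for F where
  span_zero: "\<zero> \<in> span F"
| span_add: "c \<in> C \<Longrightarrow> m \<in> F \<Longrightarrow> v \<in> span F \<Longrightarrow> c \<otimes> m \<oplus> v \<in> span F"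

lemma span_closed:
  assumes "F \<subseteq> carrier B" and "v \<in> span F"
  shows "v \<in> carrier B"
  using assms(2) by induction (use assms(1) C_sub in auto)

lemma span_mono:
  assumes "F \<subseteq> F'" and "v \<in> span F"
  shows "v \<in> span F'"
  using assms(2) by induction (use assms(1) in \<open>auto intro: span.intros\<close>)

lemma span_plus:
  assumes F: "F \<subseteq> carrier B" and "v \<in> span F" and w: "w \<in> span F"
  shows "v \<oplus> w \<in> span F"
  using assms(2)
proof (induction rule: span.induct)
  case span_zero
  then show ?case using w span_closed[OF F w] by simp
next
  case (span_add c m v)
  have "c \<otimes> m \<oplus> v \<oplus> w = c \<otimes> m \<oplus> (v \<oplus> w)"
    using span_add C_sub F span_closed[OF F] w by (intro B.a_assoc) auto
  then show ?case using span.span_add[OF span_add.hyps(1,2) span_add.IH] by simp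
qed

lemma span_single:
  assumes F: "F \<subseteq> carrier B" and "c \<in> C" "m \<in> F"
  shows "c \<otimes> m \<in> span F"
  using span_add[OF assms(2,3) span_zero] C_sub assms by auto

lemma span_mult:
  assumes F: "F \<subseteq> carrier B" and F': "F' \<subseteq> carrier B" and x: "x \<in> carrier B"
    and m: "\<And>m c. m \<in> F \<Longrightarrow> c \<in> C \<Longrightarrow> c \<otimes> (x \<otimes> m) \<in> span F'" and "v \<in> span F"
  shows "x \<otimes> v \<in> span F'"
  using assms(5)
proof (induction rule: span.induct)
  case span_zero
  then show ?case using x span.span_zero by simp
next
  case (span_add c n v)
  have n: "n \<in> carrier B" using span_add F by blast
  have "x \<otimes> (c \<otimes> n \<oplus> v) = c \<otimes> (x \<otimes> n) \<oplus> x \<otimes> v"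
    using x n C_sub[OF span_add.hyps(1)] span_closed[OF F span_add.hyps(3)]
    by (simp add: B.r_distr B.m_lcomm)
  then show ?case using span_plus[OF F' m[OF span_add.hyps(2,1)] span_add.IH] by simp
qed

lemma span_C:
  assumes F: "F \<subseteq> carrier B" and c: "c \<in> C" and v: "v \<in> span F"
  shows "c \<otimes> v \<in> span F"
proof (rule span_mult[OF F F C_sub[OF c] _ v])
  fix m d assume m: "m \<in> F" and d: "d \<in> C"
  have "d \<otimes> (c \<otimes> m) = (d \<otimes> c) \<otimes> m" using m F C_sub c d by (auto simp: B.m_assoc)
  then show "d \<otimes> (c \<otimes> m) \<in> span F" using span_single[OF F _ m] subringE(6)[OF C d c] by simp
qed

text \<open>Each generator \<open>g\<close> is integral over \<open>C\<close>, its p-th power being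
  in \<open>C\<close>. So products of powers below \<open>p\<close> span a subring, and a finitely
  generated algebra is a finitely generated module.\<close>

lemma finite_span:
  assumes "finite G" and "G \<subseteq> carrier B"
  shows "\<exists>F. finite F \<and> F \<subseteq> carrier B \<and> \<one> \<in> F \<and> (\<forall>m\<in>F. \<forall>n\<in>F. m \<otimes> n \<in> span F) \<and> G \<subseteq> span F"
  using assms
proof (induction G rule: finite_induct)
  case empty
  have "\<one> \<otimes> \<one> \<in> span {\<one>}" using span_single[of "{\<one>}" \<one> \<one>] subringE(3)[OF C] by simp
  then show ?case by (intro exI[of _ "{\<one>}"]) auto
next
  case (insert g G)
  then obtain F where F: "finite F" "F \<subseteq> carrier B" "\<one> \<in> F" "\<forall>m\<in>F. \<forall>n\<in>F. m \<otimes> n \<in> span F" "G \<subseteq> span F"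
    by auto
  have g: "g \<in> carrier B" using insert by simp
  define F' where "F' = (\<lambda>(m, k). m \<otimes> g [^] k) ` (F \<times> {..<p})"
  have F': "finite F'" "F' \<subseteq> carrier B" unfolding F'_def using F g by auto
  \<comment> \<open>Exponents from \<open>p\<close> on are reduced by moving \<open>g [^] p\<close>,
    an element of \<open>C\<close>, into \<open>v\<close>. This is why \<open>v\<close> varies in
    the induction.\<close>
  have pow: "v \<otimes> g [^] k \<in> span F'" if "v \<in> span F" for v and k :: nat
    using that
  proof (induction k arbitrary: v rule: less_induct)
    case (less k)
    have vB: "v \<in> carrier B" using span_closed[OF F(2) less.prems] .
    show ?case
    proof (cases "k < p")
      case True
      have "g [^] k \<otimes> v \<in> span F'"
      proof (rule span_mult[OF F(2) F'(2) _ _ less.prems])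
        fix m c assume m: "m \<in> F" and c: "c \<in> C"
        have "m \<otimes> g [^] k \<in> F'" unfolding F'_def using m True by force
        moreover have "g [^] k \<otimes> m = m \<otimes> g [^] k" using m F(2) g by (intro B.m_comm) auto
        ultimately show "c \<otimes> (g [^] k \<otimes> m) \<in> span F'" using span_single[OF F'(2) c] by simp
      qed (use g in simp)
      then show ?thesis using g vB by (simp add: B.m_comm)
    next
      case False
      have "g [^] p \<otimes> v \<in> span F" by (rule span_C[OF F(2) frob[OF g] less.prems])
      then have "g [^] p \<otimes> v \<otimes> g [^] (k - p) \<in> span F'"
        using less.IH[of "k - p"] False prime_gt_0_nat[OF p] by simp
      moreover have "g [^] p \<otimes> v \<otimes> g [^] (k - p) = v \<otimes> g [^] k"
        using g vB False B.nat_pow_mult[OF g, of p "k - p"] by (simp add: B.m_ac)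
      ultimately show ?thesis by simp
    qed
  qed
  have one: "F \<subseteq> F'"
  proof
    fix m assume m: "m \<in> F"
    then have "m = m \<otimes> g [^] (0::nat)" using F(2) by auto
    then show "m \<in> F'" unfolding F'_def using m prime_gt_0_nat[OF p] by force
  qed
  have "m \<otimes> n \<in> span F'" if mn: "m \<in> F'" "n \<in> F'" for m n
  proof -
    obtain m' k n' l where *: "m = m' \<otimes> g [^] (k::nat)" "m' \<in> F" "n = n' \<otimes> g [^] (l::nat)" "n' \<in> F"
      using mn unfolding F'_def by auto
    then have "m' \<in> carrier B" "n' \<in> carrier B" using F(2) by auto
    then have "m \<otimes> n = (m' \<otimes> n') \<otimes> g [^] (k + l)"
      unfolding * using g by (simp add: B.nat_pow_mult[symmetric] B.m_ac)
    then show ?thesis using pow[of "m' \<otimes> n'" "k + l"] F(4) * by simp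
  qed
  moreover have "insert g G \<subseteq> span F'"
  proof -
    have "\<one> \<otimes> \<one> \<in> span F" using F(3,4) by blast
    from pow[OF this, of 1] have "g \<in> span F'" using g by simp
    then show ?thesis using F(5) span_mono[OF one] by blast
  qed
  ultimately show ?case using F' one F(3) by (intro exI[of _ F']) auto
qed

lemma span_mult_closed:
  assumes F: "F \<subseteq> carrier B" and FF: "\<forall>m\<in>F. \<forall>n\<in>F. m \<otimes> n \<in> span F" and v: "v \<in> span F" and w: "w \<in> span F"
  shows "v \<otimes> w \<in> span F"
proof (rule span_mult[OF F F span_closed[OF F v] _ w])
  fix n c assume n: "n \<in> F" and c: "c \<in> C"
  have nB: "n \<in> carrier B" using n F by blast
  have "n \<otimes> v \<in> span F"
  proof (rule span_mult[OF F F nB _ v])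
    fix m c assume m: "m \<in> F" and c: "c \<in> C"
    show "c \<otimes> (n \<otimes> m) \<in> span F" using span_C[OF F c] FF m n by blast
  qed
  then show "c \<otimes> (v \<otimes> n) \<in> span F"
    using span_C[OF F c] nB span_closed[OF F v] by (simp add: B.m_comm)
qed

lemma span_remove:
  assumes T: "T \<subseteq> carrier B" and t: "t \<in> T" and "v \<in> span T"
  shows "\<exists>c\<in>C. \<exists>w\<in>span (T - {t}). v = c \<otimes> t \<oplus> w"
  using assms(3)
proof (induction rule: span.induct)
  case span_zero
  then show ?case
    using subringE(2)[OF C] t T span.span_zero by (intro bexI[of _ \<zero>]) auto
next
  case (span_add c m v)
  then obtain d w where d: "d \<in> C" "w \<in> span (T - {t})" "v = d \<otimes> t \<oplus> w" by blast
  have T': "T - {t} \<subseteq> carrier B" and tB: "t \<in> carrier B" and mB: "m \<in> carrier B" using T t span_add by auto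
  have wB: "w \<in> carrier B" using span_closed[OF T' d(2)] .
  note cB = C_sub[OF span_add.hyps(1)] C_sub[OF d(1)]
  show ?case
  proof (cases "m = t")
    case True
    have "c \<otimes> m \<oplus> v = (c \<oplus> d) \<otimes> t \<oplus> w"
      unfolding True d(3) using cB tB wB by (simp add: B.l_distr B.a_assoc)
    then show ?thesis using subringE(7)[OF C span_add.hyps(1) d(1)] d(2) by blast
  next
    case False
    have "c \<otimes> m \<oplus> v = d \<otimes> t \<oplus> (c \<otimes> m \<oplus> w)"
      unfolding d(3) using cB tB wB mB by (simp add: B.a_ac)
    moreover have "c \<otimes> m \<oplus> w \<in> span (T - {t})"
      using span.span_add[OF span_add.hyps(1) _ d(2)] span_add.hyps(2) False by blast
    ultimately show ?thesis using d(1) by blast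
  qed
qed

text \<open>The usual argument would invert elements of \<open>C\<close> outside the kernel of
  \<open>q\<close> and apply linear algebra over the resulting local ring. Instead a denominator
  \<open>f\<close> with \<open>q f \<noteq> 0\<close> is carried along, and a spanning set of least
  size plays the part of a minimal system of generators.\<close>

theorem generically_equal:
  assumes G: "finite G" "G \<subseteq> carrier B"
    and gen: "\<And>H. subring H B \<Longrightarrow> C \<union> G \<subseteq> H \<Longrightarrow> H = carrier B"
    and der: "\<And>\<delta>. (\<And>b. b \<in> carrier B \<Longrightarrow> \<delta> b \<in> carrier K) \<Longrightarrow>
      (\<And>b c. b \<in> carrier B \<Longrightarrow> c \<in> carrier B \<Longrightarrow> \<delta> (b \<oplus> c) = \<delta> b \<oplus>\<^bsub>K\<^esub> \<delta> c) \<Longrightarrow>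
      (\<And>b c. b \<in> carrier B \<Longrightarrow> c \<in> carrier B \<Longrightarrow> \<delta> (b \<otimes> c) = q b \<otimes>\<^bsub>K\<^esub> \<delta> c \<oplus>\<^bsub>K\<^esub> q c \<otimes>\<^bsub>K\<^esub> \<delta> b) \<Longrightarrow>
      (\<And>c. c \<in> C \<Longrightarrow> \<delta> c = \<zero>\<^bsub>K\<^esub>) \<Longrightarrow> \<forall>g\<in>G. \<delta> g = \<zero>\<^bsub>K\<^esub>"
  shows "\<exists>f\<in>C. q f \<noteq> \<zero>\<^bsub>K\<^esub> \<and> (\<forall>b\<in>carrier B. f \<otimes> b \<in> C)"
proof -
  \<comment> \<open>\<open>T\<close> spans \<open>B\<close> up to a denominator that survives in
    \<open>K\<close>. Keeping 1 in \<open>T\<close> lets the least case be \<open>{\<one>}\<close>,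
    whose span is \<open>C\<close> itself.\<close>
  define good where "good T \<longleftrightarrow> finite T \<and> T \<subseteq> carrier B \<and> \<one> \<in> T \<and>
    (\<exists>f\<in>C. q f \<noteq> \<zero>\<^bsub>K\<^esub> \<and> (\<forall>b\<in>carrier B. f \<otimes> b \<in> span T))" for T
  obtain F where F: "finite F" "F \<subseteq> carrier B" "\<one> \<in> F" "\<forall>m\<in>F. \<forall>n\<in>F. m \<otimes> n \<in> span F" "G \<subseteq> span F"
    using finite_span[OF G] by blast
  have "b \<in> span F" if b: "b \<in> carrier B" for b
  proof (rule gen_induct[where Q = "\<lambda>b. b \<in> span F", OF gen _ _ G(2) _ _ b])
    fix c assume c: "c \<in> C"
    then show "c \<in> span F" using span_single[OF F(2) c F(3)] C_sub by simp
  qed (use F(5) span_plus[OF F(2)] span_mult_closed[OF F(2,4)] in auto)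
  then have "good F" unfolding good_def using F subringE(3)[OF C] by (intro conjI bexI[of _ \<one>]) auto
  then obtain T where T: "good T" and min: "\<And>T'. good T' \<Longrightarrow> card T \<le> card T'"
    using exists_least_iff[of "\<lambda>n. \<exists>T. good T \<and> card T = n"] by (metis not_le)
  obtain f where T': "finite T" "T \<subseteq> carrier B" "\<one> \<in> T" and f: "f \<in> C" "q f \<noteq> \<zero>\<^bsub>K\<^esub>"
    "\<And>b. b \<in> carrier B \<Longrightarrow> f \<otimes> b \<in> span T"
    using T unfolding good_def by blast
  have fB: "f \<in> carrier B" using f(1) C_sub by blast
  have "T = {\<one>}"
  proof (rule ccontr)
    assume "T \<noteq> {\<one>}"
    then obtain t where t: "t \<in> T" "t \<noteq> \<one>" using T'(3) by blast
    let ?T = "T - {t}"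
    have tB: "t \<in> carrier B" and TB: "?T \<subseteq> carrier B" and oneT: "\<one> \<in> ?T" using t T' by auto
    have notgood: "\<not> good ?T"
      using min[of ?T] T'(1) t(1) by (metis card_Diff1_less not_le)
    \<comment> \<open>If the coefficient \<open>c\<close> survived in \<open>K\<close>, then
      \<open>c \<otimes> f\<close> would be a denominator for \<open>T\<close> without
      \<open>t\<close>, against minimality. Hence the class in \<open>K\<close> of a coefficient of
      \<open>t\<close> is unique.\<close>
    have zero: "q c = \<zero>\<^bsub>K\<^esub>" if c: "c \<in> C" and ct: "c \<otimes> t \<in> span ?T" for c
    proof (rule ccontr)
      assume qc: "q c \<noteq> \<zero>\<^bsub>K\<^esub>"
      have cB: "c \<in> carrier B" using c C_sub by blast
      have "c \<otimes> f \<otimes> b \<in> span ?T" if b: "b \<in> carrier B" for b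
      proof -
        obtain d w where d: "d \<in> C" "w \<in> span ?T" "f \<otimes> b = d \<otimes> t \<oplus> w"
          using span_remove[OF T'(2) t(1) f(3)[OF b]] by blast
        have "c \<otimes> f \<otimes> b = c \<otimes> (f \<otimes> b)" using cB fB b by (simp add: B.m_assoc)
        also have "\<dots> = d \<otimes> (c \<otimes> t) \<oplus> c \<otimes> w"
          unfolding d(3) using cB tB C_sub[OF d(1)] span_closed[OF TB d(2)] by (simp add: B.r_distr B.m_lcomm)
        finally show ?thesis
          using span_plus[OF TB span_C[OF TB d(1) ct] span_C[OF TB c d(2)]] by simp
      qed
      moreover have "q (c \<otimes> f) \<noteq> \<zero>\<^bsub>K\<^esub>" using qc f(2) cB fB K.integral by (metis q.hom_closed q.hom_mult)
      ultimately have "good ?T"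
        unfolding good_def using T'(1) TB oneT subringE(6)[OF C c f(1)] by blast
      with notgood show False by blast
    qed
    \<comment> \<open>The coefficient of \<open>t\<close> in \<open>f \<otimes> b\<close> is an
      arbitrary choice in \<open>C\<close>; only its image under \<open>q\<close> is well defined,
      and that image is linear over \<open>C\<close> in \<open>b\<close>.\<close>
    define coeff where "coeff b = (SOME c. c \<in> C \<and> (\<exists>w\<in>span ?T. f \<otimes> b = c \<otimes> t \<oplus> w))" for b
    have coeff: "coeff b \<in> C \<and> (\<exists>w\<in>span ?T. f \<otimes> b = coeff b \<otimes> t \<oplus> w)" if "b \<in> carrier B" for b
    proof -
      have "\<exists>c. c \<in> C \<and> (\<exists>w\<in>span ?T. f \<otimes> b = c \<otimes> t \<oplus> w)"
        using span_remove[OF T'(2) t(1) f(3)[OF that]] unfolding Bex_def .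
      then show ?thesis unfolding coeff_def by (rule someI_ex)
    qed
    have uniq: "q (coeff b) = q c"
      if b: "b \<in> carrier B" and c: "c \<in> C" and w: "w \<in> span ?T" "f \<otimes> b = c \<otimes> t \<oplus> w" for b c w
    proof -
      let ?d = "coeff b"
      obtain w' where w': "w' \<in> span ?T" "f \<otimes> b = ?d \<otimes> t \<oplus> w'" and d: "?d \<in> C" using coeff[OF b] by blast
      have cB: "c \<in> carrier B" "?d \<in> carrier B" using c d C_sub by auto
      have wB: "w \<in> carrier B" "w' \<in> carrier B" using span_closed[OF TB] w w' by auto
      have m: "\<ominus> \<one> \<otimes> w' = \<ominus> w'" using wB by (simp add: B.l_minus)
      have "\<ominus> w' \<in> span ?T" using span_C[OF TB C_minus_one w'(1)] unfolding m .
      have "?d \<otimes> t \<oplus> w' = c \<otimes> t \<oplus> w" using w(2) w'(2) by simp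
      then have "?d \<otimes> t = c \<otimes> t \<oplus> w \<oplus> \<ominus> w'"
        using cB wB tB by (metis B.add.inv_solve_right B.a_closed B.m_closed)
      then have "(?d \<oplus> \<ominus> c) \<otimes> t = w \<oplus> \<ominus> w'"
        using cB wB tB by (simp add: B.l_distr B.l_minus B.a_ac B.r_neg2 B.r_neg1 B.r_neg)
      then have "(?d \<oplus> \<ominus> c) \<otimes> t \<in> span ?T" using span_plus[OF TB w(1) \<open>\<ominus> w' \<in> span ?T\<close>] by simp
      then have "q (?d \<oplus> \<ominus> c) = \<zero>\<^bsub>K\<^esub>"
        using zero subringE(5,7)[OF C] c d by simp
      then have "q ?d \<oplus>\<^bsub>K\<^esub> \<ominus>\<^bsub>K\<^esub> q c = \<zero>\<^bsub>K\<^esub>" using cB by simp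
      then show ?thesis using cB by (metis K.minus_eq K.r_right_minus_eq q.hom_closed)
    qed
    define \<phi> where "\<phi> b = q (coeff b)" for b
    have "Hom \<phi>"
      unfolding Hom_def
    proof (intro conjI ballI)
      fix b assume b: "b \<in> carrier B"
      show "\<phi> b \<in> carrier K" unfolding \<phi>_def using coeff[OF b] C_sub by blast
      obtain w where w: "w \<in> span ?T" "f \<otimes> b = coeff b \<otimes> t \<oplus> w" and d: "coeff b \<in> C" using coeff[OF b] by blast
      have wB: "w \<in> carrier B" "coeff b \<in> carrier B" using span_closed[OF TB] w d C_sub by auto
      {
        fix b' assume b': "b' \<in> carrier B"
        obtain w' where w': "w' \<in> span ?T" "f \<otimes> b' = coeff b' \<otimes> t \<oplus> w'" and d': "coeff b' \<in> C"
          using coeff[OF b'] by blast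
        have wB': "w' \<in> carrier B" "coeff b' \<in> carrier B" using span_closed[OF TB] w' d' C_sub by auto
        have "f \<otimes> (b \<oplus> b') = (coeff b \<oplus> coeff b') \<otimes> t \<oplus> (w \<oplus> w')"
          using b b' fB w(2) w'(2) wB wB' tB by (simp add: B.r_distr B.l_distr B.a_ac)
        from uniq[OF _ _ _ this] show "\<phi> (b \<oplus> b') = \<phi> b \<oplus>\<^bsub>K\<^esub> \<phi> b'"
          unfolding \<phi>_def using b b' d d' subringE(7)[OF C d d'] span_plus[OF TB w(1) w'(1)] wB wB' by simp
      }
      fix c assume c: "c \<in> C"
      have cB: "c \<in> carrier B" using c C_sub by blast
      have "f \<otimes> (c \<otimes> b) = (c \<otimes> coeff b) \<otimes> t \<oplus> c \<otimes> w"
        using b fB w(2) wB tB cB by (simp add: B.m_lcomm[of f c b] B.r_distr B.m_assoc)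
      from uniq[OF _ _ _ this] show "\<phi> (c \<otimes> b) = q c \<otimes>\<^bsub>K\<^esub> \<phi> b"
        unfolding \<phi>_def using b c cB wB subringE(6)[OF C c d] span_C[OF TB c w(1)] by simp
    qed
    then have "lin \<phi>" using all_lin[OF G gen der] by blast
    \<comment> \<open>Linearity over \<open>B\<close> is contradicted by two values:
      \<open>f\<close> is a coefficient of \<open>t\<close> in \<open>f \<otimes> t\<close>, while
      \<open>f \<otimes> \<one>\<close> needs no \<open>t\<close> at all. So \<open>q f\<close>
      would be a multiple of zero.\<close>
    have "\<phi> t = q t \<otimes>\<^bsub>K\<^esub> \<phi> \<one>" using lin_eq[OF \<open>lin \<phi>\<close> tB B.one_closed] tB by simp
    moreover have "\<phi> \<one> = \<zero>\<^bsub>K\<^esub>"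
      unfolding \<phi>_def using uniq[OF B.one_closed subringE(2)[OF C], of "f \<otimes> \<one>"] span_single[OF TB f(1) oneT] tB fB
      by simp
    moreover have "\<phi> t = q f"
      unfolding \<phi>_def using uniq[OF tB f(1) span_zero] tB fB by simp
    ultimately show False using f(2) tB by simp
  qed
  moreover have "v \<in> C" if "v \<in> span {\<one>}" for v
    using that
  proof (induction rule: span.induct)
    case span_zero
    then show ?case using subringE(2)[OF C] .
  next
    case (span_add c m v)
    then show ?case using subringE(7)[OF C] C_sub by simp
  qed
  ultimately show ?thesis using f by blast
qed

end

section \<open>Bases of p-monomials\<close>

lemma (in abelian_group) coprime_pow_zero:
  assumes x: "x \<in> carrier G" and "[(k::nat)] \<cdot> x = \<zero>" "[(p::nat)] \<cdot> x = \<zero>" and "coprime k p" "k \<noteq> 0"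
  shows "x = \<zero>"
proof -
  obtain u v where "k * u = p * v + gcd k p" using bezout_nat[OF \<open>k \<noteq> 0\<close>] by blast
  then have uv: "k * u = p * v + 1" using \<open>coprime k p\<close> by simp
  have "[(k * u)] \<cdot> x = [u] \<cdot> ([k] \<cdot> x)" "[(p * v)] \<cdot> x = [v] \<cdot> ([p] \<cdot> x)"
    using x by (simp_all add: add.nat_pow_pow)
  moreover have "[(p * v + 1)] \<cdot> x = [(p * v)] \<cdot> x \<oplus> x"
    using x add.nat_pow_mult[OF x, of "p * v" 1] by simp
  ultimately show ?thesis using assms uv x by simp
qed

locale p_basis = A?: cring A + B?: cring B + h?: ring_hom_cring A B h
  for A :: "('r, 'z) ring_scheme" and B :: "('b, 'w) ring_scheme" (structure) and h +
  fixes n p :: nat and x :: "nat \<Rightarrow> 'b" and D :: "nat \<Rightarrow> 'b \<Rightarrow> 'b"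
  assumes inj: "inj_on h (carrier A)" and p: "Factorial_Ring.prime p"
    and char: "[p] \<cdot>\<^bsub>A\<^esub> \<one>\<^bsub>A\<^esub> = \<zero>\<^bsub>A\<^esub>"
    and x_closed: "i < n \<Longrightarrow> x i \<in> carrier B"
    and x_pow: "i < n \<Longrightarrow> x i [^] p \<in> h ` carrier A"
    and gen: "\<And>H. subring H B \<Longrightarrow> h ` carrier A \<union> x ` {..<n} \<subseteq> H \<Longrightarrow> H = carrier B"
    and D_closed: "i < n \<Longrightarrow> b \<in> carrier B \<Longrightarrow> D i b \<in> carrier B"
    and D_add: "i < n \<Longrightarrow> b \<in> carrier B \<Longrightarrow> c \<in> carrier B \<Longrightarrow> D i (b \<oplus> c) = D i b \<oplus> D i c"
    and D_mult: "i < n \<Longrightarrow> b \<in> carrier B \<Longrightarrow> c \<in> carrier B \<Longrightarrow> D i (b \<otimes> c) = b \<otimes> D i c \<oplus> c \<otimes> D i b"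
    and D_const: "i < n \<Longrightarrow> a \<in> carrier A \<Longrightarrow> D i (h a) = \<zero>"
    and D_x: "i < n \<Longrightarrow> j < n \<Longrightarrow> D i (x j) = (if i = j then \<one> else \<zero>)"
begin

text \<open>Extensional functions, so that an exponent is determined by its values below
  \<open>n\<close> and a sum over \<open>expo\<close> meets each monomial once.\<close>

definition expo :: "(nat \<Rightarrow> nat) set" where "expo = {..<n} \<rightarrow>\<^sub>E {..<p}"

definition mono :: "(nat \<Rightarrow> nat) \<Rightarrow> 'b" where "mono a = (\<Otimes>i\<in>{..<n}. x i [^] a i)"

definition rest :: "nat \<Rightarrow> (nat \<Rightarrow> nat) \<Rightarrow> 'b" where "rest i a = (\<Otimes>j\<in>{..<n} - {i}. x j [^] a j)"

definition expand :: "((nat \<Rightarrow> nat) \<Rightarrow> 'r) \<Rightarrow> 'b" where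
  "expand c = (\<Oplus>a\<in>expo. h (c a) \<otimes> mono a)"

definition zero_expo :: "nat \<Rightarrow> nat" where "zero_expo = restrict (\<lambda>_. 0) {..<n}"

lemma finite_expo: "finite expo" unfolding expo_def by (intro finite_PiE) auto

lemma p_pos: "0 < p" using prime_gt_0_nat[OF p] .

lemma zero_expo: "zero_expo \<in> expo" unfolding zero_expo_def expo_def using p_pos by auto

lemma zero_expo_unique:
  assumes "a \<in> expo" "\<And>i. i < n \<Longrightarrow> a i = 0"
  shows "a = zero_expo"
  using assms zero_expo unfolding expo_def by (intro PiE_ext[of a "{..<n}" "\<lambda>_. {..<p}"]) (auto simp: zero_expo_def)

lemma expo_upd: "a \<in> expo \<Longrightarrow> i < n \<Longrightarrow> k < p \<Longrightarrow> a(i := k) \<in> expo"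
  unfolding expo_def by (auto simp: PiE_def extensional_def)

lemma expo_lt: "a \<in> expo \<Longrightarrow> i < n \<Longrightarrow> a i < p" unfolding expo_def by auto

lemma mono_closed: "mono a \<in> carrier B"
  unfolding mono_def using x_closed by (intro B.finprod_closed) auto

lemma rest_closed: "rest i a \<in> carrier B"
  unfolding rest_def using x_closed by (intro B.finprod_closed) auto

lemma rest_upd: "rest i (a(i := k)) = rest i a"
  unfolding rest_def using x_closed by (intro B.finprod_cong') auto

lemma mono_split: "i < n \<Longrightarrow> mono a = x i [^] a i \<otimes> rest i a"
proof -
  assume i: "i < n"
  have "mono a = (\<Otimes>j\<in>insert i ({..<n} - {i}). x j [^] a j)"
    unfolding mono_def using i by (simp add: insert_absorb)
  also have "\<dots> = x i [^] a i \<otimes> rest i a"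
    unfolding rest_def using x_closed i by (intro B.finprod_insert) auto
  finally show ?thesis .
qed

lemma mono_zero: "mono zero_expo = \<one>"
proof -
  have "mono zero_expo = (\<Otimes>i\<in>{..<n}. \<one>)"
    unfolding mono_def zero_expo_def using x_closed by (intro B.finprod_cong') auto
  then show ?thesis by simp
qed

lemma D_zero: "i < n \<Longrightarrow> D i \<zero> = \<zero>"
  using D_const[of i "\<zero>\<^bsub>A\<^esub>"] by simp

text \<open>For \<open>k = 0\<close> the truncated exponent \<open>k - 1\<close> does no harm, as
  its factor is 0.\<close>

lemma D_pow: "i < n \<Longrightarrow> D i (x i [^] (k::nat)) = [k] \<cdot> (x i [^] (k - 1))"
proof (induction k)
  case 0
  then show ?case using D_const[of i "\<one>\<^bsub>A\<^esub>"] by simp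
next
  case (Suc k)
  have xi: "x i \<in> carrier B" using x_closed Suc.prems by blast
  have "D i (x i [^] Suc k) = x i [^] k \<oplus> x i \<otimes> ([k] \<cdot> (x i [^] (k - 1)))"
    using Suc xi D_mult[of i "x i [^] k" "x i"] D_x[of i i] by simp
  also have "x i \<otimes> ([k] \<cdot> (x i [^] (k - 1))) = [k] \<cdot> (x i [^] k)"
  proof (cases k)
    case (Suc l)
    then show ?thesis using xi by (simp add: B.add_pow_rdistr B.r_distr B.m_comm)
  qed (use xi in simp)
  finally show ?case using xi by (simp add: B.add.nat_pow_Suc B.a_comm)
qed

lemma D_finprod_zero:
  assumes i: "i < n" and "finite S" and "S \<subseteq> {..<n} - {i}"
  shows "D i (\<Otimes>j\<in>S. x j [^] (a j :: nat)) = \<zero>"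
  using assms(2,3)
proof (induction S rule: finite_induct)
  case empty
  then show ?case using D_const[OF i, of "\<one>\<^bsub>A\<^esub>"] by simp
next
  case (insert j S)
  have j: "j < n" "j \<noteq> i" "x j \<in> carrier B" using insert x_closed by auto
  have S: "(\<lambda>j. x j [^] a j) \<in> S \<rightarrow> carrier B" using insert x_closed by auto
  have "D i (x j [^] (k::nat)) = \<zero>" for k
  proof (induction k)
    case 0
    then show ?case using D_const[OF i, of "\<one>\<^bsub>A\<^esub>"] by simp
  next
    case (Suc k)
    then show ?case using D_mult[OF i, of "x j [^] k" "x j"] D_x[OF i j(1)] j by simp
  qed
  then show ?case
    using insert S j D_mult[OF i, of "x j [^] a j" "\<Otimes>j\<in>S. x j [^] a j"] by simp
qed

lemma D_mono:
  assumes i: "i < n"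
  shows "D i (mono a) = [(a i)] \<cdot> mono (a(i := a i - 1))"
proof -
  have xi: "x i \<in> carrier B" using x_closed i by blast
  have "D i (rest i a) = \<zero>" unfolding rest_def using D_finprod_zero[OF i] by simp
  then have "D i (mono a) = rest i a \<otimes> ([(a i)] \<cdot> (x i [^] (a i - 1)))"
    unfolding mono_split[OF i] using D_mult[OF i, of "x i [^] a i" "rest i a"] D_pow[OF i] xi rest_closed
    by simp
  also have "\<dots> = [(a i)] \<cdot> mono (a(i := a i - 1))"
    unfolding mono_split[OF i] using xi rest_closed by (simp add: rest_upd B.add_pow_rdistr B.m_comm)
  finally show ?thesis .
qed

lemma D_finsum:
  assumes i: "i < n" and "finite S" and "f \<in> S \<rightarrow> carrier B"
  shows "D i (\<Oplus>s\<in>S. f s) = (\<Oplus>s\<in>S. D i (f s))"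
  using assms(2,3)
proof (induction S rule: finite_induct)
  case empty
  then show ?case using D_zero[OF i] by simp
next
  case (insert s S)
  then show ?case using D_add[OF i] D_closed[OF i] by (simp add: Pi_def)
qed

lemma term_closed: "c \<in> S \<rightarrow> carrier A \<Longrightarrow> (\<lambda>a. h (c a) \<otimes> mono (f a)) \<in> S \<rightarrow> carrier B"
  using mono_closed by auto

lemma expand_closed: "c \<in> expo \<rightarrow> carrier A \<Longrightarrow> expand c \<in> carrier B"
  unfolding expand_def by (intro B.finsum_closed term_closed)

lemma expand_add:
  assumes "c \<in> expo \<rightarrow> carrier A" "d \<in> expo \<rightarrow> carrier A"
  shows "expand (\<lambda>a. c a \<oplus>\<^bsub>A\<^esub> d a) = expand c \<oplus> expand d"
proof -
  have "expand (\<lambda>a. c a \<oplus>\<^bsub>A\<^esub> d a) = (\<Oplus>a\<in>expo. h (c a) \<otimes> mono a \<oplus> h (d a) \<otimes> mono a)"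
    unfolding expand_def using assms mono_closed
    by (intro B.finsum_cong') (auto simp: B.l_distr Pi_def)
  also have "\<dots> = expand c \<oplus> expand d"
    unfolding expand_def using term_closed[OF assms(1), of "\<lambda>a. a"] term_closed[OF assms(2), of "\<lambda>a. a"]
    by (rule B.finsum_addf)
  finally show ?thesis .
qed

lemma expand_smult:
  assumes "c \<in> expo \<rightarrow> carrier A" and r: "r \<in> carrier A"
  shows "expand (\<lambda>a. r \<otimes>\<^bsub>A\<^esub> c a) = h r \<otimes> expand c"
proof -
  have "expand (\<lambda>a. r \<otimes>\<^bsub>A\<^esub> c a) = (\<Oplus>a\<in>expo. h r \<otimes> (h (c a) \<otimes> mono a))"
    unfolding expand_def using assms mono_closed by (intro B.finsum_cong') (auto simp: B.m_assoc Pi_def)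
  also have "\<dots> = h r \<otimes> expand c"
    unfolding expand_def using term_closed[OF assms(1), of "\<lambda>a. a"] r finite_expo
    by (intro B.finsum_rdistr[symmetric]) auto
  finally show ?thesis .
qed

lemma expand_single:
  assumes "a \<in> expo" "r \<in> carrier A"
  shows "expand (\<lambda>a'. if a = a' then r else \<zero>\<^bsub>A\<^esub>) = h r \<otimes> mono a"
proof -
  have "expand (\<lambda>a'. if a = a' then r else \<zero>\<^bsub>A\<^esub>) = (\<Oplus>a'\<in>expo. if a = a' then h r \<otimes> mono a' else \<zero>)"
    unfolding expand_def using assms mono_closed by (intro B.finsum_cong') auto
  then show ?thesis
    using B.finsum_singleton[OF assms(1) finite_expo, of "\<lambda>a'. h r \<otimes> mono a'"] assms mono_closed by simp
qed

section \<open>Existence of expansions in p-monomials\<close>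

definition rep :: "'b \<Rightarrow> bool" where "rep b \<longleftrightarrow> (\<exists>c\<in>expo \<rightarrow> carrier A. b = expand c)"

lemma rep_closed: "rep b \<Longrightarrow> b \<in> carrier B"
  unfolding rep_def using expand_closed by blast

lemma rep_add: "rep b \<Longrightarrow> rep c \<Longrightarrow> rep (b \<oplus> c)"
proof -
  assume "rep b" "rep c"
  then obtain u v where "u \<in> expo \<rightarrow> carrier A" "v \<in> expo \<rightarrow> carrier A" "b = expand u" "c = expand v"
    unfolding rep_def by blast
  then show ?thesis unfolding rep_def using expand_add by (intro bexI[of _ "\<lambda>a. u a \<oplus>\<^bsub>A\<^esub> v a"]) auto
qed

lemma rep_smult: "r \<in> carrier A \<Longrightarrow> rep b \<Longrightarrow> rep (h r \<otimes> b)"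
proof -
  assume r: "r \<in> carrier A" and "rep b"
  then obtain u where "u \<in> expo \<rightarrow> carrier A" "b = expand u" unfolding rep_def by blast
  then show ?thesis unfolding rep_def using expand_smult r by (intro bexI[of _ "\<lambda>a. r \<otimes>\<^bsub>A\<^esub> u a"]) auto
qed

lemma rep_mono: "a \<in> expo \<Longrightarrow> rep (mono a)"
  unfolding rep_def using expand_single[of a "\<one>\<^bsub>A\<^esub>"] mono_closed
  by (intro bexI[of _ "\<lambda>a'. if a = a' then \<one>\<^bsub>A\<^esub> else \<zero>\<^bsub>A\<^esub>"]) auto

lemma rep_zero: "rep \<zero>"
  using rep_smult[OF A.zero_closed rep_mono[OF zero_expo]] mono_closed by simp

lemma rep_finsum: "finite S \<Longrightarrow> (\<And>s. s \<in> S \<Longrightarrow> rep (f s)) \<Longrightarrow> rep (\<Oplus>s\<in>S. f s)"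
proof (induction S rule: finite_induct)
  case empty
  then show ?case using rep_zero by simp
next
  case (insert s S)
  then have "f \<in> S \<rightarrow> carrier B" "f s \<in> carrier B" using rep_closed by auto
  then show ?case using insert rep_add by simp
qed

text \<open>If the exponent of \<open>x i\<close> reaches \<open>p\<close>, the power
  \<open>x i [^] p\<close> comes from \<open>A\<close> and turns into a coefficient, the exponent
  dropping to 0.\<close>

lemma rep_x_mono:
  assumes i: "i < n" and a: "a \<in> expo"
  shows "rep (x i \<otimes> mono a)"
proof -
  have xi: "x i \<in> carrier B" using x_closed i by blast
  have *: "x i \<otimes> mono a = x i [^] Suc (a i) \<otimes> rest i a"
    unfolding mono_split[OF i] using xi rest_closed by (simp add: B.m_ac)
  show ?thesis
  proof (cases "Suc (a i) < p")
    case True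
    have "x i \<otimes> mono a = mono (a(i := Suc (a i)))"
      unfolding * mono_split[OF i, of "a(i := Suc (a i))"] rest_upd by simp
    then show ?thesis using rep_mono[OF expo_upd[OF a i True]] by simp
  next
    case False
    then have s: "Suc (a i) = p" using expo_lt[OF a i] by simp
    obtain r where r: "r \<in> carrier A" "x i [^] p = h r" using x_pow[OF i] by auto
    have "x i \<otimes> mono a = h r \<otimes> mono (a(i := 0))"
      unfolding * s r(2) mono_split[OF i, of "a(i := 0)"] rest_upd using rest_closed by simp
    then show ?thesis using rep_smult[OF r(1) rep_mono[OF expo_upd[OF a i p_pos]]] by simp
  qed
qed

lemma all_rep:
  assumes b: "b \<in> carrier B"
  shows "rep b"
proof -
  \<comment> \<open>Elements that multiply expansions into expansions form a subring; this avoids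
    multiplying two expansions with each other. The conclusion follows on applying such an element
    to 1.\<close>
  let ?H = "{b \<in> carrier B. \<forall>v. rep v \<longrightarrow> rep (b \<otimes> v)}"
  have const: "h r \<in> ?H" if "r \<in> carrier A" for r using that rep_smult by auto
  have mult: "b \<otimes> c \<in> ?H" if "b \<in> ?H" "c \<in> ?H" for b c
    using that rep_closed by (auto simp: B.m_assoc)
  have "subring ?H B"
  proof (rule B.subringI)
    show "\<one> \<in> ?H" using const[of "\<one>\<^bsub>A\<^esub>"] by simp
    show "b \<oplus> c \<in> ?H" if "b \<in> ?H" "c \<in> ?H" for b c
      using that rep_add rep_closed by (auto simp: B.l_distr)
    show "\<ominus> b \<in> ?H" if b: "b \<in> ?H" for b
      using mult[OF const[of "\<ominus>\<^bsub>A\<^esub> \<one>\<^bsub>A\<^esub>"] b] b by (simp add: B.l_minus)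
  qed (use mult in auto)
  moreover have "x i \<in> ?H" if i: "i < n" for i
  proof -
    have xi: "x i \<in> carrier B" using x_closed i by blast
    have "rep (x i \<otimes> v)" if v: "rep v" for v
    proof -
      obtain c where c: "c \<in> expo \<rightarrow> carrier A" "v = expand c" using v unfolding rep_def by blast
      have "x i \<otimes> v = (\<Oplus>a\<in>expo. x i \<otimes> (h (c a) \<otimes> mono a))"
        unfolding c(2) expand_def using term_closed[OF c(1), of "\<lambda>a. a"] xi finite_expo
        by (intro B.finsum_rdistr) auto
      moreover have "rep (x i \<otimes> (h (c a) \<otimes> mono a))" if a: "a \<in> expo" for a
      proof -
        have ca: "c a \<in> carrier A" using c(1) a by auto
        have "x i \<otimes> (h (c a) \<otimes> mono a) = h (c a) \<otimes> (x i \<otimes> mono a)"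
          using xi ca mono_closed by (simp add: B.m_lcomm)
        then show ?thesis using rep_smult[OF ca rep_x_mono[OF i a]] by simp
      qed
      ultimately show ?thesis using rep_finsum[OF finite_expo] by simp
    qed
    then show ?thesis using xi by blast
  qed
  ultimately have "?H = carrier B" using const by (intro gen) auto
  then have "b \<in> ?H" using b by blast
  moreover have "rep \<one>" using rep_mono[OF zero_expo] unfolding mono_zero .
  ultimately have "rep (b \<otimes> \<one>)" by blast
  then show ?thesis using b by simp
qed

text \<open>The coefficients of the derivative \<open>D i\<close> of an expansion. The value at
  exponents with \<open>a i = p - 1\<close> is zero, because no monomial of
  \<open>i\<close>-exponent \<open>p\<close> occurs that could contribute.\<close>

definition shift :: "nat \<Rightarrow> ((nat \<Rightarrow> nat) \<Rightarrow> 'r) \<Rightarrow> (nat \<Rightarrow> nat) \<Rightarrow> 'r" where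
  "shift i c a = (if Suc (a i) < p then [(Suc (a i))] \<cdot>\<^bsub>A\<^esub> c (a(i := Suc (a i))) else \<zero>\<^bsub>A\<^esub>)"

lemma shift_closed: "i < n \<Longrightarrow> c \<in> expo \<rightarrow> carrier A \<Longrightarrow> shift i c \<in> expo \<rightarrow> carrier A"
  unfolding shift_def by (auto intro!: A.add.nat_pow_closed expo_upd simp: Pi_def)

lemma h_add_pow: "r \<in> carrier A \<Longrightarrow> h ([k] \<cdot>\<^bsub>A\<^esub> r) = [(k::nat)] \<cdot> h r"
  by (induction k) (simp_all add: A.add.nat_pow_Suc B.add.nat_pow_Suc)

lemma D_expand:
  assumes i: "i < n" and c: "c \<in> expo \<rightarrow> carrier A"
  shows "D i (expand c) = expand (shift i c)"
proof -
  let ?t = "\<lambda>a. [(a i)] \<cdot> (h (c a) \<otimes> mono (a(i := a i - 1)))"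
  let ?P = "{a \<in> expo. 0 < a i}" and ?Q = "{a \<in> expo. Suc (a i) < p}"
  let ?up = "\<lambda>a. a(i := Suc (a i))"
  have t: "?t \<in> S \<rightarrow> carrier B" if "S \<subseteq> expo" for S
    using that c mono_closed by (auto intro!: B.add.nat_pow_closed simp: Pi_def subset_iff)
  have "D i (expand c) = (\<Oplus>a\<in>expo. D i (h (c a) \<otimes> mono a))"
    unfolding expand_def by (rule D_finsum[OF i finite_expo term_closed[OF c]])
  also have "\<dots> = (\<Oplus>a\<in>expo. ?t a)"
  proof (rule B.finsum_cong'[OF refl t[OF order_refl]])
    fix a assume a: "a \<in> expo"
    then have ca: "c a \<in> carrier A" using c by auto
    then show "D i (h (c a) \<otimes> mono a) = ?t a"
      using D_mult[OF i, of "h (c a)" "mono a"] mono_closed D_const[OF i ca] D_mono[OF i, of a]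
      by (simp add: B.add_pow_rdistr)
  qed
  also have "\<dots> = (\<Oplus>a\<in>?P. ?t a)"
    using t[OF order_refl] finite_expo by (intro B.add.finprod_mono_neutral_cong_right) (auto simp: c)
  \<comment> \<open>Terms with \<open>a i = 0\<close> have been killed by the factor
    \<open>a i\<close>; the others are reindexed by their lowered exponent.\<close>
  also have "?P = ?up ` ?Q"
  proof (intro equalityI subsetI)
    fix a assume a: "a \<in> ?P"
    then have "a = ?up (a(i := a i - 1))" by auto
    moreover have "a(i := a i - 1) \<in> ?Q" using a i expo_lt[of a i] by (auto intro!: expo_upd)
    ultimately show "a \<in> ?up ` ?Q" by (rule image_eqI)
  qed (use i in \<open>auto intro!: expo_upd\<close>)
  also have "(\<Oplus>a\<in>?up ` ?Q. ?t a) = (\<Oplus>a\<in>?Q. ?t (?up a))"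
  proof (rule B.add.finprod_reindex)
    show "?t \<in> ?up ` ?Q \<rightarrow> carrier B" using i by (intro t) (auto intro!: expo_upd)
    show "inj_on ?up ?Q"
    proof (rule inj_onI)
      fix a b assume "?up a = ?up b"
      then have e: "?up a j = ?up b j" for j by simp
      show "a = b"
      proof
        fix j show "a j = b j" using e[of j] by (cases "j = i") auto
      qed
    qed
  qed
  also have "\<dots> = (\<Oplus>a\<in>?Q. h (shift i c a) \<otimes> mono a)"
  proof (rule B.finsum_cong')
    show "(\<lambda>a. h (shift i c a) \<otimes> mono a) \<in> ?Q \<rightarrow> carrier B"
      using shift_closed[OF i c] mono_closed by auto
    fix a assume a: "a \<in> ?Q"
    then have "c (?up a) \<in> carrier A" using c i expo_upd[of a i "Suc (a i)"] by auto
    then show "?t (?up a) = h (shift i c a) \<otimes> mono a"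
      unfolding shift_def using a mono_closed by (simp add: h_add_pow B.add_pow_ldistr del: B.add.nat_pow_Suc A.add.nat_pow_Suc)
  qed simp
  also have "\<dots> = expand (shift i c)"
  proof -
    have "(\<lambda>a. h (shift i c a) \<otimes> mono a) \<in> expo \<rightarrow> carrier B"
      using shift_closed[OF i c] mono_closed by auto
    moreover have "h (shift i c a) \<otimes> mono a = \<zero>" if "a \<in> expo - ?Q" for a
      using that mono_closed by (simp add: shift_def)
    ultimately show ?thesis
      unfolding expand_def using finite_expo by (intro B.add.finprod_mono_neutral_cong_left) auto
  qed
  finally show ?thesis .
qed

section \<open>Uniqueness of expansions and the coefficient functions\<close>

lemma char_A: "r \<in> carrier A \<Longrightarrow> [p] \<cdot>\<^bsub>A\<^esub> r = \<zero>\<^bsub>A\<^esub>"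
  using A.add_pow_ldistr[of "\<one>\<^bsub>A\<^esub>" r p] char by simp

text \<open>Induction on a bound \<open>d\<close> for the degrees that occur. Each
  \<open>D i\<close> lowers the bound by one, so the derivatives have zero coefficients. This leaves
  \<open>a i\<close> times the coefficient at \<open>a\<close> equal to zero, and
  \<open>0 < a i < p\<close> is prime to the characteristic.\<close>

lemma expand_zero_degree:
  assumes "c \<in> expo \<rightarrow> carrier A" and "expand c = \<zero>"
    and "\<And>a. a \<in> expo \<Longrightarrow> d \<le> (\<Sum>i<n. a i) \<Longrightarrow> c a = \<zero>\<^bsub>A\<^esub>" and "a \<in> expo"
  shows "c a = \<zero>\<^bsub>A\<^esub>"
  using assms
proof (induction d arbitrary: c a)
  case 0
  then show ?case by simp
next
  case (Suc d)
  note c = Suc.prems(1)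
  have pos: "c a = \<zero>\<^bsub>A\<^esub>" if a: "a \<in> expo" and i: "i < n" and ai: "a i \<noteq> 0" for a i
  proof -
    have "expand (shift i c) = \<zero>" using D_expand[OF i c] D_zero[OF i] Suc.prems(2) by simp
    moreover have "shift i c b = \<zero>\<^bsub>A\<^esub>" if b: "b \<in> expo" and d: "d \<le> (\<Sum>j<n. b j)" for b
    proof -
      have "(\<Sum>j<n. (b(i := Suc (b i))) j) = Suc (\<Sum>j<n. b j)"
      proof -
        have "(\<Sum>j<n. (b(i := Suc (b i))) j) = Suc (b i) + (\<Sum>j\<in>{..<n} - {i}. (b(i := Suc (b i))) j)"
          using i by (subst sum.remove[of _ i]) auto
        also have "(\<Sum>j\<in>{..<n} - {i}. (b(i := Suc (b i))) j) = (\<Sum>j\<in>{..<n} - {i}. b j)"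
          by (intro sum.cong) auto
        finally show ?thesis using i by (simp add: sum.remove[of "{..<n}" i b])
      qed
      then have "c (b(i := Suc (b i))) = \<zero>\<^bsub>A\<^esub>" if "Suc (b i) < p"
        using Suc.prems(3)[OF expo_upd[OF b i that]] d by (simp only: Suc_le_mono)
      then show ?thesis unfolding shift_def by simp
    qed
    moreover have "a(i := a i - 1) \<in> expo" using a i expo_lt[OF a i] by (intro expo_upd) auto
    ultimately have "shift i c (a(i := a i - 1)) = \<zero>\<^bsub>A\<^esub>"
      by (rule Suc.IH[OF shift_closed[OF i c]])
    then have "[(a i)] \<cdot>\<^bsub>A\<^esub> c a = \<zero>\<^bsub>A\<^esub>"
      unfolding shift_def using ai expo_lt[OF a i] by (simp add: fun_upd_idem del: A.add.nat_pow_Suc)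
    moreover have "coprime (a i) p"
      using p ai expo_lt[OF a i] by (metis coprime_commute gr0I nat_dvd_not_less prime_imp_coprime)
    ultimately show ?thesis
      using c a ai char_A by (intro A.coprime_pow_zero[of "c a" "a i" p]) auto
  qed
  show ?case
  proof (cases "a = zero_expo")
    case False
    then show ?thesis using zero_expo_unique[OF Suc.prems(4)] pos[OF Suc.prems(4)] by blast
  next
    case True
    have c0: "c zero_expo \<in> carrier A" using c zero_expo by auto
    \<comment> \<open>Derivatives say nothing about the constant term. It is the only term left, and
      it vanishes because \<open>h\<close> is injective.\<close>
    have "expand c = expand (\<lambda>a'. if zero_expo = a' then c zero_expo else \<zero>\<^bsub>A\<^esub>)"
      unfolding expand_def
    proof (rule B.finsum_cong'[OF refl term_closed])
      fix a assume a: "a \<in> expo"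
      have "c a = \<zero>\<^bsub>A\<^esub>" if "zero_expo \<noteq> a"
        using zero_expo_unique[OF a] pos[OF a] that by blast
      then show "h (c a) \<otimes> mono a = h (if zero_expo = a then c zero_expo else \<zero>\<^bsub>A\<^esub>) \<otimes> mono a"
        by (cases "zero_expo = a") simp_all
    qed (use c0 in auto)
    then have "h (c zero_expo) = \<zero>"
      using expand_single[OF zero_expo c0] c0 Suc.prems(2) by (simp add: mono_zero)
    then show ?thesis using inj c0 True by (metis A.zero_closed h.hom_zero inj_onD)
  qed
qed

lemma expand_inj:
  assumes c: "c \<in> expo \<rightarrow> carrier A" and d: "d \<in> expo \<rightarrow> carrier A" and eq: "expand c = expand d" and a: "a \<in> expo"
  shows "c a = d a"
proof -
  let ?m = "\<lambda>a. \<ominus>\<^bsub>A\<^esub> \<one>\<^bsub>A\<^esub> \<otimes>\<^bsub>A\<^esub> d a"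
  let ?e = "\<lambda>a. c a \<oplus>\<^bsub>A\<^esub> ?m a"
  have m: "?m \<in> expo \<rightarrow> carrier A" using d by auto
  have "expand ?m = \<ominus> expand d"
    using expand_smult[OF d, of "\<ominus>\<^bsub>A\<^esub> \<one>\<^bsub>A\<^esub>"] expand_closed[OF d] by (simp add: B.l_minus)
  then have "expand ?e = \<zero>" using expand_add[OF c m] eq expand_closed[OF d] by (simp add: B.r_neg)
  moreover have "?e \<in> expo \<rightarrow> carrier A" using c m by auto
  \<comment> \<open>All exponents are below \<open>p\<close>, so from degree
    \<open>n * p + 1\<close> on the vanishing assumed in \<open>expand_zero_degree\<close> is
    vacuous.\<close>
  moreover have "(\<Sum>i<n. b i) < n * p + 1" if "b \<in> expo" for b
  proof -
    have "(\<Sum>i<n. b i) \<le> (\<Sum>i<n. p)" using expo_lt[OF that] by (intro sum_mono) (auto intro: less_imp_le)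
    then show ?thesis by simp
  qed
  then have "?e b = \<zero>\<^bsub>A\<^esub>" if "b \<in> expo" "n * p + 1 \<le> (\<Sum>i<n. b i)" for b using that by (meson not_le)
  ultimately have "?e a = \<zero>\<^bsub>A\<^esub>" using expand_zero_degree[of ?e "n * p + 1" a] a by blast
  moreover have "c a \<in> carrier A" "d a \<in> carrier A" using c d a by auto
  ultimately show ?thesis by (simp add: A.l_minus flip: A.minus_eq)
qed

text \<open>On \<open>expo\<close> the choice is unique by \<open>expand_inj\<close>; values at
  other arguments are arbitrary and every later statement stays within \<open>expo\<close>.\<close>

definition coeffs :: "'b \<Rightarrow> (nat \<Rightarrow> nat) \<Rightarrow> 'r" where
  "coeffs b = (SOME c. c \<in> expo \<rightarrow> carrier A \<and> b = expand c)"

lemma coeffs: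
  assumes "b \<in> carrier B"
  shows "coeffs b \<in> expo \<rightarrow> carrier A \<and> b = expand (coeffs b)"
proof -
  have "\<exists>c. c \<in> expo \<rightarrow> carrier A \<and> b = expand c"
    using all_rep[OF assms] unfolding rep_def Bex_def .
  then show ?thesis unfolding coeffs_def by (rule someI_ex)
qed

lemma coeffs_closed: "b \<in> carrier B \<Longrightarrow> a \<in> expo \<Longrightarrow> coeffs b a \<in> carrier A"
  using coeffs by blast

lemma coeffs_expand: "c \<in> expo \<rightarrow> carrier A \<Longrightarrow> a \<in> expo \<Longrightarrow> coeffs (expand c) a = c a"
  using coeffs[OF expand_closed, of c] by (intro expand_inj[of _ c]) simp_all

lemma coeffs_add:
  assumes "b \<in> carrier B" "c \<in> carrier B" "a \<in> expo"
  shows "coeffs (b \<oplus> c) a = coeffs b a \<oplus>\<^bsub>A\<^esub> coeffs c a"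
proof -
  have "b \<oplus> c = expand (\<lambda>a. coeffs b a \<oplus>\<^bsub>A\<^esub> coeffs c a)"
    using expand_add coeffs[OF assms(1)] coeffs[OF assms(2)] by simp
  then show ?thesis
    using coeffs_expand[of "\<lambda>a. coeffs b a \<oplus>\<^bsub>A\<^esub> coeffs c a" a] assms coeffs_closed by auto
qed

lemma coeffs_smult:
  assumes "b \<in> carrier B" "r \<in> carrier A" "a \<in> expo"
  shows "coeffs (h r \<otimes> b) a = r \<otimes>\<^bsub>A\<^esub> coeffs b a"
proof -
  have "h r \<otimes> b = expand (\<lambda>a. r \<otimes>\<^bsub>A\<^esub> coeffs b a)"
    using expand_smult coeffs[OF assms(1)] assms(2) by simp
  then show ?thesis
    using coeffs_expand[of "\<lambda>a. r \<otimes>\<^bsub>A\<^esub> coeffs b a" a] assms coeffs_closed by auto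
qed

lemma coeffs_zero: "a \<in> expo \<Longrightarrow> coeffs \<zero> a = \<zero>\<^bsub>A\<^esub>"
  using coeffs_smult[of \<zero> "\<zero>\<^bsub>A\<^esub>" a] coeffs_closed[of \<zero> a] by simp

lemma coeffs_one: "coeffs \<one> zero_expo = \<one>\<^bsub>A\<^esub>"
proof -
  have "\<one> = expand (\<lambda>a'. if zero_expo = a' then \<one>\<^bsub>A\<^esub> else \<zero>\<^bsub>A\<^esub>)"
    using expand_single[OF zero_expo, of "\<one>\<^bsub>A\<^esub>"] by (simp add: mono_zero)
  then show ?thesis
    using coeffs_expand[OF _ zero_expo, of "\<lambda>a'. if zero_expo = a' then \<one>\<^bsub>A\<^esub> else \<zero>\<^bsub>A\<^esub>"] by auto
qed

lemma coeffs_D: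
  assumes "i < n" "b \<in> carrier B" "a \<in> expo" "Suc (a i) < p"
  shows "coeffs (D i b) a = [(Suc (a i))] \<cdot>\<^bsub>A\<^esub> coeffs b (a(i := Suc (a i)))"
proof -
  have "D i b = expand (shift i (coeffs b))" using D_expand assms(1) coeffs[OF assms(2)] by metis
  then have "coeffs (D i b) a = shift i (coeffs b) a"
    using coeffs_expand[OF shift_closed[OF assms(1)] assms(3)] coeffs[OF assms(2)] by simp
  then show ?thesis unfolding shift_def using assms(4) by simp
qed

end

section \<open>The kernel of a connection on a scalar extension\<close>

text \<open>\<open>M\<close> is \<open>B\<close> as a module over itself. Only the relevant fields
  are prescribed, so that the sections of \<open>structure_module\<close> can be
  substituted.\<close>

locale p_basis_tensor = p_basis A B h n p x D + N?: Module.module A N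
  for A :: "('r, 'z) ring_scheme" and B :: "('b, 'w) ring_scheme" (structure) and h n p x D
    and N :: "('r, 'm, 'v) module_scheme" +
  fixes M :: "('b, 'b) module"
  assumes M: "carrier M = carrier B" "add M = add B" "zero M = zero B" "smult M = monoid.mult B"
begin

abbreviation "TG \<equiv> tens_gens M N"
abbreviation "TE \<equiv> tens_rels A h M N"
abbreviation "cl \<equiv> tens_class A h M N"
abbreviation "TQ \<equiv> tensor A h M N"

lemma TG_iff: "(b, m) \<in> TG \<longleftrightarrow> b \<in> carrier B \<and> m \<in> carrier N"
  unfolding tens_gens_def M by auto

lemma M_module: "Module.module B M"
proof (rule moduleI)
  show "cring B" by (rule B.is_cring)
  show "abelian_group M"
  proof (rule abelian_groupI)
    fix b assume "b \<in> carrier M"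
    then show "\<exists>c\<in>carrier M. c \<oplus>\<^bsub>M\<^esub> b = \<zero>\<^bsub>M\<^esub>"
      unfolding M by (intro bexI[of _ "\<ominus> b"]) (simp_all add: B.l_neg)
  qed (simp_all add: M B.a_ac)
qed (simp_all add: M B.l_distr B.r_distr B.m_assoc)

lemma TP: "fs_presentation B TG TE (\<lambda>b (m, n). (b \<odot>\<^bsub>M\<^esub> m, n))"
  by (rule tens_presentation[OF M_module N.module_axioms h.homh])

lemma TQ_module: "Module.module B TQ"
  unfolding tensor_def by (rule fs_presentation.module_Q[OF TP])

lemma TE_wf: "wf_rels TG TE"
  using TP unfolding fs_presentation_def fs_presentation_axioms_def by blast

lemma cl_closed: "set L \<subseteq> TG \<Longrightarrow> cl L \<in> carrier TQ"
  unfolding tensor_def tens_class_def by (rule fs_presentation.class_carrier[OF TP])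

lemma cl_append: "set L \<subseteq> TG \<Longrightarrow> set L' \<subseteq> TG \<Longrightarrow> cl (L @ L') = cl L \<oplus>\<^bsub>TQ\<^esub> cl L'"
  unfolding tensor_def tens_class_def by (simp add: fs_module_add)

lemma cl_Nil: "cl [] = \<zero>\<^bsub>TQ\<^esub>"
  unfolding tensor_def tens_class_def fs_module_simps ..

lemma cl_Cons: "g \<in> TG \<Longrightarrow> set L \<subseteq> TG \<Longrightarrow> cl (g # L) = cl [g] \<oplus>\<^bsub>TQ\<^esub> cl L"
  using cl_append[of "[g]" L] by simp

lemma cl_add_l:
  assumes "b \<in> carrier B" "c \<in> carrier B" "m \<in> carrier N"
  shows "cl [(b \<oplus> c, m)] = cl [(b, m)] \<oplus>\<^bsub>TQ\<^esub> cl [(c, m)]"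
proof -
  have "cl [(b \<oplus>\<^bsub>M\<^esub> c, m)] = cl [(b, m), (c, m)]"
    unfolding tens_class_def using assms by (intro fs_class_eqI tens_add_l) (simp_all add: M)
  then show ?thesis using assms cl_append[of "[(b, m)]" "[(c, m)]"] by (simp add: M TG_iff)
qed

lemma cl_add_r:
  assumes "b \<in> carrier B" "m \<in> carrier N" "m' \<in> carrier N"
  shows "cl [(b, m \<oplus>\<^bsub>N\<^esub> m')] = cl [(b, m)] \<oplus>\<^bsub>TQ\<^esub> cl [(b, m')]"
proof -
  have "cl [(b, m \<oplus>\<^bsub>N\<^esub> m')] = cl [(b, m), (b, m')]"
    unfolding tens_class_def using assms by (intro fs_class_eqI tens_add_r) (simp_all add: M)
  then show ?thesis using assms cl_append[of "[(b, m)]" "[(b, m')]"] by (simp add: TG_iff)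
qed

lemma cl_zero_l:
  assumes "m \<in> carrier N"
  shows "cl [(\<zero>, m)] = \<zero>\<^bsub>TQ\<^esub>"
  unfolding cl_Nil[symmetric]
  using fs_class_eqI[OF tens_zero[of m N TG A h M]] assms by (simp add: tens_class_def M)

lemma cl_zero_r:
  assumes "b \<in> carrier B"
  shows "cl [(b, \<zero>\<^bsub>N\<^esub>)] = \<zero>\<^bsub>TQ\<^esub>"
proof -
  interpret TQ: Module.module B TQ by (rule TQ_module)
  have "cl [(b, \<zero>\<^bsub>N\<^esub>)] \<in> carrier TQ" using assms by (intro cl_closed) (simp add: TG_iff)
  moreover have "cl [(b, \<zero>\<^bsub>N\<^esub>)] \<oplus>\<^bsub>TQ\<^esub> cl [(b, \<zero>\<^bsub>N\<^esub>)] = cl [(b, \<zero>\<^bsub>N\<^esub>)]"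
    using cl_add_r[OF assms, of "\<zero>\<^bsub>N\<^esub>" "\<zero>\<^bsub>N\<^esub>"] by simp
  ultimately show ?thesis by (rule TQ.zero_unique)
qed

lemma cl_bal:
  assumes "r \<in> carrier A" "b \<in> carrier B" "m \<in> carrier N"
  shows "cl [(h r \<otimes> b, m)] = cl [(b, r \<odot>\<^bsub>N\<^esub> m)]"
  using fs_class_eqI[OF tens_bal[of r A b M m N TG h]] assms by (simp add: tens_class_def M)

text \<open>The projection of \<open>B \<otimes> N\<close> to the summand \<open>N\<close> belonging
  to the monomial \<open>a\<close>, computed on a representing list.\<close>

definition coord :: "(nat \<Rightarrow> nat) \<Rightarrow> ('b \<times> 'm) list \<Rightarrow> 'm" where
  "coord a L = fs_eval N (\<lambda>(b, m). coeffs b a \<odot>\<^bsub>N\<^esub> m) L"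

lemma coord_simps:
  "coord a [] = \<zero>\<^bsub>N\<^esub>" "coord a ((b, m) # L) = coeffs b a \<odot>\<^bsub>N\<^esub> m \<oplus>\<^bsub>N\<^esub> coord a L"
  unfolding coord_def by simp_all

lemma coord_closed: "a \<in> expo \<Longrightarrow> set L \<subseteq> TG \<Longrightarrow> coord a L \<in> carrier N"
  unfolding coord_def using coeffs_closed by (intro N.M.fs_eval_closed) (auto simp: TG_iff subset_iff)

text \<open>The balancing relation is respected because \<open>coeffs\<close> is linear over
  \<open>A\<close>; the other relations because it is additive.\<close>

lemma coord_cong:
  assumes a: "a \<in> expo" and L: "fs_cong TG TE L L'"
  shows "coord a L = coord a L'"
  unfolding coord_def
proof (rule N.M.fs_eval_cong[OF L TE_wf])
  fix g assume "g \<in> TG"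
  then show "(case g of (b, m) \<Rightarrow> coeffs b a \<odot>\<^bsub>N\<^esub> m) \<in> carrier N"
    using coeffs_closed a by (cases g) (simp add: TG_iff)
next
  fix xs ys assume "(xs, ys) \<in> TE"
  then show "fs_eval N (\<lambda>(b, m). coeffs b a \<odot>\<^bsub>N\<^esub> m) xs = fs_eval N (\<lambda>(b, m). coeffs b a \<odot>\<^bsub>N\<^esub> m) ys"
  proof (cases rule: tens_relsE)
    case (bal r b m)
    then have b: "b \<in> carrier B" by (simp add: M)
    have "(r \<otimes>\<^bsub>A\<^esub> coeffs b a) \<odot>\<^bsub>N\<^esub> m = (coeffs b a \<otimes>\<^bsub>A\<^esub> r) \<odot>\<^bsub>N\<^esub> m"
      using bal(3) coeffs_closed[OF b a] by (simp add: A.m_comm)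
    then show ?thesis
      using bal b a coeffs_closed[OF b a] by (simp add: M coeffs_smult N.smult_assoc1)
  qed (use a in \<open>simp_all add: M coeffs_zero coeffs_add coeffs_closed N.smult_l_distr N.smult_r_distr\<close>)
qed

lemma cl_finsum:
  assumes "finite S" and "c \<in> S \<rightarrow> carrier A" and m: "m \<in> carrier N"
  shows "cl [(\<Oplus>a\<in>S. h (c a) \<otimes> mono a, m)] = (\<Oplus>\<^bsub>TQ\<^esub>a\<in>S. cl [(mono a, c a \<odot>\<^bsub>N\<^esub> m)])"
  using assms(1,2)
proof (induction S rule: finite_induct)
  interpret TQ: Module.module B TQ by (rule TQ_module)
  case empty
  then show ?case using cl_zero_l[OF m] by simp
next
  interpret TQ: Module.module B TQ by (rule TQ_module)
  case (insert s S)
  have f: "(\<lambda>a. h (c a) \<otimes> mono a) \<in> S \<rightarrow> carrier B" "h (c s) \<otimes> mono s \<in> carrier B" "c s \<in> carrier A"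
    using insert.prems mono_closed by auto
  have g: "(\<lambda>a. cl [(mono a, c a \<odot>\<^bsub>N\<^esub> m)]) \<in> S \<rightarrow> carrier TQ" "cl [(mono s, c s \<odot>\<^bsub>N\<^esub> m)] \<in> carrier TQ"
    using insert.prems m mono_closed by (auto intro!: cl_closed simp: TG_iff Pi_def)
  have "cl [(\<Oplus>a\<in>insert s S. h (c a) \<otimes> mono a, m)]
      = cl [(h (c s) \<otimes> mono s, m)] \<oplus>\<^bsub>TQ\<^esub> cl [(\<Oplus>a\<in>S. h (c a) \<otimes> mono a, m)]"
    using insert.hyps f m by (simp add: cl_add_l)
  also have "cl [(h (c s) \<otimes> mono s, m)] = cl [(mono s, c s \<odot>\<^bsub>N\<^esub> m)]"
    using f m mono_closed by (intro cl_bal)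
  also have "cl [(\<Oplus>a\<in>S. h (c a) \<otimes> mono a, m)] = (\<Oplus>\<^bsub>TQ\<^esub>a\<in>S. cl [(mono a, c a \<odot>\<^bsub>N\<^esub> m)])"
    using insert.IH insert.prems by simp
  finally show ?case using insert.hyps g by simp
qed

text \<open>The left factors are expanded in monomials and the coefficients moved to the right
  factor. This is the decomposition of \<open>B \<otimes> N\<close> that the basis of
  \<open>B\<close> induces.\<close>

lemma cl_coord:
  assumes "set L \<subseteq> TG"
  shows "cl L = (\<Oplus>\<^bsub>TQ\<^esub>a\<in>expo. cl [(mono a, coord a L)])"
  using assms
proof (induction L)
  interpret TQ: Module.module B TQ by (rule TQ_module)
  case Nil
  have "(\<Oplus>\<^bsub>TQ\<^esub>a\<in>expo. cl [(mono a, coord a [])]) = (\<Oplus>\<^bsub>TQ\<^esub>a\<in>expo. \<zero>\<^bsub>TQ\<^esub>)"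
    using mono_closed by (intro TQ.finsum_cong') (auto simp: coord_simps cl_zero_r)
  then show ?case using TQ.finsum_zero cl_Nil by simp
next
  interpret TQ: Module.module B TQ by (rule TQ_module)
  case (Cons g L)
  obtain b m where g: "g = (b, m)" "b \<in> carrier B" "m \<in> carrier N" using Cons.prems TG_iff by (cases g) auto
  have L: "set L \<subseteq> TG" using Cons.prems by simp
  have c1: "coeffs b a \<odot>\<^bsub>N\<^esub> m \<in> carrier N" "coord a L \<in> carrier N" if "a \<in> expo" for a
    using that g coeffs_closed coord_closed L by auto
  have c: "(\<lambda>a. cl [(mono a, coeffs b a \<odot>\<^bsub>N\<^esub> m)]) \<in> expo \<rightarrow> carrier TQ"
    "(\<lambda>a. cl [(mono a, coord a L)]) \<in> expo \<rightarrow> carrier TQ"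
    using c1 mono_closed by (auto intro!: cl_closed simp: TG_iff)
  have "cl (g # L) = cl [(b, m)] \<oplus>\<^bsub>TQ\<^esub> cl L" using g L cl_Cons[of g L] by (simp add: TG_iff)
  also have "cl [(b, m)] = (\<Oplus>\<^bsub>TQ\<^esub>a\<in>expo. cl [(mono a, coeffs b a \<odot>\<^bsub>N\<^esub> m)])"
    using cl_finsum[OF finite_expo _ g(3), of "coeffs b"] coeffs[OF g(2)] unfolding expand_def by simp
  also have "cl L = (\<Oplus>\<^bsub>TQ\<^esub>a\<in>expo. cl [(mono a, coord a L)])" by (rule Cons.IH[OF L])
  also have "(\<Oplus>\<^bsub>TQ\<^esub>a\<in>expo. cl [(mono a, coeffs b a \<odot>\<^bsub>N\<^esub> m)]) \<oplus>\<^bsub>TQ\<^esub> (\<Oplus>\<^bsub>TQ\<^esub>a\<in>expo. cl [(mono a, coord a L)])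
      = (\<Oplus>\<^bsub>TQ\<^esub>a\<in>expo. cl [(mono a, coeffs b a \<odot>\<^bsub>N\<^esub> m)] \<oplus>\<^bsub>TQ\<^esub> cl [(mono a, coord a L)])"
    by (rule TQ.finsum_addf[OF c, symmetric])
  also have "\<dots> = (\<Oplus>\<^bsub>TQ\<^esub>a\<in>expo. cl [(mono a, coord a (g # L))])"
    using c1 mono_closed
    by (intro TQ.finsum_cong') (auto intro!: cl_closed simp: TG_iff g(1) coord_simps cl_add_r)
  finally show ?case .
qed

lemma coord_D:
  assumes i: "i < n" and a: "a \<in> expo" "Suc (a i) < p" and a': "a' = a(i := Suc (a i))" and "set L \<subseteq> TG"
  shows "coord a (map (map_prod (D i) (\<lambda>m. m)) L) = [(Suc (a i))] \<cdot>\<^bsub>N\<^esub> coord a' L"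
  using assms(5)
proof (induction L)
  case Nil
  then show ?case by (simp add: coord_simps)
next
  case (Cons g L)
  obtain b m where g: "g = (b, m)" "b \<in> carrier B" "m \<in> carrier N" using Cons.prems TG_iff by (cases g) auto
  have a'_expo: "a' \<in> expo" using expo_upd[OF a(1) i a(2)] unfolding a' .
  have cb: "coeffs b a' \<in> carrier A" using coeffs_closed[OF g(2) a'_expo] .
  have "([k] \<cdot>\<^bsub>A\<^esub> r) \<odot>\<^bsub>N\<^esub> m = [k] \<cdot>\<^bsub>N\<^esub> (r \<odot>\<^bsub>N\<^esub> m)" if "r \<in> carrier A" for r and k :: nat
    using that g(3) by (induction k) (simp_all add: A.add.nat_pow_Suc N.M.add.nat_pow_Suc N.smult_l_distr)
  from this[OF cb, of "Suc (a i)"]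
  have "coeffs (D i b) a \<odot>\<^bsub>N\<^esub> m = [(Suc (a i))] \<cdot>\<^bsub>N\<^esub> (coeffs b a' \<odot>\<^bsub>N\<^esub> m)"
    unfolding coeffs_D[OF i g(2) a, folded a'] .
  moreover have "coord a' L \<in> carrier N" using coord_closed[OF a'_expo] Cons.prems by simp
  ultimately show ?case
    using Cons g cb by (simp add: coord_simps N.M.add.nat_pow_distrib del: N.M.add.nat_pow_Suc)
qed

theorem horizontal_tensor:
  assumes L: "set L \<subseteq> TG" and hor: "\<And>i. i < n \<Longrightarrow> fs_cong TG TE (map (map_prod (D i) (\<lambda>m. m)) L) []"
  shows "cl L = cl [(\<one>, coord zero_expo L)]"
proof -
  interpret TQ: Module.module B TQ by (rule TQ_module)
  have z: "coord a L = \<zero>\<^bsub>N\<^esub>" if a: "a \<in> expo" and ne: "a \<noteq> zero_expo" for a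
  proof -
    obtain i where i: "i < n" "a i \<noteq> 0" using zero_expo_unique[OF a] ne by blast
    \<comment> \<open>The exponent below \<open>a\<close>: the coordinate at \<open>b\<close> of the
      derivative is \<open>a i\<close> times the coordinate at \<open>a\<close>.\<close>
    define b where "b = a(i := a i - 1)"
    have lt: "a i < p" using expo_lt[OF a i(1)] .
    have b: "b \<in> expo" "Suc (b i) < p" "a = b(i := Suc (b i))" "Suc (b i) = a i"
      unfolding b_def using i lt by (auto intro!: expo_upd a)
    have "[(a i)] \<cdot>\<^bsub>N\<^esub> coord a L = coord b (map (map_prod (D i) (\<lambda>m. m)) L)"
      using coord_D[OF i(1) b(1-3) L] unfolding b(4) by (rule sym)
    also have "\<dots> = \<zero>\<^bsub>N\<^esub>" using coord_cong[OF b(1) hor[OF i(1)]] by (simp add: coord_simps)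
    finally have "[(a i)] \<cdot>\<^bsub>N\<^esub> coord a L = \<zero>\<^bsub>N\<^esub>" .
    moreover have cN: "coord a L \<in> carrier N" using coord_closed[OF a L] .
    \<comment> \<open>A multiple in \<open>N\<close> is multiplication by a multiple of 1 in
      \<open>A\<close>, which transports the characteristic from \<open>A\<close> to
      \<open>N\<close>.\<close>
    have "[k] \<cdot>\<^bsub>N\<^esub> coord a L = ([k] \<cdot>\<^bsub>A\<^esub> \<one>\<^bsub>A\<^esub>) \<odot>\<^bsub>N\<^esub> coord a L" for k :: nat
      using cN by (induction k) (simp_all add: A.add.nat_pow_Suc N.M.add.nat_pow_Suc N.smult_l_distr)
    then have "[p] \<cdot>\<^bsub>N\<^esub> coord a L = \<zero>\<^bsub>N\<^esub>" using char cN by simp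
    moreover have "coprime (a i) p"
      using p i(2) lt by (metis coprime_commute gr0I nat_dvd_not_less prime_imp_coprime)
    ultimately show ?thesis using cN i(2) by (intro N.M.coprime_pow_zero[of "coord a L" "a i" p])
  qed
  have c0: "coord zero_expo L \<in> carrier N" using coord_closed[OF zero_expo L] .
  have f: "(\<lambda>a. cl [(mono a, coord zero_expo L)]) \<in> expo \<rightarrow> carrier TQ"
    using c0 mono_closed by (auto intro!: cl_closed simp: TG_iff)
  have "cl L = (\<Oplus>\<^bsub>TQ\<^esub>a\<in>expo. if zero_expo = a then cl [(mono a, coord zero_expo L)] else \<zero>\<^bsub>TQ\<^esub>)"
    unfolding cl_coord[OF L] using f
    by (intro TQ.finsum_cong') (auto simp: z cl_zero_r mono_closed Pi_def)
  also have "\<dots> = cl [(mono zero_expo, coord zero_expo L)]"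
    by (rule TQ.finsum_singleton[OF zero_expo finite_expo f])
  finally show ?thesis unfolding mono_zero .
qed

lemma coord_one: "m \<in> carrier N \<Longrightarrow> coord zero_expo [(\<one>, m)] = m"
  by (simp add: coord_simps coeffs_one)

end

section \<open>Affine charts and units at a point\<close>

lemma ring_hom_Units:
  assumes "h \<in> ring_hom R S" and u: "u \<in> Units R"
  shows "h u \<in> Units S"
proof -
  from u obtain v where v: "v \<in> carrier R" "v \<otimes>\<^bsub>R\<^esub> u = \<one>\<^bsub>R\<^esub>" "u \<otimes>\<^bsub>R\<^esub> v = \<one>\<^bsub>R\<^esub>" "u \<in> carrier R"
    unfolding Units_def by blast
  have "h v \<otimes>\<^bsub>S\<^esub> h u = \<one>\<^bsub>S\<^esub>" "h u \<otimes>\<^bsub>S\<^esub> h v = \<one>\<^bsub>S\<^esub>"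
    using ring_hom_mult[OF assms(1) v(1,4)] ring_hom_mult[OF assms(1) v(4,1)] ring_hom_one[OF assms(1)] v
    by simp_all
  then show ?thesis unfolding Units_def using ring_hom_closed[OF assms(1)] v by blast
qed

lemma primeideal_closed:
  assumes "primeideal P R"
  shows "\<zero>\<^bsub>R\<^esub> \<in> P" "\<And>a b. a \<in> P \<Longrightarrow> b \<in> P \<Longrightarrow> a \<oplus>\<^bsub>R\<^esub> b \<in> P" "\<And>a. a \<in> P \<Longrightarrow> \<ominus>\<^bsub>R\<^esub> a \<in> P"
proof -
  interpret P: primeideal P R by (rule assms)
  have A: "additive_subgroup P R" by (rule ideal.axioms(1)[OF primeideal.axioms(1)[OF assms]])
  show "\<zero>\<^bsub>R\<^esub> \<in> P" by (rule additive_subgroup.zero_closed[OF A])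
  show "a \<oplus>\<^bsub>R\<^esub> b \<in> P" if "a \<in> P" "b \<in> P" for a b by (rule additive_subgroup.a_closed[OF A that])
  show "\<ominus>\<^bsub>R\<^esub> a \<in> P" if "a \<in> P" for a
    using P.I_l_closed[OF that, of "\<ominus>\<^bsub>R\<^esub> \<one>\<^bsub>R\<^esub>"] additive_subgroup.a_Hcarr[OF A that] by (simp add: P.l_minus)
qed

text \<open>The topology is given by a subbase; it is a base because the basic open set of a product
  is the intersection of those of the factors.\<close>

lemma zariski_base:
  assumes "cring R" and "openin (zariski_topology R) Z" and "P \<in> Z"
  shows "\<exists>f\<in>carrier R. P \<in> basic_open R f \<and> basic_open R f \<subseteq> Z"
proof -
  interpret cring R by (rule assms)
  have "generate_topology_on (basic_open R ` carrier R) Z"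
    using assms(2) unfolding zariski_topology_def openin_topology_generated_by_iff .
  then show ?thesis using assms(3)
  proof (induction rule: generate_topology_on.induct)
    case Empty
    then show ?case by simp
  next
    case (Int a b)
    then obtain f g where f: "f \<in> carrier R" "P \<in> basic_open R f" "basic_open R f \<subseteq> a"
      and g: "g \<in> carrier R" "P \<in> basic_open R g" "basic_open R g \<subseteq> b" by blast
    have "Q \<in> basic_open R (f \<otimes>\<^bsub>R\<^esub> g) \<longleftrightarrow> Q \<in> basic_open R f \<and> Q \<in> basic_open R g" for Q
    proof (cases "Q \<in> prime_spectrum R")
      case True
      then interpret Q: primeideal Q R unfolding prime_spectrum_def by simp
      show ?thesis
        using True f(1) g(1) Q.I_prime Q.I_l_closed Q.I_r_closed unfolding basic_open_def by blast
    qed (simp add: basic_open_def)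
    then show ?case using f g by (intro bexI[of _ "f \<otimes>\<^bsub>R\<^esub> g"]) auto
  next
    case (UN K)
    then show ?case by blast
  next
    case (Basis s)
    then show ?case by blast
  qed
qed

section \<open>Sections whose germ at a point is a unit\<close>

context
  fixes \<Y> :: "('y, 'b) ringed_space"
  assumes ringed: "ring_presheaf \<Y>"
begin

lemma germ_unit_res:
  assumes o: "openin (tops \<Y>) V" "openin (tops \<Y>) W" "W \<subseteq> V" and y: "y \<in> W" and b: "b \<in> carrier (Osec \<Y> V)"
  shows "germ_unit \<Y> y W (rst \<Y> V W b) \<longleftrightarrow> germ_unit \<Y> y V b"
proof
  assume "germ_unit \<Y> y W (rst \<Y> V W b)"
  then obtain Z where Z: "openin (tops \<Y>) Z" "y \<in> Z" "Z \<subseteq> W" "rst \<Y> W Z (rst \<Y> V W b) \<in> Units (Osec \<Y> Z)"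
    unfolding germ_unit_def by blast
  then show "germ_unit \<Y> y V b"
    unfolding germ_unit_def using ringed_space_rst_comp[OF ringed o(1,2) Z(1,3) o(3) b] o(3)
    by (intro exI[of _ Z]) auto
next
  assume "germ_unit \<Y> y V b"
  then obtain Z where Z: "openin (tops \<Y>) Z" "y \<in> Z" "Z \<subseteq> V" "rst \<Y> V Z b \<in> Units (Osec \<Y> Z)"
    unfolding germ_unit_def by blast
  have o': "openin (tops \<Y>) (Z \<inter> W)" using Z(1) o(2) by blast
  have "rst \<Y> Z (Z \<inter> W) (rst \<Y> V Z b) \<in> Units (Osec \<Y> (Z \<inter> W))"
    by (rule ring_hom_Units[OF ringed_space_rst[OF ringed Z(1) o'] Z(4)]) blast
  then have "rst \<Y> W (Z \<inter> W) (rst \<Y> V W b) \<in> Units (Osec \<Y> (Z \<inter> W))"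
    using ringed_space_rst_comp[OF ringed o(1) Z(1) o' _ Z(3) b] ringed_space_rst_comp[OF ringed o(1,2) o' _ o(3) b]
    by simp
  then show "germ_unit \<Y> y W (rst \<Y> V W b)"
    unfolding germ_unit_def using o' y Z(2) by (intro exI[of _ "Z \<inter> W"]) auto
qed

lemma germ_unit_mult:
  assumes V: "openin (tops \<Y>) V" "y \<in> V" and b: "b \<in> carrier (Osec \<Y> V)" and c: "c \<in> carrier (Osec \<Y> V)"
  shows "germ_unit \<Y> y V (b \<otimes>\<^bsub>Osec \<Y> V\<^esub> c) \<longleftrightarrow> germ_unit \<Y> y V b \<and> germ_unit \<Y> y V c"
proof (intro iffI conjI)
  have mult: "rst \<Y> V Z (b \<otimes>\<^bsub>Osec \<Y> V\<^esub> c) = rst \<Y> V Z b \<otimes>\<^bsub>Osec \<Y> Z\<^esub> rst \<Y> V Z c"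
    "rst \<Y> V Z b \<in> carrier (Osec \<Y> Z)" "rst \<Y> V Z c \<in> carrier (Osec \<Y> Z)" "cring (Osec \<Y> Z)"
    if "openin (tops \<Y>) Z" "Z \<subseteq> V" for Z
    using ring_hom_mult[OF ringed_space_rst[OF ringed V(1) that] b c]
      ringed_space_rst_closed[OF ringed V(1) that b] ringed_space_rst_closed[OF ringed V(1) that c]
      ringed_space_cring[OF ringed that(1)] by auto
  {
    assume "germ_unit \<Y> y V (b \<otimes>\<^bsub>Osec \<Y> V\<^esub> c)"
    then obtain Z where Z: "openin (tops \<Y>) Z" "y \<in> Z" "Z \<subseteq> V"
      "rst \<Y> V Z (b \<otimes>\<^bsub>Osec \<Y> V\<^esub> c) \<in> Units (Osec \<Y> Z)"
      unfolding germ_unit_def by blast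
    note m = mult[OF Z(1,3)]
    interpret cring "Osec \<Y> Z" by (rule m(4))
    have "rst \<Y> V Z b \<in> Units (Osec \<Y> Z)"
      using Z(4) m(2,3) unfolding m(1) by (rule unit_factor)
    then show "germ_unit \<Y> y V b" unfolding germ_unit_def using Z by blast
    have "rst \<Y> V Z c \<in> Units (Osec \<Y> Z)"
      using Z(4) m(3,2) unfolding m(1) m_comm[OF m(2,3)] by (rule unit_factor)
    then show "germ_unit \<Y> y V c" unfolding germ_unit_def using Z by blast
  }
  assume "germ_unit \<Y> y V b \<and> germ_unit \<Y> y V c"
  then obtain Z Z' where Z: "openin (tops \<Y>) Z" "y \<in> Z" "Z \<subseteq> V" "rst \<Y> V Z b \<in> Units (Osec \<Y> Z)"
    and Z': "openin (tops \<Y>) Z'" "y \<in> Z'" "Z' \<subseteq> V" "rst \<Y> V Z' c \<in> Units (Osec \<Y> Z')"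
    unfolding germ_unit_def by blast
  let ?Z = "Z \<inter> Z'"
  have o: "openin (tops \<Y>) ?Z" "?Z \<subseteq> V" using Z Z' by auto
  note m = mult[OF o]
  interpret cring "Osec \<Y> ?Z" by (rule m(4))
  have "rst \<Y> V ?Z b \<in> Units (Osec \<Y> ?Z)"
    using ring_hom_Units[OF ringed_space_rst[OF ringed Z(1) o(1)] Z(4)]
      ringed_space_rst_comp[OF ringed V(1) Z(1) o(1) _ Z(3) b] by simp
  moreover have "rst \<Y> V ?Z c \<in> Units (Osec \<Y> ?Z)"
    using ring_hom_Units[OF ringed_space_rst[OF ringed Z'(1) o(1)] Z'(4)]
      ringed_space_rst_comp[OF ringed V(1) Z'(1) o(1) _ Z'(3) c] by simp
  ultimately have "rst \<Y> V ?Z (b \<otimes>\<^bsub>Osec \<Y> V\<^esub> c) \<in> Units (Osec \<Y> ?Z)"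
    unfolding m(1) by (rule Units_m_closed)
  then show "germ_unit \<Y> y V (b \<otimes>\<^bsub>Osec \<Y> V\<^esub> c)"
    unfolding germ_unit_def using o Z(2) Z'(2) by (intro exI[of _ ?Z]) auto
qed

lemma germ_unit_Units:
  assumes "openin (tops \<Y>) V" "y \<in> V" "b \<in> Units (Osec \<Y> V)"
  shows "germ_unit \<Y> y V b"
  unfolding germ_unit_def
proof (intro exI conjI)
  interpret cring "Osec \<Y> V" using ringed_space_cring[OF ringed assms(1)] .
  show "rst \<Y> V V b \<in> Units (Osec \<Y> V)"
    using ringed_space_rst_id[OF ringed assms(1) Units_closed[OF assms(3)]] assms(3) by simp
qed (use assms in auto)

lemma germ_unit_pow:
  assumes V: "openin (tops \<Y>) V" "y \<in> V" and b: "b \<in> carrier (Osec \<Y> V)" and u: "germ_unit \<Y> y V b"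
  shows "germ_unit \<Y> y V (b [^]\<^bsub>Osec \<Y> V\<^esub> (k::nat))"
proof (induction k)
  interpret cring "Osec \<Y> V" using ringed_space_cring[OF ringed V(1)] .
  case 0
  then show ?case using germ_unit_Units[OF V] by simp
next
  interpret cring "Osec \<Y> V" using ringed_space_cring[OF ringed V(1)] .
  case (Suc k)
  then show ?case using germ_unit_mult[OF V, of "b [^]\<^bsub>Osec \<Y> V\<^esub> k" b] b u by simp
qed

end

section \<open>Affine charts and the prime ideal of non-units\<close>

locale affine_chart =
  fixes \<Y> :: "('y, 'b) ringed_space" and U :: "'y set" and \<phi> :: "'y \<Rightarrow> 'b set"
  assumes ringed: "ring_presheaf \<Y>" and U: "openin (tops \<Y>) U"
    and homeo: "homeomorphic_map (subtopology (tops \<Y>) U) (zariski_topology (Osec \<Y> U)) \<phi>"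
    and loc: "\<And>f. f \<in> carrier (Osec \<Y> U) \<Longrightarrow>
      is_localization_at (Osec \<Y> U) f (Osec \<Y> {x\<in>U. \<phi> x \<in> basic_open (Osec \<Y> U) f})
        (rst \<Y> U {x\<in>U. \<phi> x \<in> basic_open (Osec \<Y> U) f})"
begin

abbreviation "R \<equiv> Osec \<Y> U"

definition Df :: "'b \<Rightarrow> 'y set" where "Df f = {x \<in> U. \<phi> x \<in> basic_open R f}"

lemma cring_R: "cring R" using ringed_space_cring[OF ringed U] .

lemma top_U: "topspace (subtopology (tops \<Y>) U) = U"
  using openin_subset[OF U] by auto

lemma inj_phi: "inj_on \<phi> U" and phi_top: "\<phi> ` U = topspace (zariski_topology R)"
  using homeo unfolding homeomorphic_eq_everything_map top_U by auto

lemma phi_prime: "x \<in> U \<Longrightarrow> primeideal (\<phi> x) R"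
proof -
  assume "x \<in> U"
  then have "\<phi> x \<in> topspace (zariski_topology R)" using phi_top by blast
  then show ?thesis
    unfolding zariski_topology_def topology_generated_by_topspace basic_open_def prime_spectrum_def by blast
qed

lemma Df_iff: "x \<in> Df f \<longleftrightarrow> x \<in> U \<and> f \<notin> \<phi> x"
  unfolding Df_def basic_open_def prime_spectrum_def using phi_prime by blast

lemma Df_sub: "Df f \<subseteq> U" unfolding Df_def by blast

lemma Df_mult:
  assumes "f \<in> carrier R" "g \<in> carrier R"
  shows "Df (f \<otimes>\<^bsub>R\<^esub> g) = Df f \<inter> Df g"
proof -
  have "f \<otimes>\<^bsub>R\<^esub> g \<notin> \<phi> x \<longleftrightarrow> f \<notin> \<phi> x \<and> g \<notin> \<phi> x" if "x \<in> U" for x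
  proof -
    interpret primeideal "\<phi> x" R using phi_prime[OF that] .
    show ?thesis using assms I_prime I_l_closed I_r_closed by blast
  qed
  then show ?thesis by (intro equalityI subsetI) (auto simp: Df_iff)
qed

lemma Df_open: "f \<in> carrier R \<Longrightarrow> openin (tops \<Y>) (Df f)"
proof -
  assume f: "f \<in> carrier R"
  have "openin (zariski_topology R) (basic_open R f)"
    unfolding zariski_topology_def openin_topology_generated_by_iff using f by (intro generate_topology_on.Basis) blast
  then have *: "openin (subtopology (tops \<Y>) U) {x \<in> topspace (subtopology (tops \<Y>) U). \<phi> x \<in> basic_open R f}"
    using homeo unfolding homeomorphic_eq_everything_map by (intro openin_continuous_map_preimage) auto
  have "openin (subtopology (tops \<Y>) U) (Df f)" using * unfolding top_U Df_def .
  then show ?thesis using U by (simp add: openin_open_subtopology)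
qed

lemma Df_base:
  assumes W: "openin (tops \<Y>) W" and x: "x \<in> W" "x \<in> U"
  obtains f where "f \<in> carrier R" "x \<in> Df f" "Df f \<subseteq> W"
proof -
  have "openin (subtopology (tops \<Y>) U) (W \<inter> U)" using W U by (simp add: openin_open_subtopology openin_Int)
  then have "openin (zariski_topology R) (\<phi> ` (W \<inter> U))"
    using homeo unfolding homeomorphic_eq_everything_map open_map_def by blast
  then obtain f where f: "f \<in> carrier R" "\<phi> x \<in> basic_open R f" "basic_open R f \<subseteq> \<phi> ` (W \<inter> U)"
    using zariski_base[OF cring_R _ imageI[of x "W \<inter> U" \<phi>]] x by blast
  have "Df f \<subseteq> W"
  proof
    fix z assume z: "z \<in> Df f"
    then have "\<phi> z \<in> \<phi> ` (W \<inter> U)" "z \<in> U" using f(3) unfolding Df_def by auto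
    then obtain w where "\<phi> z = \<phi> w" "w \<in> W" "w \<in> U" by blast
    then show "z \<in> W" using inj_onD[OF inj_phi, of z w] \<open>z \<in> U\<close> by simp
  qed
  then show thesis using that[OF f(1)] f(2) x unfolding Df_def by blast
qed

lemma res_hom: "f \<in> carrier R \<Longrightarrow> rst \<Y> U (Df f) \<in> ring_hom R (Osec \<Y> (Df f))"
  using ringed_space_rst[OF ringed U Df_open Df_sub] .

lemma res_unit: "f \<in> carrier R \<Longrightarrow> rst \<Y> U (Df f) f \<in> Units (Osec \<Y> (Df f))"
  using loc unfolding is_localization_at_def Df_def by simp

lemma frac:
  assumes "f \<in> carrier R" "b \<in> carrier (Osec \<Y> (Df f))"
  obtains a and n :: nat where "a \<in> carrier R"
    "b \<otimes>\<^bsub>Osec \<Y> (Df f)\<^esub> rst \<Y> U (Df f) f [^]\<^bsub>Osec \<Y> (Df f)\<^esub> n = rst \<Y> U (Df f) a"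
proof -
  have "\<forall>b\<in>carrier (Osec \<Y> (Df f)). \<exists>a\<in>carrier R. \<exists>n::nat.
      b \<otimes>\<^bsub>Osec \<Y> (Df f)\<^esub> rst \<Y> U (Df f) f [^]\<^bsub>Osec \<Y> (Df f)\<^esub> n = rst \<Y> U (Df f) a"
    using loc[OF assms(1), folded Df_def] unfolding is_localization_at_def by simp
  then show thesis using assms(2) that by blast
qed

lemma res_zero_imp:
  assumes "f \<in> carrier R" "a \<in> carrier R" "rst \<Y> U (Df f) a = \<zero>\<^bsub>Osec \<Y> (Df f)\<^esub>"
  obtains n :: nat where "f [^]\<^bsub>R\<^esub> n \<otimes>\<^bsub>R\<^esub> a = \<zero>\<^bsub>R\<^esub>"
proof -
  have "\<forall>a\<in>carrier R. rst \<Y> U (Df f) a = \<zero>\<^bsub>Osec \<Y> (Df f)\<^esub> \<longrightarrow> (\<exists>n::nat. f [^]\<^bsub>R\<^esub> n \<otimes>\<^bsub>R\<^esub> a = \<zero>\<^bsub>R\<^esub>)"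
    using loc[OF assms(1), folded Df_def] unfolding is_localization_at_def by simp
  then show thesis using assms that by blast
qed

lemma res_pow:
  assumes f: "f \<in> carrier R" "g \<in> carrier R"
  shows "rst \<Y> U (Df f) (g [^]\<^bsub>R\<^esub> (n::nat)) = rst \<Y> U (Df f) g [^]\<^bsub>Osec \<Y> (Df f)\<^esub> n"
proof -
  interpret R: cring R by (rule cring_R)
  interpret S: cring "Osec \<Y> (Df f)" using ringed_space_cring[OF ringed Df_open[OF f(1)]] .
  show ?thesis
    using f ring_hom_mult[OF res_hom[OF f(1)]] ring_hom_one[OF res_hom[OF f(1)]] by (induction n) simp_all
qed

text \<open>If \<open>c\<close> becomes invertible on some \<open>Df f\<close> around
  \<open>x\<close>, clearing denominators in \<open>c u = 1\<close> gives a relation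
  \<open>f^n (c e - f^k) = 0\<close> in \<open>R\<close>. As \<open>f\<close> is outside the prime
  ideal of \<open>x\<close>, so is \<open>c\<close>. Conversely, \<open>c\<close> is invertible on
  \<open>Df c\<close>.\<close>

lemma germ_unit_iff:
  assumes x: "x \<in> U" and c: "c \<in> carrier R"
  shows "germ_unit \<Y> x U c \<longleftrightarrow> c \<notin> \<phi> x"
proof
  interpret R: cring R by (rule cring_R)
  interpret P: primeideal "\<phi> x" R using phi_prime[OF x] .
  assume "germ_unit \<Y> x U c"
  then obtain V where V: "openin (tops \<Y>) V" "x \<in> V" "V \<subseteq> U" "rst \<Y> U V c \<in> Units (Osec \<Y> V)"
    unfolding germ_unit_def by blast
  obtain f where f: "f \<in> carrier R" "x \<in> Df f" "Df f \<subseteq> V" using Df_base[OF V(1,2) x] by blast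
  let ?S = "Osec \<Y> (Df f)" and ?r = "rst \<Y> U (Df f)"
  interpret S: cring ?S using ringed_space_cring[OF ringed Df_open[OF f(1)]] .
  have "?r c = rst \<Y> V (Df f) (rst \<Y> U V c)"
    using ringed_space_rst_comp[OF ringed U V(1) Df_open[OF f(1)] f(3) V(3) c] by simp
  then have "?r c \<in> Units ?S"
    using ring_hom_Units[OF ringed_space_rst[OF ringed V(1) Df_open[OF f(1)] f(3)] V(4)] by simp
  then obtain u where u: "u \<in> carrier ?S" "?r c \<otimes>\<^bsub>?S\<^esub> u = \<one>\<^bsub>?S\<^esub>" unfolding Units_def by blast
  obtain e k where e: "e \<in> carrier R" "u \<otimes>\<^bsub>?S\<^esub> ?r f [^]\<^bsub>?S\<^esub> (k::nat) = ?r e" using frac[OF f(1) u(1)] by blast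
  note h = ring_hom_closed[OF res_hom[OF f(1)]]
  have "?r (c \<otimes>\<^bsub>R\<^esub> e) = (?r c \<otimes>\<^bsub>?S\<^esub> u) \<otimes>\<^bsub>?S\<^esub> ?r f [^]\<^bsub>?S\<^esub> k"
    using ring_hom_mult[OF res_hom[OF f(1)] c e(1)] e(2) h[OF c] h[OF f(1)] u(1) by (simp add: S.m_assoc)
  also have "\<dots> = ?r (f [^]\<^bsub>R\<^esub> k)" using u(2) h[OF f(1)] res_pow[OF f(1) f(1)] by simp
  finally have "?r (c \<otimes>\<^bsub>R\<^esub> e \<ominus>\<^bsub>R\<^esub> f [^]\<^bsub>R\<^esub> k) = \<zero>\<^bsub>?S\<^esub>"
  proof -
    interpret r: ring_hom_cring R ?S ?r
      using res_hom[OF f(1)] by (intro ring_hom_cring.intro ring_hom_cring_axioms.intro cring_R S.is_cring)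
    assume "?r (c \<otimes>\<^bsub>R\<^esub> e) = ?r (f [^]\<^bsub>R\<^esub> k)"
    then show ?thesis
      unfolding R.minus_eq using c e(1) f(1)
      by (simp only: r.hom_add r.hom_a_inv R.m_closed R.nat_pow_closed R.a_inv_closed S.r_neg r.hom_closed)
  qed
  then obtain n where n: "f [^]\<^bsub>R\<^esub> (n::nat) \<otimes>\<^bsub>R\<^esub> (c \<otimes>\<^bsub>R\<^esub> e \<ominus>\<^bsub>R\<^esub> f [^]\<^bsub>R\<^esub> k) = \<zero>\<^bsub>R\<^esub>"
    using res_zero_imp[OF f(1), of "c \<otimes>\<^bsub>R\<^esub> e \<ominus>\<^bsub>R\<^esub> f [^]\<^bsub>R\<^esub> k"] c e(1) f(1) by auto
  have fP: "f [^]\<^bsub>R\<^esub> (m::nat) \<notin> \<phi> x" for m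
  proof (induction m)
    case 0
    then show ?case using P.I_notcarr P.one_imp_carrier by auto
  next
    case (Suc m)
    then show ?case using P.I_prime[of "f [^]\<^bsub>R\<^esub> m" f] f(1,2) Df_iff by auto
  qed
  show "c \<notin> \<phi> x"
  proof
    assume cP: "c \<in> \<phi> x"
    have "f [^]\<^bsub>R\<^esub> n \<otimes>\<^bsub>R\<^esub> (c \<otimes>\<^bsub>R\<^esub> e \<ominus>\<^bsub>R\<^esub> f [^]\<^bsub>R\<^esub> k) \<in> \<phi> x" unfolding n by (rule primeideal_closed(1)[OF phi_prime[OF x]])
    then have "c \<otimes>\<^bsub>R\<^esub> e \<ominus>\<^bsub>R\<^esub> f [^]\<^bsub>R\<^esub> k \<in> \<phi> x"
      using P.I_prime[of "f [^]\<^bsub>R\<^esub> n" "c \<otimes>\<^bsub>R\<^esub> e \<ominus>\<^bsub>R\<^esub> f [^]\<^bsub>R\<^esub> k"] fP[of n] c e(1) f(1) by simp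
    moreover have "\<ominus>\<^bsub>R\<^esub> (c \<otimes>\<^bsub>R\<^esub> e) \<in> \<phi> x"
      by (rule primeideal_closed(3)[OF phi_prime[OF x] P.I_r_closed[OF cP e(1)]])
    ultimately have "\<ominus>\<^bsub>R\<^esub> (c \<otimes>\<^bsub>R\<^esub> e) \<oplus>\<^bsub>R\<^esub> (c \<otimes>\<^bsub>R\<^esub> e \<ominus>\<^bsub>R\<^esub> f [^]\<^bsub>R\<^esub> k) \<in> \<phi> x"
      using primeideal_closed(2)[OF phi_prime[OF x]] by blast
    then have "\<ominus>\<^bsub>R\<^esub> (f [^]\<^bsub>R\<^esub> k) \<in> \<phi> x" using c e(1) f(1) by (simp add: R.minus_eq R.r_neg1)
    then have "\<ominus>\<^bsub>R\<^esub> (\<ominus>\<^bsub>R\<^esub> (f [^]\<^bsub>R\<^esub> k)) \<in> \<phi> x" by (rule primeideal_closed(3)[OF phi_prime[OF x]])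
    then show False using fP f(1) by simp
  qed
next
  assume "c \<notin> \<phi> x"
  then have "x \<in> Df c" using x Df_iff by blast
  then show "germ_unit \<Y> x U c"
    unfolding germ_unit_def using Df_open[OF c] Df_sub res_unit[OF c] by blast
qed

text \<open>On \<open>Df f\<close> the section \<open>b\<close> is the fraction
  \<open>a / f^n\<close> with invertible denominator, so units are detected by the
  numerator.\<close>

lemma local_fraction:
  assumes Z: "openin (tops \<Y>) Z" and y: "y \<in> Z" "y \<in> U" and b: "b \<in> carrier (Osec \<Y> Z)"
    and f: "f \<in> carrier R" "y \<in> Df f" "Df f \<subseteq> Z"
    and a: "a \<in> carrier R" "rst \<Y> Z (Df f) b \<otimes>\<^bsub>Osec \<Y> (Df f)\<^esub> rst \<Y> U (Df f) f [^]\<^bsub>Osec \<Y> (Df f)\<^esub> (n::nat) = rst \<Y> U (Df f) a"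
  shows "germ_unit \<Y> y Z b \<longleftrightarrow> a \<notin> \<phi> y"
proof -
  let ?S = "Osec \<Y> (Df f)" and ?r = "rst \<Y> U (Df f)"
  interpret S: cring ?S using ringed_space_cring[OF ringed Df_open[OF f(1)]] .
  note o = Df_open[OF f(1)]
  have bS: "rst \<Y> Z (Df f) b \<in> carrier ?S" using ringed_space_rst_closed[OF ringed Z o f(3) b] .
  have fS: "?r f \<in> carrier ?S" using ring_hom_closed[OF res_hom[OF f(1)] f(1)] .
  have "germ_unit \<Y> y (Df f) (?r f [^]\<^bsub>?S\<^esub> n)"
    using germ_unit_pow[OF ringed o f(2) fS germ_unit_Units[OF ringed o f(2) res_unit[OF f(1)]]] .
  then have "germ_unit \<Y> y (Df f) (rst \<Y> Z (Df f) b) \<longleftrightarrow> germ_unit \<Y> y (Df f) (?r a)"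
    unfolding a(2)[symmetric] using germ_unit_mult[OF ringed o f(2) bS, of "?r f [^]\<^bsub>?S\<^esub> n"] fS by simp
  then show ?thesis
    using germ_unit_res[OF ringed Z o f(3,2) b] germ_unit_res[OF ringed U o Df_sub f(2) a(1)]
      germ_unit_iff[OF y(2) a(1)] by simp
qed

text \<open>The preimage in the sections over \<open>Z\<close> of the maximal ideal of the local
  ring at \<open>y\<close>, described without forming the stalk.\<close>

definition nonunits :: "'y \<Rightarrow> 'y set \<Rightarrow> 'b set" where
  "nonunits y Z = {b \<in> carrier (Osec \<Y> Z). \<not> germ_unit \<Y> y Z b}"

text \<open>Primality and closure under multiples hold because a product has a unit germ exactly
  when both factors have. Only sums need the chart: they are computed with numerators, which lie in
  the prime ideal of \<open>y\<close>.\<close>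

lemma nonunits_prime:
  assumes Z: "openin (tops \<Y>) Z" and y: "y \<in> Z" "y \<in> U"
  shows "primeideal (nonunits y Z) (Osec \<Y> Z)"
proof -
  let ?B = "Osec \<Y> Z" and ?P = "nonunits y Z"
  interpret R: cring R by (rule cring_R)
  interpret P: primeideal "\<phi> y" R using phi_prime[OF y(2)] .
  interpret B: cring ?B using ringed_space_cring[OF ringed Z] .
  obtain f where f: "f \<in> carrier R" "y \<in> Df f" "Df f \<subseteq> Z" using Df_base[OF Z y] by blast
  let ?S = "Osec \<Y> (Df f)" and ?r = "rst \<Y> U (Df f)" and ?s = "rst \<Y> Z (Df f)"
  note o = Df_open[OF f(1)]
  interpret S: cring ?S using ringed_space_cring[OF ringed o] .
  interpret r: ring_hom_cring R ?S ?r
    using res_hom[OF f(1)] by (intro ring_hom_cring.intro ring_hom_cring_axioms.intro cring_R S.is_cring)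
  interpret s: ring_hom_cring ?B ?S ?s
    using ringed_space_rst[OF ringed Z o f(3)]
    by (intro ring_hom_cring.intro ring_hom_cring_axioms.intro B.is_cring S.is_cring)
  have gf: "germ_unit \<Y> y Z b \<longleftrightarrow> a \<notin> \<phi> y"
    if "b \<in> carrier ?B" "a \<in> carrier R" "?s b \<otimes>\<^bsub>?S\<^esub> ?r f [^]\<^bsub>?S\<^esub> (n::nat) = ?r a" for b a n
    using local_fraction[OF Z y that(1) f that(2,3)] .
  have add: "b \<oplus>\<^bsub>?B\<^esub> c \<in> ?P" if "b \<in> ?P" "c \<in> ?P" for b c
  proof -
    have b: "b \<in> carrier ?B" "\<not> germ_unit \<Y> y Z b" and c: "c \<in> carrier ?B" "\<not> germ_unit \<Y> y Z c"
      using that unfolding nonunits_def by auto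
    obtain a m where a: "a \<in> carrier R" "?s b \<otimes>\<^bsub>?S\<^esub> ?r f [^]\<^bsub>?S\<^esub> (m::nat) = ?r a"
      using frac[OF f(1), of "?s b"] b by auto
    obtain e n where e: "e \<in> carrier R" "?s c \<otimes>\<^bsub>?S\<^esub> ?r f [^]\<^bsub>?S\<^esub> (n::nat) = ?r e"
      using frac[OF f(1), of "?s c"] c by auto
    have aP: "a \<in> \<phi> y" "e \<in> \<phi> y" using gf[OF b(1) a] gf[OF c(1) e] b c by auto
    \<comment> \<open>The numerator of the sum of \<open>a / f^m\<close> and \<open>e / f^n\<close>
      over the common denominator \<open>f^(m + n)\<close>.\<close>
    let ?g = "a \<otimes>\<^bsub>R\<^esub> f [^]\<^bsub>R\<^esub> n \<oplus>\<^bsub>R\<^esub> e \<otimes>\<^bsub>R\<^esub> f [^]\<^bsub>R\<^esub> m"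
    have g: "?g \<in> carrier R" using a e f by simp
    have "?s (b \<oplus>\<^bsub>?B\<^esub> c) \<otimes>\<^bsub>?S\<^esub> ?r f [^]\<^bsub>?S\<^esub> (m + n)
        = (?s b \<otimes>\<^bsub>?S\<^esub> ?r f [^]\<^bsub>?S\<^esub> m) \<otimes>\<^bsub>?S\<^esub> ?r f [^]\<^bsub>?S\<^esub> n \<oplus>\<^bsub>?S\<^esub> (?s c \<otimes>\<^bsub>?S\<^esub> ?r f [^]\<^bsub>?S\<^esub> n) \<otimes>\<^bsub>?S\<^esub> ?r f [^]\<^bsub>?S\<^esub> m"
      using b c f(1) by (simp add: S.nat_pow_mult[symmetric] S.l_distr S.r_distr S.m_ac)
    also have "\<dots> = ?r ?g"
      unfolding a(2) e(2) using a(1) e(1) f(1) by (simp add: res_pow[OF f(1) f(1)])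
    finally have "germ_unit \<Y> y Z (b \<oplus>\<^bsub>?B\<^esub> c) \<longleftrightarrow> ?g \<notin> \<phi> y"
      using gf[of "b \<oplus>\<^bsub>?B\<^esub> c" ?g "m + n"] b c g by simp
    moreover have "?g \<in> \<phi> y"
      using aP f(1) by (intro primeideal_closed(2)[OF phi_prime[OF y(2)]] P.I_r_closed) auto
    ultimately show ?thesis unfolding nonunits_def using b c by simp
  qed
  have mult: "x \<otimes>\<^bsub>?B\<^esub> b \<in> ?P" if "b \<in> ?P" "x \<in> carrier ?B" for b x
    using that germ_unit_mult[OF ringed Z y(1)] unfolding nonunits_def by auto
  show ?thesis
  proof (rule primeidealI)
    show "ideal ?P ?B"
    proof (rule idealI)
      show "ring ?B" by (rule B.ring_axioms)
      have "\<ominus>\<^bsub>?B\<^esub> b \<in> ?P" if b: "b \<in> ?P" for b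
      proof -
        have "\<ominus>\<^bsub>?B\<^esub> \<one>\<^bsub>?B\<^esub> \<otimes>\<^bsub>?B\<^esub> b = \<ominus>\<^bsub>?B\<^esub> b" using b unfolding nonunits_def by (simp add: B.l_minus)
        then show ?thesis using mult[OF b, of "\<ominus>\<^bsub>?B\<^esub> \<one>\<^bsub>?B\<^esub>"] by simp
      qed
      moreover have "\<zero>\<^bsub>?B\<^esub> \<in> ?P"
      proof -
        have "?s \<zero>\<^bsub>?B\<^esub> \<otimes>\<^bsub>?S\<^esub> ?r f [^]\<^bsub>?S\<^esub> (0::nat) = ?r \<zero>\<^bsub>R\<^esub>" by simp
        from gf[OF _ _ this] show ?thesis unfolding nonunits_def by simp
      qed
      moreover have "?P \<subseteq> carrier ?B" unfolding nonunits_def by blast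
      ultimately show "subgroup ?P (add_monoid ?B)" using add by (intro B.add.subgroupI) auto
      show "x \<otimes>\<^bsub>?B\<^esub> b \<in> ?P" "b \<otimes>\<^bsub>?B\<^esub> x \<in> ?P" if "b \<in> ?P" "x \<in> carrier ?B" for b x
        using mult[OF that] B.m_comm[of b x] that unfolding nonunits_def by auto
    qed
    show "cring ?B" by (rule B.is_cring)
    have "\<one>\<^bsub>?B\<^esub> \<notin> ?P" unfolding nonunits_def using germ_unit_Units[OF ringed Z y(1)] by simp
    then show "carrier ?B \<noteq> ?P" by auto
    show "a \<in> ?P \<or> b \<in> ?P" if "a \<in> carrier ?B" "b \<in> carrier ?B" "a \<otimes>\<^bsub>?B\<^esub> b \<in> ?P" for a b
      using that germ_unit_mult[OF ringed Z y(1) that(1,2)] unfolding nonunits_def by auto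
  qed
qed

text \<open>Near \<open>x\<close> the section is a fraction \<open>a / f^n\<close>. If
  \<open>a\<close> were nonzero, it would be invertible on the open set where \<open>a f\<close>
  does not vanish, and with it the section.\<close>

lemma locally_zero:
  assumes dom: "\<And>V. openin (tops \<Y>) V \<Longrightarrow> V \<noteq> {} \<Longrightarrow> domain (Osec \<Y> V)"
    and empty: "\<And>a b. a \<in> carrier (Osec \<Y> {}) \<Longrightarrow> b \<in> carrier (Osec \<Y> {}) \<Longrightarrow> a = b"
    and W: "openin (tops \<Y>) W" "x \<in> W" "x \<in> U" and s: "s \<in> carrier (Osec \<Y> W)"
    and nonunit: "\<And>V. openin (tops \<Y>) V \<Longrightarrow> V \<noteq> {} \<Longrightarrow> V \<subseteq> W \<Longrightarrow> rst \<Y> W V s \<notin> Units (Osec \<Y> V)"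
  shows "\<exists>V. openin (tops \<Y>) V \<and> x \<in> V \<and> V \<subseteq> W \<and> rst \<Y> W V s = \<zero>\<^bsub>Osec \<Y> V\<^esub>"
proof -
  obtain f where f: "f \<in> carrier R" "x \<in> Df f" "Df f \<subseteq> W" using Df_base[OF W] by blast
  let ?S = "Osec \<Y> (Df f)" and ?r = "rst \<Y> U (Df f)"
  note o = Df_open[OF f(1)]
  interpret R: domain R using dom[OF U] W(3) by blast
  interpret S: cring ?S using ringed_space_cring[OF ringed o] .
  have sS: "rst \<Y> W (Df f) s \<in> carrier ?S" using ringed_space_rst_closed[OF ringed W(1) o f(3) s] .
  have fS: "?r f \<in> carrier ?S" using ring_hom_closed[OF res_hom[OF f(1)] f(1)] .
  have uf: "?r f [^]\<^bsub>?S\<^esub> (n::nat) \<in> Units ?S" for n using res_unit[OF f(1)] by (induction n) auto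
  obtain a n where a: "a \<in> carrier R" "rst \<Y> W (Df f) s \<otimes>\<^bsub>?S\<^esub> ?r f [^]\<^bsub>?S\<^esub> (n::nat) = ?r a"
    using frac[OF f(1) sS] by blast
  have "a = \<zero>\<^bsub>R\<^esub>"
  proof (rule ccontr)
    assume "a \<noteq> \<zero>\<^bsub>R\<^esub>"
    interpret P: primeideal "\<phi> x" R using phi_prime[OF W(3)] .
    have f0: "f \<noteq> \<zero>\<^bsub>R\<^esub>" using f(2) Df_iff primeideal_closed(1)[OF phi_prime[OF W(3)]] by metis
    let ?V = "Df (a \<otimes>\<^bsub>R\<^esub> f)"
    have af: "a \<otimes>\<^bsub>R\<^esub> f \<in> carrier R" using a f by simp
    have V: "openin (tops \<Y>) ?V" "?V \<subseteq> Df f" "?V \<subseteq> W" "?V \<subseteq> U"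
      using Df_open[OF af] Df_mult[OF a(1) f(1)] f(3) Df_sub by auto
    interpret V: cring "Osec \<Y> ?V" using ringed_space_cring[OF ringed V(1)] .
    \<comment> \<open>Over the empty set 1 = 0, by \<open>empty\<close>; as the sections over
      \<open>?V\<close> are the localization at \<open>a f\<close>, a power of \<open>a f\<close>
      would then vanish in the domain \<open>R\<close>.\<close>
    have "?V \<noteq> {}"
    proof
      assume e: "?V = {}"
      have "rst \<Y> U ?V \<one>\<^bsub>R\<^esub> = \<zero>\<^bsub>Osec \<Y> ?V\<^esub>"
        using ring_hom_closed[OF res_hom[OF af], of "\<one>\<^bsub>R\<^esub>"] empty[of "rst \<Y> U ?V \<one>\<^bsub>R\<^esub>" "\<zero>\<^bsub>Osec \<Y> ?V\<^esub>"] V.zero_closed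
        unfolding e by simp
      then obtain k where "(a \<otimes>\<^bsub>R\<^esub> f) [^]\<^bsub>R\<^esub> (k::nat) \<otimes>\<^bsub>R\<^esub> \<one>\<^bsub>R\<^esub> = \<zero>\<^bsub>R\<^esub>" using res_zero_imp[OF af] by blast
      moreover have "(a \<otimes>\<^bsub>R\<^esub> f) [^]\<^bsub>R\<^esub> (k::nat) \<noteq> \<zero>\<^bsub>R\<^esub>"
        using R.integral[OF _ a(1) f(1)] f0 \<open>a \<noteq> \<zero>\<^bsub>R\<^esub>\<close> af by (induction k) (auto dest: R.integral)
      ultimately show False using af by simp
    qed
    have "rst \<Y> U ?V (a \<otimes>\<^bsub>R\<^esub> f) \<in> Units (Osec \<Y> ?V)" by (rule res_unit[OF af])
    from V.unit_factor[OF this[unfolded ring_hom_mult[OF res_hom[OF af] a(1) f(1)]]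
        ring_hom_closed[OF res_hom[OF af] a(1)] ring_hom_closed[OF res_hom[OF af] f(1)]]
    have "rst \<Y> U ?V a \<in> Units (Osec \<Y> ?V)" .
    moreover have "rst \<Y> U ?V a = rst \<Y> (Df f) ?V (?r a)"
      using ringed_space_rst_comp[OF ringed U o V(1,2) Df_sub a(1)] by simp
    moreover have "\<dots> = rst \<Y> W ?V s \<otimes>\<^bsub>Osec \<Y> ?V\<^esub> rst \<Y> (Df f) ?V (?r f [^]\<^bsub>?S\<^esub> n)"
      unfolding a(2)[symmetric] using ring_hom_mult[OF ringed_space_rst[OF ringed o V(1,2)] sS, of "?r f [^]\<^bsub>?S\<^esub> n"] fS
        ringed_space_rst_comp[OF ringed W(1) o V(1,2) f(3) s] by simp
    ultimately have "rst \<Y> W ?V s \<otimes>\<^bsub>Osec \<Y> ?V\<^esub> rst \<Y> (Df f) ?V (?r f [^]\<^bsub>?S\<^esub> n) \<in> Units (Osec \<Y> ?V)"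
      by simp
    from V.unit_factor[OF this ringed_space_rst_closed[OF ringed W(1) V(1,3) s]
        ringed_space_rst_closed[OF ringed o V(1,2) S.nat_pow_closed[OF fS]]]
    have "rst \<Y> W ?V s \<in> Units (Osec \<Y> ?V)" .
    then show False using nonunit[OF V(1) \<open>?V \<noteq> {}\<close> V(3)] by blast
  qed
  then have "rst \<Y> W (Df f) s \<otimes>\<^bsub>?S\<^esub> ?r f [^]\<^bsub>?S\<^esub> n = \<zero>\<^bsub>?S\<^esub>"
    using a(2) ring_hom_zero[OF res_hom[OF f(1)] R.ring_axioms S.ring_axioms] by simp
  then obtain v where v: "v \<in> carrier ?S" "?r f [^]\<^bsub>?S\<^esub> n \<otimes>\<^bsub>?S\<^esub> v = \<one>\<^bsub>?S\<^esub>"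
    "rst \<Y> W (Df f) s \<otimes>\<^bsub>?S\<^esub> ?r f [^]\<^bsub>?S\<^esub> n = \<zero>\<^bsub>?S\<^esub>"
    using uf[of n] unfolding Units_def by blast
  have "rst \<Y> W (Df f) s = (rst \<Y> W (Df f) s \<otimes>\<^bsub>?S\<^esub> ?r f [^]\<^bsub>?S\<^esub> n) \<otimes>\<^bsub>?S\<^esub> v"
    using v(1,2) sS fS by (simp add: S.m_assoc)
  also have "\<dots> = \<zero>\<^bsub>?S\<^esub>" unfolding v(3) using v(1) by simp
  finally show ?thesis using o f by blast
qed

end

lemma affine_openE:
  assumes "ring_presheaf \<Y>" "affine_open \<Y> U"
  obtains \<phi> where "affine_chart \<Y> U \<phi>"
proof -
  have o: "openin (tops \<Y>) U" using assms(2)[unfolded affine_open_def] by (rule conjunct1)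
  obtain \<phi> where \<phi>: "homeomorphic_map (subtopology (tops \<Y>) U) (zariski_topology (Osec \<Y> U)) \<phi> \<and>
     (\<forall>f\<in>carrier (Osec \<Y> U). is_localization_at (Osec \<Y> U) f (Osec \<Y> {x\<in>U. \<phi> x \<in> basic_open (Osec \<Y> U) f})
        (rst \<Y> U {x\<in>U. \<phi> x \<in> basic_open (Osec \<Y> U) f}))"
    using assms(2)[unfolded affine_open_def, THEN conjunct2] by (rule exE)
  show thesis
    by (rule that[OF affine_chart.intro[OF assms(1) o \<phi>[THEN conjunct1] \<phi>[THEN conjunct2, rule_format]]])
qed

section \<open>The morphism\<close>

locale frobenius_factor =
  fixes L :: "'l ring" and K :: "'l set" and p :: nat
    and \<X> :: "('x, 'a) ringed_space" and \<kappa>\<^sub>K :: "'l \<Rightarrow> 'a"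
    and \<Y> :: "('y, 'b) ringed_space" and \<kappa>\<^sub>L :: "'l \<Rightarrow> 'b"
    and \<pi> :: "('y, 'b, 'x, 'a) rs_map"
  assumes p: "Factorial_Ring.prime p" and L: "Ring.field L" and K: "subfield K L"
    and char_L: "[p] \<cdot>\<^bsub>L\<^esub> \<one>\<^bsub>L\<^esub> = \<zero>\<^bsub>L\<^esub>"
    and fin: "finite_purely_insep_ext p L K"
    and var_X: "variety_over (L\<lparr>carrier := K\<rparr>) \<kappa>\<^sub>K \<X>"
    and var_Y: "variety_over L \<kappa>\<^sub>L \<Y>"
    and mor: "scheme_morphism \<Y> \<X> \<pi>"
    and homeo: "homeomorphic_map (tops \<Y>) (tops \<X>) (pt \<pi>)"
    and compat: "\<And>c. c \<in> K \<Longrightarrow> sharp \<pi> (topspace (tops \<X>)) (\<kappa>\<^sub>K c) = \<kappa>\<^sub>L c"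
    and frob: "factors_abs_frobenius p \<Y> \<X> \<pi>"
begin

abbreviation "\<A> \<equiv> inv_image_rs \<Y> \<X> \<pi>"
abbreviation "h \<equiv> inv_image_map \<pi>"
abbreviation "T \<equiv> tops \<Y>"

lemma is_ringed: "is_ringed_space \<Y>" "is_ringed_space \<X>"
  using var_X var_Y unfolding variety_over_def integral_scheme_def is_scheme_def by simp_all

lemma ringed_Y: "ring_presheaf \<Y>" and ringed_X: "ring_presheaf \<X>"
  using is_ringed by (simp_all add: is_ringed_space_ring_presheaf)

lemma domain_Y: "openin T V \<Longrightarrow> V \<noteq> {} \<Longrightarrow> domain (Osec \<Y> V)"
  using var_Y unfolding variety_over_def integral_scheme_def by simp

lemma domain_X: "openin (tops \<X>) V \<Longrightarrow> V \<noteq> {} \<Longrightarrow> domain (Osec \<X> V)"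
  using var_X unfolding variety_over_def integral_scheme_def by simp

lemma pi_top: "pt \<pi> ` topspace T = topspace (tops \<X>)" and pi_inj: "inj_on (pt \<pi>) (topspace T)"
  using homeo unfolding homeomorphic_eq_everything_map by auto

lemma im_open: "openin T W \<Longrightarrow> openin (tops \<X>) (pt \<pi> ` W)"
  using homeo unfolding homeomorphic_map_openness_eq[OF homeo] by blast

lemma pre_open: "openin (tops \<X>) U \<Longrightarrow> openin T (preim \<Y> \<pi> U)"
  unfolding preim_def using homeo unfolding homeomorphic_eq_everything_map
  by (intro openin_continuous_map_preimage) auto

lemma pre_im: "openin T W \<Longrightarrow> preim \<Y> \<pi> (pt \<pi> ` W) = W"
  using openin_subset[of T W] pi_inj unfolding preim_def by (auto dest: inj_onD)

lemma im_pre: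
  assumes "openin (tops \<X>) U"
  shows "pt \<pi> ` preim \<Y> \<pi> U = U"
proof (intro equalityI subsetI)
  fix x assume x: "x \<in> U"
  then have "x \<in> pt \<pi> ` topspace T" unfolding pi_top using openin_subset[OF assms] by blast
  then obtain y where "y \<in> topspace T" "x = pt \<pi> y" by (rule imageE)
  then show "x \<in> pt \<pi> ` preim \<Y> \<pi> U" unfolding preim_def using x by simp
qed (auto simp: preim_def)

lemma pre_mono: "V \<subseteq> U \<Longrightarrow> preim \<Y> \<pi> V \<subseteq> preim \<Y> \<pi> U" unfolding preim_def by blast

lemma A_simps: "tops \<A> = T" "Osec \<A> W = Osec \<X> (pt \<pi> ` W)" "rst \<A> V W = rst \<X> (pt \<pi> ` V) (pt \<pi> ` W)"
  unfolding inv_image_rs_def by simp_all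

lemma ringed_A: "ring_presheaf \<A>"
  unfolding ring_presheaf_def A_simps
  using ringed_space_cring[OF ringed_X] ringed_space_rst_id[OF ringed_X] ringed_space_rst[OF ringed_X]
    ringed_space_rst_comp[OF ringed_X] by (simp add: im_open image_mono)

lemma sharp_hom: "openin (tops \<X>) U \<Longrightarrow> sharp \<pi> U \<in> ring_hom (Osec \<X> U) (Osec \<Y> (preim \<Y> \<pi> U))"
  using mor unfolding scheme_morphism_def by simp

lemma sharp_rst: "openin (tops \<X>) U \<Longrightarrow> openin (tops \<X>) V \<Longrightarrow> V \<subseteq> U \<Longrightarrow> s \<in> carrier (Osec \<X> U) \<Longrightarrow>
  sharp \<pi> V (rst \<X> U V s) = rst \<Y> (preim \<Y> \<pi> U) (preim \<Y> \<pi> V) (sharp \<pi> U s)"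
  using mor unfolding scheme_morphism_def by simp

lemma pair: "ringed_pair \<Y> \<A> h"
proof (rule ringed_pair.intro[OF ringed_Y ringed_A A_simps(1)])
  fix V assume V: "openin T V"
  show "h V \<in> ring_hom (Osec \<A> V) (Osec \<Y> V)"
    using sharp_hom[OF im_open[OF V]] unfolding A_simps inv_image_map_def pre_im[OF V] .
  fix W a assume W: "openin T W" "W \<subseteq> V" and a: "a \<in> carrier (Osec \<A> V)"
  then show "h W (rst \<A> V W a) = rst \<Y> V W (h V a)"
    using sharp_rst[OF im_open[OF V] im_open[OF W(1)] image_mono[OF W(2)], of a]
    unfolding A_simps inv_image_map_def pre_im[OF V] pre_im[OF W(1)] by blast
qed

text \<open>\<open>F\<close> is the structure map of the second factor \<open>g\<close> of
  Frobenius. On points \<open>g\<close> is inverse to \<open>\<pi>\<close>, so preimages under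
  \<open>g\<close> are images under \<open>\<pi>\<close> and \<open>F\<close> maps to the inverse
  image sheaf.\<close>

lemma frobenius_section:
  obtains F where "\<And>W. openin T W \<Longrightarrow> F W \<in> ring_hom (Osec \<Y> W) (Osec \<A> W)"
    "\<And>W b. openin T W \<Longrightarrow> b \<in> carrier (Osec \<Y> W) \<Longrightarrow> h W (F W b) = b [^]\<^bsub>Osec \<Y> W\<^esub> p"
proof -
  obtain g where g: "scheme_morphism \<X> \<Y> g" "\<forall>y\<in>topspace T. pt g (pt \<pi> y) = y"
    "\<forall>V. openin T V \<longrightarrow> (\<forall>s\<in>carrier (Osec \<Y> V). sharp \<pi> (preim \<X> g V) (sharp g V s) = s [^]\<^bsub>Osec \<Y> V\<^esub> p)"
    using frob[unfolded factors_abs_frobenius_def] by (elim exE conjE)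
  have im: "preim \<X> g W = pt \<pi> ` W" if W: "openin T W" for W
  proof (intro equalityI subsetI)
    fix x assume "x \<in> preim \<X> g W"
    then have x: "x \<in> topspace (tops \<X>)" "pt g x \<in> W" unfolding preim_def by auto
    then obtain y where "y \<in> topspace T" "x = pt \<pi> y" using pi_top by blast
    then show "x \<in> pt \<pi> ` W" using x g(2) by auto
  next
    fix x assume "x \<in> pt \<pi> ` W"
    then obtain y where "y \<in> W" "x = pt \<pi> y" "y \<in> topspace T" using openin_subset[OF W] by blast
    then show "x \<in> preim \<X> g W" unfolding preim_def using g(2) pi_top by auto
  qed
  show thesis
  proof (rule that[of "sharp g"])
    fix W assume W: "openin T W"
    have "sharp g W \<in> ring_hom (Osec \<Y> W) (Osec \<X> (preim \<X> g W))"
      using g(1) W unfolding scheme_morphism_def by simp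
    then show "sharp g W \<in> ring_hom (Osec \<Y> W) (Osec \<A> W)" unfolding im[OF W] A_simps .
    show "h W (sharp g W b) = b [^]\<^bsub>Osec \<Y> W\<^esub> p" if b: "b \<in> carrier (Osec \<Y> W)" for b
      using g(3) W b unfolding inv_image_map_def im[OF W, symmetric] by blast
  qed
qed

lemma char_Y:
  assumes W: "openin T W"
  shows "[p] \<cdot>\<^bsub>Osec \<Y> W\<^esub> \<one>\<^bsub>Osec \<Y> W\<^esub> = \<zero>\<^bsub>Osec \<Y> W\<^esub>"
proof -
  interpret L: field L by (rule L)
  interpret Y: cring "Osec \<Y> (topspace T)" using ringed_space_cring[OF ringed_Y] by simp
  interpret W: cring "Osec \<Y> W" using ringed_space_cring[OF ringed_Y W] .
  have k: "\<kappa>\<^sub>L \<in> ring_hom L (Osec \<Y> (topspace T))" using var_Y unfolding variety_over_def by simp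
  let ?c = "\<lambda>x. rst \<Y> (topspace T) W (\<kappa>\<^sub>L x)"
  have r: "rst \<Y> (topspace T) W \<in> ring_hom (Osec \<Y> (topspace T)) (Osec \<Y> W)"
    using ringed_space_rst[OF ringed_Y _ W] openin_subset[OF W] by simp
  interpret c: ring_hom_cring L "Osec \<Y> W" ?c
  proof (intro ring_hom_cring.intro ring_hom_cring_axioms.intro L.is_cring W.is_cring)
    show "?c \<in> ring_hom L (Osec \<Y> W)" using ring_hom_trans[OF k r] unfolding comp_def .
  qed
  have "?c ([n] \<cdot>\<^bsub>L\<^esub> \<one>\<^bsub>L\<^esub>) = [n] \<cdot>\<^bsub>Osec \<Y> W\<^esub> \<one>\<^bsub>Osec \<Y> W\<^esub>" for n :: nat
    by (induction n) (simp_all add: L.add.nat_pow_Suc W.add.nat_pow_Suc)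
  from this[of p] show ?thesis unfolding char_L using c.hom_zero by simp
qed

lemma chart_X:
  assumes "x \<in> topspace (tops \<X>)"
  obtains U \<phi> where "affine_chart \<X> U \<phi>" "x \<in> U"
proof -
  obtain U where "affine_open \<X> U" "x \<in> U"
    using var_X assms unfolding variety_over_def integral_scheme_def is_scheme_def by blast
  then show thesis using affine_openE[OF ringed_X] that by metis
qed

lemma sheaf_unique_X:
  assumes "\<And>V. V \<in> \<U> \<Longrightarrow> openin (tops \<X>) V" "s \<in> carrier (Osec \<X> (\<Union>\<U>))" "t \<in> carrier (Osec \<X> (\<Union>\<U>))"
    "\<And>V. V \<in> \<U> \<Longrightarrow> rst \<X> (\<Union>\<U>) V s = rst \<X> (\<Union>\<U>) V t"
  shows "s = t"
  using is_ringed(2)[unfolded is_ringed_space_def sheaf_of_sets_def, THEN conjunct1, THEN conjunct2,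
      THEN conjunct2, THEN conjunct2, THEN conjunct1] assms by blast

text \<open>The image of \<open>s\<close> is zero, which is no unit in the nonzero ring of sections
  over a nonempty open set of \<Y>. So \<open>s\<close> is invertible on no nonempty open set, hence
  locally zero on the integral scheme \<X>.\<close>

lemma sharp_kernel:
  assumes oU: "openin (tops \<X>) U" and s: "s \<in> carrier (Osec \<X> U)"
    and z: "sharp \<pi> U s = \<zero>\<^bsub>Osec \<Y> (preim \<Y> \<pi> U)\<^esub>"
  shows "s = \<zero>\<^bsub>Osec \<X> U\<^esub>"
proof -
  let ?\<U> = "{V. openin (tops \<X>) V \<and> V \<subseteq> U \<and> rst \<X> U V s = \<zero>\<^bsub>Osec \<X> V\<^esub>}"
  interpret U: cring "Osec \<X> U" using ringed_space_cring[OF ringed_X oU] .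
  have res0: "rst \<X> U V \<zero>\<^bsub>Osec \<X> U\<^esub> = \<zero>\<^bsub>Osec \<X> V\<^esub>" if "openin (tops \<X>) V" "V \<subseteq> U" for V
    using ring_hom_zero[OF ringed_space_rst[OF ringed_X oU that]] ringed_space_cring[OF ringed_X that(1)]
      U.ring_axioms cring.axioms(1) by blast
  have "U \<subseteq> \<Union>?\<U>"
  proof
    fix x assume x: "x \<in> U"
    then obtain U' \<phi> where c: "affine_chart \<X> U' \<phi>" "x \<in> U'" using chart_X openin_subset[OF oU] by blast
    interpret affine_chart \<X> U' \<phi> by (rule c(1))
    have "\<exists>V. openin (tops \<X>) V \<and> x \<in> V \<and> V \<subseteq> U \<and> rst \<X> U V s = \<zero>\<^bsub>Osec \<X> V\<^esub>"
    proof (rule locally_zero[OF domain_X _ oU x c(2) s])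
      \<comment> \<open>The empty family covers the empty set, so the sheaf condition identifies any
        two sections there.\<close>
      fix a b assume "a \<in> carrier (Osec \<X> {})" "b \<in> carrier (Osec \<X> {})"
      then show "a = b" using sheaf_unique_X[of "{}" a b] by simp
    next
      fix V assume V: "openin (tops \<X>) V" "V \<noteq> {}" "V \<subseteq> U"
      let ?V = "preim \<Y> \<pi> V"
      have ne: "?V \<noteq> {}" using im_pre[OF V(1)] V(2) by blast
      interpret D: domain "Osec \<Y> ?V" using domain_Y[OF pre_open[OF V(1)] ne] .
      interpret PU: cring "Osec \<Y> (preim \<Y> \<pi> U)" using ringed_space_cring[OF ringed_Y pre_open[OF oU]] .
      have "sharp \<pi> V (rst \<X> U V s) = \<zero>\<^bsub>Osec \<Y> ?V\<^esub>"
        unfolding sharp_rst[OF oU V(1,3) s] z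
        using ring_hom_zero[OF ringed_space_rst[OF ringed_Y pre_open[OF oU] pre_open[OF V(1)] pre_mono[OF V(3)]]
            PU.ring_axioms D.ring_axioms] .
      moreover have "\<zero>\<^bsub>Osec \<Y> ?V\<^esub> \<notin> Units (Osec \<Y> ?V)"
        unfolding Units_def using D.one_not_zero by auto
      ultimately show "rst \<X> U V s \<notin> Units (Osec \<X> V)"
        using ring_hom_Units[OF sharp_hom[OF V(1)]] by metis
    qed
    then show "x \<in> \<Union>?\<U>" by blast
  qed
  then have eq: "\<Union>?\<U> = U" by blast
  show ?thesis
  proof (rule sheaf_unique_X[of ?\<U>, unfolded eq, OF _ s U.zero_closed])
    fix V assume "V \<in> ?\<U>"
    then show "openin (tops \<X>) V" "rst \<X> U V s = rst \<X> U V \<zero>\<^bsub>Osec \<X> U\<^esub>" using res0 by auto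
  qed
qed

lemma h_inj:
  assumes W: "openin T W"
  shows "inj_on (h W) (carrier (Osec \<A> W))"
proof (rule inj_onI)
  interpret r: ringed_pair \<Y> \<A> h by (rule pair)
  interpret A: cring "Osec \<A> W" using ringed_space_cring[OF ringed_A] W unfolding A_simps(1) by blast
  interpret B: cring "Osec \<Y> W" using ringed_space_cring[OF ringed_Y W] .
  interpret h: ring_hom_cring "Osec \<A> W" "Osec \<Y> W" "h W"
    using r.h_hom[OF W] by (intro ring_hom_cring.intro ring_hom_cring_axioms.intro A.is_cring B.is_cring)
  fix a b assume a: "a \<in> carrier (Osec \<A> W)" and b: "b \<in> carrier (Osec \<A> W)" and e: "h W a = h W b"
  have "h W (a \<oplus>\<^bsub>Osec \<A> W\<^esub> \<ominus>\<^bsub>Osec \<A> W\<^esub> b) = \<zero>\<^bsub>Osec \<Y> W\<^esub>" using a b e by (simp add: B.r_neg)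
  then have "a \<oplus>\<^bsub>Osec \<A> W\<^esub> \<ominus>\<^bsub>Osec \<A> W\<^esub> b = \<zero>\<^bsub>Osec \<A> W\<^esub>"
    using sharp_kernel[OF im_open[OF W], of "a \<oplus>\<^bsub>Osec \<A> W\<^esub> \<ominus>\<^bsub>Osec \<A> W\<^esub> b"] a b
    unfolding A_simps inv_image_map_def pre_im[OF W] by (metis A.a_closed A.a_inv_closed A_simps(2))
  then show "a = b" using a b by (metis A.minus_eq A.r_right_minus_eq)
qed

lemma char_A:
  assumes W: "openin T W"
  shows "[p] \<cdot>\<^bsub>Osec \<A> W\<^esub> \<one>\<^bsub>Osec \<A> W\<^esub> = \<zero>\<^bsub>Osec \<A> W\<^esub>"
proof -
  interpret r: ringed_pair \<Y> \<A> h by (rule pair)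
  interpret A: cring "Osec \<A> W" using ringed_space_cring[OF ringed_A] W unfolding A_simps(1) by blast
  interpret B: cring "Osec \<Y> W" using ringed_space_cring[OF ringed_Y W] .
  interpret h: ring_hom_cring "Osec \<A> W" "Osec \<Y> W" "h W"
    using r.h_hom[OF W] by (intro ring_hom_cring.intro ring_hom_cring_axioms.intro A.is_cring B.is_cring)
  have "h W ([n] \<cdot>\<^bsub>Osec \<A> W\<^esub> \<one>\<^bsub>Osec \<A> W\<^esub>) = [n] \<cdot>\<^bsub>Osec \<Y> W\<^esub> \<one>\<^bsub>Osec \<Y> W\<^esub>" for n :: nat
    by (induction n) (simp_all add: A.add.nat_pow_Suc B.add.nat_pow_Suc)
  from this[of p] have "h W ([p] \<cdot>\<^bsub>Osec \<A> W\<^esub> \<one>\<^bsub>Osec \<A> W\<^esub>) = h W \<zero>\<^bsub>Osec \<A> W\<^esub>"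
    unfolding char_Y[OF W] by simp
  then show ?thesis by (rule inj_onD[OF h_inj[OF W]]) simp_all
qed

lemma subring_vimage:
  assumes "cring R" "cring S" "r \<in> ring_hom R S" "subring H S"
  shows "subring {b \<in> carrier R. r b \<in> H} R"
proof -
  interpret R: cring R by (rule assms)
  interpret S: cring S by (rule assms)
  interpret r: ring_hom_cring R S r
    using assms(3) by (intro ring_hom_cring.intro ring_hom_cring_axioms.intro R.is_cring S.is_cring)
  show ?thesis
    using subringE[OF assms(4)] by (intro R.subringI) auto
qed

text \<open>Finite type provides generators over the constants \<open>L\<close>, whereas the ring
  coming from \<X> is only known to contain the constants \<open>K\<close>. A finite spanning set of
  \<open>L\<close> over \<open>K\<close> bridges the gap.\<close>

lemma finite_generators:
  assumes y: "y \<in> topspace T"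
  obtains U G where "affine_open \<Y> U" "y \<in> U" "finite G" "G \<subseteq> carrier (Osec \<Y> U)"
    "\<And>H. subring H (Osec \<Y> U) \<Longrightarrow> h U ` carrier (Osec \<A> U) \<union> G \<subseteq> H \<Longrightarrow> H = carrier (Osec \<Y> U)"
proof -
  interpret L: field L by (rule L)
  interpret r: ringed_pair \<Y> \<A> h by (rule pair)
  have "finite_type_over L \<kappa>\<^sub>L \<Y>" using var_Y unfolding variety_over_def by simp
  then obtain \<U> where \<U>: "\<Union>\<U> = topspace T" "\<forall>U\<in>\<U>. affine_open \<Y> U \<and>
      (\<exists>G. finite G \<and> G \<subseteq> carrier (Osec \<Y> U) \<and>
         generate_ring (Osec \<Y> U) (rst \<Y> (topspace T) U ` \<kappa>\<^sub>L ` carrier L \<union> G) = carrier (Osec \<Y> U))"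
    unfolding finite_type_over_def by (elim exE conjE)
  obtain U where U: "U \<in> \<U>" "y \<in> U" using y \<U>(1) by blast
  have aff: "affine_open \<Y> U" using bspec[OF \<U>(2) U(1)] by (rule conjunct1)
  have "\<exists>G. finite G \<and> G \<subseteq> carrier (Osec \<Y> U) \<and>
         generate_ring (Osec \<Y> U) (rst \<Y> (topspace T) U ` \<kappa>\<^sub>L ` carrier L \<union> G) = carrier (Osec \<Y> U)"
    using bspec[OF \<U>(2) U(1)] by (rule conjunct2)
  then obtain G where G: "finite G" "G \<subseteq> carrier (Osec \<Y> U)"
    "generate_ring (Osec \<Y> U) (rst \<Y> (topspace T) U ` \<kappa>\<^sub>L ` carrier L \<union> G) = carrier (Osec \<Y> U)"
    by (elim exE conjE)
  have oU: "openin T U" using aff unfolding affine_open_def by simp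
  interpret R: cring "Osec \<Y> U" using ringed_space_cring[OF ringed_Y oU] .
  let ?c = "\<lambda>x. rst \<Y> (topspace T) U (\<kappa>\<^sub>L x)"
  have k: "\<kappa>\<^sub>L \<in> ring_hom L (Osec \<Y> (topspace T))" using var_Y unfolding variety_over_def by simp
  have rU: "rst \<Y> (topspace T) U \<in> ring_hom (Osec \<Y> (topspace T)) (Osec \<Y> U)"
    using ringed_space_rst[OF ringed_Y _ oU] openin_subset[OF oU] by simp
  have c: "?c \<in> ring_hom L (Osec \<Y> U)" using ring_hom_trans[OF k rU] unfolding comp_def .
  obtain n where "L.dimension n K (carrier L)"
    using fin unfolding finite_purely_insep_ext_def L.finite_dimension_def by blast
  then obtain Vs where Vs: "set Vs \<subseteq> carrier L" "L.Span K Vs = carrier L"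
    using L.exists_base[OF K] by blast
  \<comment> \<open>Compatibility of \<open>\<pi>\<close> with the two structure maps: constants
    from \<open>K\<close> on \<Y> are images of constants on \<X>.\<close>
  have Kc: "?c x \<in> h U ` carrier (Osec \<A> U)" if x: "x \<in> K" for x
  proof -
    have kK: "\<kappa>\<^sub>K x \<in> carrier (Osec \<X> (topspace (tops \<X>)))"
    proof -
      have "\<kappa>\<^sub>K \<in> ring_hom (L\<lparr>carrier := K\<rparr>) (Osec \<X> (topspace (tops \<X>)))"
        using var_X unfolding variety_over_def by simp
      from ring_hom_closed[OF this, of x] show ?thesis using x by simp
    qed
    then have kA: "\<kappa>\<^sub>K x \<in> carrier (Osec \<A> (topspace T))" unfolding A_simps pi_top .
    have oT: "openin T (topspace T)" "U \<subseteq> topspace T" using openin_subset[OF oU] by auto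
    have "?c x = rst \<Y> (topspace T) U (h (topspace T) (\<kappa>\<^sub>K x))"
      using compat[OF x] unfolding inv_image_map_def pi_top by simp
    also have "\<dots> = h U (rst \<A> (topspace T) U (\<kappa>\<^sub>K x))" using r.h_rst[OF oT(1) oU oT(2) kA] by simp
    finally show ?thesis
      using ringed_space_rst_closed[OF ringed_A, of "topspace T" U, unfolded A_simps(1), OF oT(1) oU oT(2) kA] by blast
  qed
  let ?G = "G \<union> ?c ` set Vs"
  have "H = carrier (Osec \<Y> U)" if H: "subring H (Osec \<Y> U)" "h U ` carrier (Osec \<A> U) \<union> ?G \<subseteq> H" for H
  proof -
    have "?c v \<in> H" if "set Us \<subseteq> set Vs" "v \<in> L.Span K Us" for v Us
      using that
    proof (induction Us arbitrary: v)
      case Nil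
      then have "?c v = \<zero>\<^bsub>Osec \<Y> U\<^esub>" using ring_hom_zero[OF c L.ring_axioms R.ring_axioms] by simp
      then show ?case using subringE(2)[OF H(1)] by simp
    next
      case (Cons u Us)
      then have "v \<in> L.line_extension K u (L.Span K Us)" by simp
      then obtain k w where w: "k \<in> K" "w \<in> L.Span K Us" "v = k \<otimes>\<^bsub>L\<^esub> u \<oplus>\<^bsub>L\<^esub> w"
        unfolding L.line_extension_mem_iff by blast
      have KL: "K \<subseteq> carrier L" using subfieldE(3)[OF K] .
      have cl: "k \<in> carrier L" "u \<in> carrier L" using w(1) KL Cons.prems(1) Vs(1) by auto
      have wL: "w \<in> carrier L" using L.Span_in_carrier[OF KL, of Us] w(2) Cons.prems(1) Vs(1) by auto
      have "?c v = ?c k \<otimes>\<^bsub>Osec \<Y> U\<^esub> ?c u \<oplus>\<^bsub>Osec \<Y> U\<^esub> ?c w"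
        unfolding w(3) using cl wL ring_hom_add[OF c, of "k \<otimes>\<^bsub>L\<^esub> u" w] ring_hom_mult[OF c, of k u] by simp
      moreover have "?c w \<in> H" using Cons.IH[of w] Cons.prems(1) w(2) by simp
      moreover have "?c k \<in> H" "?c u \<in> H" using Kc[OF w(1)] H(2) Cons.prems(1) by auto
      ultimately show ?case using subringE(6,7)[OF H(1)] by simp
    qed
    then have "?c ` carrier L \<subseteq> H" using Vs(2) by blast
    then have "generate_ring (Osec \<Y> U) (rst \<Y> (topspace T) U ` \<kappa>\<^sub>L ` carrier L \<union> G) \<subseteq> H"
      using H subringE(1)[OF H(1)] by (intro R.generate_ring_min_subring1) (auto simp: image_image)
    then show ?thesis using G(3) subringE(1)[OF H(1)] by blast
  qed
  moreover have "?G \<subseteq> carrier (Osec \<Y> U)" using G(2) Vs(1) ring_hom_closed[OF c] by blast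
  moreover have "finite ?G" using G(1) by simp
  ultimately show thesis using that[OF aff U(2), of ?G] by blast
qed

text \<open>Collects what is used of an affine chart: a base of open sets on which restrictions of
  the same finite set still generate, and the prime ideals of non-units. Generation passes to
  \<open>Df f\<close> because the one new element \<open>1/f\<close> already lies in the
  subring.\<close>

lemma good_base:
  assumes y: "y \<in> topspace T"
  obtains U G \<B> where "openin T U" "y \<in> U" "finite G" "G \<subseteq> carrier (Osec \<Y> U)"
    "\<And>W. W \<in> \<B> \<Longrightarrow> openin T W \<and> W \<subseteq> U"
    "\<And>Z z. openin T Z \<Longrightarrow> z \<in> Z \<Longrightarrow> z \<in> U \<Longrightarrow> \<exists>W\<in>\<B>. z \<in> W \<and> W \<subseteq> Z"
    "\<And>W H. W \<in> \<B> \<Longrightarrow> subring H (Osec \<Y> W) \<Longrightarrow> h W ` carrier (Osec \<A> W) \<union> rst \<Y> U W ` G \<subseteq> H \<Longrightarrow>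
      H = carrier (Osec \<Y> W)"
    "\<And>Z z. openin T Z \<Longrightarrow> z \<in> Z \<Longrightarrow> z \<in> U \<Longrightarrow>
      primeideal {b \<in> carrier (Osec \<Y> Z). \<not> germ_unit \<Y> z Z b} (Osec \<Y> Z)"
proof -
  obtain U G where G: "affine_open \<Y> U" "y \<in> U" "finite G" "G \<subseteq> carrier (Osec \<Y> U)"
    "\<And>H. subring H (Osec \<Y> U) \<Longrightarrow> h U ` carrier (Osec \<A> U) \<union> G \<subseteq> H \<Longrightarrow> H = carrier (Osec \<Y> U)"
    using finite_generators[OF y] by blast
  obtain \<phi> where \<phi>: "affine_chart \<Y> U \<phi>" using affine_openE[OF ringed_Y G(1)] by blast
  interpret affine_chart \<Y> U \<phi> by (rule \<phi>)
  interpret r: ringed_pair \<Y> \<A> h by (rule pair)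
  obtain F where F: "\<And>W. openin T W \<Longrightarrow> F W \<in> ring_hom (Osec \<Y> W) (Osec \<A> W)"
    "\<And>W b. openin T W \<Longrightarrow> b \<in> carrier (Osec \<Y> W) \<Longrightarrow> h W (F W b) = b [^]\<^bsub>Osec \<Y> W\<^esub> p"
    using frobenius_section by blast
  have gen: "H = carrier (Osec \<Y> (Df f))"
    if f: "f \<in> carrier R" and H: "subring H (Osec \<Y> (Df f))"
      "h (Df f) ` carrier (Osec \<A> (Df f)) \<union> rst \<Y> U (Df f) ` G \<subseteq> H" for f H
  proof -
    let ?S = "Osec \<Y> (Df f)" and ?r = "rst \<Y> U (Df f)"
    note o = Df_open[OF f]
    interpret S: cring ?S using ringed_space_cring[OF ringed_Y o] .
    \<comment> \<open>The preimage of \<open>H\<close> contains generators of \<open>R\<close> and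
      so is all of \<open>R\<close>; it remains to put the denominators into
      \<open>H\<close>.\<close>
    let ?H = "{b \<in> carrier R. ?r b \<in> H}"
    have "subring ?H R" by (rule subring_vimage[OF cring_R S.is_cring res_hom[OF f] H(1)])
    moreover have "h U a \<in> ?H" if a: "a \<in> carrier (Osec \<A> U)" for a
    proof -
      have "?r (h U a) = h (Df f) (rst \<A> U (Df f) a)" using r.h_rst[OF U o Df_sub a] by simp
      moreover have "rst \<A> U (Df f) a \<in> carrier (Osec \<A> (Df f))"
        using ringed_space_rst_closed[OF ringed_A, of U "Df f", unfolded A_simps(1), OF U o Df_sub a] .
      ultimately show ?thesis using H(2) ring_hom_closed[OF r.h_hom[OF U] a] by auto
    qed
    moreover have "G \<subseteq> ?H" using G(4) H(2) by auto
    ultimately have all: "?H = carrier R" by (intro G(5)) auto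
    have rf: "?r f \<in> carrier ?S" "?r f \<in> H" using all f ring_hom_closed[OF res_hom[OF f] f] by auto
    have powH: "b [^]\<^bsub>?S\<^esub> (k::nat) \<in> H" if "b \<in> H" for b k
      using that subringE(3,6)[OF H(1)] by (induction k) auto
    have "Units (Osec \<A> (Df f)) \<subseteq> carrier (Osec \<A> (Df f))" unfolding Units_def by blast
    obtain q where q: "p = Suc q" using prime_gt_0_nat[OF p] gr0_conv_Suc by blast
    have "F (Df f) (?r f) \<in> Units (Osec \<A> (Df f))"
      by (rule ring_hom_Units[OF F(1)[OF o] res_unit[OF f]])
    then obtain a where a: "a \<in> carrier (Osec \<A> (Df f))"
      "F (Df f) (?r f) \<otimes>\<^bsub>Osec \<A> (Df f)\<^esub> a = \<one>\<^bsub>Osec \<A> (Df f)\<^esub>" "F (Df f) (?r f) \<in> carrier (Osec \<A> (Df f))"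
      unfolding Units_def by blast
    have ha: "h (Df f) a \<in> H" "h (Df f) a \<in> carrier ?S" using H(2) a(1) ring_hom_closed[OF r.h_hom[OF o] a(1)] by auto
    have "?r f [^]\<^bsub>?S\<^esub> p \<otimes>\<^bsub>?S\<^esub> h (Df f) a = \<one>\<^bsub>?S\<^esub>"
      using ring_hom_mult[OF r.h_hom[OF o] a(3,1)] ring_hom_one[OF r.h_hom[OF o]] F(2)[OF o rf(1)] a(2) by simp
    \<comment> \<open>The inverse of \<open>f\<close> is \<open>f^(p-1)\<close> times the inverse of
      \<open>f^p\<close>, and the latter comes from \<X>, since \<open>F\<close> sends the unit
      \<open>f\<close> to a unit.\<close>
    define w where "w = ?r f [^]\<^bsub>?S\<^esub> q \<otimes>\<^bsub>?S\<^esub> h (Df f) a"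
    have w: "w \<in> H" "w \<in> carrier ?S" "?r f \<otimes>\<^bsub>?S\<^esub> w = \<one>\<^bsub>?S\<^esub>"
    proof -
      show "w \<in> H" unfolding w_def using powH[OF rf(2)] ha(1) subringE(6)[OF H(1)] by blast
      show "w \<in> carrier ?S" unfolding w_def using rf ha by simp
      show "?r f \<otimes>\<^bsub>?S\<^esub> w = \<one>\<^bsub>?S\<^esub>"
        using \<open>?r f [^]\<^bsub>?S\<^esub> p \<otimes>\<^bsub>?S\<^esub> h (Df f) a = \<one>\<^bsub>?S\<^esub>\<close> rf ha unfolding w_def q by (simp add: S.m_ac)
    qed
    have wn: "?r f [^]\<^bsub>?S\<^esub> (n::nat) \<otimes>\<^bsub>?S\<^esub> w [^]\<^bsub>?S\<^esub> n = \<one>\<^bsub>?S\<^esub>" for n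
    proof (induction n)
      case (Suc n)
      have "?r f [^]\<^bsub>?S\<^esub> Suc n \<otimes>\<^bsub>?S\<^esub> w [^]\<^bsub>?S\<^esub> Suc n
          = (?r f [^]\<^bsub>?S\<^esub> n \<otimes>\<^bsub>?S\<^esub> w [^]\<^bsub>?S\<^esub> n) \<otimes>\<^bsub>?S\<^esub> (?r f \<otimes>\<^bsub>?S\<^esub> w)"
        using rf w(2) by (simp add: S.m_ac)
      then show ?case using Suc w by simp
    qed simp
    have "b \<in> H" if b: "b \<in> carrier ?S" for b
    proof -
      obtain c n where c: "c \<in> carrier R" "b \<otimes>\<^bsub>?S\<^esub> ?r f [^]\<^bsub>?S\<^esub> (n::nat) = ?r c" using frac[OF f b] by blast
      have "b = (b \<otimes>\<^bsub>?S\<^esub> ?r f [^]\<^bsub>?S\<^esub> n) \<otimes>\<^bsub>?S\<^esub> w [^]\<^bsub>?S\<^esub> n"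
        using wn[of n] b rf w(2) by (simp add: S.m_assoc)
      also have "\<dots> \<in> H"
        unfolding c(2) using c(1) all powH[OF w(1)] by (intro subringE(6)[OF H(1)]) auto
      finally show ?thesis .
    qed
    then show ?thesis using subringE(1)[OF H(1)] by blast
  qed
  show thesis
  proof (rule that[of U G "Df ` carrier R"])
    show "openin T U" "y \<in> U" "finite G" "G \<subseteq> carrier (Osec \<Y> U)" using U G by auto
    show "openin T W \<and> W \<subseteq> U" if "W \<in> Df ` carrier R" for W using that Df_open Df_sub by blast
    show "\<exists>W\<in>Df ` carrier R. z \<in> W \<and> W \<subseteq> Z" if "openin T Z" "z \<in> Z" "z \<in> U" for Z z
    proof (rule Df_base[OF that])
      fix f assume "f \<in> carrier R" "z \<in> Df f" "Df f \<subseteq> Z"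
      then show ?thesis by (intro bexI[of _ "Df f"]) auto
    qed
    show "H = carrier (Osec \<Y> W)"
      if W: "W \<in> Df ` carrier R" and H: "subring H (Osec \<Y> W)"
        "h W ` carrier (Osec \<A> W) \<union> rst \<Y> U W ` G \<subseteq> H" for W H
    proof -
      obtain f where f: "W = Df f" "f \<in> carrier R" using W by (rule imageE)
      then show ?thesis using gen[OF f(2), of H] H by simp
    qed
    show "primeideal {b \<in> carrier (Osec \<Y> Z). \<not> germ_unit \<Y> z Z b} (Osec \<Y> Z)"
      if "openin T Z" "z \<in> Z" "z \<in> U" for Z z
      using nonunits_prime[OF that] unfolding nonunits_def .
  qed
qed

end

section \<open>Differentials\<close>

context frobenius_factor
begin

sublocale pair: ringed_pair \<Y> \<A> h by (rule pair)

abbreviation "KP \<equiv> Omega_presheaf \<Y> \<X> \<pi>"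
abbreviation "Om \<equiv> Omega \<Y> \<X> \<pi>"
abbreviation "kgens V \<equiv> kaehler_gens (Osec \<Y> V)"
abbreviation "krels V \<equiv> kaehler_rels (Osec \<A> V) (h V) (Osec \<Y> V)"
abbreviation "kcl V \<equiv> kaehler_class (Osec \<A> V) (h V) (Osec \<Y> V)"
abbreviation "dif \<equiv> diff \<Y> \<X> \<pi>"

lemma KP_eq: "KP = pair.kaehler_presheaf"
  unfolding Omega_presheaf_def pair.kaehler_presheaf_def ..

sublocale KP: module_presheaf \<Y> KP
  unfolding KP_eq by (rule pair.kaehler_presheaf(1))

lemma Om_eq: "Om = sheafify \<Y> KP" unfolding Omega_def ..

sublocale Om: module_presheaf \<Y> Om
  unfolding Om_eq by (rule KP.sheafify_presheaf)

text \<open>The differential form that is the sum of \<open>b dc\<close> over the pairs in the list,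
  as a section of the associated sheaf.\<close>

definition form :: "'y set \<Rightarrow> ('b \<times> 'b) list \<Rightarrow> 'y \<Rightarrow> ('y set \<times> ('b \<times> 'b) list set) set" where
  "form V xs = sheafify_unit T KP V (kcl V xs)"

lemma KP_sec: "msec KP V = kaehler (Osec \<A> V) (h V) (Osec \<Y> V)"
  unfolding Omega_presheaf_def by simp

lemma kpres: "openin T V \<Longrightarrow> fs_presentation (Osec \<Y> V) (kgens V) (krels V) (\<lambda>b (b', c). (b \<otimes>\<^bsub>Osec \<Y> V\<^esub> b', c))"
  by (intro kaehler_presentation ringed_space_cring[OF ringed_Y] pair.h_hom)

lemma kcl_closed: "openin T V \<Longrightarrow> set xs \<subseteq> kgens V \<Longrightarrow> kcl V xs \<in> carrier (msec KP V)"
  unfolding KP_sec kaehler_def kaehler_class_def by (rule fs_presentation.class_carrier[OF kpres])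

lemma kgens_iff: "(b, c) \<in> kgens V \<longleftrightarrow> b \<in> carrier (Osec \<Y> V) \<and> c \<in> carrier (Osec \<Y> V)"
  unfolding kaehler_gens_def by simp

lemma form_closed: "openin T V \<Longrightarrow> set xs \<subseteq> kgens V \<Longrightarrow> form V xs \<in> carrier (msec Om V)"
  unfolding form_def Om_eq by (intro KP.unit_closed kcl_closed)

lemma form_append:
  assumes "openin T V" "set xs \<subseteq> kgens V" "set ys \<subseteq> kgens V"
  shows "form V (xs @ ys) = form V xs \<oplus>\<^bsub>msec Om V\<^esub> form V ys"
proof -
  have "kcl V (xs @ ys) = kcl V xs \<oplus>\<^bsub>msec KP V\<^esub> kcl V ys"
    unfolding KP_sec kaehler_def kaehler_class_def using assms(2,3) by (simp add: fs_module_add)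
  then show ?thesis
    unfolding form_def Om_eq using KP.unit_add[OF assms(1) kcl_closed kcl_closed] assms by simp
qed

lemma form_Nil: "form V [] = \<zero>\<^bsub>msec Om V\<^esub>"
  unfolding form_def Om_eq KP.sheafify_simps(2) KP_sec kaehler_def kaehler_class_def fs_module_simps ..

lemma form_Cons:
  assumes "openin T V" "g \<in> kgens V" "set xs \<subseteq> kgens V"
  shows "form V (g # xs) = form V [g] \<oplus>\<^bsub>msec Om V\<^esub> form V xs"
  using form_append[of V "[g]" xs] assms by simp

lemma form_cong: "fs_cong (kgens V) (krels V) xs ys \<Longrightarrow> form V xs = form V ys"
  unfolding form_def kaehler_class_def by (simp add: fs_class_eqI)

lemma dif_form: "dif V b = form V [(\<one>\<^bsub>Osec \<Y> V\<^esub>, b)]"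
  unfolding diff_def form_def ..

lemma smult_form:
  assumes V: "openin T V" and b: "b \<in> carrier (Osec \<Y> V)" and c: "c \<in> carrier (Osec \<Y> V)"
  shows "b \<odot>\<^bsub>msec Om V\<^esub> dif V c = form V [(b, c)]"
proof -
  interpret B: cring "Osec \<Y> V" using ringed_space_cring[OF ringed_Y V] .
  interpret k: fs_presentation "Osec \<Y> V" "kgens V" "krels V" "\<lambda>b (b', c). (b \<otimes>\<^bsub>Osec \<Y> V\<^esub> b', c)"
    by (rule kpres[OF V])
  have g: "set [(\<one>\<^bsub>Osec \<Y> V\<^esub>, c)] \<subseteq> kgens V" using c by (simp add: kgens_iff)
  have "b \<odot>\<^bsub>msec KP V\<^esub> kcl V [(\<one>\<^bsub>Osec \<Y> V\<^esub>, c)] = kcl V [(b, c)]"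
    unfolding KP_sec kaehler_def kaehler_class_def k.smult_class[OF b g] using b by simp
  then show ?thesis
    unfolding dif_form form_def Om_eq using KP.unit_smult[OF V kcl_closed[OF V g] b] by simp
qed

lemma form_res:
  assumes "openin T V" "openin T W" "W \<subseteq> V" "set xs \<subseteq> kgens V"
  shows "mrst Om V W (form V xs) = form W (map (map_prod (rst \<Y> V W) (rst \<Y> V W)) xs)"
  unfolding form_def Om_eq KP.unit_res[OF assms(1-3) kcl_closed[OF assms(1,4)]]
  unfolding KP_eq pair.kaehler_presheaf(2)[OF assms] ..

lemma dif_closed: "openin T V \<Longrightarrow> b \<in> carrier (Osec \<Y> V) \<Longrightarrow> dif V b \<in> carrier (msec Om V)"
  unfolding dif_form using cring.cring_simprules(6)[OF ringed_space_cring[OF ringed_Y]]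
  by (intro form_closed) (simp_all add: kgens_iff)

lemma dif_res:
  assumes "openin T V" "openin T W" "W \<subseteq> V" "b \<in> carrier (Osec \<Y> V)"
  shows "mrst Om V W (dif V b) = dif W (rst \<Y> V W b)"
proof -
  interpret B: cring "Osec \<Y> V" using ringed_space_cring[OF ringed_Y assms(1)] .
  have "set [(\<one>\<^bsub>Osec \<Y> V\<^esub>, b)] \<subseteq> kgens V" using assms(4) by (simp add: kgens_iff)
  from form_res[OF assms(1-3) this] show ?thesis
    unfolding dif_form using ring_hom_one[OF ringed_space_rst[OF ringed_Y assms(1-3)]] by simp
qed

lemma dif_add:
  assumes V: "openin T V" and b: "b \<in> carrier (Osec \<Y> V)" and c: "c \<in> carrier (Osec \<Y> V)"
  shows "dif V (b \<oplus>\<^bsub>Osec \<Y> V\<^esub> c) = dif V b \<oplus>\<^bsub>msec Om V\<^esub> dif V c"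
proof -
  interpret B: cring "Osec \<Y> V" using ringed_space_cring[OF ringed_Y V] .
  show ?thesis
    unfolding dif_form form_cong[OF kaehler_add_r[OF B.one_closed b c]]
    using b c V by (subst form_Cons) (simp_all add: kgens_iff)
qed

lemma dif_mult:
  assumes V: "openin T V" and b: "b \<in> carrier (Osec \<Y> V)" and c: "c \<in> carrier (Osec \<Y> V)"
  shows "dif V (b \<otimes>\<^bsub>Osec \<Y> V\<^esub> c) = b \<odot>\<^bsub>msec Om V\<^esub> dif V c \<oplus>\<^bsub>msec Om V\<^esub> c \<odot>\<^bsub>msec Om V\<^esub> dif V b"
proof -
  interpret B: cring "Osec \<Y> V" using ringed_space_cring[OF ringed_Y V] .
  have "dif V (b \<otimes>\<^bsub>Osec \<Y> V\<^esub> c) = form V [(b, c), (c, b)]"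
    unfolding dif_form form_cong[OF kaehler_leibniz[OF B.one_closed b c]] using b c by simp
  also have "\<dots> = form V [(b, c)] \<oplus>\<^bsub>msec Om V\<^esub> form V [(c, b)]"
    using b c V by (subst form_Cons) (simp_all add: kgens_iff)
  finally show ?thesis unfolding smult_form[OF V b c] smult_form[OF V c b] .
qed

lemma dif_const:
  assumes V: "openin T V" and a: "a \<in> carrier (Osec \<A> V)"
  shows "dif V (h V a) = \<zero>\<^bsub>msec Om V\<^esub>"
proof -
  interpret B: cring "Osec \<Y> V" using ringed_space_cring[OF ringed_Y V] .
  show ?thesis unfolding dif_form form_cong[OF kaehler_const[OF B.one_closed a]] form_Nil ..
qed

lemma Om_local:
  assumes V: "openin T V" "y \<in> V" and t: "t \<in> carrier (msec Om V)"
  obtains W xs where "openin T W" "y \<in> W" "W \<subseteq> V" "set xs \<subseteq> kgens W" "mrst Om V W t = form W xs"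
proof -
  obtain W m where W: "openin T W" "y \<in> W" "W \<subseteq> V" "m \<in> carrier (msec KP W)" "\<And>z. z \<in> W \<Longrightarrow> t z = germ T KP z W m"
    using KP.sec_local[OF t[unfolded Om_eq] V(2)] by blast
  obtain xs where xs: "m = kcl W xs" "set xs \<subseteq> kgens W"
    using W(4) unfolding KP_sec kaehler_def kaehler_class_def fs_module_simps by blast
  have "mrst Om V W t = form W xs"
    unfolding form_def xs(1)[symmetric]
  proof (rule KP.unit_eqI[OF W(1,4)])
    show "mrst Om V W t \<in> carrier (msec (sheafify \<Y> KP) W)"
      using Om.res_closed[OF V(1) W(1,3) t] unfolding Om_eq .
    show "mrst Om V W t z = germ T KP z W m" if "z \<in> W" for z
      using W(5)[OF that] that unfolding Om_eq KP.sheafify_simps by simp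
  qed
  then show thesis using that W xs by blast
qed

text \<open>A homomorphism from \<Omega> restricted to \<open>V\<close> to the structure sheaf,
  given by its values over the open subsets of \<open>V\<close>. Composed with \<open>d\<close> it
  is a derivation over \<X>.\<close>

definition functional :: "'y set \<Rightarrow> ('y set \<Rightarrow> ('y \<Rightarrow> ('y set \<times> ('b \<times> 'b) list set) set) \<Rightarrow> 'b) \<Rightarrow> bool" where
  "functional V l \<longleftrightarrow> (\<forall>W. openin T W \<and> W \<subseteq> V \<longrightarrow> (\<forall>t\<in>carrier (msec Om W).
      l W t \<in> carrier (Osec \<Y> W) \<and>
      (\<forall>t'\<in>carrier (msec Om W). l W (t \<oplus>\<^bsub>msec Om W\<^esub> t') = l W t \<oplus>\<^bsub>Osec \<Y> W\<^esub> l W t') \<and>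
      (\<forall>b\<in>carrier (Osec \<Y> W). l W (b \<odot>\<^bsub>msec Om W\<^esub> t) = b \<otimes>\<^bsub>Osec \<Y> W\<^esub> l W t) \<and>
      (\<forall>Z. openin T Z \<and> Z \<subseteq> W \<longrightarrow> l Z (mrst Om W Z t) = rst \<Y> W Z (l W t))))"

lemma functionalD:
  assumes "functional V l" "openin T W" "W \<subseteq> V" "t \<in> carrier (msec Om W)"
  shows "l W t \<in> carrier (Osec \<Y> W)"
    and "\<And>t'. t' \<in> carrier (msec Om W) \<Longrightarrow> l W (t \<oplus>\<^bsub>msec Om W\<^esub> t') = l W t \<oplus>\<^bsub>Osec \<Y> W\<^esub> l W t'"
    and "\<And>b. b \<in> carrier (Osec \<Y> W) \<Longrightarrow> l W (b \<odot>\<^bsub>msec Om W\<^esub> t) = b \<otimes>\<^bsub>Osec \<Y> W\<^esub> l W t"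
    and "\<And>Z. openin T Z \<Longrightarrow> Z \<subseteq> W \<Longrightarrow> l Z (mrst Om W Z t) = rst \<Y> W Z (l W t)"
  using assms unfolding functional_def by simp_all

lemma functional_mono: "functional V l \<Longrightarrow> V' \<subseteq> V \<Longrightarrow> functional V' l"
  unfolding functional_def by (meson order_trans)

lemma functional_zero:
  assumes "functional V l" "openin T W" "W \<subseteq> V"
  shows "l W \<zero>\<^bsub>msec Om W\<^esub> = \<zero>\<^bsub>Osec \<Y> W\<^esub>"
proof -
  interpret M: Module.module "Osec \<Y> W" "msec Om W" by (rule Om.module_sec[OF assms(2)])
  note f = functionalD[OF assms M.zero_closed]
  from f(2)[OF M.zero_closed] show ?thesis by (intro M.R.zero_unique) (simp_all add: f(1))
qed

lemma functional_form:
  assumes l: "functional V l" and W: "openin T W" "W \<subseteq> V" and "set xs \<subseteq> kgens W"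
  shows "l W (form W xs) = fs_eval (Osec \<Y> W) (\<lambda>(b, c). b \<otimes>\<^bsub>Osec \<Y> W\<^esub> l W (dif W c)) xs"
  using assms(4)
proof (induction xs)
  case Nil
  then show ?case unfolding form_Nil functional_zero[OF l W] by simp
next
  case (Cons g xs)
  obtain b c where g: "g = (b, c)" "b \<in> carrier (Osec \<Y> W)" "c \<in> carrier (Osec \<Y> W)"
    using Cons.prems kgens_iff by (cases g) auto
  have gW: "g \<in> kgens W" "set xs \<subseteq> kgens W" using Cons.prems by auto
  have f: "form W [g] \<in> carrier (msec Om W)" "form W xs \<in> carrier (msec Om W)"
    using gW by (auto intro!: form_closed[OF W(1)])
  have "l W (form W (g # xs)) = l W (form W [g]) \<oplus>\<^bsub>Osec \<Y> W\<^esub> l W (form W xs)"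
    unfolding form_Cons[OF W(1) gW] by (rule functionalD(2)[OF l W f])
  also have "l W (form W [g]) = b \<otimes>\<^bsub>Osec \<Y> W\<^esub> l W (dif W c)"
    unfolding g(1) smult_form[OF W(1) g(2,3), symmetric]
    by (rule functionalD(3)[OF l W dif_closed[OF W(1) g(3)] g(2)])
  also have "l W (form W xs) = fs_eval (Osec \<Y> W) (\<lambda>(b, c). b \<otimes>\<^bsub>Osec \<Y> W\<^esub> l W (dif W c)) xs"
    by (rule Cons.IH[OF gW(2)])
  finally show ?case unfolding g(1) by simp
qed

text \<open>A basis recorded together with its dual basis. Instead of expansions, joint injectivity
  of the dual functionals is required over every smaller open set; this passes to restrictions and
  is easy to maintain when one basis element is exchanged.\<close>

definition frame :: "'y set \<Rightarrow> nat \<Rightarrow> (nat \<Rightarrow> 'y set \<Rightarrow> ('y \<Rightarrow> ('y set \<times> ('b \<times> 'b) list set) set) \<Rightarrow> 'b) \<Rightarrow>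
    (nat \<Rightarrow> 'y \<Rightarrow> ('y set \<times> ('b \<times> 'b) list set) set) \<Rightarrow> bool" where
  "frame V n l e \<longleftrightarrow> openin T V \<and> (\<forall>i<n. functional V (l i) \<and> e i \<in> carrier (msec Om V) \<and>
      (\<forall>j<n. l i V (e j) = (if i = j then \<one>\<^bsub>Osec \<Y> V\<^esub> else \<zero>\<^bsub>Osec \<Y> V\<^esub>))) \<and>
    (\<forall>W. openin T W \<and> W \<subseteq> V \<longrightarrow> (\<forall>t\<in>carrier (msec Om W). \<forall>t'\<in>carrier (msec Om W).
      (\<forall>i<n. l i W t = l i W t') \<longrightarrow> t = t'))"

lemma frameD:
  assumes "frame V n l e"
  shows "openin T V"
    and "\<And>i. i < n \<Longrightarrow> functional V (l i)"
    and "\<And>i. i < n \<Longrightarrow> e i \<in> carrier (msec Om V)"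
    and "\<And>i j. i < n \<Longrightarrow> j < n \<Longrightarrow> l i V (e j) = (if i = j then \<one>\<^bsub>Osec \<Y> V\<^esub> else \<zero>\<^bsub>Osec \<Y> V\<^esub>)"
    and "\<And>W t t'. openin T W \<Longrightarrow> W \<subseteq> V \<Longrightarrow> t \<in> carrier (msec Om W) \<Longrightarrow> t' \<in> carrier (msec Om W) \<Longrightarrow>
      (\<And>i. i < n \<Longrightarrow> l i W t = l i W t') \<Longrightarrow> t = t'"
  using assms unfolding frame_def by simp_all

lemma rst_delta:
  assumes "openin T V" "openin T W" "W \<subseteq> V"
  shows "rst \<Y> V W (if P then \<one>\<^bsub>Osec \<Y> V\<^esub> else \<zero>\<^bsub>Osec \<Y> V\<^esub>) = (if P then \<one>\<^bsub>Osec \<Y> W\<^esub> else \<zero>\<^bsub>Osec \<Y> W\<^esub>)"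
  using ring_hom_one[OF ringed_space_rst[OF ringed_Y assms]]
    ring_hom_zero[OF ringed_space_rst[OF ringed_Y assms]] ringed_space_cring[OF ringed_Y assms(1)]
    ringed_space_cring[OF ringed_Y assms(2)] by (simp add: cring.axioms(1))

lemma frame_res:
  assumes f: "frame V n l e" and W: "openin T W" "W \<subseteq> V"
  shows "frame W n l (\<lambda>i. mrst Om V W (e i))"
  unfolding frame_def
proof (intro conjI allI impI ballI)
  show "openin T W" by (rule W(1))
  note fD = frameD[OF f]
  fix i assume i: "i < n"
  show "functional W (l i)" by (rule functional_mono[OF fD(2)[OF i] W(2)])
  show "mrst Om V W (e i) \<in> carrier (msec Om W)" by (rule Om.res_closed[OF fD(1) W fD(3)[OF i]])
  fix j assume j: "j < n"
  show "l i W (mrst Om V W (e j)) = (if i = j then \<one>\<^bsub>Osec \<Y> W\<^esub> else \<zero>\<^bsub>Osec \<Y> W\<^esub>)"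
    unfolding functionalD(4)[OF fD(2)[OF i] fD(1) order_refl fD(3)[OF j] W] fD(4)[OF i j]
    by (rule rst_delta[OF fD(1) W])
next
  fix Z t t' assume "openin T Z \<and> Z \<subseteq> W" "t \<in> carrier (msec Om Z)" "t' \<in> carrier (msec Om Z)"
    "\<forall>i<n. l i Z t = l i Z t'"
  then show "t = t'" using frameD(5)[OF f, of Z t t'] W(2) by auto
qed

text \<open>The dual functionals are the coordinate functions. Uniqueness of coordinates makes them
  linear and compatible with restriction, since sums, multiples and restrictions of expansions are
  again expansions.\<close>

lemma locally_free_frame:
  assumes lf: "locally_free_sheaf \<Y> Om" and y: "y \<in> topspace T"
  obtains V n l e where "y \<in> V" "frame V n l e"
proof -
  obtain V n e where V: "openin T V" "y \<in> V" and e: "e \<in> {..<n} \<rightarrow> carrier (msec Om V)"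
    and ex: "\<forall>W. openin T W \<and> W \<subseteq> V \<longrightarrow> (\<forall>t\<in>carrier (msec Om W).
           \<exists>!a. a \<in> {..<n} \<rightarrow>\<^sub>E carrier (Osec \<Y> W) \<and> t = lin_comb Om V n e W a)"
    using bspec[OF lf[unfolded locally_free_sheaf_def] y] by (elim exE conjE)
  define co where "co W t = (THE a. a \<in> {..<n} \<rightarrow>\<^sub>E carrier (Osec \<Y> W) \<and> t = lin_comb Om V n e W a)" for W t
  have er: "mrst Om V W (e i) \<in> carrier (msec Om W)" if "openin T W" "W \<subseteq> V" "i < n" for W i
    using Om.res_closed[OF V(1) that(1,2)] e that(3) by auto
  have co: "co W t \<in> {..<n} \<rightarrow>\<^sub>E carrier (Osec \<Y> W)" "t = lin_comb Om V n e W (co W t)"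
    if "openin T W" "W \<subseteq> V" "t \<in> carrier (msec Om W)" for W t
  proof -
    have "\<exists>!a. a \<in> {..<n} \<rightarrow>\<^sub>E carrier (Osec \<Y> W) \<and> t = lin_comb Om V n e W a" using ex that by simp
    from theI'[OF this] show "co W t \<in> {..<n} \<rightarrow>\<^sub>E carrier (Osec \<Y> W)" "t = lin_comb Om V n e W (co W t)"
      unfolding co_def[symmetric] by simp_all
  qed
  have co_eq: "co W t i = a i"
    if W: "openin T W" "W \<subseteq> V" and t: "t \<in> carrier (msec Om W)" and a: "a \<in> {..<n} \<rightarrow> carrier (Osec \<Y> W)"
      "t = lin_comb Om V n e W a" and i: "i < n" for W t a i
  proof -
    interpret M: Module.module "Osec \<Y> W" "msec Om W" by (rule Om.module_sec[OF W(1)])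
    \<comment> \<open>Unique existence is stated for extensional families, so the given coordinates
      are first cut off outside the index range.\<close>
    have "lin_comb Om V n e W (restrict a {..<n}) = lin_comb Om V n e W a"
      unfolding lin_comb_def using a(1) er[OF W] by (intro M.finsum_cong') auto
    then have "restrict a {..<n} \<in> {..<n} \<rightarrow>\<^sub>E carrier (Osec \<Y> W) \<and> t = lin_comb Om V n e W (restrict a {..<n})"
      using a by simp
    moreover have "\<exists>!a. a \<in> {..<n} \<rightarrow>\<^sub>E carrier (Osec \<Y> W) \<and> t = lin_comb Om V n e W a" using ex W t by simp
    ultimately have "co W t = restrict a {..<n}" unfolding co_def by (intro the1_equality)
    then show ?thesis using i by simp
  qed
  have fn: "functional V (\<lambda>W t. co W t i)" if i: "i < n" for i
    unfolding functional_def
  proof (intro allI impI ballI conjI; (elim conjE)?)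
    fix W t assume W: "openin T W" "W \<subseteq> V" and t: "t \<in> carrier (msec Om W)"
    interpret M: Module.module "Osec \<Y> W" "msec Om W" by (rule Om.module_sec[OF W(1)])
    note ct = co[OF W t]
    have ct1: "co W t \<in> {..<n} \<rightarrow> carrier (Osec \<Y> W)" using ct(1) by auto
    have s: "(\<lambda>i. a i \<odot>\<^bsub>msec Om W\<^esub> mrst Om V W (e i)) \<in> {..<n} \<rightarrow> carrier (msec Om W)"
      if "a \<in> {..<n} \<rightarrow> carrier (Osec \<Y> W)" for a using that er[OF W] by auto
    show "co W t i \<in> carrier (Osec \<Y> W)" using ct1 i by auto
    {
      fix t' assume t': "t' \<in> carrier (msec Om W)"
      note ct' = co[OF W t']
      have ct'1: "co W t' \<in> {..<n} \<rightarrow> carrier (Osec \<Y> W)" using ct'(1) by auto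
      have "lin_comb Om V n e W (\<lambda>i. co W t i \<oplus>\<^bsub>Osec \<Y> W\<^esub> co W t' i)
          = (\<Oplus>\<^bsub>msec Om W\<^esub>i\<in>{..<n}. co W t i \<odot>\<^bsub>msec Om W\<^esub> mrst Om V W (e i) \<oplus>\<^bsub>msec Om W\<^esub> co W t' i \<odot>\<^bsub>msec Om W\<^esub> mrst Om V W (e i))"
        unfolding lin_comb_def using s[OF ct1] s[OF ct'1] ct1 ct'1 er[OF W]
        by (intro M.finsum_cong') (auto intro!: M.smult_l_distr)
      also have "\<dots> = t \<oplus>\<^bsub>msec Om W\<^esub> t'"
        unfolding M.finsum_addf[OF s[OF ct1] s[OF ct'1]]
          ct(2)[unfolded lin_comb_def, symmetric] ct'(2)[unfolded lin_comb_def, symmetric] ..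
      finally have *: "t \<oplus>\<^bsub>msec Om W\<^esub> t' = lin_comb Om V n e W (\<lambda>i. co W t i \<oplus>\<^bsub>Osec \<Y> W\<^esub> co W t' i)" ..
      show "co W (t \<oplus>\<^bsub>msec Om W\<^esub> t') i = co W t i \<oplus>\<^bsub>Osec \<Y> W\<^esub> co W t' i"
        using co_eq[OF W _ _ * i] t t' ct1 ct'1 by auto
    }
    {
      fix b assume b: "b \<in> carrier (Osec \<Y> W)"
      have "lin_comb Om V n e W (\<lambda>i. b \<otimes>\<^bsub>Osec \<Y> W\<^esub> co W t i)
          = (\<Oplus>\<^bsub>msec Om W\<^esub>i\<in>{..<n}. b \<odot>\<^bsub>msec Om W\<^esub> (co W t i \<odot>\<^bsub>msec Om W\<^esub> mrst Om V W (e i)))"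
        unfolding lin_comb_def using s[OF ct1] b ct1 er[OF W]
        by (intro M.finsum_cong') (auto intro!: M.smult_assoc1)
      also have "\<dots> = b \<odot>\<^bsub>msec Om W\<^esub> t"
        unfolding M.finsum_smult_ldistr[OF finite_lessThan b s[OF ct1], symmetric]
          ct(2)[unfolded lin_comb_def, symmetric] ..
      finally have *: "b \<odot>\<^bsub>msec Om W\<^esub> t = lin_comb Om V n e W (\<lambda>i. b \<otimes>\<^bsub>Osec \<Y> W\<^esub> co W t i)" ..
      show "co W (b \<odot>\<^bsub>msec Om W\<^esub> t) i = b \<otimes>\<^bsub>Osec \<Y> W\<^esub> co W t i"
        using co_eq[OF W _ _ * i] t b ct1 by auto
    }
    fix Z assume Z: "openin T Z" "Z \<subseteq> W"
    have ZV: "Z \<subseteq> V" using Z W by blast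
    interpret Z: Module.module "Osec \<Y> Z" "msec Om Z" by (rule Om.module_sec[OF Z(1)])
    have rc: "rst \<Y> W Z (co W t i) \<in> carrier (Osec \<Y> Z)" if "i < n" for i
      using ringed_space_rst_closed[OF ringed_Y W(1) Z] ct1 that by auto
    have fin: "mrst Om W Z (\<Oplus>\<^bsub>msec Om W\<^esub>i\<in>S. f i) = (\<Oplus>\<^bsub>msec Om Z\<^esub>i\<in>S. mrst Om W Z (f i))"
      if "finite S" "f \<in> S \<rightarrow> carrier (msec Om W)" for S and f :: "nat \<Rightarrow> _"
      using that
    proof (induction S rule: finite_induct)
      case empty
      then show ?case using Om.res_zero[OF W(1) Z] by simp
    next
      case (insert s S)
      then have "f \<in> S \<rightarrow> carrier (msec Om W)" "f s \<in> carrier (msec Om W)"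
        "(\<lambda>i. mrst Om W Z (f i)) \<in> S \<rightarrow> carrier (msec Om Z)" "mrst Om W Z (f s) \<in> carrier (msec Om Z)"
        using Om.res_closed[OF W(1) Z] by auto
      then show ?case using insert Om.res_add[OF W(1) Z] by simp
    qed
    have "mrst Om W Z t = (\<Oplus>\<^bsub>msec Om Z\<^esub>i\<in>{..<n}. mrst Om W Z (co W t i \<odot>\<^bsub>msec Om W\<^esub> mrst Om V W (e i)))"
      unfolding fin[OF finite_lessThan s[OF ct1], symmetric] ct(2)[unfolded lin_comb_def, symmetric] ..
    also have "\<dots> = lin_comb Om V n e Z (\<lambda>i. rst \<Y> W Z (co W t i))"
      unfolding lin_comb_def
    proof (rule Z.finsum_cong')
      show "(\<lambda>i. rst \<Y> W Z (co W t i) \<odot>\<^bsub>msec Om Z\<^esub> mrst Om V Z (e i)) \<in> {..<n} \<rightarrow> carrier (msec Om Z)"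
        using rc er[OF Z(1) ZV] by auto
      fix i assume "i \<in> {..<n}"
      then have i: "i < n" "co W t i \<in> carrier (Osec \<Y> W)" "e i \<in> carrier (msec Om V)" using ct1 e by auto
      show "mrst Om W Z (co W t i \<odot>\<^bsub>msec Om W\<^esub> mrst Om V W (e i)) = rst \<Y> W Z (co W t i) \<odot>\<^bsub>msec Om Z\<^esub> mrst Om V Z (e i)"
        unfolding Om.res_smult[OF W(1) Z er[OF W i(1)] i(2)] Om.res_comp[OF V(1) W(1) Z(1,2) W(2) i(3)] ..
    qed simp
    finally have *: "mrst Om W Z t = lin_comb Om V n e Z (\<lambda>i. rst \<Y> W Z (co W t i))" .
    show "co Z (mrst Om W Z t) i = rst \<Y> W Z (co W t i)"
      using co_eq[OF Z(1) ZV Om.res_closed[OF W(1) Z t] _ * i] rc by auto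
  qed
  have "frame V n (\<lambda>i W t. co W t i) e"
    unfolding frame_def
  proof (intro conjI allI impI ballI)
    show "openin T V" by (rule V(1))
    fix i assume i: "i < n"
    show "functional V (\<lambda>W t. co W t i)" by (rule fn[OF i])
    show "e i \<in> carrier (msec Om V)" using e i by auto
    fix j assume j: "j < n"
    interpret M: Module.module "Osec \<Y> V" "msec Om V" by (rule Om.module_sec[OF V(1)])
    have ej: "e j \<in> carrier (msec Om V)" using e j by auto
    let ?a = "\<lambda>i. if j = i then \<one>\<^bsub>Osec \<Y> V\<^esub> else \<zero>\<^bsub>Osec \<Y> V\<^esub>"
    have "lin_comb Om V n e V ?a = (\<Oplus>\<^bsub>msec Om V\<^esub>i\<in>{..<n}. if j = i then e i else \<zero>\<^bsub>msec Om V\<^esub>)"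
      unfolding lin_comb_def using e Om.res_id[OF V(1)] by (intro M.finsum_cong') (auto simp: Pi_def)
    also have "\<dots> = e j" using M.finsum_singleton[of j "{..<n}" e] e j by simp
    finally have "e j = lin_comb Om V n e V ?a" ..
    from co_eq[OF V(1) order_refl ej _ this i]
    show "co V (e j) i = (if i = j then \<one>\<^bsub>Osec \<Y> V\<^esub> else \<zero>\<^bsub>Osec \<Y> V\<^esub>)" by auto
  next
    fix W t t' assume W: "openin T W \<and> W \<subseteq> V" and t: "t \<in> carrier (msec Om W)" "t' \<in> carrier (msec Om W)"
      and eq: "\<forall>i<n. co W t i = co W t' i"
    have "co W t \<in> {..<n} \<rightarrow>\<^sub>E carrier (Osec \<Y> W)" "co W t' \<in> {..<n} \<rightarrow>\<^sub>E carrier (Osec \<Y> W)"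
      using co(1)[of W] W t by auto
    then have "co W t = co W t'" using eq by (intro PiE_ext) auto
    then show "t = t'" using co(2)[of W t] co(2)[of W t'] W t by metis
  qed
  then show thesis using that V(2) by blast
qed

end

section \<open>Local p-bases\<close>

context frobenius_factor
begin

text \<open>Otherwise every summand, and with them the sum 1, would lie in the ideal of
  non-units.\<close>

lemma germ_unit_summand:
  assumes y: "y \<in> topspace T" and Z: "openin T Z" "y \<in> Z"
    and f: "\<And>x. x \<in> set xs \<Longrightarrow> f x \<in> carrier (Osec \<Y> Z)"
    and sum: "fs_eval (Osec \<Y> Z) f xs = \<one>\<^bsub>Osec \<Y> Z\<^esub>"
  shows "\<exists>x\<in>set xs. germ_unit \<Y> y Z (f x)"
proof (rule ccontr)
  assume none: "\<not> (\<exists>x\<in>set xs. germ_unit \<Y> y Z (f x))"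
  interpret B: cring "Osec \<Y> Z" using ringed_space_cring[OF ringed_Y Z(1)] .
  let ?P = "{b \<in> carrier (Osec \<Y> Z). \<not> germ_unit \<Y> y Z b}"
  have P: "primeideal ?P (Osec \<Y> Z)"
  proof (rule good_base[OF y])
    fix U assume "y \<in> U" "\<And>Z z. openin T Z \<Longrightarrow> z \<in> Z \<Longrightarrow> z \<in> U \<Longrightarrow>
      primeideal {b \<in> carrier (Osec \<Y> Z). \<not> germ_unit \<Y> z Z b} (Osec \<Y> Z)"
    then show ?thesis using Z by simp
  qed
  have "fs_eval (Osec \<Y> Z) f xs \<in> ?P"
    using f none
  proof (induction xs)
    case Nil
    then show ?case using primeideal_closed(1)[OF P] by simp
  next
    case (Cons x xs)
    have "f x \<in> ?P" "fs_eval (Osec \<Y> Z) f xs \<in> ?P" using Cons by simp_all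
    then show ?case unfolding fs_eval_simps by (rule primeideal_closed(2)[OF P])
  qed
  moreover have "germ_unit \<Y> y Z \<one>\<^bsub>Osec \<Y> Z\<^esub>" by (rule germ_unit_Units[OF ringed_Y Z B.Units_one_closed])
  ultimately show False unfolding sum by simp
qed

lemma functional_scale:
  assumes l: "functional V l" and V: "openin T V" and v: "v \<in> carrier (Osec \<Y> V)"
  shows "functional V (\<lambda>Z t. rst \<Y> V Z v \<otimes>\<^bsub>Osec \<Y> Z\<^esub> l Z t)"
  unfolding functional_def
proof (intro allI impI ballI conjI; (elim conjE)?)
  fix W t assume W: "openin T W" "W \<subseteq> V" and t: "t \<in> carrier (msec Om W)"
  interpret B: cring "Osec \<Y> W" using ringed_space_cring[OF ringed_Y W(1)] .
  have vW: "rst \<Y> V W v \<in> carrier (Osec \<Y> W)" by (rule ringed_space_rst_closed[OF ringed_Y V W v])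
  note lt = functionalD[OF l W t]
  show "rst \<Y> V W v \<otimes>\<^bsub>Osec \<Y> W\<^esub> l W t \<in> carrier (Osec \<Y> W)" using vW lt(1) by simp
  show "rst \<Y> V W v \<otimes>\<^bsub>Osec \<Y> W\<^esub> l W (t \<oplus>\<^bsub>msec Om W\<^esub> t')
      = rst \<Y> V W v \<otimes>\<^bsub>Osec \<Y> W\<^esub> l W t \<oplus>\<^bsub>Osec \<Y> W\<^esub> rst \<Y> V W v \<otimes>\<^bsub>Osec \<Y> W\<^esub> l W t'"
    if "t' \<in> carrier (msec Om W)" for t'
    unfolding lt(2)[OF that] using vW lt(1) functionalD(1)[OF l W that] by (simp add: B.r_distr)
  show "rst \<Y> V W v \<otimes>\<^bsub>Osec \<Y> W\<^esub> l W (b \<odot>\<^bsub>msec Om W\<^esub> t) = b \<otimes>\<^bsub>Osec \<Y> W\<^esub> (rst \<Y> V W v \<otimes>\<^bsub>Osec \<Y> W\<^esub> l W t)"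
    if "b \<in> carrier (Osec \<Y> W)" for b
    unfolding lt(3)[OF that] using vW lt(1) that by (simp add: B.m_lcomm)
  show "rst \<Y> V Z v \<otimes>\<^bsub>Osec \<Y> Z\<^esub> l Z (mrst Om W Z t) = rst \<Y> W Z (rst \<Y> V W v \<otimes>\<^bsub>Osec \<Y> W\<^esub> l W t)"
    if Z: "openin T Z" "Z \<subseteq> W" for Z
    unfolding lt(4)[OF Z] ring_hom_mult[OF ringed_space_rst[OF ringed_Y W(1) Z] vW lt(1)]
      ringed_space_rst_comp[OF ringed_Y V W(1) Z W(2) v] ..
qed

lemma functional_diff:
  assumes l: "functional V l" and l': "functional V l'"
  shows "functional V (\<lambda>Z t. l Z t \<ominus>\<^bsub>Osec \<Y> Z\<^esub> l' Z t)"
  unfolding functional_def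
proof (intro allI impI ballI conjI; (elim conjE)?)
  fix W t assume W: "openin T W" "W \<subseteq> V" and t: "t \<in> carrier (msec Om W)"
  interpret B: cring "Osec \<Y> W" using ringed_space_cring[OF ringed_Y W(1)] .
  note lt = functionalD[OF l W t] and lt' = functionalD[OF l' W t]
  show "l W t \<ominus>\<^bsub>Osec \<Y> W\<^esub> l' W t \<in> carrier (Osec \<Y> W)" using lt(1) lt'(1) by simp
  show "l W (t \<oplus>\<^bsub>msec Om W\<^esub> t') \<ominus>\<^bsub>Osec \<Y> W\<^esub> l' W (t \<oplus>\<^bsub>msec Om W\<^esub> t')
      = (l W t \<ominus>\<^bsub>Osec \<Y> W\<^esub> l' W t) \<oplus>\<^bsub>Osec \<Y> W\<^esub> (l W t' \<ominus>\<^bsub>Osec \<Y> W\<^esub> l' W t')"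
    if "t' \<in> carrier (msec Om W)" for t'
    unfolding lt(2)[OF that] lt'(2)[OF that]
    using lt(1) lt'(1) functionalD(1)[OF l W that] functionalD(1)[OF l' W that]
    by (simp add: B.minus_eq B.minus_add B.a_ac)
  show "l W (b \<odot>\<^bsub>msec Om W\<^esub> t) \<ominus>\<^bsub>Osec \<Y> W\<^esub> l' W (b \<odot>\<^bsub>msec Om W\<^esub> t) = b \<otimes>\<^bsub>Osec \<Y> W\<^esub> (l W t \<ominus>\<^bsub>Osec \<Y> W\<^esub> l' W t)"
    if "b \<in> carrier (Osec \<Y> W)" for b
    unfolding lt(3)[OF that] lt'(3)[OF that] using lt(1) lt'(1) that by (simp add: B.minus_eq B.r_distr B.r_minus)
  fix Z assume Z: "openin T Z" "Z \<subseteq> W"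
  interpret Z: cring "Osec \<Y> Z" using ringed_space_cring[OF ringed_Y Z(1)] .
  interpret r: ring_hom_cring "Osec \<Y> W" "Osec \<Y> Z" "rst \<Y> W Z"
    using ringed_space_rst[OF ringed_Y W(1) Z]
    by (intro ring_hom_cring.intro ring_hom_cring_axioms.intro B.is_cring Z.is_cring)
  show "l Z (mrst Om W Z t) \<ominus>\<^bsub>Osec \<Y> Z\<^esub> l' Z (mrst Om W Z t) = rst \<Y> W Z (l W t \<ominus>\<^bsub>Osec \<Y> W\<^esub> l' W t)"
    unfolding lt(4)[OF Z] lt'(4)[OF Z] using lt(1) lt'(1) by (simp add: B.minus_eq Z.minus_eq)
qed

text \<open>Steinitz exchange: some \<open>dc\<close> in an expression of the \<open>k\<close>-th basis element has a unit
  as \<open>k\<close>-th coordinate near \<open>y\<close>, because non-units at \<open>y\<close> form an ideal.\<close>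

lemma exchange_step:
  assumes f: "frame V n l e" and y: "y \<in> V" and k: "k < n"
    and x: "\<And>j. j < k \<Longrightarrow> x j \<in> carrier (Osec \<Y> V) \<and> e j = dif V (x j)"
  obtains V' l' e' x' where "y \<in> V'" "frame V' n l' e'"
    "\<And>j. j < Suc k \<Longrightarrow> x' j \<in> carrier (Osec \<Y> V') \<and> e' j = dif V' (x' j)"
proof -
  note fD = frameD[OF f]
  note V = fD(1)
  have yt: "y \<in> topspace T" using openin_subset[OF V] y by blast
  obtain W xs where W: "openin T W" "y \<in> W" "W \<subseteq> V" "set xs \<subseteq> kgens W" "mrst Om V W (e k) = form W xs"
    using Om_local[OF V y fD(3)[OF k]] by blast
  interpret BW: cring "Osec \<Y> W" using ringed_space_cring[OF ringed_Y W(1)] .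
  note lk = functional_mono[OF fD(2)[OF k] W(3)]
  have closed: "case g of (b, c) \<Rightarrow> b \<in> carrier (Osec \<Y> W) \<and> c \<in> carrier (Osec \<Y> W) \<and> l k W (dif W c) \<in> carrier (Osec \<Y> W)"
    if "g \<in> set xs" for g
    using W(4) that functionalD(1)[OF lk W(1) order_refl dif_closed[OF W(1)]]
    by (cases g) (auto simp: subset_iff kgens_iff)
  have "fs_eval (Osec \<Y> W) (\<lambda>(b, c). b \<otimes>\<^bsub>Osec \<Y> W\<^esub> l k W (dif W c)) xs = \<one>\<^bsub>Osec \<Y> W\<^esub>"
    unfolding functional_form[OF lk W(1) order_refl W(4), symmetric] W(5)[symmetric]
      functionalD(4)[OF fD(2)[OF k] V order_refl fD(3)[OF k] W(1,3)] fD(4)[OF k k]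
    using ring_hom_one[OF ringed_space_rst[OF ringed_Y V W(1,3)]] by simp
  then have "\<exists>g\<in>set xs. germ_unit \<Y> y W (case g of (b, c) \<Rightarrow> b \<otimes>\<^bsub>Osec \<Y> W\<^esub> l k W (dif W c))"
    using closed by (intro germ_unit_summand[OF yt W(1,2)]) (auto split: prod.splits)
  then obtain g where g: "g \<in> set xs" "germ_unit \<Y> y W (case g of (b, c) \<Rightarrow> b \<otimes>\<^bsub>Osec \<Y> W\<^esub> l k W (dif W c))"
    by (rule bexE)
  obtain b c where gbc: "g = (b, c)" by (rule prod.exhaust)
  have bc: "b \<in> carrier (Osec \<Y> W)" "c \<in> carrier (Osec \<Y> W)" "l k W (dif W c) \<in> carrier (Osec \<Y> W)"
    "germ_unit \<Y> y W (b \<otimes>\<^bsub>Osec \<Y> W\<^esub> l k W (dif W c))"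
    using closed[OF g(1)] g(2) unfolding gbc by simp_all
  then have "germ_unit \<Y> y W (l k W (dif W c))" using germ_unit_mult[OF ringed_Y W(1,2) bc(1,3)] by simp
  then obtain V' where V': "openin T V'" "y \<in> V'" "V' \<subseteq> W" "rst \<Y> W V' (l k W (dif W c)) \<in> Units (Osec \<Y> V')"
    unfolding germ_unit_def by blast
  let ?B = "Osec \<Y> V'"
  interpret B: cring ?B using ringed_space_cring[OF ringed_Y V'(1)] .
  have VV: "V' \<subseteq> V" using V' W by blast
  define c' where "c' = rst \<Y> W V' c"
  have c': "c' \<in> carrier ?B" unfolding c'_def by (rule ringed_space_rst_closed[OF ringed_Y W(1) V'(1,3) bc(2)])
  define u where "u = l k V' (dif V' c')"
  have u_eq: "u = rst \<Y> W V' (l k W (dif W c))"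
    unfolding u_def c'_def dif_res[OF W(1) V'(1,3) bc(2), symmetric]
    by (rule functionalD(4)[OF lk W(1) order_refl dif_closed[OF W(1) bc(2)] V'(1,3)])
  have u: "u \<in> Units ?B" using V'(4) unfolding u_eq .
  define v where "v = inv\<^bsub>?B\<^esub> u"
  have v: "v \<in> carrier ?B" "v \<otimes>\<^bsub>?B\<^esub> u = \<one>\<^bsub>?B\<^esub>" unfolding v_def using u by simp_all
  define e0 where "e0 i = mrst Om V V' (e i)" for i
  have f0: "frame V' n l e0" unfolding e0_def by (rule frame_res[OF f V'(1) VV])
  note f0D = frameD[OF f0]
  have lt: "l i Z t \<in> carrier (Osec \<Y> Z)" if "i < n" "openin T Z" "Z \<subseteq> V'" "t \<in> carrier (msec Om Z)" for i Z t
    by (rule functionalD(1)[OF f0D(2)[OF that(1)] that(2-4)])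
  have dc: "dif V' c' \<in> carrier (msec Om V')" by (rule dif_closed[OF V'(1) c'])
  define w where "w i = l i V' (dif V' c')" for i
  have w: "w i \<in> carrier ?B" if "i < n" for i unfolding w_def by (rule lt[OF that V'(1) order_refl dc])
  \<comment> \<open>Change of the dual basis: the new form \<open>dc\<close> has coordinates
    \<open>w i\<close>, with \<open>w k = u\<close> invertible. The new k-th functional is the old
    one divided by \<open>u\<close>, and from each other \<open>l i\<close> its multiple by
    \<open>w i\<close> is subtracted, so that \<open>dc\<close> gets coordinate 0 there.\<close>
  define lk' where "lk' Z t = rst \<Y> V' Z v \<otimes>\<^bsub>Osec \<Y> Z\<^esub> l k Z t" for Z t
  have lk': "functional V' lk'" unfolding lk'_def by (rule functional_scale[OF f0D(2)[OF k] V'(1) v(1)])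
  define l' where "l' i = (if i = k then lk' else (\<lambda>Z t. l i Z t \<ominus>\<^bsub>Osec \<Y> Z\<^esub> rst \<Y> V' Z (w i) \<otimes>\<^bsub>Osec \<Y> Z\<^esub> lk' Z t))" for i
  define e' where "e' i = (if i = k then dif V' c' else e0 i)" for i
  define x' where "x' i = (if i = k then c' else rst \<Y> V V' (x i))" for i
  have id: "rst \<Y> V' V' b = b" if "b \<in> carrier ?B" for b by (rule ringed_space_rst_id[OF ringed_Y V'(1) that])
  have "frame V' n l' e'"
    unfolding frame_def
  proof (intro conjI allI impI ballI)
    show "openin T V'" by (rule V'(1))
    fix i assume i: "i < n"
    show "functional V' (l' i)"
      unfolding l'_def using lk' functional_diff[OF f0D(2)[OF i] functional_scale[OF lk' V'(1) w[OF i]]] by simp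
    show "e' i \<in> carrier (msec Om V')" unfolding e'_def using dc f0D(3)[OF i] by simp
    fix j assume j: "j < n"
    have lkdc: "lk' V' (dif V' c') = \<one>\<^bsub>?B\<^esub>" unfolding lk'_def id[OF v(1)] u_def[symmetric] by (rule v(2))
    have lke: "lk' V' (e0 j) = \<zero>\<^bsub>?B\<^esub>" if "j \<noteq> k"
      unfolding lk'_def id[OF v(1)] f0D(4)[OF k j] using that v(1) by simp
    show "l' i V' (e' j) = (if i = j then \<one>\<^bsub>?B\<^esub> else \<zero>\<^bsub>?B\<^esub>)"
    proof (cases "j = k")
      case True
      then have e: "e' j = dif V' c'" unfolding e'_def by simp
      show ?thesis
      proof (cases "i = k")
        case True
        then show ?thesis unfolding e l'_def using lkdc \<open>j = k\<close> by simp
      next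
        case False
        have "l' i V' (e' j) = w i \<ominus>\<^bsub>?B\<^esub> w i \<otimes>\<^bsub>?B\<^esub> \<one>\<^bsub>?B\<^esub>"
          unfolding e l'_def using False lkdc id[OF w[OF i]] by (simp add: w_def)
        then show ?thesis using w[OF i] False \<open>j = k\<close> by (simp add: B.minus_eq B.r_neg)
      qed
    next
      case False
      then have e: "e' j = e0 j" unfolding e'_def by simp
      show ?thesis
      proof (cases "i = k")
        case True
        then show ?thesis unfolding e l'_def using lke[OF False] False by simp
      next
        case ik: False
        have "l' i V' (e' j) = l i V' (e0 j) \<ominus>\<^bsub>?B\<^esub> w i \<otimes>\<^bsub>?B\<^esub> \<zero>\<^bsub>?B\<^esub>"
          unfolding e l'_def using ik lke[OF False] id[OF w[OF i]] by simp
        then show ?thesis unfolding f0D(4)[OF i j] using w[OF i] by (simp add: B.minus_eq)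
      qed
    qed
  next
    fix Z t t' assume "openin T Z \<and> Z \<subseteq> V'" and t: "t \<in> carrier (msec Om Z)" "t' \<in> carrier (msec Om Z)"
      and eq: "\<forall>i<n. l' i Z t = l' i Z t'"
    then have Z: "openin T Z" "Z \<subseteq> V'" by auto
    interpret BZ: cring "Osec \<Y> Z" using ringed_space_cring[OF ringed_Y Z(1)] .
    have r: "rst \<Y> V' Z a \<in> carrier (Osec \<Y> Z)" if "a \<in> carrier ?B" for a
      by (rule ringed_space_rst_closed[OF ringed_Y V'(1) Z that])
    have uB: "u \<in> carrier ?B" using u by (rule B.Units_closed)
    have vu: "rst \<Y> V' Z u \<otimes>\<^bsub>Osec \<Y> Z\<^esub> rst \<Y> V' Z v = \<one>\<^bsub>Osec \<Y> Z\<^esub>"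
      using ring_hom_mult[OF ringed_space_rst[OF ringed_Y V'(1) Z] uB v(1)] v B.m_comm[OF uB v(1)]
        ring_hom_one[OF ringed_space_rst[OF ringed_Y V'(1) Z]] by simp
    have lkeq: "lk' Z t = lk' Z t'" using eq k unfolding l'_def by force
    \<comment> \<open>Multiplying back by \<open>u\<close> recovers the old k-th functional, and
      then the others, so the new functionals separate forms because the old ones do.\<close>
    have cancel: "rst \<Y> V' Z u \<otimes>\<^bsub>Osec \<Y> Z\<^esub> lk' Z s = l k Z s" if "s \<in> carrier (msec Om Z)" for s
      unfolding lk'_def using vu r[OF uB] r[OF v(1)] lt[OF k Z that] by (simp add: BZ.m_assoc[symmetric])
    show "t = t'"
    proof (rule f0D(5)[OF Z t])
      fix i assume i: "i < n"
      show "l i Z t = l i Z t'"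
      proof (cases "i = k")
        case True
        then show ?thesis using cancel[OF t(1)] cancel[OF t(2)] lkeq by simp
      next
        case False
        have lkc: "lk' Z t' \<in> carrier (Osec \<Y> Z)" by (rule functionalD(1)[OF lk' Z t(2)])
        have "l i Z t \<ominus>\<^bsub>Osec \<Y> Z\<^esub> rst \<Y> V' Z (w i) \<otimes>\<^bsub>Osec \<Y> Z\<^esub> lk' Z t'
            = l i Z t' \<ominus>\<^bsub>Osec \<Y> Z\<^esub> rst \<Y> V' Z (w i) \<otimes>\<^bsub>Osec \<Y> Z\<^esub> lk' Z t'"
          using eq[rule_format, OF i] False lkeq unfolding l'_def by simp
        then show ?thesis
          unfolding BZ.minus_eq using lt[OF i Z t(1)] lt[OF i Z t(2)] r[OF w[OF i]] lkc by simp
      qed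
    qed
  qed
  moreover have "x' j \<in> carrier ?B \<and> e' j = dif V' (x' j)" if j: "j < Suc k" for j
  proof (cases "j = k")
    case False
    then have j: "j < k" using j by simp
    show ?thesis
      unfolding x'_def e'_def e0_def using False x[OF j] dif_res[OF V V'(1) VV]
        ringed_space_rst_closed[OF ringed_Y V V'(1) VV] by simp
  qed (use c' in \<open>simp add: x'_def e'_def\<close>)
  ultimately show thesis using that V'(2) by blast
qed

text \<open>The exchange is carried out once for each index; the neighbourhood of \<open>y\<close>
  shrinks each time while the rank stays the same.\<close>

lemma dual_frame:
  assumes lf: "locally_free_sheaf \<Y> Om" and y: "y \<in> topspace T"
  obtains V n l x where "y \<in> V" "frame V n l (\<lambda>j. dif V (x j))" "\<And>j. j < n \<Longrightarrow> x j \<in> carrier (Osec \<Y> V)"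
proof -
  obtain V0 n l0 e0 where f0: "y \<in> V0" "frame V0 n l0 e0" using locally_free_frame[OF lf y] by blast
  have "\<exists>V l e x. y \<in> V \<and> frame V n l e \<and> (\<forall>j<k. x j \<in> carrier (Osec \<Y> V) \<and> e j = dif V (x j))" if "k \<le> n" for k
    using that
  proof (induction k)
    case 0
    then show ?case using f0 by auto
  next
    case (Suc k)
    then obtain V l e x where V: "y \<in> V" "frame V n l e" "\<forall>j<k. x j \<in> carrier (Osec \<Y> V) \<and> e j = dif V (x j)"
      by auto
    have k: "k < n" using Suc.prems by simp
    have xk: "x j \<in> carrier (Osec \<Y> V) \<and> e j = dif V (x j)" if "j < k" for j using V(3) that by simp
    show ?case
    proof (rule exchange_step[OF V(2,1) k xk])
      fix V' l' e' x' assume "y \<in> V'" "frame V' n l' e'"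
        "\<And>j. j < Suc k \<Longrightarrow> x' j \<in> carrier (Osec \<Y> V') \<and> e' j = dif V' (x' j)"
      then show ?case by (intro exI[of _ V'] exI[of _ l'] exI[of _ e'] exI[of _ x']) simp
    qed
  qed
  from this[OF order_refl] obtain V l e x where V: "y \<in> V" "frame V n l e"
    "\<forall>j<n. x j \<in> carrier (Osec \<Y> V) \<and> e j = dif V (x j)" by blast
  have "frame V n l (\<lambda>j. dif V (x j))"
    using V(2,3) unfolding frame_def by simp
  then show thesis using that V by blast
qed

end

section \<open>The structure sheaf of \<Y> near a point\<close>

context frobenius_factor
begin

lemma fs_eval_delta:
  assumes "abelian_monoid R" and "\<And>i. i < m \<Longrightarrow> f (g i) = (if j = i then d else \<zero>\<^bsub>R\<^esub>)" and "d \<in> carrier R"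
  shows "fs_eval R f (map g [0..<m]) = (if j < m then d else \<zero>\<^bsub>R\<^esub>)"
  using assms(2)
proof (induction m)
  case 0
  then show ?case by simp
next
  interpret abelian_monoid R by (rule assms)
  case (Suc m)
  have "fs_eval R f (map g [0..<m] @ [g m]) = fs_eval R f (map g [0..<m]) \<oplus>\<^bsub>R\<^esub> fs_eval R f [g m]"
    using Suc.prems assms(3) by (intro fs_eval_append) auto
  also have "fs_eval R f (map g [0..<m]) = (if j < m then d else \<zero>\<^bsub>R\<^esub>)" using Suc by simp
  also have "fs_eval R f [g m] = (if j = m then d else \<zero>\<^bsub>R\<^esub>)"
    using Suc.prems[of m] assms(3) by simp
  finally show ?case using assms(3) by auto
qed

text \<open>The expansion of \<open>dg\<close> in the basis
  \<open>dx\<^sub>1, \<dots>, dx\<^sub>n\<close>, with the derivatives of \<open>g\<close> as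
  coefficients. Both sides take the same values under the dual functionals.\<close>

lemma kaehler_expand:
  assumes f: "frame V n l (\<lambda>j. dif V (x j))" and x: "\<And>j. j < n \<Longrightarrow> x j \<in> carrier (Osec \<Y> V)"
    and g: "g \<in> carrier (Osec \<Y> V)"
  shows "dif V g = form V (map (\<lambda>i. (l i V (dif V g), x i)) [0..<n])"
proof -
  note fD = frameD[OF f]
  interpret B: cring "Osec \<Y> V" using ringed_space_cring[OF ringed_Y fD(1)] .
  have d: "l i V (dif V g) \<in> carrier (Osec \<Y> V)" if "i < n" for i
    by (rule functionalD(1)[OF fD(2)[OF that] fD(1) order_refl dif_closed[OF fD(1) g]])
  have xs: "set (map (\<lambda>i. (l i V (dif V g), x i)) [0..<n]) \<subseteq> kgens V"
    using d x by (auto simp: kgens_iff)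
  show ?thesis
  proof (rule fD(5)[OF fD(1) order_refl dif_closed[OF fD(1) g] form_closed[OF fD(1) xs]])
    fix j assume j: "j < n"
    have "fs_eval (Osec \<Y> V) (\<lambda>(b, c). b \<otimes>\<^bsub>Osec \<Y> V\<^esub> l j V (dif V c)) (map (\<lambda>i. (l i V (dif V g), x i)) [0..<n])
        = (if j < n then l j V (dif V g) else \<zero>\<^bsub>Osec \<Y> V\<^esub>)"
    proof (rule fs_eval_delta[OF B.abelian_monoid_axioms _ d[OF j]])
      fix i assume i: "i < n"
      show "(case (l i V (dif V g), x i) of (b, c) \<Rightarrow> b \<otimes>\<^bsub>Osec \<Y> V\<^esub> l j V (dif V c))
          = (if j = i then l j V (dif V g) else \<zero>\<^bsub>Osec \<Y> V\<^esub>)"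
        unfolding prod.case fD(4)[OF j i] using d[OF i] by simp
    qed
    then show "l j V (dif V g) = l j V (form V (map (\<lambda>i. (l i V (dif V g), x i)) [0..<n]))"
      unfolding functional_form[OF fD(2)[OF j] fD(1) order_refl xs] using j by simp
  qed
qed

text \<open>The inverse is \<open>u^(p-1)\<close> times the inverse of \<open>u^p\<close>, which
  comes from \<X> because \<open>F\<close> preserves units. Hence a subring containing the sections
  of \<X> contains the inverse of each of its elements that is a unit.\<close>

lemma unit_inverse:
  assumes W: "openin T W" and u: "u \<in> Units (Osec \<Y> W)"
  obtains w where "w \<in> carrier (Osec \<Y> W)" "w \<otimes>\<^bsub>Osec \<Y> W\<^esub> u = \<one>\<^bsub>Osec \<Y> W\<^esub>"
    "\<And>H. subring H (Osec \<Y> W) \<Longrightarrow> h W ` carrier (Osec \<A> W) \<subseteq> H \<Longrightarrow> u \<in> H \<Longrightarrow> w \<in> H"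
proof -
  let ?S = "Osec \<Y> W"
  interpret S: cring ?S using ringed_space_cring[OF ringed_Y W] .
  obtain F where F: "\<And>W. openin T W \<Longrightarrow> F W \<in> ring_hom (Osec \<Y> W) (Osec \<A> W)"
    "\<And>W b. openin T W \<Longrightarrow> b \<in> carrier (Osec \<Y> W) \<Longrightarrow> h W (F W b) = b [^]\<^bsub>Osec \<Y> W\<^esub> p"
    using frobenius_section by blast
  have uS: "u \<in> carrier ?S" using u by (rule S.Units_closed)
  obtain q where q: "p = Suc q" using prime_gt_0_nat[OF p] gr0_conv_Suc by blast
  have "F W u \<in> Units (Osec \<A> W)" by (rule ring_hom_Units[OF F(1)[OF W] u])
  then obtain a where a: "a \<in> carrier (Osec \<A> W)" "F W u \<otimes>\<^bsub>Osec \<A> W\<^esub> a = \<one>\<^bsub>Osec \<A> W\<^esub>" "F W u \<in> carrier (Osec \<A> W)"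
    unfolding Units_def by blast
  have ha: "h W a \<in> carrier ?S" using ring_hom_closed[OF pair.h_hom[OF W] a(1)] .
  have e: "u [^]\<^bsub>?S\<^esub> p \<otimes>\<^bsub>?S\<^esub> h W a = \<one>\<^bsub>?S\<^esub>"
    using ring_hom_mult[OF pair.h_hom[OF W] a(3,1)] ring_hom_one[OF pair.h_hom[OF W]] F(2)[OF W uS] a(2) by simp
  show thesis
  proof (rule that[of "u [^]\<^bsub>?S\<^esub> q \<otimes>\<^bsub>?S\<^esub> h W a"])
    show "u [^]\<^bsub>?S\<^esub> q \<otimes>\<^bsub>?S\<^esub> h W a \<in> carrier ?S" using uS ha by simp
    show "u [^]\<^bsub>?S\<^esub> q \<otimes>\<^bsub>?S\<^esub> h W a \<otimes>\<^bsub>?S\<^esub> u = \<one>\<^bsub>?S\<^esub>" using e uS ha unfolding q by (simp add: S.m_ac)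
    fix H assume H: "subring H ?S" "h W ` carrier (Osec \<A> W) \<subseteq> H" "u \<in> H"
    have "u [^]\<^bsub>?S\<^esub> (k::nat) \<in> H" for k using H(3) subringE(3,6)[OF H(1)] by (induction k) auto
    then show "u [^]\<^bsub>?S\<^esub> q \<otimes>\<^bsub>?S\<^esub> h W a \<in> H" using H(2) a(1) subringE(6)[OF H(1)] by blast
  qed
qed

text \<open>The universal property of differentials on formal sums: a derivation
  \<open>\<delta>\<close> over the sections of \<X> turns \<open>b dc\<close> into
  \<open>q b\<close> times \<open>\<delta> c\<close>.\<close>

lemma kaehler_derivation:
  assumes W: "openin T W" and "cring Q" and "q \<in> ring_hom (Osec \<Y> W) Q"
    and \<delta>: "\<And>b. b \<in> carrier (Osec \<Y> W) \<Longrightarrow> \<delta> b \<in> carrier Q"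
    and add: "\<And>b c. b \<in> carrier (Osec \<Y> W) \<Longrightarrow> c \<in> carrier (Osec \<Y> W) \<Longrightarrow> \<delta> (b \<oplus>\<^bsub>Osec \<Y> W\<^esub> c) = \<delta> b \<oplus>\<^bsub>Q\<^esub> \<delta> c"
    and mult: "\<And>b c. b \<in> carrier (Osec \<Y> W) \<Longrightarrow> c \<in> carrier (Osec \<Y> W) \<Longrightarrow>
      \<delta> (b \<otimes>\<^bsub>Osec \<Y> W\<^esub> c) = q b \<otimes>\<^bsub>Q\<^esub> \<delta> c \<oplus>\<^bsub>Q\<^esub> q c \<otimes>\<^bsub>Q\<^esub> \<delta> b"
    and const: "\<And>a. a \<in> carrier (Osec \<A> W) \<Longrightarrow> \<delta> (h W a) = \<zero>\<^bsub>Q\<^esub>"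
    and eq: "fs_cong (kgens W) (krels W) xs ys"
  shows "fs_eval Q (\<lambda>(b, c). q b \<otimes>\<^bsub>Q\<^esub> \<delta> c) xs = fs_eval Q (\<lambda>(b, c). q b \<otimes>\<^bsub>Q\<^esub> \<delta> c) ys"
proof -
  interpret Q: cring Q by (rule assms)
  interpret B: cring "Osec \<Y> W" using ringed_space_cring[OF ringed_Y W] .
  interpret q: ring_hom_cring "Osec \<Y> W" Q q
    using assms(3) by (intro ring_hom_cring.intro ring_hom_cring_axioms.intro B.is_cring Q.is_cring)
  show ?thesis
  proof (rule Q.fs_eval_cong[OF eq kaehler_wf[OF B.is_cring pair.h_hom[OF W]]])
    fix g assume "g \<in> kgens W"
    then show "(case g of (b, c) \<Rightarrow> q b \<otimes>\<^bsub>Q\<^esub> \<delta> c) \<in> carrier Q" using \<delta> by (cases g) (simp add: kgens_iff)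
  next
    fix xs ys assume "(xs, ys) \<in> krels W"
    then show "fs_eval Q (\<lambda>(b, c). q b \<otimes>\<^bsub>Q\<^esub> \<delta> c) xs = fs_eval Q (\<lambda>(b, c). q b \<otimes>\<^bsub>Q\<^esub> \<delta> c) ys"
      by (cases rule: kaehler_relsE)
        (simp_all add: \<delta> add mult const Q.l_distr Q.r_distr Q.m_assoc)
  qed
qed

lemma finite_neighbourhood:
  assumes "finite G" and "openin T V" "y \<in> V" and "\<And>g. g \<in> G \<Longrightarrow> \<exists>Z. openin T Z \<and> y \<in> Z \<and> Z \<subseteq> V \<and> P g Z"
    and mono: "\<And>g Z Z'. g \<in> G \<Longrightarrow> openin T Z \<Longrightarrow> Z \<subseteq> V \<Longrightarrow> P g Z \<Longrightarrow> openin T Z' \<Longrightarrow> Z' \<subseteq> Z \<Longrightarrow> P g Z'"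
  shows "\<exists>Z. openin T Z \<and> y \<in> Z \<and> Z \<subseteq> V \<and> (\<forall>g\<in>G. P g Z)"
  using assms(1,4) mono
proof (induction G rule: finite_induct)
  case empty
  then show ?case using assms(2,3) by blast
next
  case (insert g G)
  have "\<exists>Z. openin T Z \<and> y \<in> Z \<and> Z \<subseteq> V \<and> (\<forall>g\<in>G. P g Z)"
  proof (rule insert.IH)
    show "\<exists>Z. openin T Z \<and> y \<in> Z \<and> Z \<subseteq> V \<and> P g Z" if "g \<in> G" for g
      by (rule insert.prems(1)[OF insertI2[OF that]])
    show "P g Z'" if "g \<in> G" "openin T Z" "Z \<subseteq> V" "P g Z" "openin T Z'" "Z' \<subseteq> Z" for g Z Z'
      by (rule insert.prems(2)[OF insertI2[OF that(1)] that(2-6)])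
  qed
  then obtain Z where Z: "openin T Z" "y \<in> Z" "Z \<subseteq> V" "\<forall>g\<in>G. P g Z" by blast
  obtain Z' where Z': "openin T Z'" "y \<in> Z'" "Z' \<subseteq> V" "P g Z'" using insert.prems(1)[OF insertI1] by blast
  have o: "openin T (Z \<inter> Z')" using Z Z' by blast
  have "P g (Z \<inter> Z')" by (rule insert.prems(2)[OF insertI1 Z'(1,3,4) o Int_lower2])
  moreover have "P g' (Z \<inter> Z')" if "g' \<in> G" for g'
    by (rule insert.prems(2)[OF insertI2[OF that] Z(1,3) bspec[OF Z(4) that] o Int_lower1])
  ultimately have "\<forall>g'\<in>insert g G. P g' (Z \<inter> Z')" by simp
  moreover have "y \<in> Z \<inter> Z'" "Z \<inter> Z' \<subseteq> V" using Z(2,3) Z'(2) by auto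
  ultimately show ?case using o by blast
qed

text \<open>A base of open sets appears in the conclusion because generation by a fixed finite set
  is known on the basic open sets of a chart. Arguments that need the p-basis later shrink their
  neighbourhood to a member of the base.\<close>

theorem local_structure:
  assumes lf: "locally_free_sheaf \<Y> Om" and y: "y \<in> topspace T"
  obtains V n l \<B> x where "openin T V" "y \<in> V" "\<And>i. i < n \<Longrightarrow> functional V (l i)"
    "\<And>W. W \<in> \<B> \<Longrightarrow> openin T W \<and> W \<subseteq> V"
    "\<And>Z z. openin T Z \<Longrightarrow> z \<in> Z \<Longrightarrow> z \<in> V \<Longrightarrow> \<exists>W\<in>\<B>. z \<in> W \<and> W \<subseteq> Z"
    "\<And>W. W \<in> \<B> \<Longrightarrow> p_basis (Osec \<A> W) (Osec \<Y> W) (h W) n p (\<lambda>i. rst \<Y> V W (x i)) (\<lambda>i b. l i W (dif W b))"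
proof -
  obtain U G \<B>0 where U: "openin T U" "y \<in> U" "finite G" "G \<subseteq> carrier (Osec \<Y> U)"
    and \<B>0: "\<And>W. W \<in> \<B>0 \<Longrightarrow> openin T W \<and> W \<subseteq> U"
    and base: "\<And>Z z. openin T Z \<Longrightarrow> z \<in> Z \<Longrightarrow> z \<in> U \<Longrightarrow> \<exists>W\<in>\<B>0. z \<in> W \<and> W \<subseteq> Z"
    and gen: "\<And>W H. W \<in> \<B>0 \<Longrightarrow> subring H (Osec \<Y> W) \<Longrightarrow> h W ` carrier (Osec \<A> W) \<union> rst \<Y> U W ` G \<subseteq> H \<Longrightarrow>
      H = carrier (Osec \<Y> W)"
    and prime: "\<And>Z z. openin T Z \<Longrightarrow> z \<in> Z \<Longrightarrow> z \<in> U \<Longrightarrow>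
      primeideal {b \<in> carrier (Osec \<Y> Z). \<not> germ_unit \<Y> z Z b} (Osec \<Y> Z)"
    by (fact good_base[OF y])
  obtain V0 n l x0 where f0: "y \<in> V0" "frame V0 n l (\<lambda>j. dif V0 (x0 j))" "\<And>j. j < n \<Longrightarrow> x0 j \<in> carrier (Osec \<Y> V0)"
    by (fact dual_frame[OF lf y])
  obtain F where F: "\<And>W. openin T W \<Longrightarrow> F W \<in> ring_hom (Osec \<Y> W) (Osec \<A> W)"
    "\<And>W b. openin T W \<Longrightarrow> b \<in> carrier (Osec \<Y> W) \<Longrightarrow> h W (F W b) = b [^]\<^bsub>Osec \<Y> W\<^esub> p"
    using frobenius_section by blast
  have frobA: "b [^]\<^bsub>Osec \<Y> W\<^esub> p \<in> h W ` carrier (Osec \<A> W)" if "openin T W" "b \<in> carrier (Osec \<Y> W)" for W b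
    using F(2)[OF that, symmetric] ring_hom_closed[OF F(1)[OF that(1)] that(2)] by (rule image_eqI)
  note V0 = frameD(1)[OF f0(2)]
  define V where "V = V0 \<inter> U"
  have V: "openin T V" "y \<in> V" "V \<subseteq> V0" "V \<subseteq> U" unfolding V_def using V0 U f0 by auto
  define x where "x i = rst \<Y> V0 V (x0 i)" for i
  have x: "x i \<in> carrier (Osec \<Y> V)" if "i < n" for i
    unfolding x_def by (rule ringed_space_rst_closed[OF ringed_Y V0 V(1,3) f0(3)[OF that]])
  have fV: "frame V n l (\<lambda>j. dif V (x j))"
    using frame_res[OF f0(2) V(1,3)] dif_res[OF V0 V(1,3) f0(3)] unfolding frame_def x_def by simp
  note fD = frameD[OF fV]
  have gV: "rst \<Y> U V g \<in> carrier (Osec \<Y> V)" if "g \<in> G" for g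
    using ringed_space_rst_closed[OF ringed_Y U(1) V(1,4)] U(4) that by blast
  define ex where "ex g = map (\<lambda>i. (l i V (dif V g), x i)) [0..<n]" for g
  have ex: "set (ex g) \<subseteq> kgens V" if "g \<in> carrier (Osec \<Y> V)" for g
    unfolding ex_def using x functionalD(1)[OF fD(2) V(1) order_refl dif_closed[OF V(1) that]] by (auto simp: kgens_iff)
  have one: "set [(\<one>\<^bsub>Osec \<Y> V\<^esub>, g)] \<subseteq> kgens V" if "g \<in> carrier (Osec \<Y> V)" for g
    using that cring.cring_simprules(6)[OF ringed_space_cring[OF ringed_Y V(1)]] by (simp add: kgens_iff)
  \<comment> \<open>The expansion of \<open>dg\<close> holds in the associated sheaf.
    \<open>P g Z\<close> says that it holds already in the presheaf module over \<open>Z\<close>;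
    finitely many \<open>g\<close> allow a common \<open>Z\<close>.\<close>
  define P where "P g Z \<longleftrightarrow> mrst KP V Z (kcl V [(\<one>\<^bsub>Osec \<Y> V\<^esub>, rst \<Y> U V g)]) = mrst KP V Z (kcl V (ex (rst \<Y> U V g)))" for g Z
  have "\<exists>Z. openin T Z \<and> y \<in> Z \<and> Z \<subseteq> V \<and> (\<forall>g\<in>G. P g Z)"
  proof (rule finite_neighbourhood[OF U(3) V(1,2)])
    fix g assume g: "g \<in> G"
    note k = kcl_closed[OF V(1) one[OF gV[OF g]]] kcl_closed[OF V(1) ex[OF gV[OF g]]]
    have "form V [(\<one>\<^bsub>Osec \<Y> V\<^esub>, rst \<Y> U V g)] = form V (ex (rst \<Y> U V g))"
      unfolding ex_def dif_form[symmetric] by (rule kaehler_expand[OF fV x gV[OF g]])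
    from fun_cong[OF this, of y] have gg: "KP.gm y V (kcl V [(\<one>\<^bsub>Osec \<Y> V\<^esub>, rst \<Y> U V g)]) = KP.gm y V (kcl V (ex (rst \<Y> U V g)))"
      unfolding form_def sheafify_unit_def using V(2) by simp
    obtain Z1 where "openin T Z1" "y \<in> Z1" "Z1 \<subseteq> V" "P g Z1"
      unfolding P_def by (fact KP.germ_eq_resD[OF V(1) k V(2) gg])
    then show "\<exists>Z. openin T Z \<and> y \<in> Z \<and> Z \<subseteq> V \<and> P g Z" by (intro exI[of _ Z1] conjI)
    fix Z Z' assume Z: "openin T Z" "Z \<subseteq> V" "P g Z" and Z': "openin T Z'" "Z' \<subseteq> Z"
    show "P g Z'"
      using Z(3) unfolding P_def KP.res_comp[OF V(1) Z(1) Z' Z(2) k(1), symmetric]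
        KP.res_comp[OF V(1) Z(1) Z' Z(2) k(2), symmetric] by simp
  qed
  then obtain Z0 where Z0: "openin T Z0" "y \<in> Z0" "Z0 \<subseteq> V" "\<forall>g\<in>G. P g Z0" by blast
  obtain W0 where W0: "W0 \<in> \<B>0" "y \<in> W0" "W0 \<subseteq> Z0" using base[OF Z0(1,2) U(2)] by blast
  have oW0: "openin T W0" "W0 \<subseteq> U" "W0 \<subseteq> V" using \<B>0[OF W0(1)] W0 Z0 by auto
  let ?B0 = "Osec \<Y> W0"
  interpret B0: cring ?B0 using ringed_space_cring[OF ringed_Y oW0(1)] .
  \<comment> \<open>The expansion as a congruence of formal sums over \<open>W0\<close>, the form in
    which arbitrary derivations of the sections over \<open>W0\<close> can be applied to it.\<close>
  have cong: "fs_cong (kgens W0) (krels W0) [(\<one>\<^bsub>?B0\<^esub>, rst \<Y> U W0 g)]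
      (map (\<lambda>i. (rst \<Y> V W0 (l i V (dif V (rst \<Y> U V g))), rst \<Y> V W0 (x i))) [0..<n])" if g: "g \<in> G" for g
  proof -
    note k = kcl_closed[OF V(1) one[OF gV[OF g]]] kcl_closed[OF V(1) ex[OF gV[OF g]]]
    have "mrst KP V W0 (kcl V [(\<one>\<^bsub>Osec \<Y> V\<^esub>, rst \<Y> U V g)]) = mrst KP V W0 (kcl V (ex (rst \<Y> U V g)))"
      using Z0(4) g unfolding P_def KP.res_comp[OF V(1) Z0(1) oW0(1) W0(3) Z0(3) k(1), symmetric]
        KP.res_comp[OF V(1) Z0(1) oW0(1) W0(3) Z0(3) k(2), symmetric] by simp
    then have "kcl W0 (map (map_prod (rst \<Y> V W0) (rst \<Y> V W0)) [(\<one>\<^bsub>Osec \<Y> V\<^esub>, rst \<Y> U V g)])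
        = kcl W0 (map (map_prod (rst \<Y> V W0) (rst \<Y> V W0)) (ex (rst \<Y> U V g)))"
      unfolding KP_eq pair.kaehler_presheaf(2)[OF V(1) oW0(1,3) one[OF gV[OF g]]]
        pair.kaehler_presheaf(2)[OF V(1) oW0(1,3) ex[OF gV[OF g]]] .
    moreover have "map (map_prod (rst \<Y> V W0) (rst \<Y> V W0)) [(\<one>\<^bsub>Osec \<Y> V\<^esub>, rst \<Y> U V g)] = [(\<one>\<^bsub>?B0\<^esub>, rst \<Y> U W0 g)]"
      using ring_hom_one[OF ringed_space_rst[OF ringed_Y V(1) oW0(1,3)]]
        ringed_space_rst_comp[OF ringed_Y U(1) V(1) oW0(1,3) V(4)] U(4) g by auto
    moreover have "set (map (map_prod (rst \<Y> V W0) (rst \<Y> V W0)) (ex (rst \<Y> U V g))) \<subseteq> kgens W0"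
      using ex[OF gV[OF g]] ringed_space_rst_closed[OF ringed_Y V(1) oW0(1,3)]
      by (auto simp: kaehler_gens_def subset_iff)
    ultimately have "fs_cong (kgens W0) (krels W0) [(\<one>\<^bsub>?B0\<^esub>, rst \<Y> U W0 g)]
        (map (map_prod (rst \<Y> V W0) (rst \<Y> V W0)) (ex (rst \<Y> U V g)))"
      unfolding kaehler_class_def by (simp add: fs_class_eq_iff)
    then show ?thesis unfolding ex_def by (simp add: comp_def)
  qed
  define xs where "xs W = (\<lambda>i. rst \<Y> V W (x i)) ` {..<n}" for W
  define C where "C W = generate_ring (Osec \<Y> W) (h W ` carrier (Osec \<A> W) \<union> xs W)" for W
  have xW: "rst \<Y> V W (x i) \<in> carrier (Osec \<Y> W)" if "openin T W" "W \<subseteq> V" "i < n" for W i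
    using ringed_space_rst_closed[OF ringed_Y V(1) that(1,2) x[OF that(3)]] .
  have Cgen: "h W ` carrier (Osec \<A> W) \<union> xs W \<subseteq> carrier (Osec \<Y> W)" if "openin T W" "W \<subseteq> V" for W
    unfolding xs_def using xW[OF that] ring_hom_closed[OF pair.h_hom[OF that(1)]] by auto
  have Csub: "subring (C W) (Osec \<Y> W)" "h W ` carrier (Osec \<A> W) \<union> xs W \<subseteq> C W"
    and Cmin: "\<And>H. subring H (Osec \<Y> W) \<Longrightarrow> h W ` carrier (Osec \<A> W) \<union> xs W \<subseteq> H \<Longrightarrow> C W \<subseteq> H"
    if W: "openin T W" "W \<subseteq> V" for W
  proof -
    interpret B: cring "Osec \<Y> W" using ringed_space_cring[OF ringed_Y W(1)] .
    show "subring (C W) (Osec \<Y> W)" unfolding C_def by (rule B.generate_ring_is_subring[OF Cgen[OF W]])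
    show "h W ` carrier (Osec \<A> W) \<union> xs W \<subseteq> C W" unfolding C_def by (auto intro: generate_ring.incl)
    show "C W \<subseteq> H" if "subring H (Osec \<Y> W)" "h W ` carrier (Osec \<A> W) \<union> xs W \<subseteq> H" for H
      unfolding C_def by (rule B.generate_ring_min_subring1[OF Cgen[OF W] that])
  qed
  \<comment> \<open>The quotient by \<open>I\<close> is the domain in which derivations take their
    values; being nonzero there means having a unit germ at \<open>y\<close>.\<close>
  define I where "I = {b \<in> carrier ?B0. \<not> germ_unit \<Y> y W0 b}"
  interpret P: primeideal I ?B0 unfolding I_def using prime[OF oW0(1) W0(2) U(2)] .
  interpret ch: char_p_extension ?B0 "?B0 Quot I" "(+>\<^bsub>?B0\<^esub>) I" "C W0" p
  proof (intro char_p_extension.intro char_p_extension_axioms.intro)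
    show "cring ?B0" by (rule B0.is_cring)
    show "domain (?B0 Quot I)" by (rule P.quotient_is_domain)
    show "ring_hom_cring ?B0 (?B0 Quot I) ((+>\<^bsub>?B0\<^esub>) I)" by (rule P.rcos_ring_hom_cring)
    show "subring (C W0) ?B0" by (rule Csub(1)[OF oW0(1,3)])
    show "Factorial_Ring.prime p" by (rule p)
    show "[p] \<cdot>\<^bsub>?B0\<^esub> \<one>\<^bsub>?B0\<^esub> = \<zero>\<^bsub>?B0\<^esub>" by (rule char_Y[OF oW0(1)])
    show "b [^]\<^bsub>?B0\<^esub> p \<in> C W0" if "b \<in> carrier ?B0" for b
      using frobA[OF oW0(1) that] Csub(2)[OF oW0(1,3)] by blast
  qed
  have "\<exists>f\<in>C W0. I +>\<^bsub>?B0\<^esub> f \<noteq> \<zero>\<^bsub>?B0 Quot I\<^esub> \<and> (\<forall>b\<in>carrier ?B0. f \<otimes>\<^bsub>?B0\<^esub> b \<in> C W0)"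
  proof (rule ch.generically_equal)
    show "finite (rst \<Y> U W0 ` G)" using U(3) by simp
    show "rst \<Y> U W0 ` G \<subseteq> carrier ?B0" using U(4) ringed_space_rst_closed[OF ringed_Y U(1) oW0(1,2)] by blast
    show "H = carrier ?B0" if "subring H ?B0" "C W0 \<union> rst \<Y> U W0 ` G \<subseteq> H" for H
      by (rule gen[OF W0(1) that(1)]) (use that(2) Csub(2)[OF oW0(1,3)] in blast)
    fix \<delta> assume \<delta>: "\<And>b. b \<in> carrier ?B0 \<Longrightarrow> \<delta> b \<in> carrier (?B0 Quot I)"
      "\<And>b c. b \<in> carrier ?B0 \<Longrightarrow> c \<in> carrier ?B0 \<Longrightarrow> \<delta> (b \<oplus>\<^bsub>?B0\<^esub> c) = \<delta> b \<oplus>\<^bsub>?B0 Quot I\<^esub> \<delta> c"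
      "\<And>b c. b \<in> carrier ?B0 \<Longrightarrow> c \<in> carrier ?B0 \<Longrightarrow>
        \<delta> (b \<otimes>\<^bsub>?B0\<^esub> c) = (I +>\<^bsub>?B0\<^esub> b) \<otimes>\<^bsub>?B0 Quot I\<^esub> \<delta> c \<oplus>\<^bsub>?B0 Quot I\<^esub> (I +>\<^bsub>?B0\<^esub> c) \<otimes>\<^bsub>?B0 Quot I\<^esub> \<delta> b"
      "\<And>c. c \<in> C W0 \<Longrightarrow> \<delta> c = \<zero>\<^bsub>?B0 Quot I\<^esub>"
    have \<delta>x: "\<delta> (rst \<Y> V W0 (x i)) = \<zero>\<^bsub>?B0 Quot I\<^esub>" if "i < n" for i
      using \<delta>(4) Csub(2)[OF oW0(1,3)] that unfolding xs_def by blast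
    have \<delta>A: "\<delta> (h W0 a) = \<zero>\<^bsub>?B0 Quot I\<^esub>" if "a \<in> carrier (Osec \<A> W0)" for a
      using \<delta>(4) Csub(2)[OF oW0(1,3)] that by blast
    show "\<forall>g\<in>rst \<Y> U W0 ` G. \<delta> g = \<zero>\<^bsub>?B0 Quot I\<^esub>"
    proof (intro ballI, elim imageE)
      fix g' g assume g: "g \<in> G" and g': "g' = rst \<Y> U W0 g"
      let ?ev = "fs_eval (?B0 Quot I) (\<lambda>(b, c). (I +>\<^bsub>?B0\<^esub> b) \<otimes>\<^bsub>?B0 Quot I\<^esub> \<delta> c)"
      let ?L = "\<lambda>m. map (\<lambda>i. (rst \<Y> V W0 (l i V (dif V (rst \<Y> U V g))), rst \<Y> V W0 (x i))) [0..<m]"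
      have gc: "g' \<in> carrier ?B0" unfolding g' using U(4) g ringed_space_rst_closed[OF ringed_Y U(1) oW0(1,2)] by blast
      \<comment> \<open>Applying the derivation to the expansion of \<open>dg\<close> expresses
        \<open>\<delta> g\<close> through the \<open>\<delta> x\<^sub>i\<close>, which vanish
        because the \<open>x\<^sub>i\<close> belong to \<open>C\<close>.\<close>
      have "?ev [(\<one>\<^bsub>?B0\<^esub>, g')] = ?ev (?L n)"
        unfolding g'
        by (rule kaehler_derivation[OF oW0(1) ch.K.is_cring P.rcos_ring_hom \<delta>(1-3) \<delta>A cong[OF g]])
      \<comment> \<open>Every summand is zero. The index \<open>n\<close>, which never occurs, casts
        this as an instance of \<open>fs_eval_delta\<close> with value zero.\<close>
      moreover have "?ev (?L n) = (if n < n then \<zero>\<^bsub>?B0 Quot I\<^esub> else \<zero>\<^bsub>?B0 Quot I\<^esub>)"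
      proof (rule fs_eval_delta[OF ch.K.abelian_monoid_axioms])
        fix i assume i: "i < n"
        have "rst \<Y> V W0 (l i V (dif V (rst \<Y> U V g))) \<in> carrier ?B0"
          using ringed_space_rst_closed[OF ringed_Y V(1) oW0(1,3)]
            functionalD(1)[OF fD(2)[OF i] V(1) order_refl dif_closed[OF V(1) gV[OF g]]] by blast
        then show "(case (rst \<Y> V W0 (l i V (dif V (rst \<Y> U V g))), rst \<Y> V W0 (x i)) of
            (b, c) \<Rightarrow> (I +>\<^bsub>?B0\<^esub> b) \<otimes>\<^bsub>?B0 Quot I\<^esub> \<delta> c) = (if n = i then \<zero>\<^bsub>?B0 Quot I\<^esub> else \<zero>\<^bsub>?B0 Quot I\<^esub>)"
          unfolding prod.case \<delta>x[OF i] if_cancel by (intro ch.K.r_null ch.q.hom_closed)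
      qed simp
      ultimately have "(I +>\<^bsub>?B0\<^esub> \<one>\<^bsub>?B0\<^esub>) \<otimes>\<^bsub>?B0 Quot I\<^esub> \<delta> g' \<oplus>\<^bsub>?B0 Quot I\<^esub> \<zero>\<^bsub>?B0 Quot I\<^esub> = \<zero>\<^bsub>?B0 Quot I\<^esub>"
        by simp
      then show "\<delta> g' = \<zero>\<^bsub>?B0 Quot I\<^esub>" using \<delta>(1)[OF gc] ch.q.hom_one by simp
    qed
  qed
  then obtain f where f: "f \<in> C W0" "I +>\<^bsub>?B0\<^esub> f \<noteq> \<zero>\<^bsub>?B0 Quot I\<^esub>" "\<And>b. b \<in> carrier ?B0 \<Longrightarrow> f \<otimes>\<^bsub>?B0\<^esub> b \<in> C W0"
    by blast
  have fB: "f \<in> carrier ?B0" using f(1) ch.C_sub by blast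
  have "f \<notin> I"
  proof
    assume "f \<in> I"
    then have "I +>\<^bsub>?B0\<^esub> f = I" by (rule P.a_rcos_const)
    then show False using f(2) unfolding FactRing_def by simp
  qed
  \<comment> \<open>The denominator becomes invertible on a neighbourhood of \<open>y\<close>, and
    there the subring generated by the \<open>x\<^sub>i\<close> over \<X> is everything.\<close>
  then have "germ_unit \<Y> y W0 f" using fB unfolding I_def by simp
  then obtain V1 where V1: "openin T V1" "y \<in> V1" "V1 \<subseteq> W0" "rst \<Y> W0 V1 f \<in> Units (Osec \<Y> V1)"
    unfolding germ_unit_def by blast
  have V1V: "V1 \<subseteq> V" "V1 \<subseteq> U" using V1(3) oW0 by auto
  let ?\<B> = "{W \<in> \<B>0. W \<subseteq> V1}"
  \<comment> \<open>Over \<open>W\<close> the subring contains \<open>f\<close>, hence its inverse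
    by \<open>unit_inverse\<close>, and the products of \<open>f\<close> with the generators; so it
    contains the generators.\<close>
  have full: "C W = carrier (Osec \<Y> W)" if W: "openin T W" "W \<subseteq> V1" "W \<in> \<B>0" for W
  proof (rule gen[OF W(3)])
    let ?r = "rst \<Y> W0 W"
    have WV: "W \<subseteq> V" "W \<subseteq> W0" using W(2) V1V V1(3) by auto
    note CW = Csub[OF W(1) WV(1)]
    interpret B: cring "Osec \<Y> W" using ringed_space_cring[OF ringed_Y W(1)] .
    have r: "?r \<in> ring_hom ?B0 (Osec \<Y> W)" by (rule ringed_space_rst[OF ringed_Y oW0(1) W(1) WV(2)])
    show "subring (C W) (Osec \<Y> W)" by (rule CW(1))
    have "C W0 \<subseteq> {b \<in> carrier ?B0. ?r b \<in> C W}"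
    proof (rule Cmin[OF oW0(1,3) subring_vimage[OF B0.is_cring B.is_cring r CW(1)]], intro Un_least subsetI)
      fix b assume "b \<in> h W0 ` carrier (Osec \<A> W0)"
      then obtain a where a: "a \<in> carrier (Osec \<A> W0)" "b = h W0 a" by blast
      have "?r b = h W (rst \<A> W0 W a)" unfolding a(2) using pair.h_rst[OF oW0(1) W(1) WV(2) a(1)] by simp
      moreover have "rst \<A> W0 W a \<in> carrier (Osec \<A> W)"
        using ringed_space_rst_closed[OF ringed_A, of W0 W, unfolded A_simps(1), OF oW0(1) W(1) WV(2) a(1)] .
      ultimately show "b \<in> {b \<in> carrier ?B0. ?r b \<in> C W}"
        using CW(2) a ring_hom_closed[OF pair.h_hom[OF oW0(1)] a(1)] by auto
    next
      fix b assume "b \<in> xs W0"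
      then obtain i where i: "i < n" "b = rst \<Y> V W0 (x i)" unfolding xs_def by blast
      have "?r b = rst \<Y> V W (x i)"
        unfolding i(2) by (rule ringed_space_rst_comp[OF ringed_Y V(1) oW0(1) W(1) WV(2) oW0(3) x[OF i(1)]])
      then show "b \<in> {b \<in> carrier ?B0. ?r b \<in> C W}"
        using CW(2) i xW[OF oW0(1,3) i(1)] unfolding xs_def by auto
    qed
    then have rC: "?r b \<in> C W" if "b \<in> C W0" for b using that by blast
    have "?r f = rst \<Y> V1 W (rst \<Y> W0 V1 f)"
      using ringed_space_rst_comp[OF ringed_Y oW0(1) V1(1) W(1,2) V1(3) fB] by simp
    then have rf: "?r f \<in> Units (Osec \<Y> W)"
      using ring_hom_Units[OF ringed_space_rst[OF ringed_Y V1(1) W(1,2)] V1(4)] by simp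
    obtain w where w: "w \<in> carrier (Osec \<Y> W)" "w \<otimes>\<^bsub>Osec \<Y> W\<^esub> ?r f = \<one>\<^bsub>Osec \<Y> W\<^esub>"
      "\<And>H. subring H (Osec \<Y> W) \<Longrightarrow> h W ` carrier (Osec \<A> W) \<subseteq> H \<Longrightarrow> ?r f \<in> H \<Longrightarrow> w \<in> H"
      by (fact unit_inverse[OF W(1) rf])
    have wC: "w \<in> C W" using w(3)[OF CW(1)] CW(2) rC[OF f(1)] by blast
    have "rst \<Y> U W g \<in> C W" if g: "g \<in> G" for g
    proof -
      have gU: "g \<in> carrier (Osec \<Y> U)" using U(4) g by blast
      have gB: "rst \<Y> U W0 g \<in> carrier ?B0" by (rule ringed_space_rst_closed[OF ringed_Y U(1) oW0(1,2) gU])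
      have eq: "rst \<Y> U W g = ?r (rst \<Y> U W0 g)"
        using ringed_space_rst_comp[OF ringed_Y U(1) oW0(1) W(1) WV(2) oW0(2) gU] by simp
      have "?r (f \<otimes>\<^bsub>?B0\<^esub> rst \<Y> U W0 g) \<in> C W" by (rule rC[OF f(3)[OF gB]])
      then have "w \<otimes>\<^bsub>Osec \<Y> W\<^esub> (?r f \<otimes>\<^bsub>Osec \<Y> W\<^esub> rst \<Y> U W g) \<in> C W"
        unfolding eq ring_hom_mult[OF r fB gB] using wC subringE(6)[OF CW(1)] by blast
      then show ?thesis
        using w(1,2) ring_hom_closed[OF r fB] ring_hom_closed[OF r gB] unfolding eq by (simp add: B.m_assoc[symmetric])
    qed
    then show "h W ` carrier (Osec \<A> W) \<union> rst \<Y> U W ` G \<subseteq> C W" using CW(2) by blast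
  qed
  have pb: "p_basis (Osec \<A> W) (Osec \<Y> W) (h W) n p (\<lambda>i. rst \<Y> V W (x i)) (\<lambda>i b. l i W (dif W b))"
    if W: "W \<in> ?\<B>" for W
  proof -
    have oW: "openin T W" "W \<subseteq> V1" "W \<in> \<B>0" "W \<subseteq> V" using W \<B>0 V1V by auto
    interpret A: cring "Osec \<A> W" using ringed_space_cring[OF ringed_A, of W] oW(1) unfolding A_simps(1) by blast
    interpret B: cring "Osec \<Y> W" using ringed_space_cring[OF ringed_Y oW(1)] .
    interpret h: ring_hom_cring "Osec \<A> W" "Osec \<Y> W" "h W"
      using pair.h_hom[OF oW(1)] by (intro ring_hom_cring.intro ring_hom_cring_axioms.intro A.is_cring B.is_cring)
    have fn: "functional V (l i)" if "i < n" for i by (rule fD(2)[OF that])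
    note lD = functionalD[OF fn oW(1,4)]
    note dc = dif_closed[OF oW(1)]
    interpret M: Module.module "Osec \<Y> W" "msec Om W" by (rule Om.module_sec[OF oW(1)])
    show ?thesis
    proof (intro p_basis.intro p_basis_axioms.intro)
      show "cring (Osec \<A> W)" "cring (Osec \<Y> W)" by (rule A.is_cring, rule B.is_cring)
      show "ring_hom_cring (Osec \<A> W) (Osec \<Y> W) (h W)" by (rule h.ring_hom_cring_axioms)
      show "inj_on (h W) (carrier (Osec \<A> W))" by (rule h_inj[OF oW(1)])
      show "Factorial_Ring.prime p" by (rule p)
      show "[p] \<cdot>\<^bsub>Osec \<A> W\<^esub> \<one>\<^bsub>Osec \<A> W\<^esub> = \<zero>\<^bsub>Osec \<A> W\<^esub>" by (rule char_A[OF oW(1)])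
      show "H = carrier (Osec \<Y> W)" if "subring H (Osec \<Y> W)"
        "h W ` carrier (Osec \<A> W) \<union> (\<lambda>i. rst \<Y> V W (x i)) ` {..<n} \<subseteq> H" for H
        using Cmin[OF oW(1,4) that(1)] that(2) full[OF oW(1-3)] subringE(1)[OF that(1)] unfolding xs_def by blast
      fix i assume i: "i < n"
      show "rst \<Y> V W (x i) \<in> carrier (Osec \<Y> W)" by (rule xW[OF oW(1,4) i])
      then show "rst \<Y> V W (x i) [^]\<^bsub>Osec \<Y> W\<^esub> p \<in> h W ` carrier (Osec \<A> W)" by (rule frobA[OF oW(1)])
      show "l i W (dif W (h W a)) = \<zero>\<^bsub>Osec \<Y> W\<^esub>" if "a \<in> carrier (Osec \<A> W)" for a
        unfolding dif_const[OF oW(1) that] by (rule functional_zero[OF fn[OF i] oW(1,4)])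
      show "l i W (dif W (rst \<Y> V W (x j))) = (if i = j then \<one>\<^bsub>Osec \<Y> W\<^esub> else \<zero>\<^bsub>Osec \<Y> W\<^esub>)" if j: "j < n" for j
        unfolding dif_res[OF V(1) oW(1,4) x[OF j], symmetric]
          functionalD(4)[OF fn[OF i] V(1) order_refl fD(3)[OF j] oW(1,4)] fD(4)[OF i j]
        by (rule rst_delta[OF V(1) oW(1,4)])
      fix b assume b: "b \<in> carrier (Osec \<Y> W)"
      show "l i W (dif W b) \<in> carrier (Osec \<Y> W)" by (rule lD(1)[OF i dc[OF b]])
      fix c assume c: "c \<in> carrier (Osec \<Y> W)"
      show "l i W (dif W (b \<oplus>\<^bsub>Osec \<Y> W\<^esub> c)) = l i W (dif W b) \<oplus>\<^bsub>Osec \<Y> W\<^esub> l i W (dif W c)"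
        unfolding dif_add[OF oW(1) b c] by (rule lD(2)[OF i dc[OF b] dc[OF c]])
      show "l i W (dif W (b \<otimes>\<^bsub>Osec \<Y> W\<^esub> c)) = b \<otimes>\<^bsub>Osec \<Y> W\<^esub> l i W (dif W c) \<oplus>\<^bsub>Osec \<Y> W\<^esub> c \<otimes>\<^bsub>Osec \<Y> W\<^esub> l i W (dif W b)"
        unfolding dif_mult[OF oW(1) b c] lD(2)[OF i M.smult_closed[OF b dc[OF c]] M.smult_closed[OF c dc[OF b]]]
          lD(3)[OF i dc[OF c] b] lD(3)[OF i dc[OF b] c] ..
    qed
  qed
  \<comment> \<open>The same p-basis, with the \<open>x\<^sub>i\<close> first restricted to the
    smaller neighbourhood \<open>V1\<close> on which the conclusion is stated.\<close>
  have pb1: "p_basis (Osec \<A> W) (Osec \<Y> W) (h W) n p (\<lambda>i. rst \<Y> V1 W (rst \<Y> V V1 (x i))) (\<lambda>i b. l i W (dif W b))"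
    if W: "W \<in> ?\<B>" for W
  proof -
    have oW: "openin T W" "W \<subseteq> V1" using W \<B>0 by auto
    have xx: "rst \<Y> V W (x i) = rst \<Y> V1 W (rst \<Y> V V1 (x i))" if "i < n" for i
      using ringed_space_rst_comp[OF ringed_Y V(1) V1(1) oW V1V(1) x[OF that]] by simp
    have im: "(\<lambda>i. rst \<Y> V W (x i)) ` {..<n} = (\<lambda>i. rst \<Y> V1 W (rst \<Y> V V1 (x i))) ` {..<n}"
      using xx by (intro image_cong) auto
    show ?thesis
      using pb[OF W] unfolding p_basis_def p_basis_axioms_def im by (simp add: xx)
  qed
  show thesis
  proof (rule that[of V1 n l ?\<B> "\<lambda>i. rst \<Y> V V1 (x i)"])
    show "openin T V1" "y \<in> V1" by (rule V1(1), rule V1(2))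
    show "functional V1 (l i)" if "i < n" for i by (rule functional_mono[OF fD(2)[OF that] V1V(1)])
    show "openin T W \<and> W \<subseteq> V1" if "W \<in> ?\<B>" for W using that \<B>0 by blast
    show "\<exists>W\<in>?\<B>. z \<in> W \<and> W \<subseteq> Z" if Z: "openin T Z" "z \<in> Z" "z \<in> V1" for Z z
    proof -
      have "openin T (Z \<inter> V1)" using Z V1(1) by blast
      moreover have "z \<in> Z \<inter> V1" "z \<in> U" using Z V1V by auto
      ultimately obtain W where "W \<in> \<B>0" "z \<in> W" "W \<subseteq> Z \<inter> V1" using base by blast
      then show ?thesis by blast
    qed
    show "p_basis (Osec \<A> W) (Osec \<Y> W) (h W) n p (\<lambda>i. rst \<Y> V1 W (rst \<Y> V V1 (x i))) (\<lambda>i b. l i W (dif W b))"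
      if "W \<in> ?\<B>" for W by (rule pb1[OF that])
  qed
qed

end

section \<open>The canonical connection\<close>

text \<open>\<open>sheafify_map\<close> is a union over all representatives of a germ. Compatibility
  of \<open>\<phi>\<close> with restriction makes the resulting germ independent of the
  representative.\<close>

lemma sheafify_map_germ:
  assumes F: "module_presheaf \<X> F" and G: "module_presheaf \<X> G"
    and \<phi>: "\<And>V m. openin (tops \<X>) V \<Longrightarrow> m \<in> carrier (msec F V) \<Longrightarrow> \<phi> V m \<in> carrier (msec G V)"
    and nat: "\<And>V W m. openin (tops \<X>) V \<Longrightarrow> openin (tops \<X>) W \<Longrightarrow> W \<subseteq> V \<Longrightarrow> m \<in> carrier (msec F V) \<Longrightarrow>
      mrst G V W (\<phi> V m) = \<phi> W (mrst F V W m)"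
    and V: "openin (tops \<X>) V" "x \<in> V" "m \<in> carrier (msec F V)" and s: "s x = germ (tops \<X>) F x V m"
  shows "sheafify_map (tops \<X>) G \<phi> s x = germ (tops \<X>) G x V (\<phi> V m)"
proof -
  interpret F: module_presheaf \<X> F by (rule F)
  interpret G: module_presheaf \<X> G by (rule G)
  show ?thesis
    unfolding sheafify_map_def s
  proof (rule F.germ_Un_const[OF V])
    fix W n assume W: "openin (tops \<X>) W" "x \<in> W" "n \<in> carrier (msec F W)"
      and "germ (tops \<X>) F x W n = germ (tops \<X>) F x V m"
    then obtain Z where Z: "openin (tops \<X>) Z" "x \<in> Z" "Z \<subseteq> W \<inter> V" "mrst F W Z n = mrst F V Z m"
      unfolding F.germ_eq_iff[OF W V] by blast
    have "Z \<subseteq> W" "Z \<subseteq> V" using Z(3) by auto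
    then have "mrst G W Z (\<phi> W n) = mrst G V Z (\<phi> V m)"
      using nat[OF W(1) Z(1) _ W(3)] nat[OF V(1) Z(1) _ V(3)] Z(4) by simp
    then have "germ (tops \<X>) G x W (\<phi> W n) = germ (tops \<X>) G x V (\<phi> V m)"
      unfolding G.germ_eq_iff[OF W(1,2) \<phi>[OF W(1,3)] V(1,2) \<phi>[OF V(1,3)]] using Z by blast
    then show "(case (W, n) of (V, m) \<Rightarrow> germ (tops \<X>) G x V (\<phi> V m)) = germ (tops \<X>) G x V (\<phi> V m)" by simp
  qed
qed

section \<open>Sections of a tensor product of sheaves as formal sums\<close>

locale tensor_pair = ringed_pair \<Y> \<A> h + M: module_presheaf \<Y> M + N: module_presheaf \<A> N
  for \<Y> :: "('y, 'b) ringed_space" and \<A> :: "('y, 'r) ringed_space" and h :: "'y set \<Rightarrow> 'r \<Rightarrow> 'b"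
    and M :: "('y, 'b, 'm) mod_sheaf" and N :: "('y, 'r, 'n) mod_sheaf"
begin

abbreviation "P \<equiv> tensor_presheaf \<A> h M N"
abbreviation "gens V \<equiv> tens_gens (msec M V) (msec N V)"
abbreviation "rels V \<equiv> tens_rels (Osec \<A> V) (h V) (msec M V) (msec N V)"
abbreviation "cl V \<equiv> tens_class (Osec \<A> V) (h V) (msec M V) (msec N V)"
abbreviation "ucl V L \<equiv> sheafify_unit (tops \<Y>) P V (cl V L)"

sublocale P: module_presheaf \<Y> P
  by (rule tensor_presheaf(1)) (unfold_locales)

lemmas res_cl = tensor_presheaf(2)[OF M.module_presheaf_axioms N.module_presheaf_axioms]

lemma gens_iff: "(m, n) \<in> gens V \<longleftrightarrow> m \<in> carrier (msec M V) \<and> n \<in> carrier (msec N V)"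
  unfolding tens_gens_def by simp

lemma P_sec: "msec P V = tensor (Osec \<A> V) (h V) (msec M V) (msec N V)"
  unfolding tensor_presheaf_def by simp

lemma presentation:
  assumes "openin (tops \<Y>) V"
  shows "fs_presentation (Osec \<Y> V) (gens V) (rels V) (\<lambda>b (m, n). (b \<odot>\<^bsub>msec M V\<^esub> m, n))"
  using assms tops_A by (intro tens_presentation M.module_sec N.module_sec h_hom) simp_all

lemma cl_closed: "openin (tops \<Y>) V \<Longrightarrow> set L \<subseteq> gens V \<Longrightarrow> cl V L \<in> carrier (msec P V)"
  unfolding P_sec tensor_def tens_class_def by (rule fs_presentation.class_carrier[OF presentation])

lemma P_cases:
  assumes "c \<in> carrier (msec P V)"
  obtains L where "set L \<subseteq> gens V" "c = cl V L"
  using assms unfolding P_sec tensor_def tens_class_def fs_module_simps by blast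

lemma cl_append: "set L \<subseteq> gens V \<Longrightarrow> set L' \<subseteq> gens V \<Longrightarrow> cl V (L @ L') = cl V L \<oplus>\<^bsub>msec P V\<^esub> cl V L'"
  unfolding P_sec tensor_def tens_class_def by (simp add: fs_module_add)

lemma cl_Nil: "cl V [] = \<zero>\<^bsub>msec P V\<^esub>"
  unfolding P_sec tensor_def tens_class_def fs_module_simps ..

lemma cl_smult:
  assumes "openin (tops \<Y>) V" "b \<in> carrier (Osec \<Y> V)" "(m, n) \<in> gens V"
  shows "b \<odot>\<^bsub>msec P V\<^esub> cl V [(m, n)] = cl V [(b \<odot>\<^bsub>msec M V\<^esub> m, n)]"
  unfolding P_sec tensor_def tens_class_def
  using fs_presentation.smult_class[OF presentation[OF assms(1)] assms(2), of "[(m, n)]"] assms(3) by simp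

lemma cl_eqI: "fs_cong (gens V) (rels V) L L' \<Longrightarrow> cl V L = cl V L'"
  unfolding tens_class_def by (rule fs_class_eqI)

lemma cl_eqD: "cl V L = cl V L' \<Longrightarrow> set L' \<subseteq> gens V \<Longrightarrow> fs_cong (gens V) (rels V) L L'"
  unfolding tens_class_def by (simp add: fs_class_eq_iff)

lemma gens_res:
  assumes "openin (tops \<Y>) V" "openin (tops \<Y>) W" "W \<subseteq> V" "set L \<subseteq> gens V"
  shows "set (map (map_prod (mrst M V W) (mrst N V W)) L) \<subseteq> gens W"
proof
  fix g assume "g \<in> set (map (map_prod (mrst M V W) (mrst N V W)) L)"
  then obtain m n where "(m, n) \<in> gens V" "g = (mrst M V W m, mrst N V W n)" using assms(4) by auto
  then show "g \<in> gens W"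
    using M.res_closed[OF assms(1-3)] N.res_closed[unfolded tops_A, OF assms(1-3)] by (simp add: gens_iff)
qed

lemma ucl_closed: "openin (tops \<Y>) V \<Longrightarrow> set L \<subseteq> gens V \<Longrightarrow> ucl V L \<in> carrier (msec (sheafify \<Y> P) V)"
  by (intro P.unit_closed cl_closed)

lemma ucl_Cons:
  assumes "openin (tops \<Y>) V" "g \<in> gens V" "set L \<subseteq> gens V"
  shows "ucl V (g # L) = ucl V [g] \<oplus>\<^bsub>msec (sheafify \<Y> P) V\<^esub> ucl V L"
  using P.unit_add[OF assms(1) cl_closed[OF assms(1), of "[g]"] cl_closed[OF assms(1,3)]]
    cl_append[of "[g]" V L] assms by simp

lemma ucl_Nil: "ucl V [] = \<zero>\<^bsub>msec (sheafify \<Y> P) V\<^esub>"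
  unfolding P.sheafify_simps(2) cl_Nil ..

lemma ucl_res:
  assumes "openin (tops \<Y>) V" "openin (tops \<Y>) W" "W \<subseteq> V" "set L \<subseteq> gens V"
  shows "mrst (sheafify \<Y> P) V W (ucl V L) = ucl W (map (map_prod (mrst M V W) (mrst N V W)) L)"
  unfolding P.unit_res[OF assms(1-3) cl_closed[OF assms(1,4)]] res_cl[OF assms] ..

text \<open>Equal germs agree over some neighbourhood as elements of the presheaf tensor product,
  and there equality is congruence of the restricted lists.\<close>

lemma ucl_eq_local:
  assumes V: "openin (tops \<Y>) V" "x \<in> V" and L: "set L \<subseteq> gens V" "set L' \<subseteq> gens V"
    and eq: "germ (tops \<Y>) P x V (cl V L) = germ (tops \<Y>) P x V (cl V L')"
  shows "\<exists>Z. openin (tops \<Y>) Z \<and> x \<in> Z \<and> Z \<subseteq> V \<and> fs_cong (gens Z) (rels Z)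
    (map (map_prod (mrst M V Z) (mrst N V Z)) L) (map (map_prod (mrst M V Z) (mrst N V Z)) L')"
proof -
  obtain Z where Z: "openin (tops \<Y>) Z" "x \<in> Z" "Z \<subseteq> V" "mrst P V Z (cl V L) = mrst P V Z (cl V L')"
    by (fact P.germ_eq_resD[OF V(1) cl_closed[OF V(1) L(1)] cl_closed[OF V(1) L(2)] V(2) eq])
  show ?thesis
    using Z(1-3) cl_eqD[OF Z(4)[unfolded res_cl[OF V(1) Z(1,3) L(1)] res_cl[OF V(1) Z(1,3) L(2)]]
      gens_res[OF V(1) Z(1,3) L(2)]] by (intro exI[of _ Z] conjI)
qed

lemma sec_cl:
  assumes "s \<in> carrier (msec (sheafify \<Y> P) U)" "x \<in> U"
  obtains V L where "openin (tops \<Y>) V" "x \<in> V" "V \<subseteq> U" "set L \<subseteq> gens V"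
    "mrst (sheafify \<Y> P) U V s = ucl V L"
proof -
  obtain V m where V: "openin (tops \<Y>) V" "x \<in> V" "V \<subseteq> U" "m \<in> carrier (msec P V)"
    "\<And>z. z \<in> V \<Longrightarrow> s z = germ (tops \<Y>) P z V m" by (fact P.sec_local[OF assms])
  obtain L where L: "set L \<subseteq> gens V" "m = cl V L" by (fact P_cases[OF V(4)])
  have "mrst (sheafify \<Y> P) U V s = ucl V L"
    unfolding P.sheafify_simps(3) sheafify_unit_def L(2)[symmetric] by (rule ext) (simp add: V(5))
  then show thesis by (rule that[OF V(1-3) L(1)])
qed

lemma fs_cong_res:
  assumes "openin (tops \<Y>) V" "openin (tops \<Y>) W" "W \<subseteq> V"
    and L: "set L \<subseteq> gens V" "set L' \<subseteq> gens V" and "fs_cong (gens V) (rels V) L L'"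
  shows "fs_cong (gens W) (rels W) (map (map_prod (mrst M V W) (mrst N V W)) L) (map (map_prod (mrst M V W) (mrst N V W)) L')"
proof (rule cl_eqD[OF _ gens_res[OF assms(1-3) L(2)]])
  show "cl W (map (map_prod (mrst M V W) (mrst N V W)) L) = cl W (map (map_prod (mrst M V W) (mrst N V W)) L')"
    unfolding res_cl[OF assms(1-3) L(1), symmetric] res_cl[OF assms(1-3) L(2), symmetric] cl_eqI[OF assms(6)] ..
qed

end


locale module_frobenius_factor = frobenius_factor L K p \<X> \<kappa>\<^sub>K \<Y> \<kappa>\<^sub>L \<pi>
  for L :: "'l ring" and K :: "'l set" and p :: nat
    and \<X> :: "('x, 'a) ringed_space" and \<kappa>\<^sub>K :: "'l \<Rightarrow> 'a"
    and \<Y> :: "('y, 'b) ringed_space" and \<kappa>\<^sub>L :: "'l \<Rightarrow> 'b"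
    and \<pi> :: "('y, 'b, 'x, 'a) rs_map" +
  fixes S\<^sub>1 :: "('x, 'a, 'm) mod_sheaf"
  assumes S1: "is_module_sheaf \<X> S\<^sub>1" and lf: "locally_free_sheaf \<Y> Om"
begin

abbreviation "N \<equiv> inv_image_mod \<pi> S\<^sub>1"
abbreviation "OY \<equiv> structure_module \<Y>"

lemma N_simps: "msec N V = msec S\<^sub>1 (pt \<pi> ` V)" "mrst N V W = mrst S\<^sub>1 (pt \<pi> ` V) (pt \<pi> ` W)"
  unfolding inv_image_mod_def by simp_all

lemma OY_simps: "carrier (msec OY V) = carrier (Osec \<Y> V)" "add (msec OY V) = add (Osec \<Y> V)"
    "zero (msec OY V) = zero (Osec \<Y> V)" "smult (msec OY V) = monoid.mult (Osec \<Y> V)" "mrst OY = rst \<Y>"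
  unfolding structure_module_def by simp_all

sublocale S1: module_presheaf \<X> S\<^sub>1
  by (rule is_module_sheaf_module_presheaf[OF ringed_X S1])

lemma N_presheaf: "module_presheaf \<A> N"
  unfolding module_presheaf_def N_simps A_simps
  using ringed_A S1.module_sec S1.res_closed S1.res_add S1.res_smult S1.res_id S1.res_comp
  by (simp add: im_open image_mono)

text \<open>\<open>B\<close>, \<open>O\<close> and \<open>C\<close> are the three tensor products
  that the connection passes through: the structure sheaf of \<Y> with \<open>S\<^sub>1\<close> over
  \<X>, then \<Omega> with \<open>S\<^sub>1\<close> over \<X>, then \<Omega> with the sheaf
  \<open>E\<close> obtained from \<open>B\<close>, over \<Y>.\<close>

sublocale B: tensor_pair \<Y> \<A> h OY N
  by (intro tensor_pair.intro pair structure_module_presheaf ringed_Y N_presheaf)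

sublocale O: tensor_pair \<Y> \<A> h Om N
  by (intro tensor_pair.intro pair Om.module_presheaf_axioms N_presheaf)

abbreviation "E \<equiv> sheafify \<Y> B.P"

sublocale E: module_presheaf \<Y> E
  by (rule B.P.sheafify_presheaf)

lemma identity_pair: "ringed_pair \<Y> \<Y> (\<lambda>V b. b)"
  by (rule ringed_pair.intro[OF ringed_Y ringed_Y refl]) (auto simp: ring_hom_def)

sublocale C: tensor_pair \<Y> \<Y> "\<lambda>V b. b" Om E
  by (intro tensor_pair.intro identity_pair Om.module_presheaf_axioms E.module_presheaf_axioms)

lemma functor_eqs:
  "tensor_X_presheaf \<Y> \<X> \<pi> OY S\<^sub>1 = B.P" "tensor_X_presheaf \<Y> \<X> \<pi> Om S\<^sub>1 = O.P"
  "tensor_X \<Y> \<X> \<pi> OY S\<^sub>1 = E" "Omega_tensor_presheaf \<Y> \<X> \<pi> E = C.P" "Omega_tensor \<Y> \<X> \<pi> E = sheafify \<Y> C.P"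
  unfolding tensor_X_presheaf_def tensor_X_def tensor_sheaf_def Omega_tensor_presheaf_def Omega_tensor_def
  by (rule refl)+

abbreviation "ot \<equiv> one_tensor \<Y> \<X> \<pi> S\<^sub>1"

lemma ot_eq: "ot V m = B.ucl V [(\<one>\<^bsub>Osec \<Y> V\<^esub>, m)]"
  unfolding one_tensor_def functor_eqs ..

lemma one_gens:
  assumes "openin T V" "m \<in> carrier (msec N V)"
  shows "set [(\<one>\<^bsub>Osec \<Y> V\<^esub>, m)] \<subseteq> B.gens V"
proof -
  interpret R: cring "Osec \<Y> V" using ringed_space_cring[OF ringed_Y assms(1)] .
  show ?thesis using assms by (simp add: B.gens_iff OY_simps)
qed

lemma ot_closed: "openin T V \<Longrightarrow> m \<in> carrier (msec N V) \<Longrightarrow> ot V m \<in> carrier (msec E V)"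
  unfolding ot_eq by (intro B.ucl_closed one_gens)

lemma ot_res:
  assumes "openin T V" "openin T W" "W \<subseteq> V" "m \<in> carrier (msec N V)"
  shows "mrst E V W (ot V m) = ot W (mrst N V W m)"
  unfolding ot_eq B.ucl_res[OF assms(1-3) one_gens[OF assms(1,4)]]
  using ring_hom_one[OF ringed_space_rst[OF ringed_Y assms(1-3)]] by (simp add: OY_simps)

lemma smult_ot:
  assumes V: "openin T V" and b: "b \<in> carrier (Osec \<Y> V)" and m: "m \<in> carrier (msec N V)"
  shows "b \<odot>\<^bsub>msec E V\<^esub> ot V m = B.ucl V [(b, m)]"
proof -
  interpret R: cring "Osec \<Y> V" using ringed_space_cring[OF ringed_Y V] .
  have "b \<odot>\<^bsub>msec E V\<^esub> ot V m = sheafify_unit T B.P V (b \<odot>\<^bsub>msec B.P V\<^esub> B.cl V [(\<one>\<^bsub>Osec \<Y> V\<^esub>, m)])"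
    unfolding ot_eq by (rule B.P.unit_smult[OF V B.cl_closed[OF V one_gens[OF V m]] b])
  also have "b \<odot>\<^bsub>msec B.P V\<^esub> B.cl V [(\<one>\<^bsub>Osec \<Y> V\<^esub>, m)] = B.cl V [(b, m)]"
    using B.cl_smult[OF V b, of "\<one>\<^bsub>Osec \<Y> V\<^esub>" m] one_gens[OF V m] b by (simp add: OY_simps)
  finally show ?thesis .
qed

lemma ot_add:
  assumes V: "openin T V" and m: "m \<in> carrier (msec N V)" and n: "n \<in> carrier (msec N V)"
  shows "ot V (m \<oplus>\<^bsub>msec N V\<^esub> n) = ot V m \<oplus>\<^bsub>msec E V\<^esub> ot V n"
proof -
  note g = one_gens[OF V m] one_gens[OF V n]
  have "B.cl V [(\<one>\<^bsub>Osec \<Y> V\<^esub>, m \<oplus>\<^bsub>msec N V\<^esub> n)] = B.cl V [(\<one>\<^bsub>Osec \<Y> V\<^esub>, m), (\<one>\<^bsub>Osec \<Y> V\<^esub>, n)]"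
    by (rule B.cl_eqI, rule tens_add_r) (use g in \<open>simp_all add: B.gens_iff\<close>)
  then show ?thesis
    unfolding ot_eq using B.ucl_Cons[OF V, of "(\<one>\<^bsub>Osec \<Y> V\<^esub>, m)" "[(\<one>\<^bsub>Osec \<Y> V\<^esub>, n)]"] g by simp
qed

lemma ot_smult:
  assumes V: "openin T V" and m: "m \<in> carrier (msec N V)" and a: "a \<in> carrier (Osec \<A> V)"
  shows "ot V (a \<odot>\<^bsub>msec N V\<^esub> m) = h V a \<odot>\<^bsub>msec E V\<^esub> ot V m"
proof -
  interpret R: cring "Osec \<Y> V" using ringed_space_cring[OF ringed_Y V] .
  have ha: "h V a \<in> carrier (Osec \<Y> V)" by (rule ring_hom_closed[OF pair.h_hom[OF V] a])
  have "fs_cong (B.gens V) (B.rels V) [(h V a \<odot>\<^bsub>msec OY V\<^esub> \<one>\<^bsub>Osec \<Y> V\<^esub>, m)] [(\<one>\<^bsub>Osec \<Y> V\<^esub>, a \<odot>\<^bsub>msec N V\<^esub> m)]"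
    by (rule tens_bal[OF a _ m]) (simp add: OY_simps)
  from B.cl_eqI[OF this] show ?thesis
    unfolding smult_ot[OF V ha m] unfolding ot_eq using ha by (simp add: OY_simps)
qed

abbreviation "dL V \<equiv> map (map_prod (dif V) (\<lambda>m. m))"
abbreviation "dLot V \<equiv> map (map_prod (dif V) (ot V))"


lemma dL_gens:
  assumes V: "openin T V" and xs: "set xs \<subseteq> B.gens V"
  shows "set (dL V xs) \<subseteq> O.gens V"
proof
  fix g assume "g \<in> set (dL V xs)"
  then obtain b m where "(b, m) \<in> B.gens V" "g = (dif V b, m)" using xs by auto
  then show "g \<in> O.gens V" using dif_closed[OF V] by (simp add: B.gens_iff O.gens_iff OY_simps)
qed

lemma ot_gens:
  assumes V: "openin T V" and xs: "set xs \<subseteq> O.gens V"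
  shows "set (map (map_prod (\<lambda>\<omega>. \<omega>) (ot V)) xs) \<subseteq> C.gens V"
proof
  fix g assume "g \<in> set (map (map_prod (\<lambda>\<omega>. \<omega>) (ot V)) xs)"
  then obtain \<omega> m where "(\<omega>, m) \<in> O.gens V" "g = (\<omega>, ot V m)" using xs by auto
  then show "g \<in> C.gens V" using ot_closed[OF V] by (simp add: C.gens_iff O.gens_iff)
qed

lemma dLot_eq: "map (map_prod (\<lambda>\<omega>. \<omega>) (ot V)) (dL V xs) = dLot V xs"
  by (induction xs) auto

lemma dif_zero: "openin T V \<Longrightarrow> dif V \<zero>\<^bsub>Osec \<Y> V\<^esub> = \<zero>\<^bsub>msec Om V\<^esub>"
  and dif_one: "openin T V \<Longrightarrow> dif V \<one>\<^bsub>Osec \<Y> V\<^esub> = \<zero>\<^bsub>msec Om V\<^esub>"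
proof -
  assume V: "openin T V"
  interpret A: cring "Osec \<A> V" using ringed_space_cring[OF ringed_A, of V] V unfolding A_simps(1) by blast
  interpret R: cring "Osec \<Y> V" using ringed_space_cring[OF ringed_Y V] .
  show "dif V \<zero>\<^bsub>Osec \<Y> V\<^esub> = \<zero>\<^bsub>msec Om V\<^esub>" "dif V \<one>\<^bsub>Osec \<Y> V\<^esub> = \<zero>\<^bsub>msec Om V\<^esub>"
    using dif_const[OF V A.zero_closed] dif_const[OF V A.one_closed]
      ring_hom_zero[OF pair.h_hom[OF V] A.ring_axioms R.ring_axioms] ring_hom_one[OF pair.h_hom[OF V]] by simp_all
qed

lemma dif_smult:
  assumes V: "openin T V" and a: "a \<in> carrier (Osec \<A> V)" and b: "b \<in> carrier (Osec \<Y> V)"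
  shows "dif V (h V a \<otimes>\<^bsub>Osec \<Y> V\<^esub> b) = h V a \<odot>\<^bsub>msec Om V\<^esub> dif V b"
proof -
  interpret M: Module.module "Osec \<Y> V" "msec Om V" by (rule Om.module_sec[OF V])
  have ha: "h V a \<in> carrier (Osec \<Y> V)" by (rule ring_hom_closed[OF pair.h_hom[OF V] a])
  show ?thesis
    unfolding dif_mult[OF V ha b] dif_const[OF V a] M.smult_r_null[OF b]
    by (rule M.M.r_zero[OF M.smult_closed[OF ha dif_closed[OF V b]]])
qed

text \<open>\<open>d \<otimes> 1\<close> respects balancing because \<open>d\<close> kills sections
  from \<X> and so is linear over them (\<open>dif_smult\<close>).\<close>

lemma d_map:
  assumes V: "openin T V" and xs: "set xs \<subseteq> B.gens V"
  shows "tensor_X_fs_map \<Y> \<X> \<pi> Om S\<^sub>1 V (map_prod (dif V) (\<lambda>m. m)) (B.cl V xs) = O.cl V (dL V xs)"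
  unfolding tensor_X_fs_map_def tens_class_def
proof (rule fs_map_class[OF xs])
  show "map_prod (dif V) (\<lambda>m. m) ` B.gens V \<subseteq> O.gens V"
  proof (rule image_subsetI)
    fix g assume g: "g \<in> B.gens V"
    show "map_prod (dif V) (\<lambda>m. m) g \<in> O.gens V" using dL_gens[OF V, of "[g]"] g by simp
  qed
  fix ys zs assume r: "(ys, zs) \<in> B.rels V"
  show "fs_cong (O.gens V) (O.rels V) (dL V ys) (dL V zs)"
  proof (rule tens_rels_map[OF r])
    fix a b m assume a: "a \<in> carrier (Osec \<A> V)" and b: "b \<in> carrier (msec OY V)" and m: "m \<in> carrier (msec N V)"
    note b = b[unfolded OY_simps]
    show "fs_cong (O.gens V) (O.rels V) [(dif V (h V a \<odot>\<^bsub>msec OY V\<^esub> b), m)] [(dif V b, a \<odot>\<^bsub>msec N V\<^esub> m)]"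
      unfolding OY_simps dif_smult[OF V a b] by (rule tens_bal[OF a dif_closed[OF V b] m])
  qed (simp_all add: OY_simps dif_closed[OF V] dif_zero[OF V] dif_add[OF V])
qed

text \<open>Balancing over \<X> turns into balancing over \<Y>, because
  \<open>m \<mapsto> 1 \<otimes> m\<close> is linear along \<open>h\<close>
  (\<open>ot_smult\<close>).\<close>

lemma ot_map:
  assumes V: "openin T V" and xs: "set xs \<subseteq> O.gens V"
  shows "fs_map (C.gens V) (C.rels V) (map_prod (\<lambda>\<omega>. \<omega>) (ot V)) (O.cl V xs)
    = C.cl V (map (map_prod (\<lambda>\<omega>. \<omega>) (ot V)) xs)"
  unfolding tens_class_def
proof (rule fs_map_class[OF xs])
  show "map_prod (\<lambda>\<omega>. \<omega>) (ot V) ` O.gens V \<subseteq> C.gens V"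
  proof (rule image_subsetI)
    fix g assume g: "g \<in> O.gens V"
    show "map_prod (\<lambda>\<omega>. \<omega>) (ot V) g \<in> C.gens V" using ot_gens[OF V, of "[g]"] g by simp
  qed
  fix ys zs assume r: "(ys, zs) \<in> O.rels V"
  show "fs_cong (C.gens V) (C.rels V) (map (map_prod (\<lambda>\<omega>. \<omega>) (ot V)) ys) (map (map_prod (\<lambda>\<omega>. \<omega>) (ot V)) zs)"
  proof (rule tens_rels_map[OF r])
    fix a \<omega> m assume a: "a \<in> carrier (Osec \<A> V)" and \<omega>: "\<omega> \<in> carrier (msec Om V)" and m: "m \<in> carrier (msec N V)"
    show "fs_cong (C.gens V) (C.rels V) [(h V a \<odot>\<^bsub>msec Om V\<^esub> \<omega>, ot V m)] [(\<omega>, ot V (a \<odot>\<^bsub>msec N V\<^esub> m))]"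
      unfolding ot_smult[OF V m a]
      by (rule tens_bal[where f = "\<lambda>b. b", OF ring_hom_closed[OF pair.h_hom[OF V] a] \<omega> ot_closed[OF V m]])
  qed (simp_all add: ot_closed[OF V] ot_add[OF V])
qed

lemma dL_res:
  assumes "openin T V" "openin T W" "W \<subseteq> V" "set xs \<subseteq> B.gens V"
  shows "map (map_prod (mrst Om V W) (mrst N V W)) (dL V xs) = dL W (map (map_prod (rst \<Y> V W) (mrst N V W)) xs)"
  using assms(4) by (induction xs) (auto simp: B.gens_iff OY_simps dif_res[OF assms(1-3)])

lemma ot_list_res:
  assumes "openin T V" "openin T W" "W \<subseteq> V" "set xs \<subseteq> O.gens V"
  shows "map (map_prod (mrst Om V W) (mrst E V W)) (map (map_prod (\<lambda>\<omega>. \<omega>) (ot V)) xs)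
    = map (map_prod (\<lambda>\<omega>. \<omega>) (ot W)) (map (map_prod (mrst Om V W) (mrst N V W)) xs)"
  using assms(4) by (induction xs) (auto simp: O.gens_iff ot_res[OF assms(1-3)])

abbreviation "nabla \<equiv> assoc_iso \<Y> \<X> \<pi> S\<^sub>1 \<circ> d_tensor_one \<Y> \<X> \<pi> S\<^sub>1"

text \<open>On germs the composite of the two sheafified maps is
  \<open>b \<otimes> m \<mapsto> db \<otimes> (1 \<otimes> m)\<close>. Each map is compatible with
  restriction, so it can be evaluated on any representing list.\<close>

lemma nabla_germ:
  assumes V: "openin T V" "y \<in> V" and xs: "set xs \<subseteq> B.gens V" and s: "s y = germ T B.P y V (B.cl V xs)"
  shows "nabla s y = germ T C.P y V (C.cl V (dLot V xs))"
proof -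
  let ?f = "\<lambda>V. tensor_X_fs_map \<Y> \<X> \<pi> Om S\<^sub>1 V (map_prod (dif V) (\<lambda>m. m))"
  let ?g = "\<lambda>V. fs_map (C.gens V) (C.rels V) (map_prod (\<lambda>\<omega>. \<omega>) (ot V))"
  have "d_tensor_one \<Y> \<X> \<pi> S\<^sub>1 s y = germ T O.P y V (?f V (B.cl V xs))"
    unfolding d_tensor_one_def functor_eqs
  proof (rule sheafify_map_germ[where s = s, OF B.P.module_presheaf_axioms O.P.module_presheaf_axioms _ _ V B.cl_closed[OF V(1) xs] s])
    fix V m assume V: "openin T V" and "m \<in> carrier (msec B.P V)"
    then obtain ys where ys: "set ys \<subseteq> B.gens V" "m = B.cl V ys" using B.P_cases by blast
    show "?f V m \<in> carrier (msec O.P V)"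
      unfolding ys(2) d_map[OF V ys(1)] by (rule O.cl_closed[OF V dL_gens[OF V ys(1)]])
    fix W assume W: "openin T W" "W \<subseteq> V"
    show "mrst O.P V W (?f V m) = ?f W (mrst B.P V W m)"
      unfolding ys(2) d_map[OF V ys(1)] B.res_cl[OF V W ys(1), unfolded OY_simps(5)]
        d_map[OF W(1) B.gens_res[OF V W ys(1), unfolded OY_simps(5)]]
        O.res_cl[OF V W dL_gens[OF V ys(1)]] dL_res[OF V W ys(1)] ..
  qed
  then have d: "d_tensor_one \<Y> \<X> \<pi> S\<^sub>1 s y = germ T O.P y V (O.cl V (dL V xs))"
    unfolding d_map[OF V(1) xs] .
  have "assoc_iso \<Y> \<X> \<pi> S\<^sub>1 (d_tensor_one \<Y> \<X> \<pi> S\<^sub>1 s) y = germ T C.P y V (?g V (O.cl V (dL V xs)))"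
    unfolding assoc_iso_def functor_eqs
  proof (rule sheafify_map_germ[where s = "d_tensor_one \<Y> \<X> \<pi> S\<^sub>1 s", OF O.P.module_presheaf_axioms C.P.module_presheaf_axioms _ _ V
        O.cl_closed[OF V(1) dL_gens[OF V(1) xs]] d])
    fix V m assume V: "openin T V" and "m \<in> carrier (msec O.P V)"
    then obtain ys where ys: "set ys \<subseteq> O.gens V" "m = O.cl V ys" using O.P_cases by blast
    show "?g V m \<in> carrier (msec C.P V)"
      unfolding ys(2) ot_map[OF V ys(1)] by (rule C.cl_closed[OF V ot_gens[OF V ys(1)]])
    fix W assume W: "openin T W" "W \<subseteq> V"
    show "mrst C.P V W (?g V m) = ?g W (mrst O.P V W m)"
      unfolding ys(2) ot_map[OF V ys(1)] O.res_cl[OF V W ys(1)] ot_map[OF W(1) O.gens_res[OF V W ys(1)]]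
        C.res_cl[OF V W ot_gens[OF V ys(1)]] ot_list_res[OF V W ys(1)] ..
  qed
  then show ?thesis unfolding ot_map[OF V(1) dL_gens[OF V(1) xs]] dLot_eq by simp
qed

lemma nabla_outside: "s y = {} \<Longrightarrow> nabla s y = {}"
  unfolding assoc_iso_def d_tensor_one_def sheafify_map_def by simp

text \<open>On germs this is \<open>d1 = 0\<close>. The equality of functions also has to be checked
  outside \<open>V\<close>, where both take the default value \<open>{}\<close>.\<close>

lemma nabla_ot:
  assumes V: "openin T V" and m: "m \<in> carrier (msec N V)"
  shows "nabla (ot V m) = \<zero>\<^bsub>msec (sheafify \<Y> C.P) V\<^esub>"
proof
  fix y
  show "nabla (ot V m) y = \<zero>\<^bsub>msec (sheafify \<Y> C.P) V\<^esub> y"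
  proof (cases "y \<in> V")
    case True
    have "nabla (ot V m) y = germ T C.P y V (C.cl V (dLot V [(\<one>\<^bsub>Osec \<Y> V\<^esub>, m)]))"
      by (rule nabla_germ[where s = "ot V m", OF V True one_gens[OF V m]]) (simp add: ot_eq sheafify_unit_def True)
    also have "C.cl V (dLot V [(\<one>\<^bsub>Osec \<Y> V\<^esub>, m)]) = C.cl V []"
      unfolding list.map map_prod_simp dif_one[OF V] by (rule C.cl_eqI[OF tens_zero[OF ot_closed[OF V m]]])
    finally show ?thesis
      unfolding C.P.zero_germ[OF V V order_refl True] C.cl_Nil .
  next
    case False
    then have "ot V m y = {}" unfolding ot_eq sheafify_unit_def by simp
    then have "nabla (ot V m) y = {}" by (rule nabla_outside)
    then show ?thesis unfolding C.P.sheafify_simps(2) sheafify_unit_def using False by simp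
  qed
qed

end

section \<open>Horizontal sections\<close>

context module_frobenius_factor
begin

lemma rel_wf:
  assumes "openin T V"
  shows "wf_rels (B.gens V) (B.rels V)" "wf_rels (C.gens V) (C.rels V)"
  by (rule fs_presentation.wf[OF B.presentation[OF assms]], rule fs_presentation.wf[OF C.presentation[OF assms]])

abbreviation "resL V W \<equiv> map (map_prod (rst \<Y> V W) (mrst N V W))"

lemmas B_res = B.res_cl[unfolded OY_simps(5)] B.gens_res[unfolded OY_simps(5)] B.ucl_res[unfolded OY_simps(5)]
  B.fs_cong_res[unfolded OY_simps(5)] B.ucl_eq_local[unfolded OY_simps(5)]

lemma dLot_gens:
  assumes V: "openin T V" and xs: "set xs \<subseteq> B.gens V"
  shows "set (dLot V xs) \<subseteq> C.gens V"
  using ot_gens[OF V dL_gens[OF V xs]] unfolding dLot_eq .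

lemma dLot_res:
  assumes "openin T V" "openin T W" "W \<subseteq> V" "set xs \<subseteq> B.gens V"
  shows "map (map_prod (mrst Om V W) (mrst E V W)) (dLot V xs) = dLot W (resL V W xs)"
  unfolding dLot_eq[symmetric] ot_list_res[OF assms(1-3) dL_gens[OF assms(1,4)]] dL_res[OF assms] ..

lemma resL_comp:
  assumes "openin T W" "openin T Z" "Z \<subseteq> W" "openin T Z'" "Z' \<subseteq> Z" "set xs \<subseteq> B.gens W"
  shows "resL Z Z' (resL W Z xs) = resL W Z' xs"
  using assms(6) ringed_space_rst_comp[OF ringed_Y assms(1,2,4,5,3)]
    B.N.res_comp[unfolded A_simps(1), OF assms(1,2,4,5,3)]
  by (induction xs) (auto simp: B.gens_iff OY_simps)

text \<open>The operator \<open>D \<otimes> 1\<close> on representing lists, for the derivation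
  \<open>D = l \<circ> d\<close>.\<close>

definition contract where
  "contract l V = map (map_prod (\<lambda>b. l V (dif V b)) (\<lambda>m. m))"

lemma contract_gens:
  assumes l: "functional V l" and W: "openin T W" "W \<subseteq> V" and xs: "set xs \<subseteq> B.gens W"
  shows "set (contract l W xs) \<subseteq> B.gens W"
proof
  fix g assume "g \<in> set (contract l W xs)"
  then obtain b m where "(b, m) \<in> B.gens W" "g = (l W (dif W b), m)" using xs unfolding contract_def by auto
  then show "g \<in> B.gens W"
    using functionalD(1)[OF l W dif_closed[OF W(1)]] by (simp add: B.gens_iff OY_simps)
qed

lemma contract_res:
  assumes l: "functional V l" and W: "openin T W" "W \<subseteq> V" and Z: "openin T Z" "Z \<subseteq> W" and xs: "set xs \<subseteq> B.gens W"
  shows "resL W Z (contract l W xs) = contract l Z (resL W Z xs)"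
proof -
  have "rst \<Y> W Z (l W (dif W b)) = l Z (dif Z (rst \<Y> W Z b))" if "b \<in> carrier (Osec \<Y> W)" for b
    unfolding functionalD(4)[OF l W dif_closed[OF W(1) that] Z, symmetric] dif_res[OF W(1) Z that] ..
  then show ?thesis using xs unfolding contract_def by (induction xs) (auto simp: B.gens_iff OY_simps)
qed

text \<open>The map \<open>\<omega> \<otimes> s \<mapsto> l(\<omega>) s\<close> from \<Omega> tensor
  \<open>E\<close> to \<open>E\<close> is well defined on formal sums, because \<open>l\<close> is
  linear over the structure sheaf of \<Y>.\<close>

lemma contraction:
  assumes l: "functional V l" and W: "openin T W" "W \<subseteq> V"
    and eq: "fs_cong (C.gens W) (C.rels W) xs ys"
  shows "fs_eval (msec E W) (\<lambda>(\<omega>, s). l W \<omega> \<odot>\<^bsub>msec E W\<^esub> s) xs = fs_eval (msec E W) (\<lambda>(\<omega>, s). l W \<omega> \<odot>\<^bsub>msec E W\<^esub> s) ys"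
proof -
  interpret M: Module.module "Osec \<Y> W" "msec E W" by (rule E.module_sec[OF W(1)])
  note lc = functionalD(1)[OF l W]
  note ls = functionalD(3)[OF l W]
  show ?thesis
  proof (rule M.M.fs_eval_cong[OF eq rel_wf(2)[OF W(1)]])
    fix g assume "g \<in> C.gens W"
    then show "(case g of (\<omega>, s) \<Rightarrow> l W \<omega> \<odot>\<^bsub>msec E W\<^esub> s) \<in> carrier (msec E W)"
      by (cases g) (simp add: C.gens_iff lc)
  next
    fix xs ys assume "(xs, ys) \<in> C.rels W"
    then show "fs_eval (msec E W) (\<lambda>(\<omega>, s). l W \<omega> \<odot>\<^bsub>msec E W\<^esub> s) xs
        = fs_eval (msec E W) (\<lambda>(\<omega>, s). l W \<omega> \<odot>\<^bsub>msec E W\<^esub> s) ys"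
    proof (cases rule: tens_relsE)
      case (zero n)
      then show ?thesis by (simp add: functional_zero[OF l W])
    next
      case (add_l m m' n)
      then show ?thesis by (simp add: lc functionalD(2)[OF l W] M.smult_l_distr)
    next
      case (add_r m n n')
      then show ?thesis by (simp add: lc M.smult_r_distr)
    next
      case (bal r m n)
      then show ?thesis by (simp add: lc ls M.smult_assoc1[symmetric] M.R.m_comm)
    qed
  qed
qed

text \<open>Contracting the connection with \<open>l\<close> gives \<open>D \<otimes> 1\<close>: the
  term \<open>db \<otimes> (1 \<otimes> m)\<close> goes to \<open>l(db)\<close> times
  \<open>1 \<otimes> m\<close>, which is the class of \<open>l(db) \<otimes> m\<close>.\<close>

lemma contraction_dLot:
  assumes l: "functional V l" and W: "openin T W" "W \<subseteq> V" and xs: "set xs \<subseteq> B.gens W"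
  shows "fs_eval (msec E W) (\<lambda>(\<omega>, s). l W \<omega> \<odot>\<^bsub>msec E W\<^esub> s) (dLot W xs) = B.ucl W (contract l W xs)"
  using xs
proof (induction xs)
  case Nil
  then show ?case by (simp add: contract_def B.ucl_Nil)
next
  case (Cons g xs)
  obtain b m where g: "g = (b, m)" by (cases g)
  have bm: "b \<in> carrier (Osec \<Y> W)" "m \<in> carrier (msec N W)" using Cons.prems by (simp_all add: g B.gens_iff OY_simps)
  have c: "contract l W (g # xs) = (l W (dif W b), m) # contract l W xs"
    unfolding contract_def g by simp
  have cg: "set (contract l W (g # xs)) \<subseteq> B.gens W" by (rule contract_gens[OF l W Cons.prems])
  have "B.ucl W (contract l W (g # xs)) = B.ucl W [(l W (dif W b), m)] \<oplus>\<^bsub>msec E W\<^esub> B.ucl W (contract l W xs)"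
    unfolding c by (rule B.ucl_Cons[OF W(1)]) (use cg[unfolded c] in auto)
  also have "B.ucl W [(l W (dif W b), m)] = l W (dif W b) \<odot>\<^bsub>msec E W\<^esub> ot W m"
    by (rule smult_ot[OF W(1) functionalD(1)[OF l W dif_closed[OF W(1) bm(1)]] bm(2), symmetric])
  finally show ?case using Cons by (simp add: g)
qed

text \<open>Two associated sheaves lie between the connection and the formal sums, so the
  neighbourhood shrinks twice: once to turn the vanishing of the connection into a congruence that
  can be contracted, once to turn the resulting equation in \<open>E\<close> into a
  congruence.\<close>

lemma nabla_zero_contract:
  assumes V: "openin T V" and s: "s \<in> carrier (msec E V)" and z: "nabla s = \<zero>\<^bsub>msec (sheafify \<Y> C.P) V\<^esub>"
    and W: "openin T W" "y \<in> W" "W \<subseteq> V" and xs: "set xs \<subseteq> B.gens W" "mrst E V W s = B.ucl W xs"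
    and l: "functional V' l" "W \<subseteq> V'"
  shows "\<exists>Z. openin T Z \<and> y \<in> Z \<and> Z \<subseteq> W \<and> fs_cong (B.gens Z) (B.rels Z) (contract l Z (resL W Z xs)) []"
proof -
  have sy: "s y = germ T B.P y W (B.cl W xs)"
    using fun_cong[OF xs(2), of y] W(2) unfolding B.P.sheafify_simps(3) sheafify_unit_def by simp
  have "germ T C.P y W (C.cl W (dLot W xs)) = germ T C.P y W (C.cl W [])"
    unfolding nabla_germ[where s = s, OF W(1,2) xs(1) sy, symmetric] z C.P.zero_germ[OF V W(1,3,2)] C.cl_Nil ..
  then have "\<exists>Z. openin T Z \<and> y \<in> Z \<and> Z \<subseteq> W \<and>
      fs_cong (C.gens Z) (C.rels Z) (map (map_prod (mrst Om W Z) (mrst E W Z)) (dLot W xs)) []"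
    using C.ucl_eq_local[OF W(1,2) dLot_gens[OF W(1) xs(1)], of "[]"] unfolding list.map(1) list.set(1) by (simp only: empty_subsetI)
  then obtain Z where Z: "openin T Z" "y \<in> Z" "Z \<subseteq> W"
    and Z': "fs_cong (C.gens Z) (C.rels Z) (map (map_prod (mrst Om W Z) (mrst E W Z)) (dLot W xs)) []"
    by blast
  have Z4: "fs_cong (C.gens Z) (C.rels Z) (dLot Z (resL W Z xs)) []"
    using Z' unfolding dLot_res[OF W(1) Z(1,3) xs(1)] .
  have ZV: "Z \<subseteq> V'" using Z(3) l(2) by blast
  have r: "set (resL W Z xs) \<subseteq> B.gens Z" by (rule B_res(2)[OF W(1) Z(1,3) xs(1)])
  have cg: "set (contract l Z (resL W Z xs)) \<subseteq> B.gens Z" by (rule contract_gens[OF l(1) Z(1) ZV r])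
  \<comment> \<open>After contraction the equality holds only between sections of the sheaf
    \<open>E\<close>; a second shrinking is needed to reach the lists.\<close>
  have "B.ucl Z (contract l Z (resL W Z xs)) = B.ucl Z []"
    using contraction[OF l(1) Z(1) ZV Z4] unfolding contraction_dLot[OF l(1) Z(1) ZV r] B.ucl_Nil by simp
  from fun_cong[OF this, of y]
  have "germ T B.P y Z (B.cl Z (contract l Z (resL W Z xs))) = germ T B.P y Z (B.cl Z [])"
    unfolding sheafify_unit_def using Z(2) by simp
  then have "\<exists>Z'. openin T Z' \<and> y \<in> Z' \<and> Z' \<subseteq> Z \<and>
      fs_cong (B.gens Z') (B.rels Z') (resL Z Z' (contract l Z (resL W Z xs))) []"
    using B_res(5)[OF Z(1,2) cg, of "[]"] unfolding list.map(1) list.set(1) by (simp only: empty_subsetI)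
  then obtain Z' where Z': "openin T Z'" "y \<in> Z'" "Z' \<subseteq> Z"
    "fs_cong (B.gens Z') (B.rels Z') (resL Z Z' (contract l Z (resL W Z xs))) []" by blast
  have "fs_cong (B.gens Z') (B.rels Z') (contract l Z' (resL W Z' xs)) []"
    using Z'(4) unfolding contract_res[OF l(1) Z(1) ZV Z'(1,3) r] resL_comp[OF W(1) Z(1,3) Z'(1,3) xs(1)] .
  then show ?thesis using Z'(1,2) order_trans[OF Z'(3) Z(3)] by (intro exI[of _ Z'] conjI)
qed

lemma contract_cong_mono:
  assumes W: "openin T W" and xs: "set xs \<subseteq> B.gens W" and l: "functional V l" and Z: "openin T Z" "Z \<subseteq> W" "Z \<subseteq> V"
    and Z': "openin T Z'" "Z' \<subseteq> Z" and c: "fs_cong (B.gens Z) (B.rels Z) (contract l Z (resL W Z xs)) []"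
  shows "fs_cong (B.gens Z') (B.rels Z') (contract l Z' (resL W Z' xs)) []"
proof -
  have r: "set (resL W Z xs) \<subseteq> B.gens Z" by (rule B_res(2)[OF W Z(1,2) xs])
  show ?thesis
    using B_res(4)[OF Z(1) Z' contract_gens[OF l Z(1,3) r] _ c]
    unfolding contract_res[OF l Z(1,3) Z' r] resL_comp[OF W Z(1,2) Z' xs] by simp
qed

lemma tensor_p_basis:
  assumes W: "openin T W" and "p_basis (Osec \<A> W) (Osec \<Y> W) (h W) n p x D"
  shows "p_basis_tensor (Osec \<A> W) (Osec \<Y> W) (h W) n p x D (msec N W) (msec OY W)"
proof (intro p_basis_tensor.intro p_basis_tensor_axioms.intro assms(2))
  show "Module.module (Osec \<A> W) (msec N W)" by (rule B.N.module_sec[unfolded A_simps(1), OF W])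
qed (simp_all add: OY_simps)

lemma kernel_local:
  assumes V: "openin T V" and s: "s \<in> carrier (msec E V)" and z: "nabla s = \<zero>\<^bsub>msec (sheafify \<Y> C.P) V\<^esub>" and y: "y \<in> V"
  shows "\<exists>W m. openin T W \<and> y \<in> W \<and> W \<subseteq> V \<and> m \<in> carrier (msec N W) \<and> mrst E V W s = ot W m"
proof -
  have yT: "y \<in> topspace T" using openin_subset[OF V] y by blast
  obtain V0 n l \<B> x where V0: "openin T V0" "y \<in> V0" and l: "\<And>i. i < n \<Longrightarrow> functional V0 (l i)"
    and \<B>: "\<And>W. W \<in> \<B> \<Longrightarrow> openin T W \<and> W \<subseteq> V0"
    and base: "\<And>Z z. openin T Z \<Longrightarrow> z \<in> Z \<Longrightarrow> z \<in> V0 \<Longrightarrow> \<exists>W\<in>\<B>. z \<in> W \<and> W \<subseteq> Z"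
    and pb: "\<And>W. W \<in> \<B> \<Longrightarrow> p_basis (Osec \<A> W) (Osec \<Y> W) (h W) n p (\<lambda>i. rst \<Y> V0 W (x i)) (\<lambda>i b. l i W (dif W b))"
    by (fact local_structure[OF lf yT])
  obtain W0 ys where W0: "openin T W0" "y \<in> W0" "W0 \<subseteq> V" "set ys \<subseteq> B.gens W0" "mrst E V W0 s = B.ucl W0 ys"
    by (fact B.sec_cl[OF s y])
  define W1 where "W1 = W0 \<inter> V0"
  have W1: "openin T W1" "y \<in> W1" "W1 \<subseteq> W0" "W1 \<subseteq> V0" "W1 \<subseteq> V" unfolding W1_def using W0 V0 by auto
  define xs where "xs = resL W0 W1 ys"
  have xs: "set xs \<subseteq> B.gens W1" unfolding xs_def by (rule B_res(2)[OF W0(1) W1(1,3) W0(4)])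
  have sW1: "mrst E V W1 s = B.ucl W1 xs"
    unfolding xs_def B_res(3)[OF W0(1) W1(1,3) W0(4), symmetric] W0(5)[symmetric]
    by (rule E.res_comp[OF V W0(1) W1(1,3) W0(3) s, symmetric])
  \<comment> \<open>For each functional the neighbourhood may differ; there are finitely many, and
    the congruences pass to smaller sets.\<close>
  have "\<exists>Z. openin T Z \<and> y \<in> Z \<and> Z \<subseteq> W1 \<and>
    (\<forall>i\<in>{..<n}. fs_cong (B.gens Z) (B.rels Z) (contract (l i) Z (resL W1 Z xs)) [])"
  proof (rule finite_neighbourhood[OF finite_lessThan W1(1,2)])
    fix i assume "i \<in> {..<n}"
    then have i: "i < n" by simp
    show "\<exists>Z. openin T Z \<and> y \<in> Z \<and> Z \<subseteq> W1 \<and> fs_cong (B.gens Z) (B.rels Z) (contract (l i) Z (resL W1 Z xs)) []"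
      by (rule nabla_zero_contract[OF V s z W1(1,2,5) xs sW1 l[OF i] W1(4)])
    fix Z Z' assume Z: "openin T Z" "Z \<subseteq> W1" "fs_cong (B.gens Z) (B.rels Z) (contract (l i) Z (resL W1 Z xs)) []"
      and Z': "openin T Z'" "Z' \<subseteq> Z"
    show "fs_cong (B.gens Z') (B.rels Z') (contract (l i) Z' (resL W1 Z' xs)) []"
      by (rule contract_cong_mono[OF W1(1) xs l[OF i] Z(1,2) order_trans[OF Z(2) W1(4)] Z' Z(3)])
  qed
  then obtain Z where Z: "openin T Z" "y \<in> Z" "Z \<subseteq> W1"
    "\<And>i. i < n \<Longrightarrow> fs_cong (B.gens Z) (B.rels Z) (contract (l i) Z (resL W1 Z xs)) []" by auto
  \<comment> \<open>Only over members of the base is the p-basis available, so the neighbourhood is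
    shrunk once more before the algebraic result is used.\<close>
  obtain W where W: "W \<in> \<B>" "y \<in> W" "W \<subseteq> Z" using base[OF Z(1,2) V0(2)] by blast
  have oW: "openin T W" "W \<subseteq> W1" "W \<subseteq> V" using \<B>[OF W(1)] W Z W1 by auto
  interpret t: p_basis_tensor "Osec \<A> W" "Osec \<Y> W" "h W" n p "\<lambda>i. rst \<Y> V0 W (x i)"
    "\<lambda>i b. l i W (dif W b)" "msec N W" "msec OY W"
    by (rule tensor_p_basis[OF oW(1) pb[OF W(1)]])
  have r: "set (resL W1 W xs) \<subseteq> B.gens W" by (rule B_res(2)[OF W1(1) oW(1,2) xs])
  have "B.cl W (resL W1 W xs) = B.cl W [(\<one>\<^bsub>Osec \<Y> W\<^esub>, t.coord t.zero_expo (resL W1 W xs))]"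
  proof (rule t.horizontal_tensor[OF r])
    fix i assume i: "i < n"
    have "fs_cong (B.gens W) (B.rels W) (contract (l i) W (resL W1 W xs)) []"
      by (rule contract_cong_mono[OF W1(1) xs l[OF i] Z(1,3) order_trans[OF Z(3) W1(4)] oW(1) W(3) Z(4)[OF i]])
    then show "fs_cong (B.gens W) (B.rels W) (map (map_prod (\<lambda>b. l i W (dif W b)) (\<lambda>m. m)) (resL W1 W xs)) []"
      unfolding contract_def .
  qed
  moreover have "mrst E V W s = B.ucl W (resL W1 W xs)"
    unfolding B_res(3)[OF W1(1) oW(1,2) xs, symmetric] sW1[symmetric]
    by (rule E.res_comp[OF V W1(1) oW(1,2) W1(5) s, symmetric])
  moreover have "t.coord t.zero_expo (resL W1 W xs) \<in> carrier (msec N W)"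
    by (rule t.coord_closed[OF t.zero_expo r])
  ultimately show ?thesis
    using oW W(2) unfolding ot_eq by (intro exI[of _ W] exI[of _ "t.coord t.zero_expo (resL W1 W xs)"] conjI) simp_all
qed

text \<open>Over a member of the base the coordinate at the monomial 1 recovers \<open>m\<close>
  from a list representing \<open>1 \<otimes> m\<close>. To get from sections to lists the equality
  is first restricted.\<close>

lemma ot_local_inj:
  assumes V: "openin T V" and m: "m \<in> carrier (msec N V)" "m' \<in> carrier (msec N V)" and eq: "ot V m = ot V m'" and y: "y \<in> V"
  shows "\<exists>W. openin T W \<and> y \<in> W \<and> W \<subseteq> V \<and> mrst N V W m = mrst N V W m'"
proof -
  have yT: "y \<in> topspace T" using openin_subset[OF V] y by blast
  obtain V0 n l \<B> x where V0: "openin T V0" "y \<in> V0" and "\<And>i. i < n \<Longrightarrow> functional V0 (l i)"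
    and \<B>: "\<And>W. W \<in> \<B> \<Longrightarrow> openin T W \<and> W \<subseteq> V0"
    and base: "\<And>Z z. openin T Z \<Longrightarrow> z \<in> Z \<Longrightarrow> z \<in> V0 \<Longrightarrow> \<exists>W\<in>\<B>. z \<in> W \<and> W \<subseteq> Z"
    and pb: "\<And>W. W \<in> \<B> \<Longrightarrow> p_basis (Osec \<A> W) (Osec \<Y> W) (h W) n p (\<lambda>i. rst \<Y> V0 W (x i)) (\<lambda>i b. l i W (dif W b))"
    by (fact local_structure[OF lf yT])
  note g = one_gens[OF V m(1)] one_gens[OF V m(2)]
  have "germ T B.P y V (B.cl V [(\<one>\<^bsub>Osec \<Y> V\<^esub>, m)]) = germ T B.P y V (B.cl V [(\<one>\<^bsub>Osec \<Y> V\<^esub>, m')])"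
    using fun_cong[OF eq, of y] y unfolding ot_eq sheafify_unit_def by simp
  from B_res(5)[OF V y g this]
  obtain Z where Z: "openin T Z" "y \<in> Z" "Z \<subseteq> V"
    "fs_cong (B.gens Z) (B.rels Z) (resL V Z [(\<one>\<^bsub>Osec \<Y> V\<^esub>, m)]) (resL V Z [(\<one>\<^bsub>Osec \<Y> V\<^esub>, m')])" by blast
  obtain W where W: "W \<in> \<B>" "y \<in> W" "W \<subseteq> Z" using base[OF Z(1,2) V0(2)] by blast
  have oW: "openin T W" "W \<subseteq> V" using \<B>[OF W(1)] W Z by auto
  interpret t: p_basis_tensor "Osec \<A> W" "Osec \<Y> W" "h W" n p "\<lambda>i. rst \<Y> V0 W (x i)"
    "\<lambda>i b. l i W (dif W b)" "msec N W" "msec OY W"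
    by (rule tensor_p_basis[OF oW(1) pb[OF W(1)]])
  have rN: "mrst N V W k \<in> carrier (msec N W)" if "k \<in> carrier (msec N V)" for k
    by (rule B.N.res_closed[unfolded A_simps(1), OF V oW that])
  have res1: "resL Z W (resL V Z [(\<one>\<^bsub>Osec \<Y> V\<^esub>, k)]) = [(\<one>\<^bsub>Osec \<Y> W\<^esub>, mrst N V W k)]" if k: "k \<in> carrier (msec N V)" for k
    unfolding resL_comp[OF V Z(1,3) oW(1) W(3) one_gens[OF V k]]
    using ring_hom_one[OF ringed_space_rst[OF ringed_Y V oW]] by simp
  have "fs_cong (B.gens W) (B.rels W) [(\<one>\<^bsub>Osec \<Y> W\<^esub>, mrst N V W m)] [(\<one>\<^bsub>Osec \<Y> W\<^esub>, mrst N V W m')]"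
    using B_res(4)[OF Z(1) oW(1) W(3) B_res(2)[OF V Z(1,3) g(1)] B_res(2)[OF V Z(1,3) g(2)] Z(4)]
    unfolding res1[OF m(1)] res1[OF m(2)] .
  then have "mrst N V W m = mrst N V W m'"
    using t.coord_cong[OF t.zero_expo] t.coord_one[OF rN[OF m(1)]] t.coord_one[OF rN[OF m(2)]] by metis
  then show ?thesis using oW W(2) by blast
qed

section \<open>Gluing on \<X> and the isomorphism\<close>

abbreviation "pre \<equiv> preim \<Y> \<pi>"

lemma
  shows S1_unique: "(\<And>V. V \<in> \<U> \<Longrightarrow> openin (tops \<X>) V) \<Longrightarrow> s \<in> carrier (msec S\<^sub>1 (\<Union>\<U>)) \<Longrightarrow> t \<in> carrier (msec S\<^sub>1 (\<Union>\<U>)) \<Longrightarrow>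
      (\<And>V. V \<in> \<U> \<Longrightarrow> mrst S\<^sub>1 (\<Union>\<U>) V s = mrst S\<^sub>1 (\<Union>\<U>) V t) \<Longrightarrow> s = t"
    and S1_glue: "(\<And>V. V \<in> \<U> \<Longrightarrow> openin (tops \<X>) V) \<Longrightarrow> (\<And>V. V \<in> \<U> \<Longrightarrow> f V \<in> carrier (msec S\<^sub>1 V)) \<Longrightarrow>
      (\<And>V W. V \<in> \<U> \<Longrightarrow> W \<in> \<U> \<Longrightarrow> mrst S\<^sub>1 V (V \<inter> W) (f V) = mrst S\<^sub>1 W (V \<inter> W) (f W)) \<Longrightarrow>
      \<exists>t\<in>carrier (msec S\<^sub>1 (\<Union>\<U>)). \<forall>V\<in>\<U>. mrst S\<^sub>1 (\<Union>\<U>) V t = f V"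
proof -
  have u: "\<forall>\<U>. (\<forall>V\<in>\<U>. openin (tops \<X>) V) \<longrightarrow> (\<forall>s\<in>carrier (msec S\<^sub>1 (\<Union>\<U>)). \<forall>t\<in>carrier (msec S\<^sub>1 (\<Union>\<U>)).
      (\<forall>V\<in>\<U>. mrst S\<^sub>1 (\<Union>\<U>) V s = mrst S\<^sub>1 (\<Union>\<U>) V t) \<longrightarrow> s = t)"
    using S1 unfolding is_module_sheaf_def sheaf_of_sets_def by (elim conjE)
  have g: "\<forall>\<U> s. (\<forall>V\<in>\<U>. openin (tops \<X>) V \<and> s V \<in> carrier (msec S\<^sub>1 V)) \<and>
      (\<forall>V\<in>\<U>. \<forall>W\<in>\<U>. mrst S\<^sub>1 V (V \<inter> W) (s V) = mrst S\<^sub>1 W (V \<inter> W) (s W)) \<longrightarrow>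
      (\<exists>t\<in>carrier (msec S\<^sub>1 (\<Union>\<U>)). \<forall>V\<in>\<U>. mrst S\<^sub>1 (\<Union>\<U>) V t = s V)"
    using S1 unfolding is_module_sheaf_def sheaf_of_sets_def by (elim conjE)
  show "s = t" if "\<And>V. V \<in> \<U> \<Longrightarrow> openin (tops \<X>) V" "s \<in> carrier (msec S\<^sub>1 (\<Union>\<U>))" "t \<in> carrier (msec S\<^sub>1 (\<Union>\<U>))"
    "\<And>V. V \<in> \<U> \<Longrightarrow> mrst S\<^sub>1 (\<Union>\<U>) V s = mrst S\<^sub>1 (\<Union>\<U>) V t"
    using u that by blast
  show "\<exists>t\<in>carrier (msec S\<^sub>1 (\<Union>\<U>)). \<forall>V\<in>\<U>. mrst S\<^sub>1 (\<Union>\<U>) V t = f V"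
    if "\<And>V. V \<in> \<U> \<Longrightarrow> openin (tops \<X>) V" "\<And>V. V \<in> \<U> \<Longrightarrow> f V \<in> carrier (msec S\<^sub>1 V)"
      "\<And>V W. V \<in> \<U> \<Longrightarrow> W \<in> \<U> \<Longrightarrow> mrst S\<^sub>1 V (V \<inter> W) (f V) = mrst S\<^sub>1 W (V \<inter> W) (f W)"
    by (rule g[rule_format]) (use that in blast)
qed

lemma N_pre:
  assumes "openin (tops \<X>) U"
  shows "msec N (pre U) = msec S\<^sub>1 U" "openin (tops \<X>) V \<Longrightarrow> mrst N (pre U) (pre V) = mrst S\<^sub>1 U V"
  unfolding N_simps using im_pre assms by simp_all

text \<open>Local injectivity is known on open sets of \<Y>; these are transported by the
  homeomorphism to a cover of \<open>U\<close>, on which the sheaf \<open>S\<^sub>1\<close>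
  separates sections.\<close>

lemma ot_inj:
  assumes U: "openin (tops \<X>) U" and m: "m \<in> carrier (msec S\<^sub>1 U)" "m' \<in> carrier (msec S\<^sub>1 U)"
    and eq: "ot (pre U) m = ot (pre U) m'"
  shows "m = m'"
proof -
  define \<U> where "\<U> = {U'. openin (tops \<X>) U' \<and> U' \<subseteq> U \<and> mrst S\<^sub>1 U U' m = mrst S\<^sub>1 U U' m'}"
  have "\<Union>\<U> = U"
  proof (intro equalityI subsetI)
    fix x assume "x \<in> U"
    then obtain y where y: "y \<in> pre U" "x = pt \<pi> y" using im_pre[OF U] by blast
    obtain W where W: "openin T W" "y \<in> W" "W \<subseteq> pre U" "mrst N (pre U) W m = mrst N (pre U) W m'"
      using ot_local_inj[OF pre_open[OF U] _ _ eq y(1)] m unfolding N_pre(1)[OF U] by blast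
    have "pt \<pi> ` W \<subseteq> U" using image_mono[OF W(3), of "pt \<pi>"] unfolding im_pre[OF U] .
    then have "pt \<pi> ` W \<in> \<U>" unfolding \<U>_def using im_open[OF W(1)] W(4) unfolding N_simps im_pre[OF U] by simp
    then show "x \<in> \<Union>\<U>" using W(2) y(2) by blast
  qed (auto simp: \<U>_def)
  then show ?thesis using S1_unique[of \<U> m m'] m unfolding \<U>_def by auto
qed

lemma kernel_ot:
  assumes U: "openin (tops \<X>) U" and s: "s \<in> carrier (msec E (pre U))"
    and z: "nabla s = \<zero>\<^bsub>msec (sheafify \<Y> C.P) (pre U)\<^esub>"
  shows "\<exists>m\<in>carrier (msec S\<^sub>1 U). s = ot (pre U) m"
proof -
  \<comment> \<open>All open sets on which \<open>s\<close> has the required form;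
    \<open>kernel_local\<close> shows that they cover \<open>U\<close>.\<close>
  define \<U> where "\<U> = {U'. openin (tops \<X>) U' \<and> U' \<subseteq> U \<and>
    (\<exists>m\<in>carrier (msec S\<^sub>1 U'). mrst E (pre U) (pre U') s = ot (pre U') m)}"
  have op: "openin (tops \<X>) U'" "U' \<subseteq> U" if "U' \<in> \<U>" for U' using that unfolding \<U>_def by auto
  have "\<forall>U'\<in>\<U>. \<exists>m. m \<in> carrier (msec S\<^sub>1 U') \<and> mrst E (pre U) (pre U') s = ot (pre U') m"
    unfolding \<U>_def by blast
  from bchoice[OF this] obtain f where
    f': "\<forall>U'\<in>\<U>. f U' \<in> carrier (msec S\<^sub>1 U') \<and> mrst E (pre U) (pre U') s = ot (pre U') (f U')" ..
  have f: "f U' \<in> carrier (msec S\<^sub>1 U')" "mrst E (pre U) (pre U') s = ot (pre U') (f U')" if "U' \<in> \<U>" for U'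
    using bspec[OF f' that] by (rule conjunct1, rule conjunct2)
  have cover: "\<exists>U'\<in>\<U>. y \<in> pre U'" if y: "y \<in> pre U" for y
  proof -
    obtain W m where W: "openin T W" "y \<in> W" "W \<subseteq> pre U" "m \<in> carrier (msec N W)" "mrst E (pre U) W s = ot W m"
      using kernel_local[OF pre_open[OF U] s z y] by blast
    have "pt \<pi> ` W \<subseteq> U" using image_mono[OF W(3), of "pt \<pi>"] unfolding im_pre[OF U] .
    then have "pt \<pi> ` W \<in> \<U>" unfolding \<U>_def using im_open[OF W(1)] W(4,5) pre_im[OF W(1)] unfolding N_simps by auto
    then show ?thesis using W(2) pre_im[OF W(1)] by blast
  qed
  have Un: "\<Union>\<U> = U"
  proof (intro equalityI subsetI)
    fix x assume "x \<in> U"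
    then obtain y where y: "y \<in> pre U" "x = pt \<pi> y" using im_pre[OF U] by blast
    then show "x \<in> \<Union>\<U>" using cover[OF y(1)] unfolding preim_def by blast
  qed (use op in blast)
  have res: "ot (pre V) (mrst S\<^sub>1 U' V m) = mrst E (pre U') (pre V) (ot (pre U') m)"
    if "openin (tops \<X>) U'" "openin (tops \<X>) V" "V \<subseteq> U'" "m \<in> carrier (msec S\<^sub>1 U')" for U' V m
    using ot_res[OF pre_open[OF that(1)] pre_open[OF that(2)] pre_mono[OF that(3)]] that(4) N_pre[OF that(1)] that(2) by simp
  have "\<exists>t\<in>carrier (msec S\<^sub>1 (\<Union>\<U>)). \<forall>V\<in>\<U>. mrst S\<^sub>1 (\<Union>\<U>) V t = f V"
  proof (rule S1_glue[OF op(1) f(1)])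
    fix V W assume V: "V \<in> \<U>" and W: "W \<in> \<U>"
    have o: "openin (tops \<X>) (V \<inter> W)" using op(1)[OF V] op(1)[OF W] by blast
    have "ot (pre (V \<inter> W)) (mrst S\<^sub>1 Z (V \<inter> W) (f Z)) = mrst E (pre U) (pre (V \<inter> W)) s" if Z: "Z \<in> \<U>" "V \<inter> W \<subseteq> Z" for Z
      unfolding res[OF op(1)[OF Z(1)] o Z(2) f(1)[OF Z(1)]] f(2)[OF Z(1), symmetric]
      by (rule E.res_comp[OF pre_open[OF U] pre_open[OF op(1)[OF Z(1)]] pre_open[OF o] pre_mono[OF Z(2)]
          pre_mono[OF op(2)[OF Z(1)]] s])
    from this[OF V] this[OF W]
    \<comment> \<open>On an overlap both sides have the same image, the restriction of
      \<open>s\<close>, so the injectivity of \<open>m \<mapsto> 1 \<otimes> m\<close> over the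
      overlap makes the chosen local sections compatible.\<close>
    show "mrst S\<^sub>1 V (V \<inter> W) (f V) = mrst S\<^sub>1 W (V \<inter> W) (f W)"
      by (intro ot_inj[OF o S1.res_closed[OF op(1)[OF V] o _ f(1)[OF V]] S1.res_closed[OF op(1)[OF W] o _ f(1)[OF W]]]) auto
  qed
  then obtain t where t: "t \<in> carrier (msec S\<^sub>1 U)" "\<And>V. V \<in> \<U> \<Longrightarrow> mrst S\<^sub>1 U V t = f V" unfolding Un by blast
  have "s = ot (pre U) t"
  proof (rule B.P.sec_eqI[OF s ot_closed[OF pre_open[OF U]]])
    show "t \<in> carrier (msec N (pre U))" using t(1) N_pre(1)[OF U] by simp
    fix y assume "y \<in> pre U"
    then obtain V where V: "V \<in> \<U>" "y \<in> pre V" using cover by blast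
    have "mrst E (pre U) (pre V) s = mrst E (pre U) (pre V) (ot (pre U) t)"
      unfolding f(2)[OF V(1)] t(2)[OF V(1), symmetric] by (rule res[OF U op[OF V(1)] t(1)])
    from fun_cong[OF this, of y] show "s y = ot (pre U) t y" using V(2) unfolding B.P.sheafify_simps(3) by simp
  qed
  then show ?thesis using t(1) by blast
qed

text \<open>The natural map goes the other way, \<open>m \<mapsto> 1 \<otimes> m\<close>. It is a
  bijection onto the kernel over every open set, and the isomorphism sought is its inverse;
  linearity and compatibility with restriction are inherited.\<close>

theorem horizontal_sections_iso:
  "mod_sheaf_iso \<X> (F_functor \<Y> \<X> \<pi> (G_functor \<Y> \<X> \<pi> S\<^sub>1)) S\<^sub>1"
proof -
  let ?F = "F_functor \<Y> \<X> \<pi> (G_functor \<Y> \<X> \<pi> S\<^sub>1)"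
  have F: "carrier (msec ?F U) = {s \<in> carrier (msec E (pre U)). nabla s = \<zero>\<^bsub>msec (sheafify \<Y> C.P) (pre U)\<^esub>}"
    "s \<oplus>\<^bsub>msec ?F U\<^esub> t = s \<oplus>\<^bsub>msec E (pre U)\<^esub> t" "a \<odot>\<^bsub>msec ?F U\<^esub> s = sharp \<pi> U a \<odot>\<^bsub>msec E (pre U)\<^esub> s"
    "mrst ?F U V s = mrst E (pre U) (pre V) s" for U V s t a
    unfolding F_functor_def G_functor_def by (simp_all add: functor_eqs)
  define \<psi> where "\<psi> U m = ot (pre U) m" for U m
  have bij: "bij_betw (\<psi> U) (carrier (msec S\<^sub>1 U)) (carrier (msec ?F U))" if U: "openin (tops \<X>) U" for U
    unfolding bij_betw_def
  proof (intro conjI inj_onI equalityI subsetI)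
    show "m = m'" if "m \<in> carrier (msec S\<^sub>1 U)" "m' \<in> carrier (msec S\<^sub>1 U)" "\<psi> U m = \<psi> U m'" for m m'
      using ot_inj[OF U that(1,2)] that(3) unfolding \<psi>_def .
    show "s \<in> carrier (msec ?F U)" if s: "s \<in> \<psi> U ` carrier (msec S\<^sub>1 U)" for s
    proof -
      obtain m where m: "m \<in> carrier (msec N (pre U))" "s = ot (pre U) m"
        using s unfolding \<psi>_def N_pre(1)[OF U] by blast
      show ?thesis
        unfolding F(1) m(2) using ot_closed[OF pre_open[OF U] m(1)] nabla_ot[OF pre_open[OF U] m(1)] by blast
    qed
    show "s \<in> \<psi> U ` carrier (msec S\<^sub>1 U)" if "s \<in> carrier (msec ?F U)" for s
      using that kernel_ot[OF U, of s] unfolding F(1) \<psi>_def by blast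
  qed
  define \<phi> where "\<phi> U = inv_into (carrier (msec S\<^sub>1 U)) (\<psi> U)" for U
  have \<phi>\<psi>: "\<phi> U (\<psi> U m) = m" if "openin (tops \<X>) U" "m \<in> carrier (msec S\<^sub>1 U)" for U m
    unfolding \<phi>_def by (rule bij_betw_inv_into_left[OF bij[OF that(1)] that(2)])
  show ?thesis
    unfolding mod_sheaf_iso_def
  proof (intro exI[of _ \<phi>] allI impI conjI ballI)
    fix U assume U: "openin (tops \<X>) U"
    interpret M: Module.module "Osec \<X> U" "msec S\<^sub>1 U" by (rule S1.module_sec[OF U])
    show "bij_betw (\<phi> U) (carrier (msec ?F U)) (carrier (msec S\<^sub>1 U))"
      unfolding \<phi>_def by (rule bij_betw_inv_into[OF bij[OF U]])
    fix s assume "s \<in> carrier (msec ?F U)"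
    then obtain m where m: "m \<in> carrier (msec S\<^sub>1 U)" "s = \<psi> U m"
      using bij_betw_imp_surj_on[OF bij[OF U]] by blast
    note mN = m(1)[folded N_pre(1)[OF U]]
    show "\<phi> U (s \<oplus>\<^bsub>msec ?F U\<^esub> t) = \<phi> U s \<oplus>\<^bsub>msec S\<^sub>1 U\<^esub> \<phi> U t" if t: "t \<in> carrier (msec ?F U)" for t
    proof -
      obtain n where n: "n \<in> carrier (msec S\<^sub>1 U)" "t = \<psi> U n"
        using t bij_betw_imp_surj_on[OF bij[OF U]] by blast
      have "s \<oplus>\<^bsub>msec ?F U\<^esub> t = \<psi> U (m \<oplus>\<^bsub>msec S\<^sub>1 U\<^esub> n)"
        unfolding F m(2) n(2) \<psi>_def
        by (rule ot_add[OF pre_open[OF U] mN n(1)[folded N_pre(1)[OF U]], unfolded N_pre(1)[OF U], symmetric])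
      then show ?thesis using m n \<phi>\<psi>[OF U] M.M.a_closed by simp
    qed
    show "\<phi> U (a \<odot>\<^bsub>msec ?F U\<^esub> s) = a \<odot>\<^bsub>msec S\<^sub>1 U\<^esub> \<phi> U s" if a: "a \<in> carrier (Osec \<X> U)" for a
    proof -
      have "a \<in> carrier (Osec \<A> (pre U))" unfolding A_simps im_pre[OF U] by (rule a)
      from ot_smult[OF pre_open[OF U] mN this]
      have "a \<odot>\<^bsub>msec ?F U\<^esub> s = \<psi> U (a \<odot>\<^bsub>msec S\<^sub>1 U\<^esub> m)"
        unfolding F m(2) \<psi>_def N_pre(1)[OF U] inv_image_map_def im_pre[OF U] by (rule sym)
      then show ?thesis using m a \<phi>\<psi>[OF U] M.smult_closed by simp
    qed
    show "\<phi> V (mrst ?F U V s) = mrst S\<^sub>1 U V (\<phi> U s)" if V: "openin (tops \<X>) V \<and> V \<subseteq> U" for V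
    proof -
      have V: "openin (tops \<X>) V" "V \<subseteq> U" using V by auto
      have "mrst ?F U V s = \<psi> V (mrst S\<^sub>1 U V m)"
        using ot_res[OF pre_open[OF U] pre_open[OF V(1)] pre_mono[OF V(2)] mN]
        unfolding F m(2) \<psi>_def N_pre(2)[OF U V(1)] .
      then show ?thesis using m \<phi>\<psi>[OF U] \<phi>\<psi>[OF V(1)] S1.res_closed[OF U V] by simp
    qed
  qed
qed

end

theorem theorem2p23:
  fixes L :: "'l ring" and K :: "'l set" and p :: nat
    and \<X> :: "('x, 'a) ringed_space" and \<kappa>\<^sub>K :: "'l \<Rightarrow> 'a"
    and \<Y> :: "('y, 'b) ringed_space" and \<kappa>\<^sub>L :: "'l \<Rightarrow> 'b"
    and \<pi> :: "('y, 'b, 'x, 'a) rs_map"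
    and S\<^sub>1 :: "('x, 'a, 'm) mod_sheaf"
  assumes "Factorial_Ring.prime p" and "Ring.field L" and "subfield K L"
    and "[p] \<cdot>\<^bsub>L\<^esub> \<one>\<^bsub>L\<^esub> = \<zero>\<^bsub>L\<^esub>"
    and "\<not> perfect_char p (L\<lparr>carrier := K\<rparr>)"
    and "separably_closed (L\<lparr>carrier := K\<rparr>)"
    and "finite_purely_insep_ext p L K"
    and "variety_over (L\<lparr>carrier := K\<rparr>) \<kappa>\<^sub>K \<X>"
    and "variety_over L \<kappa>\<^sub>L \<Y>"
    and "purely_insep_morphism p \<Y> \<X> \<pi>"
    and "homeomorphic_map (tops \<Y>) (tops \<X>) (pt \<pi>)"
    and "\<And>c. c \<in> K \<Longrightarrow> sharp \<pi> (topspace (tops \<X>)) (\<kappa>\<^sub>K c) = \<kappa>\<^sub>L c"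
    and "factors_abs_frobenius p \<Y> \<X> \<pi>"
    and "locally_free_sheaf \<Y> (Omega \<Y> \<X> \<pi>)"
    and "coherent_sheaf \<X> S\<^sub>1"
  shows "mod_sheaf_iso \<X> (F_functor \<Y> \<X> \<pi> (G_functor \<Y> \<X> \<pi> S\<^sub>1)) S\<^sub>1"
proof -
  have mor: "scheme_morphism \<Y> \<X> \<pi>" using assms(10) unfolding purely_insep_morphism_def by blast
  have S1: "is_module_sheaf \<X> S\<^sub>1" using assms(15) unfolding coherent_sheaf_def by blast
  have "module_frobenius_factor L K p \<X> \<kappa>\<^sub>K \<Y> \<kappa>\<^sub>L \<pi> S\<^sub>1"
    by (intro module_frobenius_factor.intro frobenius_factor.intro module_frobenius_factor_axioms.intro
        assms(1-4,7-9,11-14) mor S1)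
  then show ?thesis by (rule module_frobenius_factor.horizontal_sections_iso)
qed

end
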